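(* Let $m\ge 3$, let $0<\tau\le 1$, and let $h$ be a smooth Riemannian metric on $\mathbb{R}^m\setminus B^m_1(0)$ with $h_{\alpha\beta}(p)=\delta_{\alpha\beta}+\mathrm{O}_2(|p|^{-\tau})$ for $|p|\gg 1$. Let $\vec\xi: D_1(0)\setminus\{0\}\to (\mathbb{R}^m\setminus B_1^m(0),h)$ be a weak Willmore immersion whose image is non-compact and complete, such that: (1) $\vec\xi(D_r(0)\setminus\{0\})$ is non-compact for every $r\in(0,1)$; (2) $\int_{D_1(0)}|\vec A^h_{\vec\xi}|_h^2\,d\mathrm{vol}_{\vec\xi^*h}<\infty$; (3) there are constants $\Theta>0$ and $0<q<2(1+\tau)$ with $\mathscr{H}^2_h\big(\vec\xi(D_1(0)\setminus\{0\})\cap B^m_r(p)\big)\le\Theta\, r^q$ for all $p\in\vec\xi(D_1(0)\setminus\{0\})$ and all $r\ge 1$. Then there is a function $\mu$ with $\lim_{s\to\infty}\mu(s)=0$ such that $$|\vec A^h_{\vec\xi}|(p)\;\lesssim\;|p|^{-1}\mu(|p|)\qquad\text{for all }p\in\vec\xi(D_1(0)\setminus\{0\})\text{ with }|p|\gg 1 .$$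
   Context: Notation. $D_r(0)$ is the disk of radius $r$ centered at the origin of $\mathbb{R}^2\cong\mathbb{C}$; $B^m_r(p)$ is the Euclidean ball in $\mathbb{R}^m$. $f(X)=\mathrm{O}_N(|X|^s)$ means $f^{(j)}(X)=\mathrm{O}(|X|^{s-j})$ for all integers $0\le j\le N$. $a\lesssim b$ means $a\le Cb$ for a constant $C$. $\mathscr H^2_h$ is the 2-dimensional Hausdorff measure of $h$. Weak immersion: $\vec\xi$ is locally Lipschitz on $D_1(0)\setminus\{0\}$, locally non-degenerate (locally on compact subsets $C^{-1}|X|\le |d\vec\xi(X)|\le C|X|$ a.e.), and its Gauss map $\vec n_h=\star_h\frac{\partial_{x^1}\vec\xi\wedge\partial_{x^2}\vec\xi}{|\partial_{x^1}\vec\xi\wedge\partial_{x^2}\vec\xi|_h}$ lies in $W^{1,2}(D_1(0))$. $\vec A^h_{\vec\xi}$ is the (normal-vector valued) second fundamental form of $\vec\xi$ in the metric $h$, and $\vec H^h_{\vec\xi}$ is the mean curvature vector, i.e. half the trace of $\vec A^h_{\vec\xi}$ with respect to $\vec\xi^*h$. The immersion is Willmore if it is a critical point, for compactly supported variations in $D_1(0)\setminus\{0\}$, of the energy $\int|\vec H^h_{\vec\xi}|_h^2\,d\mathrm{vol}_{\vec\xi^*h}$. Weak Willmore immersions are taken to be smooth on the punctured disk (after a conformal reparametrization), so that pointwise statements make sense; a bound at $p$ is understood at every parameter $x$ with $\vec\xi(x)=p$. Completeness is understood at the end $x\to 0$: paths in the punctured disk tending to $0$ have infinite length for $\vec\xi^*h$.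 *)

theory Defs
  imports "HOL-Analysis.Analysis"
begin

text \<open>Disks are closed, so that the parametrized surface has the boundary curve
  \<open>norm x = 1\<close> and its only end is \<open>x \<rightarrow> 0\<close>.  Interior notions (smoothness, variations, Sobolev
  spaces) live on \<open>open_pdisk\<close> or on the open unit ball.  The ball removed from the ambient space
  is open.\<close>

definition pdisk :: "real \<Rightarrow> (real^2) set" where
  "pdisk r = cball 0 r - {0}"

definition open_pdisk :: "(real^2) set" where
  "open_pdisk = ball 0 1 - {0}"

definition exterior :: "(real^'m) set" where
  "exterior = - ball 0 1"

text \<open>Iterated directional derivatives; on lists of basis vectors, the iterated partials.\<close>

primrec iter_deriv ::
  "'a::euclidean_space list \<Rightarrow> ('a \<Rightarrow> 'b::real_normed_vector) \<Rightarrow> 'a \<Rightarrow> 'b" where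
  "iter_deriv [] f = f"
| "iter_deriv (v # vs) f = (\<lambda>x. frechet_derivative (iter_deriv vs f) (at x) v)"

text \<open>For a non-open set, smoothness means that the given total function is itself smooth on a
  neighbourhood, so that its derivatives make sense at boundary points.\<close>

definition smooth_on :: "'a::euclidean_space set \<Rightarrow> ('a \<Rightarrow> 'b::real_normed_vector) \<Rightarrow> bool" where
  "smooth_on S f \<longleftrightarrow> (\<exists>U. open U \<and> S \<subseteq> U \<and>
     (\<forall>vs. set vs \<subseteq> Basis \<longrightarrow> (\<forall>x\<in>U. iter_deriv vs f differentiable (at x))))"

text \<open>\<open>f(X) = O\<^sub>N(|X|\<^sup>s)\<close> as \<open>|X| \<rightarrow> \<infinity>\<close>, derivatives included.\<close>

definition bigo_derivs :: "nat \<Rightarrow> real \<Rightarrow> ('a::euclidean_space \<Rightarrow> real) \<Rightarrow> bool" where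
  "bigo_derivs N s f \<longleftrightarrow> (\<forall>vs. set vs \<subseteq> Basis \<and> length vs \<le> N \<longrightarrow>
     iter_deriv vs f \<in> O[at_infinity](\<lambda>X. norm X powr (s - real (length vs))))"

abbreviation pd :: "'n::finite \<Rightarrow> (real^'n \<Rightarrow> 'b::real_normed_vector) \<Rightarrow> real^'n \<Rightarrow> 'b" where
  "pd i f x \<equiv> frechet_derivative f (at x) (axis i 1)"

text \<open>A metric is the matrix field \<open>p \<mapsto> (h\<^sub>\<alpha>\<^sub>\<beta>(p))\<close>; its values inside the
  removed ball are irrelevant.\<close>

definition riemannian_metric :: "(real^'m \<Rightarrow> real^'m^'m) \<Rightarrow> bool" where
  "riemannian_metric h \<longleftrightarrow> smooth_on exterior h \<and>
     (\<forall>p\<in>exterior. transpose (h p) = h p \<and> (\<forall>v. v \<noteq> 0 \<longrightarrow> v \<bullet> (h p *v v) > 0))"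

definition asymptotically_flat :: "real \<Rightarrow> (real^'m \<Rightarrow> real^'m^'m) \<Rightarrow> bool" where
  "asymptotically_flat \<tau> h \<longleftrightarrow>
     (\<forall>\<alpha> \<beta>. bigo_derivs 2 (- \<tau>) (\<lambda>p. h p $ \<alpha> $ \<beta> - (if \<alpha> = \<beta> then 1 else 0)))"

definition h_inner :: "(real^'m \<Rightarrow> real^'m^'m) \<Rightarrow> real^'m \<Rightarrow> real^'m \<Rightarrow> real^'m \<Rightarrow> real" where
  "h_inner h p v w = v \<bullet> (h p *v w)"

definition h_norm :: "(real^'m \<Rightarrow> real^'m^'m) \<Rightarrow> real^'m \<Rightarrow> real^'m \<Rightarrow> real" where
  "h_norm h p v = sqrt (h_inner h p v v)"

text \<open>\<open>christoffel h p \<gamma> \<alpha> \<beta>\<close> is the Christoffel symbol with upper index \<open>\<gamma>\<close>.\<close>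

definition christoffel :: "(real^'m \<Rightarrow> real^'m^'m) \<Rightarrow> real^'m \<Rightarrow> 'm \<Rightarrow> 'm \<Rightarrow> 'm \<Rightarrow> real" where
  "christoffel h p \<gamma> \<alpha> \<beta> = 1/2 * (\<Sum>\<delta>\<in>UNIV. matrix_inv (h p) $ \<gamma> $ \<delta> *
     (pd \<alpha> (\<lambda>q. h q $ \<beta> $ \<delta>) p + pd \<beta> (\<lambda>q. h q $ \<alpha> $ \<delta>) p - pd \<delta> (\<lambda>q. h q $ \<alpha> $ \<beta>) p))"

definition curve_length :: "(real^'m \<Rightarrow> real^'m^'m) \<Rightarrow> (real \<Rightarrow> real^'m) \<Rightarrow> real" where
  "curve_length h \<gamma> = integral {0..1} (\<lambda>t. h_norm h (\<gamma> t) (vector_derivative \<gamma> (at t)))"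

definition h_dist :: "(real^'m \<Rightarrow> real^'m^'m) \<Rightarrow> real^'m \<Rightarrow> real^'m \<Rightarrow> real" where
  "h_dist h p q = Inf {curve_length h \<gamma> | \<gamma>. valid_path \<gamma> \<and> path_image \<gamma> \<subseteq> exterior \<and>
     pathstart \<gamma> = p \<and> pathfinish \<gamma> = q}"

definition h_diam :: "(real^'m \<Rightarrow> real^'m^'m) \<Rightarrow> (real^'m) set \<Rightarrow> ennreal" where
  "h_diam h C = (SUP p\<in>C. SUP q\<in>C. ennreal (h_dist h p q))"

text \<open>Two-dimensional Hausdorff (outer) measure of the metric space \<open>(exterior, h_dist h)\<close>; the
  factor \<open>pi / 4\<close> is the usual normalization, giving a flat unit disk the measure \<open>pi\<close>.\<close>

definition hausdorff2 :: "(real^'m \<Rightarrow> real^'m^'m) \<Rightarrow> (real^'m) set \<Rightarrow> ennreal" where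
  "hausdorff2 h E = (SUP \<delta>\<in>{0<..}. INF C\<in>{C :: nat \<Rightarrow> (real^'m) set.
       E \<subseteq> (\<Union>i. C i) \<and> (\<forall>i. C i \<subseteq> exterior \<and> h_diam h (C i) \<le> ennreal \<delta>)}.
     (\<Sum>i. ennreal (pi / 4) * (h_diam h (C i))\<^sup>2))"

text \<open>Surface quantities of an immersion \<open>\<xi>\<close>, in the coordinates of the parameter domain.\<close>

definition pullback :: "(real^'m \<Rightarrow> real^'m^'m) \<Rightarrow> (real^2 \<Rightarrow> real^'m) \<Rightarrow> real^2 \<Rightarrow> real^2^2" where
  "pullback h \<xi> x = (\<chi> i j. h_inner h (\<xi> x) (pd i \<xi> x) (pd j \<xi> x))"

definition area_density :: "(real^'m \<Rightarrow> real^'m^'m) \<Rightarrow> (real^2 \<Rightarrow> real^'m) \<Rightarrow> real^2 \<Rightarrow> real" where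
  "area_density h \<xi> x = sqrt (det (pullback h \<xi> x))"

definition normal_part ::
  "(real^'m \<Rightarrow> real^'m^'m) \<Rightarrow> (real^2 \<Rightarrow> real^'m) \<Rightarrow> real^2 \<Rightarrow> real^'m \<Rightarrow> real^'m" where
  "normal_part h \<xi> x v = v - (\<Sum>i\<in>UNIV. \<Sum>j\<in>UNIV.
     (matrix_inv (pullback h \<xi> x) $ i $ j * h_inner h (\<xi> x) v (pd i \<xi> x)) *\<^sub>R pd j \<xi> x)"

text \<open>The covariant derivative of the field \<open>\<partial>\<^sub>j\<xi>\<close> in direction \<open>\<partial>\<^sub>i\<xi>\<close>, for the Levi-Civita
  connection of \<open>h\<close>.\<close>

definition cov_deriv ::
  "(real^'m \<Rightarrow> real^'m^'m) \<Rightarrow> (real^2 \<Rightarrow> real^'m) \<Rightarrow> real^2 \<Rightarrow> 2 \<Rightarrow> 2 \<Rightarrow> real^'m" where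
  "cov_deriv h \<xi> x i j = pd i (\<lambda>y. pd j \<xi> y) x +
     (\<chi> \<gamma>. \<Sum>\<alpha>\<in>UNIV. \<Sum>\<beta>\<in>UNIV. christoffel h (\<xi> x) \<gamma> \<alpha> \<beta> * pd i \<xi> x $ \<alpha> * pd j \<xi> x $ \<beta>)"

definition second_ff ::
  "(real^'m \<Rightarrow> real^'m^'m) \<Rightarrow> (real^2 \<Rightarrow> real^'m) \<Rightarrow> real^2 \<Rightarrow> 2 \<Rightarrow> 2 \<Rightarrow> real^'m" where
  "second_ff h \<xi> x i j = normal_part h \<xi> x (cov_deriv h \<xi> x i j)"

definition second_ff_norm :: "(real^'m \<Rightarrow> real^'m^'m) \<Rightarrow> (real^2 \<Rightarrow> real^'m) \<Rightarrow> real^2 \<Rightarrow> real" where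
  "second_ff_norm h \<xi> x = (let G = matrix_inv (pullback h \<xi> x) in
     sqrt (\<Sum>i\<in>UNIV. \<Sum>j\<in>UNIV. \<Sum>k\<in>UNIV. \<Sum>l\<in>UNIV. G $ i $ k * G $ j $ l *
       h_inner h (\<xi> x) (second_ff h \<xi> x i j) (second_ff h \<xi> x k l)))"

definition mean_curvature ::
  "(real^'m \<Rightarrow> real^'m^'m) \<Rightarrow> (real^2 \<Rightarrow> real^'m) \<Rightarrow> real^2 \<Rightarrow> real^'m" where
  "mean_curvature h \<xi> x = (1/2) *\<^sub>R (\<Sum>i\<in>UNIV. \<Sum>j\<in>UNIV.
     matrix_inv (pullback h \<xi> x) $ i $ j *\<^sub>R second_ff h \<xi> x i j)"

definition willmore_energy ::
  "(real^'m \<Rightarrow> real^'m^'m) \<Rightarrow> (real^2 \<Rightarrow> real^'m) \<Rightarrow> (real^2) set \<Rightarrow> real" where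
  "willmore_energy h \<xi> K =
     (LINT x:K|lborel. (h_norm h (\<xi> x) (mean_curvature h \<xi> x))\<^sup>2 * area_density h \<xi> x)"

text \<open>Bivectors are antisymmetric matrices of components.  An \<open>(m-2)\<close>-vector \<open>\<nu>\<close> is given by
  its alternating components \<open>\<nu> K\<close>, where \<open>K\<close> is a list of \<open>m - 2\<close> indices.  The ambient
  orientation is the one for which \<open>to_nat\<close> enumerates the coordinates in order; the opposite
  orientation only changes the sign of the Gauss map.\<close>

definition wedge :: "real^'m \<Rightarrow> real^'m \<Rightarrow> real^'m^'m" where
  "wedge u v = (\<chi> \<alpha> \<beta>. u $ \<alpha> * v $ \<beta> - u $ \<beta> * v $ \<alpha>)"

text \<open>Here \<open>(h B h)\<^sub>\<alpha>\<^sub>\<beta>\<close> is the \<open>h\<close>-inner product of \<open>e\<^sub>\<alpha> \<and> e\<^sub>\<beta>\<close> and \<open>B\<close>.\<close>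

definition bivector_norm :: "(real^'m \<Rightarrow> real^'m^'m) \<Rightarrow> real^'m \<Rightarrow> real^'m^'m \<Rightarrow> real" where
  "bivector_norm h p B =
     sqrt (1/2 * (\<Sum>\<alpha>\<in>UNIV. \<Sum>\<beta>\<in>UNIV. B $ \<alpha> $ \<beta> * (h p ** B ** h p) $ \<alpha> $ \<beta>))"

definition levi_civita :: "'m::finite list \<Rightarrow> real" where
  "levi_civita K = (if distinct K
     then (-1) ^ card {(i, j). i < j \<and> j < length K \<and> to_nat (K ! j) < to_nat (K ! i)} else 0)"

text \<open>Determined by \<open>A \<and> hodge_star h p B = \<langle>A, B\<rangle>\<^sub>h vol\<^sub>h\<close> for all bivectors \<open>A\<close>, where the unit
  \<open>m\<close>-vector is \<open>vol\<^sub>h = (det h)\<^sup>-\<^sup>1\<^sup>/\<^sup>2 e\<^sub>1 \<and> \<dots> \<and> e\<^sub>m\<close>.\<close>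

definition hodge_star ::
  "(real^'m \<Rightarrow> real^'m^'m) \<Rightarrow> real^'m \<Rightarrow> real^'m^'m \<Rightarrow> 'm list \<Rightarrow> real" where
  "hodge_star h p B K = 1 / sqrt (det (h p)) *
     (1/2 * (\<Sum>\<alpha>\<in>UNIV. \<Sum>\<beta>\<in>UNIV. levi_civita (\<alpha> # \<beta> # K) * (h p ** B ** h p) $ \<alpha> $ \<beta>))"

definition gauss_map ::
  "(real^'m \<Rightarrow> real^'m^'m) \<Rightarrow> (real^2 \<Rightarrow> real^'m) \<Rightarrow> real^2 \<Rightarrow> 'm list \<Rightarrow> real" where
  "gauss_map h \<xi> x = (let B = wedge (pd 1 \<xi> x) (pd 2 \<xi> x) in
     hodge_star h (\<xi> x) ((1 / bivector_norm h (\<xi> x) B) *\<^sub>R B))"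

definition L2_on :: "'a::euclidean_space set \<Rightarrow> ('a \<Rightarrow> real) \<Rightarrow> bool" where
  "L2_on \<Omega> f \<longleftrightarrow> set_borel_measurable lebesgue \<Omega> f \<and> set_integrable lebesgue \<Omega> (\<lambda>x. (f x)\<^sup>2)"

definition test_function :: "'a::euclidean_space set \<Rightarrow> ('a \<Rightarrow> real) \<Rightarrow> bool" where
  "test_function \<Omega> \<phi> \<longleftrightarrow>
     smooth_on UNIV \<phi> \<and> (\<exists>K. compact K \<and> K \<subseteq> \<Omega> \<and> (\<forall>x. x \<notin> K \<longrightarrow> \<phi> x = 0))"

definition W12_on :: "'a::euclidean_space set \<Rightarrow> ('a \<Rightarrow> real) \<Rightarrow> bool" where
  "W12_on \<Omega> f \<longleftrightarrow> L2_on \<Omega> f \<and> (\<forall>b\<in>Basis. \<exists>g. L2_on \<Omega> g \<and>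
     (\<forall>\<phi>. test_function \<Omega> \<phi> \<longrightarrow>
       (LINT x:\<Omega>|lebesgue. f x * frechet_derivative \<phi> (at x) b) =
       - (LINT x:\<Omega>|lebesgue. g x * \<phi> x)))"

definition weak_immersion :: "(real^'m \<Rightarrow> real^'m^'m) \<Rightarrow> (real^2 \<Rightarrow> real^'m) \<Rightarrow> bool" where
  "weak_immersion h \<xi> \<longleftrightarrow>
     \<xi> ` pdisk 1 \<subseteq> exterior \<and>
     (\<forall>x\<in>pdisk 1. \<exists>u>0. \<exists>L. L-lipschitz_on (cball x u \<inter> pdisk 1) \<xi>) \<and>
     (\<forall>K. compact K \<and> K \<subseteq> pdisk 1 \<longrightarrow> (\<exists>C>0. AE x in lebesgue. x \<in> K \<longrightarrow>
        (\<forall>X. norm X / C \<le> norm (frechet_derivative \<xi> (at x) X) \<and>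
             norm (frechet_derivative \<xi> (at x) X) \<le> C * norm X))) \<and>
     (\<forall>K. length K = CARD('m) - 2 \<longrightarrow> W12_on (ball 0 1) (\<lambda>x. gauss_map h \<xi> x K))"

text \<open>The energy is evaluated on the compact set \<open>K\<close> carrying the variation; its complement
  contributes a constant.\<close>

definition willmore_critical :: "(real^'m \<Rightarrow> real^'m^'m) \<Rightarrow> (real^2 \<Rightarrow> real^'m) \<Rightarrow> bool" where
  "willmore_critical h \<xi> \<longleftrightarrow> (\<forall>\<Phi> K \<epsilon>.
     \<epsilon> > 0 \<and> compact K \<and> K \<subseteq> open_pdisk \<and>
     smooth_on ({- \<epsilon><..<\<epsilon>} \<times> open_pdisk) (\<lambda>(t, x). \<Phi> t x) \<and>
     (\<forall>t\<in>{- \<epsilon><..<\<epsilon>}. \<forall>x\<in>open_pdisk. \<Phi> t x \<in> exterior) \<and>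
     (\<forall>x\<in>open_pdisk. \<Phi> 0 x = \<xi> x) \<and>
     (\<forall>t\<in>{- \<epsilon><..<\<epsilon>}. \<forall>x\<in>open_pdisk - K. \<Phi> t x = \<xi> x) \<longrightarrow>
     ((\<lambda>t. willmore_energy h (\<Phi> t) K) has_real_derivative 0) (at 0))"

definition weak_willmore_immersion ::
  "(real^'m \<Rightarrow> real^'m^'m) \<Rightarrow> (real^2 \<Rightarrow> real^'m) \<Rightarrow> bool" where
  "weak_willmore_immersion h \<xi> \<longleftrightarrow>
     weak_immersion h \<xi> \<and> smooth_on open_pdisk \<xi> \<and> willmore_critical h \<xi>"

definition complete_end :: "(real^'m \<Rightarrow> real^'m^'m) \<Rightarrow> (real^2 \<Rightarrow> real^'m) \<Rightarrow> bool" where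
  "complete_end h \<xi> \<longleftrightarrow> (\<forall>\<gamma> :: real \<Rightarrow> real^2.
     (\<forall>b\<in>{0<..<1}. \<gamma> piecewise_C1_differentiable_on {0..b}) \<and>
     \<gamma> ` {0..<1} \<subseteq> open_pdisk \<and> (\<gamma> \<longlongrightarrow> 0) (at_left 1) \<longrightarrow>
     (\<integral>\<^sup>+t\<in>{0..<1}. ennreal (sqrt (vector_derivative \<gamma> (at t) \<bullet>
        (pullback h \<xi> (\<gamma> t) *v vector_derivative \<gamma> (at t)))) \<partial>lborel) = \<infinity>)"

end

theory Submission
  imports Defs
begin

text \<open>If the estimate failed, there would be points \<open>x\<close> with \<open>|\<xi>(x)| \<rightarrow> \<infinity>\<close> and
  \<open>|\<xi>(x)| |A|(x) \<ge> \<delta>\<close>.  Completeness allows to replace \<open>x\<close> by a point at comparable distance where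
  \<open>K = |A|\<close> is at least as large and at most doubles along paths of length \<open>c / K\<close>.  Scaled by
  \<open>K\<close>, the surface is there a graph over a disc of fixed size in its tangent plane, with bounded
  Hessian \<open>D\<^sup>2u\<close>, in a metric that differs from a constant one by \<open>\<eta> \<rightarrow> 0\<close>.  Testing the Willmore
  equation with cut-off second derivatives of the fundamental solution of \<open>\<Delta>\<^sup>2\<close> bounds \<open>|D\<^sup>2u(0)|\<close> by
  the integral of \<open>(|D\<^sup>2u| + \<eta>) / |y|\<close>.  This integral tends to \<open>0\<close> together with the energy of
  the tail of the end, whereas \<open>|A| = 1\<close> at the centre of the scaled surface.\<close>

text \<open>The argument is quantitative: no limit surface is extracted. Three obstacles shape it.
  The surface is merely immersed, so the graph has to be produced by continuing an inverse of the
  tangential coordinates over a disc; completeness keeps such an inverse from running into the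
  puncture. The fourth order Euler-Lagrange equation is never written down: criticality enters as
  the vanishing derivative of the energy under displacements \<phi> e with a constant vector e
  normal at the centre, and freezing the coefficients there leaves the integral of \<Delta>w
  \<Delta>\<phi>, with errors that gain a factor |y|. Finally, 1/|y| just fails to be square
  integrable in the plane, so small energy alone does not make the weighted integral small; the
  pointwise bound on the Hessian serves near the centre, the energy away from it. The negated
  estimate also gives 1/K \<le> |\<xi>|/\<delta> up to comparable distances, which is why the scaled
  derivatives of the metric still tend to zero, like |\<xi>| to the power -\<tau>.\<close>

abbreviation frechet :: "('a::real_normed_vector \<Rightarrow> 'b::real_normed_vector) \<Rightarrow> 'a \<Rightarrow> 'a \<Rightarrow> 'b" where
  "frechet f x \<equiv> frechet_derivative f (at x)"

abbreviation pd2 :: "'n::finite \<Rightarrow> 'n \<Rightarrow> (real^'n \<Rightarrow> 'b::real_normed_vector) \<Rightarrow> real^'n \<Rightarrow> 'b" where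
  "pd2 i j f x \<equiv> pd i (\<lambda>z. pd j f z) x"

section \<open>Calculus of finitely often differentiable functions\<close>

text \<open>Index \<open>0\<close> already demands one derivative: \<open>Ck n\<close> means that all iterated partials of order
  at most \<open>n\<close> are differentiable.\<close>

primrec Ck :: "nat \<Rightarrow> 'a::euclidean_space set \<Rightarrow> ('a \<Rightarrow> 'b::real_normed_vector) \<Rightarrow> bool" where
  "Ck 0 U f \<longleftrightarrow> (\<forall>x\<in>U. f differentiable at x)"
| "Ck (Suc n) U f \<longleftrightarrow> (\<forall>x\<in>U. f differentiable at x) \<and>
     (\<forall>v\<in>Basis. Ck n U (\<lambda>x. frechet f x v))"

lemma Ck_differentiable: "Ck n U f \<Longrightarrow> x \<in> U \<Longrightarrow> f differentiable at x"
  by (cases n) auto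

lemma Ck_has_derivative:
  "Ck n U f \<Longrightarrow> x \<in> U \<Longrightarrow> (f has_derivative frechet f x) (at x)"
  using Ck_differentiable frechet_derivative_works by blast

lemma Ck_continuous_on: "Ck n U f \<Longrightarrow> continuous_on U f"
  by (meson Ck_differentiable continuous_at_imp_continuous_on differentiable_imp_continuous_within)

lemma Ck_Suc_imp: "Ck (Suc n) U f \<Longrightarrow> Ck n U f"
  by (induction n arbitrary: f) auto

lemma Ck_le: "Ck n U f \<Longrightarrow> m \<le> n \<Longrightarrow> Ck m U f"
  by (induction n) (auto simp: le_Suc_eq simp del: Ck.simps dest: Ck_Suc_imp)

lemma Ck_subset: "Ck n U f \<Longrightarrow> V \<subseteq> U \<Longrightarrow> Ck n V f"
  by (induction n arbitrary: f) auto

lemma differentiable_cong_open: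
  assumes "f differentiable at x" "open U" "x \<in> U" "\<And>x. x \<in> U \<Longrightarrow> f x = g x"
  shows "g differentiable at x"
  using assms has_derivative_transform_within_open unfolding differentiable_def by blast

lemma Ck_cong:
  assumes "open U" "\<And>x. x \<in> U \<Longrightarrow> f x = g x" "Ck n U f"
  shows "Ck n U g" using assms(2,3)
proof (induction n arbitrary: f g)
  case 0
  then show ?case using assms(1) by (auto intro: differentiable_cong_open)
next
  case (Suc n)
  have "Ck n U (\<lambda>x. frechet g x v)" if "v \<in> Basis" for v
  proof (rule Suc.IH)
    show "Ck n U (\<lambda>x. frechet f x v)" using Suc.prems that by simp
    show "frechet f x v = frechet g x v" if "x \<in> U" for x
      using frechet_derivative_transform_within_open[of f x U g] Suc.prems that assms(1) by auto
  qed
  moreover have "Ck 0 U g" using Suc.prems assms(1) by (auto intro: differentiable_cong_open)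
  ultimately show ?case by auto
qed

text \<open>Functions glued from several formulas, such as an extension by zero, can thus be checked
  piece by piece.\<close>

lemma Ck_local:
  assumes "\<And>x. x \<in> U \<Longrightarrow> \<exists>V. open V \<and> x \<in> V \<and> Ck n V f"
  shows "Ck n U f" using assms
proof (induction n arbitrary: f)
  case 0
  then show ?case by fastforce
next
  case (Suc n)
  have "Ck n U (\<lambda>x. frechet f x v)" if "v \<in> Basis" for v
  proof (rule Suc.IH)
    fix x assume "x \<in> U"
    with Suc.prems obtain V where "open V" "x \<in> V" "Ck (Suc n) V f" by blast
    then show "\<exists>V. open V \<and> x \<in> V \<and> Ck n V (\<lambda>x. frechet f x v)" using that by auto
  qed
  moreover have "\<forall>x\<in>U. f differentiable at x" using Suc.prems Ck_differentiable by blast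
  ultimately show ?case by auto
qed

lemma frechet_eqI: "(f has_derivative f') (at x) \<Longrightarrow> frechet f x v = f' v"
  by (metis frechet_derivative_at)

text \<open>The working form of the recursion: any explicit derivative may replace
  \<open>frechet\<close>, so a closure property reduces to naming the derivative and treating its
  entries by induction.\<close>

lemma Ck_SucI:
  assumes "open U" "\<And>x. x \<in> U \<Longrightarrow> (f has_derivative f' x) (at x)"
    and "\<And>v. v \<in> Basis \<Longrightarrow> Ck n U (\<lambda>x. f' x v)"
  shows "Ck (Suc n) U f"
proof -
  have "Ck n U (\<lambda>x. frechet f x v)" if "v \<in> Basis" for v
    by (rule Ck_cong[OF assms(1) _ assms(3)[OF that]])
      (simp add: frechet_eqI[OF assms(2)])
  then show ?thesis using assms(2) by (auto intro: differentiableI)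
qed

lemma Ck_const: "Ck n U (\<lambda>x. c)"
  by (induction n arbitrary: c) auto

lemma Ck_linear:
  assumes "open U" "bounded_linear L" shows "Ck n U L"
proof (cases n)
  case 0
  then show ?thesis using assms by (auto intro: bounded_linear_imp_differentiable)
next
  case (Suc m)
  show ?thesis unfolding Suc
    by (rule Ck_SucI[OF assms(1) bounded_linear_imp_has_derivative[OF assms(2)]]) (rule Ck_const)
qed

lemma Ck_bounded_linear:
  assumes "open U" "bounded_linear L" "Ck n U f"
  shows "Ck n U (\<lambda>x. L (f x))" using assms(3)
proof (induction n arbitrary: f)
  case 0
  then have "((\<lambda>x. L (f x)) has_derivative (\<lambda>h. L (frechet f x h))) (at x)" if "x \<in> U" for x
    using bounded_linear.has_derivative[OF assms(2) Ck_has_derivative[OF _ that]] by blast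
  then show ?case by (auto simp: differentiable_def)
next
  case (Suc n)
  show ?case
    by (rule Ck_SucI[OF assms(1) bounded_linear.has_derivative[OF assms(2) Ck_has_derivative[OF Suc.prems]]])
      (use Suc in auto)
qed

lemma Ck_add:
  assumes "open U" "Ck n U f" "Ck n U g"
  shows "Ck n U (\<lambda>x. f x + g x)" using assms(2,3)
proof (induction n arbitrary: f g)
  case 0
  then show ?case by (auto intro: differentiable_add)
next
  case (Suc n)
  show ?case by (rule Ck_SucI[OF assms(1)], rule has_derivative_add[OF Ck_has_derivative[OF Suc.prems(1)]
            Ck_has_derivative[OF Suc.prems(2)]])
      (use Suc in auto)
qed

lemma Ck_bilinear:
  assumes U: "open U" and B: "bounded_bilinear B" and "Ck n U f" "Ck n U g"
  shows "Ck n U (\<lambda>x. B (f x) (g x))" using assms(3,4)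
proof (induction n arbitrary: f g)
  case 0
  then have "((\<lambda>x. B (f x) (g x)) has_derivative
      (\<lambda>h. B (f x) (frechet g x h) + B (frechet f x h) (g x))) (at x)"
    if "x \<in> U" for x
    using bounded_bilinear.FDERIV[OF B Ck_has_derivative[OF _ that] Ck_has_derivative[OF _ that]] by blast
  then show ?case by (auto simp: differentiable_def)
next
  case (Suc n)
  note fg = Ck_Suc_imp[OF Suc.prems(1)] Ck_Suc_imp[OF Suc.prems(2)]
  show ?case by (rule Ck_SucI[OF U bounded_bilinear.FDERIV[OF B Ck_has_derivative[OF Suc.prems(1)]
            Ck_has_derivative[OF Suc.prems(2)]]])
      (use Suc.prems in \<open>auto intro!: Ck_add[OF U] Suc.IH fg\<close>)
qed

lemmas Ck_mult = Ck_bilinear[OF _ bounded_bilinear_mult]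
lemmas Ck_scaleR = Ck_bilinear[OF _ bounded_bilinear_scaleR]
lemmas Ck_inner = Ck_bilinear[OF _ bounded_bilinear_inner]

lemma Ck_minus: "open U \<Longrightarrow> Ck n U f \<Longrightarrow> Ck n U (\<lambda>x. - f x)"
  by (rule Ck_bounded_linear[OF _ bounded_linear_minus[OF bounded_linear_ident]])

lemma Ck_diff: "open U \<Longrightarrow> Ck n U f \<Longrightarrow> Ck n U g \<Longrightarrow> Ck n U (\<lambda>x. f x - g x)"
  using Ck_add[of U n f "\<lambda>x. - g x"] Ck_minus[of U n g] by simp

lemma Ck_sum:
  assumes "open U" "\<And>i. i \<in> I \<Longrightarrow> Ck n U (f i)"
  shows "Ck n U (\<lambda>x. \<Sum>i\<in>I. f i x)"
  using assms(2) by (induction I rule: infinite_finite_induct) (auto intro: Ck_const Ck_add[OF assms(1)])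

lemma Ck_prod:
  fixes f :: "'i \<Rightarrow> 'a::euclidean_space \<Rightarrow> real"
  assumes "open U" "\<And>i. i \<in> I \<Longrightarrow> Ck n U (f i)"
  shows "Ck n U (\<lambda>x. \<Prod>i\<in>I. f i x)"
  using assms(2) by (induction I rule: infinite_finite_induct) (auto intro: Ck_const Ck_mult[OF assms(1)])

lemma frechet_expand:
  fixes f :: "'a::euclidean_space \<Rightarrow> 'b::real_normed_vector"
  assumes "f differentiable at x"
  shows "frechet f x v = (\<Sum>b\<in>Basis. (v \<bullet> b) *\<^sub>R frechet f x b)"
proof -
  interpret linear "frechet f x"
    by (rule linear_frechet_derivative[OF assms])
  have "frechet f x v = frechet f x (\<Sum>b\<in>Basis. (v \<bullet> b) *\<^sub>R b)" by (simp add: euclidean_representation)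
  then show ?thesis by (simp add: sum scaleR)
qed

lemma Ck_compose:
  fixes f :: "'a::euclidean_space \<Rightarrow> 'b::euclidean_space" and g :: "'b \<Rightarrow> 'c::real_normed_vector"
  assumes U: "open U" and V: "open V" and "f ` U \<subseteq> V" "Ck n U f" "Ck n V g"
  shows "Ck n U (\<lambda>x. g (f x))" using assms(4,5)
proof (induction n arbitrary: g)
  case 0
  then show ?case using assms(3) differentiable_chain_at[of f _ g] by (force simp: o_def)
next
  case (Suc n)
  \<comment> \<open>The chain rule is expanded over the basis so that the outer derivative is
    evaluated at fixed vectors; the induction hypothesis, general in \<open>g\<close>, then applies
    to each of these partial derivatives.\<close>
  have d: "((\<lambda>x. g (f x)) has_derivative
      (\<lambda>v. \<Sum>b\<in>Basis. (frechet f x v \<bullet> b) *\<^sub>R frechet g (f x) b)) (at x)"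
    if "x \<in> U" for x
  proof -
    have "f x \<in> V" using that assms(3) by auto
    then have g: "g differentiable at (f x)" using Suc.prems(2) by simp
    have "((\<lambda>x. g (f x)) has_derivative
        (\<lambda>v. frechet g (f x) (frechet f x v))) (at x)"
      by (rule has_derivative_compose[OF Ck_has_derivative[OF Suc.prems(1) that]
            frechet_derivative_works[THEN iffD1, OF g]])
    moreover have "(\<lambda>v. frechet g (f x) (frechet f x v)) =
        (\<lambda>v. \<Sum>b\<in>Basis. (frechet f x v \<bullet> b) *\<^sub>R frechet g (f x) b)"
      by (rule ext) (rule frechet_expand[OF g])
    ultimately show ?thesis by argo
  qed
  show ?case
  proof (rule Ck_SucI[OF U d], assumption)
    fix v :: 'a assume v: "v \<in> Basis"
    have f: "Ck n U f" and 1: "Ck n U (\<lambda>x. frechet f x v)" using Suc.prems(1) v Ck_Suc_imp by auto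
    have 2: "Ck n U (\<lambda>x. frechet g (f x) b)" if "b \<in> Basis" for b
      by (rule Suc.IH[OF f]) (use Suc.prems(2) that in simp)
    show "Ck n U (\<lambda>x. \<Sum>b\<in>Basis. (frechet f x v \<bullet> b) *\<^sub>R frechet g (f x) b)"
      by (intro Ck_sum[OF U] Ck_scaleR[OF U] Ck_inner[OF U] 1 2 Ck_const)
  qed
qed

lemma Ck_frechet:
  assumes "open U" "Ck (Suc n) U f"
  shows "Ck n U (\<lambda>x. frechet f x v)"
proof (rule Ck_cong[OF assms(1)])
  show "Ck n U (\<lambda>x. \<Sum>b\<in>Basis. (v \<bullet> b) *\<^sub>R frechet f x b)"
    using assms by (intro Ck_sum Ck_scaleR Ck_const) auto
qed (simp add: frechet_expand[symmetric] Ck_differentiable[OF assms(2)])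

lemma Ck_fst: "open U \<Longrightarrow> Ck n U f \<Longrightarrow> Ck n U (\<lambda>x. fst (f x))"
  by (rule Ck_bounded_linear[OF _ bounded_linear_fst])

lemma Ck_snd: "open U \<Longrightarrow> Ck n U f \<Longrightarrow> Ck n U (\<lambda>x. snd (f x))"
  by (rule Ck_bounded_linear[OF _ bounded_linear_snd])

lemma Ck_id: "open U \<Longrightarrow> Ck n U (\<lambda>x. x)"
  by (rule Ck_linear[OF _ bounded_linear_ident])

lemma Ck_vec_nth: "open U \<Longrightarrow> Ck n U f \<Longrightarrow> Ck n U (\<lambda>x. f x $ i)"
  by (rule Ck_bounded_linear[OF _ bounded_linear_vec_nth])

lemma bounded_linear_axis: "bounded_linear (axis i :: 'a::real_normed_vector \<Rightarrow> 'a^'n)"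
proof (rule bounded_linear_intro)
  show "norm (axis i x :: 'a^'n) \<le> norm x * 1" for x
  proof -
    have "(\<lambda>j. (norm ((axis i x :: 'a^'n) $ j))\<^sup>2) = (\<lambda>j. if j = i then (norm x)\<^sup>2 else 0)"
      by (auto simp: axis_def)
    then have "norm (axis i x :: 'a^'n) = sqrt (\<Sum>j\<in>UNIV. if j = i then (norm x)\<^sup>2 else 0)"
      unfolding norm_vec_def L2_set_def by metis
    then show ?thesis by simp
  qed
qed (auto simp: axis_def vec_eq_iff)

lemma Ck_vec_lambda:
  fixes f :: "'n::finite \<Rightarrow> 'a::euclidean_space \<Rightarrow> 'b::real_normed_vector"
  assumes "open U" "\<And>i. Ck n U (f i)"
  shows "Ck n U (\<lambda>x. \<chi> i. f i x)"
proof -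
  have "(\<lambda>x. \<chi> i. f i x) = (\<lambda>x. \<Sum>i\<in>UNIV. axis i (f i x))" by (auto simp: vec_eq_iff axis_def fun_eq_iff)
  then show ?thesis
    by (simp add: Ck_sum[OF assms(1)] Ck_bounded_linear[OF assms(1) bounded_linear_axis assms(2)])
qed

section \<open>Smoothness of the elementary functions on their domains\<close>

lemma Ck_real_inverse: "Ck n (- {0}) (inverse :: real \<Rightarrow> real)"
proof (induction n)
  case 0
  then show ?case by (auto intro: differentiable_inverse)
next
  case (Suc n)
  show ?case by (rule Ck_SucI[where f' = "\<lambda>x h. - (inverse x * h * inverse x)"])
      (auto intro!: has_derivative_inverse' Ck_minus Ck_mult Suc open_Compl)
qed

lemma Ck_inverse:
  fixes f :: "'a::euclidean_space \<Rightarrow> real"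
  assumes "open U" "Ck n U f" "\<And>x. x \<in> U \<Longrightarrow> f x \<noteq> 0"
  shows "Ck n U (\<lambda>x. inverse (f x))"
  by (rule Ck_compose[OF assms(1) _ _ assms(2) Ck_real_inverse]) (use assms(3) in auto)

lemma Ck_divide:
  fixes f :: "'a::euclidean_space \<Rightarrow> real"
  assumes "open U" "Ck n U f" "Ck n U g" "\<And>x. x \<in> U \<Longrightarrow> g x \<noteq> 0"
  shows "Ck n U (\<lambda>x. f x / g x)" unfolding divide_inverse using assms by (intro Ck_mult Ck_inverse)

lemma Ck_real_ln: "Ck n {0<..} (ln :: real \<Rightarrow> real)"
proof (cases n)
  case 0
  then show ?thesis by (auto intro!: differentiableI derivative_eq_intros simp: differentiable_def)
next
  case (Suc m)
  show ?thesis unfolding Suc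
  proof (rule Ck_SucI[where f' = "\<lambda>x h. h * inverse x"])
    show "(ln has_derivative (\<lambda>h. h * inverse x)) (at x)" if "x \<in> {0<..}" for x :: real
      using that has_derivative_ln[of "\<lambda>x. x" x "\<lambda>x. x" UNIV] by (auto intro!: derivative_eq_intros simp: divide_inverse)
    show "Ck m {0<..} (\<lambda>x. v * inverse x)" for v :: real
      by (rule Ck_mult[OF _ Ck_const Ck_subset[OF Ck_real_inverse]]) auto
  qed auto
qed

lemma Ck_ln:
  fixes f :: "'a::euclidean_space \<Rightarrow> real"
  assumes "open U" "Ck n U f" "\<And>x. x \<in> U \<Longrightarrow> f x > 0"
  shows "Ck n U (\<lambda>x. ln (f x))"
  by (rule Ck_compose[OF assms(1) _ _ assms(2) Ck_real_ln]) (use assms(3) in auto)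

lemma Ck_real_exp: "Ck n UNIV (exp :: real \<Rightarrow> real)"
proof (induction n)
  case 0
  then show ?case by (auto intro!: differentiableI derivative_eq_intros simp: differentiable_def)
next
  case (Suc n)
  show ?case by (rule Ck_SucI[where f' = "\<lambda>x h. h * exp x"])
      (auto intro!: derivative_eq_intros Ck_mult Suc Ck_const)
qed

lemma Ck_exp:
  fixes f :: "'a::euclidean_space \<Rightarrow> real"
  assumes "open U" "Ck n U f"
  shows "Ck n U (\<lambda>x. exp (f x))" by (rule Ck_compose[OF assms(1) _ _ assms(2) Ck_real_exp]) auto

text \<open>The exponential of half the logarithm: at positive arguments this reduces the root to
  functions already treated.\<close>

lemma Ck_sqrt:
  fixes f :: "'a::euclidean_space \<Rightarrow> real"
  assumes "open U" "Ck n U f" "\<And>x. x \<in> U \<Longrightarrow> f x > 0"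
  shows "Ck n U (\<lambda>x. sqrt (f x))"
proof (rule Ck_cong[OF assms(1)])
  show "Ck n U (\<lambda>x. exp (ln (f x) * (1/2)))" using assms by (intro Ck_exp Ck_mult Ck_ln Ck_const)
  show "exp (ln (f x) * (1/2)) = sqrt (f x)" if "x \<in> U" for x
    using assms(3)[OF that] by (simp add: powr_half_sqrt[symmetric] powr_def)
qed

lemma iter_deriv_append: "iter_deriv (vs @ ws) f = iter_deriv vs (iter_deriv ws f)"
  by (induction vs) auto

lemma Ck_iff_iter_deriv:
  "Ck n U f \<longleftrightarrow> (\<forall>vs. set vs \<subseteq> Basis \<and> length vs \<le> n \<longrightarrow> (\<forall>x\<in>U. iter_deriv vs f differentiable at x))"
proof (induction n arbitrary: f)
  case 0
  then show ?case by auto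
next
  case (Suc n)
  show ?case
  proof
    assume L: "Ck (Suc n) U f"
    show "\<forall>vs. set vs \<subseteq> Basis \<and> length vs \<le> Suc n \<longrightarrow> (\<forall>x\<in>U. iter_deriv vs f differentiable at x)"
    proof (intro allI impI)
      fix vs :: "'a list" assume vs: "set vs \<subseteq> Basis \<and> length vs \<le> Suc n"
      show "\<forall>x\<in>U. iter_deriv vs f differentiable at x"
      \<comment> \<open>\<open>iter_deriv\<close> applies the last vector of the list first, so the
        derivative that \<open>Ck\<close> takes first is found at the end of the list.\<close>
      proof (cases vs rule: rev_cases)
        case Nil
        then show ?thesis using L by simp
      next
        case (snoc ws v)
        then have "Ck n U (\<lambda>x. frechet f x v)" using L vs by simp
        then show ?thesis using Suc snoc vs by (auto simp: iter_deriv_append)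
      qed
    qed
  next
    assume R: "\<forall>vs. set vs \<subseteq> Basis \<and> length vs \<le> Suc n \<longrightarrow> (\<forall>x\<in>U. iter_deriv vs f differentiable at x)"
    have "\<forall>x\<in>U. f differentiable at x" using R[rule_format, of "[]"] by simp
    moreover have "Ck n U (\<lambda>x. frechet f x v)" if "v \<in> Basis" for v unfolding Suc
    proof (intro allI impI)
      fix vs :: "'a list" assume vs: "set vs \<subseteq> Basis \<and> length vs \<le> n"
      then show "\<forall>x\<in>U. iter_deriv vs (\<lambda>x. frechet f x v) differentiable at x"
        using R[rule_format, of "vs @ [v]"] that by (auto simp: iter_deriv_append)
    qed
    ultimately show "Ck (Suc n) U f" by auto
  qed
qed

lemma smooth_on_imp_Ck:
  assumes "smooth_on S f"
  obtains U where "open U" "S \<subseteq> U" "\<And>n. Ck n U f"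
  using assms unfolding smooth_on_def by (metis Ck_iff_iter_deriv)

lemma smooth_onI:
  assumes "open S" "\<And>n. Ck n S f"
  shows "smooth_on S f" using assms unfolding smooth_on_def by (meson Ck_iff_iter_deriv order_refl)

section \<open>Integration by parts and a smooth bump function\<close>

lemma has_vector_derivative_along_line:
  assumes "(c has_derivative c') (at (x + t *\<^sub>R v))"
  shows "((\<lambda>t. c (x + t *\<^sub>R v)) has_vector_derivative c' v) (at t within S)"
proof -
  have "((\<lambda>t. x + t *\<^sub>R v) has_vector_derivative v) (at t within S)"
    by (auto intro!: derivative_eq_intros)
  from vector_derivative_diff_chain_within[OF this has_derivative_at_withinI[OF assms]]
  show ?thesis by (simp add: o_def)
qed

text \<open>The second difference of \<open>f\<close> over a small parallelogram is symmetric in the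
  two sides. Two applications of the mean value theorem turn it into either mixed derivative at some
  nearby point, and continuity of both moves these points to \<open>x\<close>.\<close>

lemma Ck_second_derivative_symmetric:
  fixes f :: "'a::euclidean_space \<Rightarrow> real"
  assumes U: "open U" and f: "Ck 2 U f" and x: "x \<in> U"
  shows "frechet_derivative (\<lambda>y. frechet f y a) (at x) b =
    frechet_derivative (\<lambda>y. frechet f y b) (at x) a"
proof -
  define D where "D = (\<lambda>a b y. frechet_derivative (\<lambda>y. frechet f y a) (at y) b)"
  have f1: "Ck 1 U (\<lambda>y. frechet f y a)" for a
    using Ck_frechet[OF U, of 1 f a] f by (simp add: numeral_2_eq_2)
  have D0: "Ck 0 U (D a b)" for a b
    using Ck_frechet[OF U, of 0 "\<lambda>y. frechet f y a" b] f1 by (simp add: D_def)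
  have square: "\<exists>p q. dist p x \<le> e \<and> dist q x \<le> e \<and> D a b p = D b a q" if "e > 0" for e
  proof -
    obtain r where r: "r > 0" "ball x r \<subseteq> U" using U x openE by blast
    define k where "k = min e (r/2)"
    \<comment> \<open>The summand 1 keeps the quotient defined when both vectors vanish; the
      parallelogram with sides \<open>h *\<^sub>R a\<close> and \<open>h *\<^sub>R b\<close> stays
      within distance \<open>k\<close>.\<close>
    define h where "h = k / (1 + norm a + norm b)"
    have k: "k > 0" "k \<le> e" "k < r" using that r by (auto simp: k_def)
    have h: "h > 0" using k by (simp add: h_def add_pos_nonneg)
    have near: "norm (s *\<^sub>R a + t *\<^sub>R b) \<le> k" if "0 \<le> s" "s \<le> h" "0 \<le> t" "t \<le> h" for s t
    proof -
      have "norm (s *\<^sub>R a + t *\<^sub>R b) \<le> s * norm a + t * norm b"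
        using that by (intro norm_triangle_le) auto
      also have "\<dots> \<le> h * norm a + h * norm b" using that by (intro add_mono mult_right_mono) auto
      also have "\<dots> \<le> h * (1 + norm a + norm b)" using h by (simp add: algebra_simps)
      also have "\<dots> = k" by (simp add: h_def) (smt (verit) norm_ge_zero)
      finally show ?thesis .
    qed
    have inU: "x + s *\<^sub>R a + t *\<^sub>R b \<in> U" if "0 \<le> s" "s \<le> h" "0 \<le> t" "t \<le> h" for s t
    proof (rule subsetD[OF r(2)])
      have "norm (x + s *\<^sub>R a + t *\<^sub>R b - x) < r" using near[OF that] k(3) by (simp add: add.assoc)
      then show "x + s *\<^sub>R a + t *\<^sub>R b \<in> ball x r" by (metis dist_commute dist_norm mem_ball)
    qed
    \<comment> \<open>Stated for abstract directions, so that it serves for both orders of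
      \<open>a\<close> and \<open>b\<close>.\<close>
    have swap: "\<exists>p. dist p x \<le> e \<and> h * h * D c d p =
        f (x + h *\<^sub>R c + h *\<^sub>R d) - f (x + h *\<^sub>R c) - f (x + h *\<^sub>R d) + f x"
      if cU: "\<And>s t. \<lbrakk>0 \<le> s; s \<le> h; 0 \<le> t; t \<le> h\<rbrakk> \<Longrightarrow> x + s *\<^sub>R c + t *\<^sub>R d \<in> U \<and> norm (s *\<^sub>R c + t *\<^sub>R d) \<le> k"
      for c d
    proof -
      have "((\<lambda>s. f (x + s *\<^sub>R c + h *\<^sub>R d) - f (x + s *\<^sub>R c)) has_real_derivative
          frechet f (x + s *\<^sub>R c + h *\<^sub>R d) c - frechet f (x + s *\<^sub>R c) c) (at s)"
        if "0 \<le> s" "s \<le> h" for s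
      proof -
        have 3: "((\<lambda>s. f (x + s *\<^sub>R c + t *\<^sub>R d)) has_real_derivative
            frechet f (x + s *\<^sub>R c + t *\<^sub>R d) c) (at s)" if "0 \<le> t" "t \<le> h" for t
        proof -
          have eq: "(x + t *\<^sub>R d) + s *\<^sub>R c = x + s *\<^sub>R c + t *\<^sub>R d" for s by simp
          have "(f has_derivative frechet f (x + s *\<^sub>R c + t *\<^sub>R d)) (at (x + s *\<^sub>R c + t *\<^sub>R d))"
            using Ck_has_derivative[OF f] cU[OF \<open>0 \<le> s\<close> \<open>s \<le> h\<close> that] by blast
          then show ?thesis using has_vector_derivative_along_line[of f _ "x + t *\<^sub>R d" s c UNIV]
            unfolding eq has_real_derivative_iff_has_vector_derivative by blast
        qed
        from DERIV_diff[OF 3[of h] 3[of 0]] h show ?thesis by simp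
      qed
      from MVT2[OF h this] obtain s where s: "0 < s" "s < h" and eq:
        "(f (x + h *\<^sub>R c + h *\<^sub>R d) - f (x + h *\<^sub>R c)) - (f (x + 0 *\<^sub>R c + h *\<^sub>R d) - f (x + 0 *\<^sub>R c)) =
          (h - 0) * (frechet f (x + s *\<^sub>R c + h *\<^sub>R d) c - frechet f (x + s *\<^sub>R c) c)"
        by blast
      have "((\<lambda>t. frechet f (x + s *\<^sub>R c + t *\<^sub>R d) c) has_real_derivative
          D c d (x + s *\<^sub>R c + t *\<^sub>R d)) (at t)" if "0 \<le> t" "t \<le> h" for t
      proof -
        have "((\<lambda>y. frechet f y c) has_derivative
            frechet_derivative (\<lambda>y. frechet f y c) (at (x + s *\<^sub>R c + t *\<^sub>R d))) (at (x + s *\<^sub>R c + t *\<^sub>R d))"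
          using Ck_has_derivative[OF f1] cU[OF _ _ that] s by fastforce
        from has_vector_derivative_along_line[OF this, of UNIV] show ?thesis
          by (simp add: has_real_derivative_iff_has_vector_derivative D_def)
      qed
      from MVT2[OF h this] obtain t where t: "0 < t" "t < h" and eq2:
        "frechet f (x + s *\<^sub>R c + h *\<^sub>R d) c - frechet f (x + s *\<^sub>R c + 0 *\<^sub>R d) c =
          (h - 0) * D c d (x + s *\<^sub>R c + t *\<^sub>R d)"
        by blast
      have "dist (x + s *\<^sub>R c + t *\<^sub>R d) x \<le> e" using cU[of s t] s t k by (simp add: dist_norm add.assoc)
      then show ?thesis using eq eq2 by (intro exI[of _ "x + s *\<^sub>R c + t *\<^sub>R d"]) (simp add: algebra_simps)
    qed
    obtain p where p: "dist p x \<le> e"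
      "h * h * D a b p = f (x + h *\<^sub>R a + h *\<^sub>R b) - f (x + h *\<^sub>R a) - f (x + h *\<^sub>R b) + f x"
      using swap[of a b] inU near by blast
    obtain q where q: "dist q x \<le> e"
      "h * h * D b a q = f (x + h *\<^sub>R b + h *\<^sub>R a) - f (x + h *\<^sub>R b) - f (x + h *\<^sub>R a) + f x"
    proof -
      have "x + s *\<^sub>R b + t *\<^sub>R a \<in> U \<and> norm (s *\<^sub>R b + t *\<^sub>R a) \<le> k"
        if "0 \<le> s" "s \<le> h" "0 \<le> t" "t \<le> h" for s t
        using inU[of t s] near[of t s] that by (simp add: algebra_simps)
      then show ?thesis using swap[of b a] that by blast
    qed
    have "h * h * D a b p = h * h * D b a q" unfolding p(2) q(2) by (simp add: add_ac)
    then have "D a b p = D b a q" using h by simp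
    then show ?thesis using p(1) q(1) by blast
  qed
  have "dist (D a b x) (D b a x) \<le> 2 * e" if "e > 0" for e
  proof -
    have "isCont (D a b) x" "isCont (D b a) x"
      using D0 x Ck_differentiable differentiable_imp_continuous_within by blast+
    then have c: "\<exists>d>0. \<forall>y. dist y x < d \<longrightarrow> dist (D a b y) (D a b x) < e"
      "\<exists>d>0. \<forall>y. dist y x < d \<longrightarrow> dist (D b a y) (D b a x) < e"
      using that unfolding continuous_at_eps_delta by blast+
    obtain d1 where "d1 > 0" "\<And>y. dist y x < d1 \<Longrightarrow> dist (D a b y) (D a b x) < e" using c(1) by blast
    moreover obtain d2 where "d2 > 0" "\<And>y. dist y x < d2 \<Longrightarrow> dist (D b a y) (D b a x) < e" using c(2) by blast
    ultimately have d: "d1 > 0" "d2 > 0" "\<And>y. dist y x < d1 \<Longrightarrow> dist (D a b y) (D a b x) < e"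
      "\<And>y. dist y x < d2 \<Longrightarrow> dist (D b a y) (D b a x) < e" by blast+
    then obtain p q where "dist p x \<le> min d1 d2 / 2" "dist q x \<le> min d1 d2 / 2" "D a b p = D b a q"
      using square[of "min d1 d2 / 2"] by auto
    then have "dist p x < d1" "dist q x < d2" "D a b p = D b a q" using d(1,2) by (auto simp: min_def split: if_splits)
    then have "dist (D a b p) (D a b x) < e" "dist (D a b p) (D b a x) < e" using d by metis+
    then show ?thesis using dist_triangle2[of "D a b x" "D b a x" "D a b p"] by (simp add: dist_commute)
  qed
  then have "dist (D a b x) (D b a x) \<le> 0"
    by (metis dense_ge less_eq_real_def mult_2 half_gt_zero_iff field_sum_of_halves)
  then show ?thesis by (simp add: D_def)
qed

lemma integral_eq_UNIV_of_support:
  fixes f :: "'a::euclidean_space \<Rightarrow> real"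
  assumes "\<And>x. x \<notin> S \<Longrightarrow> f x = 0" "S \<subseteq> T"
  shows "integral T f = integral UNIV f"
proof -
  have "(\<lambda>x. if x \<in> T then f x else 0) = f" using assms by (intro ext) (metis subsetD)
  then show ?thesis using integral_restrict_UNIV[of T f] by simp
qed

text \<open>Translation invariance of the integral, differentiated along the translation.\<close>

lemma integral_derivative_compact_support:
  fixes c :: "'a::euclidean_space \<Rightarrow> real"
  assumes c: "Ck 1 UNIV c" and supp: "\<And>x. x \<notin> S \<Longrightarrow> c x = 0"
    and S: "S \<subseteq> T" "bounded S" "closed S"
  shows "integral T (\<lambda>x. frechet c x v) = 0"
proof -
  obtain B where B: "B > 0" "\<And>x. x \<in> S \<Longrightarrow> norm x \<le> B" using S(2) bounded_pos by blast
  \<comment> \<open>The box exceeds the support by \<open>norm v\<close>, so it contains every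
    translate by \<open>t *\<^sub>R v\<close> with |t| \<le> 1; hence the integral over the box does
    not depend on t.\<close>
  have "bounded (cball (0::'a) (B + norm v))" by simp
  then obtain a :: 'a where a: "cball 0 (B + norm v) \<subseteq> cbox (-a) a"
    using bounded_subset_cbox_symmetric by blast
  have der0: "frechet c x v = 0" if "x \<notin> S" for x
  proof -
    have "((\<lambda>_. 0) has_derivative (\<lambda>_. 0)) (at x)" by simp
    then have "(c has_derivative (\<lambda>_. 0)) (at x)"
      by (rule has_derivative_transform_within_open[where s = "- S"]) (use that S supp in auto)
    then show ?thesis by (simp add: frechet_eqI)
  qed
  define fx where "fx = (\<lambda>t x. frechet c (x + t *\<^sub>R v) v)"
  have "((\<lambda>t. integral (cbox (-a) a) (\<lambda>x. c (x + t *\<^sub>R v))) has_field_derivative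
      integral (cbox (-a) a) (fx 0)) (at 0 within {-1..1})"
  proof (rule leibniz_rule_field_derivative)
    fix t x
    show "((\<lambda>t. c (x + t *\<^sub>R v)) has_field_derivative fx t x) (at t within {-1..1})"
      using has_vector_derivative_along_line[OF Ck_has_derivative[OF c UNIV_I]]
      by (simp add: has_real_derivative_iff_has_vector_derivative fx_def)
  next
    fix t :: real
    show "(\<lambda>x. c (x + t *\<^sub>R v)) integrable_on cbox (-a) a"
      by (intro integrable_continuous continuous_on_compose2[OF Ck_continuous_on[OF c]]) (auto intro!: continuous_intros)
  next
    have "continuous_on UNIV (\<lambda>x. frechet c x v)"
      using Ck_continuous_on[OF Ck_frechet[of UNIV 0 c]] c by simp
    then show "continuous_on ({-1..1} \<times> cbox (-a) a) (\<lambda>(t, x). fx t x)" unfolding fx_def case_prod_unfold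
      by (rule continuous_on_compose2) (auto intro!: continuous_intros)
  qed auto
  moreover have "integral (cbox (-a) a) (\<lambda>x. c (x + t *\<^sub>R v)) = integral UNIV c" if "t \<in> {-1..1}" for t
  proof -
    have "integral (cbox (-a) a) (\<lambda>x. c (x + t *\<^sub>R v)) = integral (cbox (-a + t *\<^sub>R v) (a + t *\<^sub>R v)) c"
      using integral_shift_cbox_plus[of "-a" a c "t *\<^sub>R v"] by (simp add: o_def add.commute)
    also have "\<dots> = integral UNIV c"
    proof (rule integral_eq_UNIV_of_support[OF supp])
      show "S \<subseteq> cbox (- a + t *\<^sub>R v) (a + t *\<^sub>R v)"
      proof
        fix x assume "x \<in> S"
        have "norm (t *\<^sub>R v) \<le> norm v" using that by (simp add: mult_left_le_one_le abs_le_iff)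
        then have "norm (x - t *\<^sub>R v) \<le> B + norm v"
          using B(2)[OF \<open>x \<in> S\<close>] norm_triangle_ineq4[of x "t *\<^sub>R v"] by linarith
        then have "x - t *\<^sub>R v \<in> cbox (-a) a" using a by auto
        then show "x \<in> cbox (- a + t *\<^sub>R v) (a + t *\<^sub>R v)" by (auto simp: mem_box algebra_simps)
      qed
    qed
    finally show ?thesis .
  qed
  then have "((\<lambda>t. integral (cbox (-a) a) (\<lambda>x. c (x + t *\<^sub>R v))) has_field_derivative 0) (at 0 within {-1..1})"
    by (intro has_field_derivative_transform_within[OF DERIV_const zero_less_one]) auto
  ultimately have "integral (cbox (-a) a) (fx 0) = 0"
    using at_within_Icc_at[of "-1" "0::real" 1] by (auto intro: DERIV_unique)
  moreover have "integral (cbox (-a) a) (fx 0) = integral UNIV (fx 0)"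
    by (rule integral_eq_UNIV_of_support[of "S"]) (use der0 B a in \<open>auto simp: fx_def subset_iff\<close>, smt (verit) norm_ge_zero)
  moreover have "integral T (fx 0) = integral UNIV (fx 0)"
    by (rule integral_eq_UNIV_of_support[of "S"]) (use der0 S in \<open>auto simp: fx_def\<close>)
  ultimately show ?thesis by (simp add: fx_def)
qed

section \<open>A smooth bump with compact support\<close>

definition flat_exp :: "nat \<Rightarrow> real \<Rightarrow> real" where
  "flat_exp k t = (if t > 0 then inverse t ^ k * exp (- inverse t) else 0)"

lemma flat_exp_nonneg: "0 \<le> flat_exp k t"
  by (simp add: flat_exp_def)

text \<open>A single term of the exponential series in 1/t, the one of order k + 2, gives the bound.
  The quadratic decay is what makes the derivative at 0 vanish.\<close>

lemma flat_exp_le: "flat_exp k t \<le> fact (k + 2) * t\<^sup>2"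
proof (cases "t > 0")
  case True
  define u where "u = inverse t"
  have u: "u > 0" "t = inverse u" using True by (auto simp: u_def)
  have "(\<Sum>i\<in>{k+2}. u ^ i /\<^sub>R fact i) \<le> exp u" unfolding exp_def using u(1)
    by (intro sum_le_suminf summable_exp_generic) auto
  then have "u ^ k * u\<^sup>2 \<le> fact (k + 2) * exp u"
    by (simp add: divide_le_eq power_add mult.commute del: fact_Suc add_2_eq_Suc' flip: divide_inverse_commute)
  then have "u ^ k * exp (- u) \<le> fact (k + 2) * inverse u ^ 2"
    using u(1) by (simp add: exp_minus field_simps)
  then show ?thesis using True by (simp add: flat_exp_def u)
qed (simp add: flat_exp_def)

text \<open>The family is closed under differentiation up to linear combinations. This is why the
  power \<open>k\<close> is carried along: smoothness across 0 becomes a single induction.\<close>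

lemma flat_exp_has_derivative:
  "(flat_exp k has_derivative (\<lambda>h. h * (flat_exp (k+2) t - real k * flat_exp (k+1) t))) (at t)"
proof -
  consider "t > 0" | "t < 0" | "t = 0" by linarith
  then show ?thesis
  proof cases
    case 1
    have "((\<lambda>t. inverse t ^ k * exp (- inverse t)) has_real_derivative
        flat_exp (k+2) t - real k * flat_exp (k+1) t) (at t)"
      using 1 by (auto intro!: derivative_eq_intros simp: flat_exp_def algebra_simps power2_eq_square)
          (cases k; auto simp: algebra_simps)
    then have "((\<lambda>t. inverse t ^ k * exp (- inverse t)) has_derivative
        (\<lambda>h. h * (flat_exp (k+2) t - real k * flat_exp (k+1) t))) (at t)"
      by (simp add: has_field_derivative_def mult_commute_abs)
    then show ?thesis
      by (rule has_derivative_transform_within_open[where s = "{0<..}"]) (use 1 in \<open>auto simp: flat_exp_def\<close>)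
  next
    case 2
    have "((\<lambda>t. 0) has_derivative (\<lambda>h. h * (flat_exp (k+2) t - real k * flat_exp (k+1) t))) (at t)"
      using 2 by (simp add: flat_exp_def)
    then show ?thesis
      by (rule has_derivative_transform_within_open[where s = "{..<0}"]) (use 2 in \<open>auto simp: flat_exp_def\<close>)
  next
    case 3
    have "(flat_exp k has_real_derivative 0) (at 0)" unfolding has_field_derivative_iff
    proof (rule Lim_null_comparison[where g = "\<lambda>h. fact (k + 2) * \<bar>h\<bar>"])
      have "norm ((flat_exp k h - flat_exp k 0) / (h - 0)) \<le> fact (k + 2) * \<bar>h\<bar>" for h
      proof (cases "h = 0")
        case False
        have "flat_exp k h \<le> fact (k + 2) * \<bar>h\<bar> * \<bar>h\<bar>"
          using flat_exp_le[of k h] by (simp add: power2_eq_square mult.assoc del: fact_Suc)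
        then show ?thesis using False flat_exp_nonneg[of k h]
          by (simp add: flat_exp_def[of k 0] divide_le_eq del: fact_Suc)
      qed simp
      then show "\<forall>\<^sub>F h in at 0. norm ((flat_exp k h - flat_exp k 0) / (h - 0)) \<le> fact (k + 2) * \<bar>h\<bar>" by simp
      show "((\<lambda>h. fact (k + 2) * \<bar>h\<bar>) \<longlongrightarrow> 0) (at (0::real))" by (auto intro!: tendsto_eq_intros)
    qed
    moreover have "(*) (0::real) = (\<lambda>h. 0)" by auto
    ultimately show ?thesis using 3 by (simp add: has_field_derivative_def flat_exp_def)
  qed
qed

lemma Ck_flat_exp: "Ck n UNIV (flat_exp k)"
proof (induction n arbitrary: k)
  case 0
  then show ?case using flat_exp_has_derivative by (auto simp: differentiable_def)
next
  case (Suc n)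
  show ?case by (rule Ck_SucI[OF open_UNIV flat_exp_has_derivative])
      (intro Ck_mult Ck_diff Ck_const Suc open_UNIV)
qed

definition bump :: "real \<Rightarrow> 'a::euclidean_space \<Rightarrow> real" where
  "bump a y = flat_exp 0 (a\<^sup>2 - y \<bullet> y)"

lemma Ck_bump: "Ck n UNIV (bump a)"
  unfolding bump_def[abs_def]
  by (rule Ck_compose[OF _ open_UNIV _ _ Ck_flat_exp]) (auto intro!: Ck_diff Ck_const Ck_inner Ck_id)

lemma bump_0: "a > 0 \<Longrightarrow> bump a 0 > 0"
  by (simp add: bump_def flat_exp_def)

lemma bump_outside: "norm y \<ge> a \<Longrightarrow> a > 0 \<Longrightarrow> bump a y = 0"
  by (simp add: bump_def flat_exp_def not_less dot_square_norm)

text \<open>Dyadic discs replace polar coordinates: a point between the radii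
  \<open>r (n + 1)\<close> and \<open>r n\<close> is charged to the disc of radius
  \<open>r n\<close> with weight 2 / \<open>r n\<close>, and the areas give a geometric series. The
  result is twice the exact value.\<close>

lemma inverse_norm_integral:
  assumes "\<sigma> > 0"
  shows "(\<lambda>y::real^2. inverse (norm y)) absolutely_integrable_on cball 0 \<sigma>"
    and "integral (cball 0 \<sigma>) (\<lambda>y::real^2. inverse (norm y)) \<le> 4 * pi * \<sigma>"
proof -
  define r where "r = (\<lambda>n. \<sigma> * (1/2) ^ n)"
  have r: "r n > 0" for n using assms by (simp add: r_def)
  have le: "ennreal (inverse (norm y)) * indicator (cball 0 \<sigma>) y \<le>
      (\<Sum>n. ennreal (2 / r n) * indicator (cball 0 (r n)) y)" for y :: "real^2"
  proof (cases "y = 0 \<or> y \<notin> cball 0 \<sigma>")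
    case False
    then have y: "norm y > 0" "norm y \<le> \<sigma>" by auto
    have "r \<longlonglongrightarrow> \<sigma> * 0" unfolding r_def by (intro tendsto_intros) (auto intro: LIMSEQ_power_zero)
    then have "\<forall>\<^sub>F n in sequentially. r n < norm y" using y(1) using order_tendstoD(2)[of r "\<sigma> * 0" sequentially "norm y"] by simp
    then obtain N where N: "r N < norm y" using eventually_happens by force
    define n where "n = (LEAST n. r n < norm y)"
    have n: "r n < norm y" "\<And>k. k < n \<Longrightarrow> \<not> r k < norm y"
      unfolding n_def using N by (auto intro: LeastI dest: not_less_Least)
    have "n \<noteq> 0" using n(1) y by (auto simp: r_def intro: ccontr)
    then obtain k where k: "n = Suc k" by (cases n) auto
    have "norm y \<le> r k" using n(2) k by (auto simp: not_less)
    moreover have "inverse (norm y) \<le> 2 / r k"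
    proof -
      have "r k = 2 * r n" using k by (simp add: r_def)
      then show ?thesis using n(1) r[of n] y by (simp add: field_simps)
    qed
    ultimately have "ennreal (inverse (norm y)) * indicator (cball 0 \<sigma>) y \<le> (\<Sum>n\<in>{k}. ennreal (2 / r n) * indicator (cball 0 (r n)) y)"
      using y by (auto simp: ennreal_leI)
    also have "\<dots> \<le> (\<Sum>n. ennreal (2 / r n) * indicator (cball 0 (r n)) y)" by (rule sum_le_suminf) auto
    finally show ?thesis .
  qed auto
  have "(\<integral>\<^sup>+y. ennreal (inverse (norm y)) * indicator (cball 0 \<sigma>) (y::real^2) \<partial>lebesgue) \<le>
      (\<integral>\<^sup>+y. (\<Sum>n. ennreal (2 / r n) * indicator (cball (0::real^2) (r n)) y) \<partial>lebesgue)"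
    by (intro nn_integral_mono le)
  also have "\<dots> = (\<Sum>n. \<integral>\<^sup>+y. ennreal (2 / r n) * indicator (cball (0::real^2) (r n)) y \<partial>lebesgue)"
    by (rule nn_integral_suminf)
      (intro borel_measurable_times_ennreal borel_measurable_const borel_measurable_indicator, auto)
  also have "\<dots> = (\<Sum>n. ennreal (2 * pi * \<sigma> * (1/2) ^ n))"
  proof -
    have "(\<integral>\<^sup>+y. ennreal (2 / r n) * indicator (cball (0::real^2) (r n)) y \<partial>lebesgue) =
        ennreal (2 * pi * \<sigma> * (1/2) ^ n)" for n
    proof -
      have "(\<integral>\<^sup>+y. ennreal (2 / r n) * indicator (cball (0::real^2) (r n)) y \<partial>lebesgue) =
          ennreal (2 / r n) * emeasure lebesgue (cball (0::real^2) (r n))"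
        by (rule nn_integral_cmult_indicator) auto
      also have "emeasure lebesgue (cball (0::real^2) (r n)) = ennreal (pi * r n ^ 2)"
        using emeasure_cball[of "r n" "0::real^2"] r[of n] by (simp add: unit_ball_vol_2)
      also have "ennreal (2 / r n) * ennreal (pi * r n ^ 2) = ennreal (2 / r n * (pi * r n ^ 2))"
        using r[of n] by (subst ennreal_mult) auto
      also have "2 / r n * (pi * r n ^ 2) = 2 * pi * r n"
        using r[of n] by (simp add: field_simps power2_eq_square)
      finally show ?thesis by (simp add: r_def mult.assoc)
    qed
    then show ?thesis by simp
  qed
  also have "\<dots> = ennreal (4 * pi * \<sigma>)"
  proof (rule suminf_ennreal_eq)
    show "(\<lambda>n. 2 * pi * \<sigma> * (1/2) ^ n) sums (4 * pi * \<sigma>)"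
      using sums_mult[OF geometric_sums[of "1/2::real"], of "2 * pi * \<sigma>"] by (simp add: mult.assoc)
  qed (use assms in auto)
  finally have fin: "(\<integral>\<^sup>+y. ennreal (inverse (norm y)) * indicator (cball 0 \<sigma>) (y::real^2) \<partial>lebesgue) \<le> ennreal (4 * pi * \<sigma>)" .
  have meas: "(\<lambda>y::real^2. indicator (cball 0 \<sigma>) y *\<^sub>R inverse (norm y)) \<in> borel_measurable lebesgue"
    by (intro measurable_completion borel_measurable_scaleR borel_measurable_indicator) auto
  have eq: "(\<integral>\<^sup>+y. ennreal (indicator (cball 0 \<sigma>) (y::real^2) *\<^sub>R inverse (norm y)) \<partial>lebesgue) =
      (\<integral>\<^sup>+y. ennreal (inverse (norm y)) * indicator (cball 0 \<sigma>) (y::real^2) \<partial>lebesgue)"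
    by (intro nn_integral_cong) (auto split: split_indicator)
  have int: "integrable lebesgue (\<lambda>y::real^2. indicator (cball 0 \<sigma>) y *\<^sub>R inverse (norm y))"
    by (rule integrableI_nonneg[OF meas]) (use fin eq in \<open>auto simp: le_less_trans\<close>)
  then show ai: "(\<lambda>y::real^2. inverse (norm y)) absolutely_integrable_on cball 0 \<sigma>"
    by (simp add: set_integrable_def)
  have "integral (cball 0 \<sigma>) (\<lambda>y::real^2. inverse (norm y)) = set_lebesgue_integral lebesgue (cball 0 \<sigma>) (\<lambda>y::real^2. inverse (norm y))"
    by (rule set_lebesgue_integral_eq_integral(2)[OF ai, symmetric])
  also have "\<dots> \<le> 4 * pi * \<sigma>" unfolding set_lebesgue_integral_def
    by (rule integral_real_bounded) (use fin eq assms in auto)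
  finally show "integral (cball 0 \<sigma>) (\<lambda>y::real^2. inverse (norm y)) \<le> 4 * pi * \<sigma>" .
qed

section \<open>A kernel estimate for the bi-Laplacian in the plane\<close>

lemma pd_eqI: "(f has_derivative f') (at x) \<Longrightarrow> pd i f x = f' (axis i 1)"
  by (rule frechet_eqI)

lemma has_derivative_pd_sum:
  fixes f :: "real^'n \<Rightarrow> 'b::real_normed_vector"
  assumes "f differentiable at x"
  shows "frechet f x v = (\<Sum>i\<in>UNIV. v $ i *\<^sub>R pd i f x)"
proof -
  interpret linear "frechet f x"
    by (rule linear_frechet_derivative[OF assms])
  have "frechet f x v = frechet f x (\<Sum>i\<in>UNIV. v $ i *\<^sub>R axis i 1)"
    by (simp add: scalar_mult_eq_scaleR[symmetric] basis_expansion)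
  then show ?thesis by (simp add: sum scaleR)
qed

lemma pd_mult:
  fixes f g :: "real^'n \<Rightarrow> real"
  assumes "f differentiable at x" "g differentiable at x"
  shows "pd i (\<lambda>y. f y * g y) x = pd i f x * g x + f x * pd i g x"
  using frechet_eqI[OF has_derivative_mult[OF assms[unfolded frechet_derivative_works]]]
  by (simp add: algebra_simps)

lemma pd_add:
  assumes "f differentiable at x" "g differentiable at x"
  shows "pd i (\<lambda>y. f y + g y) x = pd i f x + pd i g x"
  using frechet_eqI[OF has_derivative_add[OF assms[unfolded frechet_derivative_works]]] .

lemma Ck_pd: "open U \<Longrightarrow> Ck (Suc n) U f \<Longrightarrow> Ck n U (\<lambda>x. pd i f x)"
  by (rule Ck_frechet)

text \<open>Bounds by a multiple of \<open>inverse (norm y)\<close> say nothing useful at the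
  origin, where the convention gives the value 0. A single point does not affect the
  integrals.\<close>

lemma integral_abs_le_except_0:
  fixes f g :: "'a::euclidean_space \<Rightarrow> real"
  assumes "f integrable_on S" "g integrable_on S" "\<And>x. x \<in> S \<Longrightarrow> x \<noteq> 0 \<Longrightarrow> \<bar>f x\<bar> \<le> g x"
  shows "\<bar>integral S f\<bar> \<le> integral S g"
proof -
  define f' where "f' x = (if x = 0 then 0 else f x)" for x
  define g' where "g' x = (if x = 0 then 0 else g x)" for x
  have eq: "integral S f = integral S f'" "integral S g = integral S g'"
    by (rule integral_spike[of "{0}"]; simp add: f'_def g'_def)+
  have "f' integrable_on S" "g' integrable_on S"
    by (rule integrable_spike[OF assms(1), of "{0}"] integrable_spike[OF assms(2), of "{0}"]; simp add: f'_def g'_def)+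
  then have "norm (integral S f') \<le> integral S g'"
    by (rule integral_norm_bound_integral) (use assms(3) in \<open>auto simp: f'_def g'_def\<close>)
  then show ?thesis using eq by simp
qed

lemma continuous_over_norm_integrable:
  fixes q :: "real^2 \<Rightarrow> real"
  assumes q: "continuous_on Q q" and Q: "compact Q"
  shows "(\<lambda>y. q y * inverse (norm y)) absolutely_integrable_on Q"
proof (rule absolutely_integrable_bounded_measurable_product[OF bilinear_times])
  obtain \<sigma> where "\<sigma> > 0" "Q \<subseteq> cball 0 \<sigma>"
    using compact_imp_bounded[OF Q] by (meson bounded_subset_ballD ball_subset_cball order_trans)
  then show "(\<lambda>y. inverse (norm y)) absolutely_integrable_on Q" using inverse_norm_integral(1)[of \<sigma>] Q
    by (meson lmeasurable_compact fmeasurableD set_integrable_subset)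
  show "Q \<in> sets lebesgue" using Q lmeasurable_compact fmeasurableD by blast
  show "q \<in> borel_measurable (lebesgue_on Q)"
    using continuous_imp_measurable_on_sets_lebesgue[OF q] Q lmeasurable_compact fmeasurableD by blast
  show "bounded (q ` Q)" using compact_continuous_image[OF q Q] compact_imp_bounded by blast
qed

definition ksig :: "real \<Rightarrow> real^2 \<Rightarrow> real" where
  "ksig e y = y \<bullet> y + e\<^sup>2"

definition kd :: "2 \<Rightarrow> 2 \<Rightarrow> real" where
  "kd i j = (if i = j then 1 else 0)"

text \<open>\<open>kg e i j\<close> is \<open>\<partial>\<^sub>i\<partial>\<^sub>j\<close> of \<open>(s + e\<^sup>2) ln (s + e\<^sup>2) / 8\<close> with
  \<open>s = |y|\<^sup>2\<close>, a regularization of \<open>|y|\<^sup>2 ln |y| / 4\<close>, whose bi-Laplacian is \<open>2\<pi>\<close> times the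
  Dirac mass.  \<open>kg3\<close> and \<open>kg4\<close> are its derivatives; they are totally symmetric in all indices.\<close>

definition kg :: "real \<Rightarrow> 2 \<Rightarrow> 2 \<Rightarrow> real^2 \<Rightarrow> real" where
  "kg e i j y = kd i j * ((ln (ksig e y) + 1) / 4) + y $ i * y $ j / (2 * ksig e y)"

definition kg3 :: "real \<Rightarrow> 2 \<Rightarrow> 2 \<Rightarrow> 2 \<Rightarrow> real^2 \<Rightarrow> real" where
  "kg3 e i j k y = (kd i j * y $ k + kd i k * y $ j + kd j k * y $ i) / (2 * ksig e y)
     - y $ i * y $ j * y $ k / (ksig e y)\<^sup>2"

definition kg4 :: "real \<Rightarrow> 2 \<Rightarrow> 2 \<Rightarrow> 2 \<Rightarrow> 2 \<Rightarrow> real^2 \<Rightarrow> real" where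
  "kg4 e i j k l y = (kd i j * kd k l + kd i k * kd j l + kd j k * kd i l) / (2 * ksig e y)
     - (kd i j * (y $ k * y $ l) + kd i k * (y $ j * y $ l) + kd j k * (y $ i * y $ l)
        + kd i l * (y $ j * y $ k) + kd j l * (y $ i * y $ k) + kd k l * (y $ i * y $ j)) / (ksig e y)\<^sup>2
     + 4 * (y $ i * y $ j * y $ k * y $ l) / (ksig e y) ^ 3"

lemma ksig_pos: "e > 0 \<Longrightarrow> ksig e y > 0"
  unfolding ksig_def by (simp add: add_nonneg_pos)

lemma ksig_has_derivative: "(ksig e has_derivative (\<lambda>h. 2 * (y \<bullet> h))) (at y)"
  unfolding ksig_def[abs_def] by (auto intro!: derivative_eq_intros simp: inner_commute)

lemma nth_has_derivative: "((\<lambda>y. y $ i) has_derivative (\<lambda>h. h $ i)) (at y)"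
  by (rule bounded_linear_imp_has_derivative) auto

lemma pd_nth: "(axis k 1 :: real^2) $ i = kd i k"
  by (auto simp: axis_def kd_def)

lemma inner_axis_2: "y \<bullet> (axis k 1 :: real^2) = y $ k"
  by (simp add: inner_axis)

lemma kg_has_derivative:
  assumes "e > 0"
  shows "(kg e i j has_derivative (\<lambda>h. kd i j * (y \<bullet> h) / (2 * ksig e y)
    + (h $ i * y $ j + y $ i * h $ j) / (2 * ksig e y) - y $ i * y $ j * (y \<bullet> h) / (ksig e y)\<^sup>2)) (at y)"
  unfolding kg_def[abs_def] using ksig_pos[OF assms, of y]
  by (auto intro!: derivative_eq_intros ksig_has_derivative nth_has_derivative)
    (simp add: fun_eq_iff divide_simps power2_eq_square, simp add: algebra_simps)

lemma kg3_has_derivative: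
  assumes "e > 0"
  shows "(kg3 e i j k has_derivative (\<lambda>h. (kd i j * h $ k + kd i k * h $ j + kd j k * h $ i) / (2 * ksig e y)
    - (kd i j * y $ k + kd i k * y $ j + kd j k * y $ i) * (y \<bullet> h) / (ksig e y)\<^sup>2
    - (h $ i * y $ j * y $ k + y $ i * h $ j * y $ k + y $ i * y $ j * h $ k) / (ksig e y)\<^sup>2
    + 4 * (y $ i * y $ j * y $ k) * (y \<bullet> h) / (ksig e y) ^ 3)) (at y)"
  unfolding kg3_def[abs_def] using ksig_pos[OF assms, of y]
  by (auto intro!: derivative_eq_intros ksig_has_derivative nth_has_derivative)
    (simp add: fun_eq_iff divide_simps power2_eq_square power3_eq_cube, simp add: algebra_simps power4_eq_xxxx)

lemma pd_kg: "e > 0 \<Longrightarrow> pd k (kg e i j) y = kg3 e i j k y"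
  by (simp add: pd_eqI[OF kg_has_derivative] kg3_def pd_nth inner_axis_2 add_divide_distrib algebra_simps)

lemma pd_kg3: "e > 0 \<Longrightarrow> pd l (kg3 e i j k) y = kg4 e i j k l y"
  by (simp add: pd_eqI[OF kg3_has_derivative] kg4_def pd_nth inner_axis_2 add_divide_distrib
      diff_divide_distrib algebra_simps)

lemma Ck_ksig: "Ck n UNIV (ksig e)"
  unfolding ksig_def[abs_def] by (intro Ck_add Ck_inner Ck_id Ck_const open_UNIV)

lemma Ck_kg:
  assumes "e > 0" shows "Ck n UNIV (kg e i j)"
proof -
  have "Ck n UNIV (\<lambda>y. kd i j * ((ln (ksig e y) + 1) * (1/4)) + y $ i * y $ j / (2 * ksig e y))"
    using ksig_pos[OF assms]
    by (intro Ck_add Ck_mult Ck_divide Ck_ln Ck_ksig Ck_const Ck_vec_nth Ck_id open_UNIV)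
      (auto simp: less_imp_neq[THEN not_sym])
  then show ?thesis by (simp add: kg_def[abs_def])
qed

lemma Ck_kg3: "e > 0 \<Longrightarrow> Ck n UNIV (kg3 e i j k)"
  using Ck_pd[OF open_UNIV Ck_kg, of e n i j] by (simp add: pd_kg)

lemma Ck_kg4: "e > 0 \<Longrightarrow> Ck n UNIV (kg4 e i j k l)"
  using Ck_pd[OF open_UNIV Ck_kg3, of e n i j k] by (simp add: pd_kg3)

lemma kg4_commute: "kg4 e k l i j y = kg4 e i j k l y" "kg4 e k l j i y = kg4 e k l i j y"
  by (simp_all add: kg4_def kd_def eq_commute ac_simps)

text \<open>This is the bi-Laplacian of the regularized potential: a positive bump of width
  \<open>e\<close> and total mass 2 pi over the plane, concentrating at the origin as
  \<open>e\<close> tends to 0.\<close>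

lemma kg4_bi_trace:
  assumes "e > 0"
  shows "(\<Sum>i\<in>UNIV. \<Sum>k\<in>UNIV. kg4 e k k i i y) = 4 * e ^ 4 / (y \<bullet> y + e\<^sup>2) ^ 3"
proof -
  have s: "y \<bullet> y = y$1 * y$1 + y$2 * y$2" by (simp add: inner_vec_def sum_2)
  have p: "ksig e y > 0" by (rule ksig_pos[OF assms])
  have "(\<Sum>i\<in>UNIV. \<Sum>k\<in>UNIV. kg4 e k k i i y) =
      4 / ksig e y - 8 * (y \<bullet> y) / (ksig e y)\<^sup>2 + 4 * (y \<bullet> y)\<^sup>2 / ksig e y ^ 3"
    unfolding sum_2 kg4_def kd_def s
    by (simp add: algebra_simps add_divide_distrib diff_divide_distrib power2_eq_square)
  also have "\<dots> = 4 * (ksig e y - y \<bullet> y)\<^sup>2 / ksig e y ^ 3"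
    using p by (simp add: field_simps power2_eq_square power3_eq_cube)
  finally show ?thesis by (simp add: ksig_def power4_eq_xxxx power2_eq_square)
qed

text \<open>The bounds do not depend on \<open>e\<close>, because \<open>ksig e y\<close> is at
  least |y|^2. The logarithm is bounded crudely by a multiple of 1/|y|, so that all terms below the
  top order share one weight.\<close>

lemma kg_bounds:
  assumes e: "0 < e" "e \<le> 1" and y: "0 < norm y" "norm y \<le> 1"
  shows "\<bar>kg e i j y\<bar> \<le> 2 / norm y" "\<bar>kg3 e i j k y\<bar> \<le> 3 / norm y" "\<bar>kg4 e i j k l y\<bar> \<le> 12 / (norm y)\<^sup>2"
proof -
  define n where "n = norm y"
  define S where "S = ksig e y"
  have n: "0 < n" "n \<le> 1" using y by (auto simp: n_def)
  have S: "S > 0" "n\<^sup>2 \<le> S" "S \<le> 2" using e y ksig_pos[OF e(1), of y]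
      power_le_one[of "norm y" 2] power_le_one[of e 2]
    by (auto simp: S_def ksig_def n_def dot_square_norm)
  have c: "\<bar>y $ i\<bar> \<le> n" for i unfolding n_def by (rule component_le_norm_cart)
  have cc: "\<bar>y $ i * y $ j\<bar> \<le> n\<^sup>2" for i j
    unfolding abs_mult power2_eq_square using c n by (intro mult_mono) auto
  have ccc: "\<bar>y $ i * y $ j * y $ k\<bar> \<le> n ^ 3" for i j k
    unfolding abs_mult[of "y $ i * y $ j"] power3_eq_cube using c cc[of i j] n
    by (intro mult_mono) (auto simp: power2_eq_square)
  have cccc: "\<bar>y $ i * y $ j * y $ k * y $ l\<bar> \<le> n ^ 4" for i j k l
    unfolding abs_mult[of "y $ i * y $ j * y $ k"] power4_eq_xxxx using c ccc[of i j k] n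
    by (intro mult_mono) (auto simp: power3_eq_cube)
  have dc: "\<bar>kd i j * z\<bar> \<le> \<bar>z\<bar>" for i j z by (simp add: kd_def)
  have iSh: "1 / (2 * S) \<le> 1 / (2 * n\<^sup>2)" using S n by (intro frac_le) auto
  have iS2: "1 / S\<^sup>2 \<le> 1 / n ^ 4"
    using power_mono[OF S(2), of 2] n S by (simp add: frac_le power_mult[symmetric])
  have iS3: "1 / S ^ 3 \<le> 1 / n ^ 6"
    using power_mono[OF S(2), of 3] n S by (simp add: frac_le power_mult[symmetric])
  have lnS: "\<bar>ln S + 1\<bar> \<le> 4 / n"
  proof -
    have "ln (n\<^sup>2) \<le> ln S" using S n by simp
    moreover have "ln (n\<^sup>2) = 2 * ln n" using n by (simp add: ln_realpow)
    moreover have "ln (1 / n) \<le> 1 / n - 1" using n by (intro ln_le_minus_one) auto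
    then have "ln n \<ge> 1 - 1 / n" using n by (simp add: ln_div)
    moreover have "ln S \<le> S - 1" using S by (intro ln_le_minus_one)
    moreover have "1 \<le> 1 / n" using n by simp
    ultimately show ?thesis using S(3) by (simp add: abs_le_iff field_simps)
  qed
  have "\<bar>y $ i * y $ j / (2 * S)\<bar> = \<bar>y $ i * y $ j\<bar> * (1 / (2 * S))" using S(1) by simp
  then have "\<bar>kg e i j y\<bar> \<le> \<bar>kd i j * ((ln S + 1) / 4)\<bar> + \<bar>y $ i * y $ j\<bar> * (1 / (2 * S))"
    unfolding kg_def S_def[symmetric]
    using abs_triangle_ineq[of "kd i j * ((ln S + 1) / 4)" "y $ i * y $ j / (2 * S)"] by linarith
  also have "\<dots> \<le> 1 / n + 1 / 2"
  proof (rule add_mono)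
    show "\<bar>kd i j * ((ln S + 1) / 4)\<bar> \<le> 1 / n" using dc[of i j "(ln S + 1) / 4"] lnS by simp
    have "\<bar>y $ i * y $ j\<bar> \<le> S" using cc S by (meson order_trans)
    then show "\<bar>y $ i * y $ j\<bar> * (1 / (2 * S)) \<le> 1 / 2" using S by (simp add: field_simps)
  qed
  also have "\<dots> \<le> 2 / n" using n by (simp add: field_simps)
  finally show "\<bar>kg e i j y\<bar> \<le> 2 / norm y" by (simp add: n_def)
  have "\<bar>kg3 e i j k y\<bar> \<le> (3 * n) * (1 / (2 * S)) + n ^ 3 * (1 / S\<^sup>2)"
  proof -
    have "\<bar>kd i j * y $ k + kd i k * y $ j + kd j k * y $ i\<bar> \<le> 3 * n"
      using dc[of i j "y $ k"] dc[of i k "y $ j"] dc[of j k "y $ i"] c[of i] c[of j] c[of k] by linarith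
    then have "\<bar>(kd i j * y $ k + kd i k * y $ j + kd j k * y $ i) / (2 * S)\<bar> \<le> (3 * n) * (1 / (2 * S))"
      using S(1) by (simp add: divide_right_mono)
    moreover have "\<bar>y $ i * y $ j * y $ k / S\<^sup>2\<bar> \<le> n ^ 3 * (1 / S\<^sup>2)"
      using ccc[of i j k] S(1) by (simp add: divide_right_mono)
    ultimately show ?thesis unfolding kg3_def S_def[symmetric] by linarith
  qed
  also have "\<dots> \<le> (3 * n) * (1 / (2 * n\<^sup>2)) + n ^ 3 * (1 / n ^ 4)"
    using iSh iS2 n by (intro add_mono mult_left_mono) auto
  also have "\<dots> \<le> 3 / n" using n by (simp add: field_simps power2_eq_square power3_eq_cube power4_eq_xxxx)
  finally show "\<bar>kg3 e i j k y\<bar> \<le> 3 / norm y" by (simp add: n_def)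
  have "\<bar>kg4 e i j k l y\<bar> \<le> 3 * (1 / (2 * S)) + 6 * n\<^sup>2 * (1 / S\<^sup>2) + 4 * n ^ 4 * (1 / S ^ 3)"
  proof -
    have dd: "\<bar>kd i j * kd k l\<bar> \<le> 1" for i j k l by (simp add: kd_def)
    have "\<bar>kd i j * kd k l + kd i k * kd j l + kd j k * kd i l\<bar> \<le> 3"
      using dd[of i j k l] dd[of i k j l] dd[of j k i l] by linarith
    then have "\<bar>(kd i j * kd k l + kd i k * kd j l + kd j k * kd i l) / (2 * S)\<bar> \<le> 3 * (1 / (2 * S))"
      using S(1) by (simp add: divide_right_mono)
    moreover have "\<bar>kd i j * (y $ k * y $ l) + kd i k * (y $ j * y $ l) + kd j k * (y $ i * y $ l)
        + kd i l * (y $ j * y $ k) + kd j l * (y $ i * y $ k) + kd k l * (y $ i * y $ j)\<bar> \<le> 6 * n\<^sup>2"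
    proof -
      have dcc: "\<bar>kd i j * (y $ k * y $ l)\<bar> \<le> n\<^sup>2" for i j k l
        using dc[of i j "y $ k * y $ l"] cc[of k l] by linarith
      have add: "\<bar>x\<bar> \<le> a \<Longrightarrow> \<bar>y\<bar> \<le> b \<Longrightarrow> \<bar>x + y\<bar> \<le> a + b" for x y a b :: real by linarith
      have "\<bar>kd i j * (y $ k * y $ l) + kd i k * (y $ j * y $ l) + kd j k * (y $ i * y $ l)
        + kd i l * (y $ j * y $ k) + kd j l * (y $ i * y $ k) + kd k l * (y $ i * y $ j)\<bar>
        \<le> n\<^sup>2 + n\<^sup>2 + n\<^sup>2 + n\<^sup>2 + n\<^sup>2 + n\<^sup>2" by (intro add dcc)
      then show ?thesis by simp
    qed
    then have "\<bar>(kd i j * (y $ k * y $ l) + kd i k * (y $ j * y $ l) + kd j k * (y $ i * y $ l)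
        + kd i l * (y $ j * y $ k) + kd j l * (y $ i * y $ k) + kd k l * (y $ i * y $ j)) / S\<^sup>2\<bar> \<le> 6 * n\<^sup>2 * (1 / S\<^sup>2)"
      using S(1) by (simp add: divide_right_mono)
    moreover have "\<bar>4 * (y $ i * y $ j * y $ k * y $ l) / S ^ 3\<bar> \<le> 4 * n ^ 4 * (1 / S ^ 3)"
      using cccc[of i j k l] S(1) by (simp add: divide_right_mono)
    ultimately show ?thesis unfolding kg4_def S_def[symmetric] by linarith
  qed
  also have "\<dots> \<le> 3 * (1 / (2 * n\<^sup>2)) + 6 * n\<^sup>2 * (1 / n ^ 4) + 4 * n ^ 4 * (1 / n ^ 6)"
    using iSh iS2 iS3 n by (intro add_mono mult_left_mono) auto
  also have "\<dots> = (3/2 + 6 + 4) / n\<^sup>2"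
  proof -
    have "n ^ 4 = n\<^sup>2 * n\<^sup>2" "n ^ 6 = n\<^sup>2 * n\<^sup>2 * n\<^sup>2" by (simp_all flip: power_add)
    then show ?thesis using n by (simp add: field_simps)
  qed
  also have "\<dots> \<le> 12 / n\<^sup>2" by (rule divide_right_mono) auto
  finally show "\<bar>kg4 e i j k l y\<bar> \<le> 12 / (norm y)\<^sup>2" by (simp add: n_def)
qed

text \<open>Only a lower bound for the concentrating mass enters. On the disc of radius
  \<open>e\<close> the kernel is at least 1 / (2 e^2), and there \<psi> keeps its sign and half of
  its size at 0; this contributes |\<psi>(0)| pi / 4. A contribution of the wrong sign can only come
  from outside a fixed disc, where the kernel is of order e^4.\<close>

lemma approximate_delta_lower_bound:
  fixes \<psi> :: "real^2 \<Rightarrow> real"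
  assumes \<psi>: "continuous_on (cbox A B) \<psi>" and a: "a > 0" "cball 0 a \<subseteq> cbox A B"
    and bound: "\<And>e. 0 < e \<Longrightarrow> e \<le> 1 \<Longrightarrow> \<bar>integral (cbox A B) (\<lambda>y. \<psi> y * (4 * e ^ 4 / (y \<bullet> y + e\<^sup>2) ^ 3))\<bar> \<le> K"
  shows "\<bar>\<psi> 0\<bar> \<le> 2 * K"
proof (cases "\<psi> 0 = 0")
  case True
  then show ?thesis using bound[of 1] by simp
next
  case False
  define Q where "Q = cbox A B"
  define s where "s = sgn (\<psi> 0)"
  define m where "m = \<bar>\<psi> 0\<bar>"
  have m: "m > 0" "s * \<psi> 0 = m" "\<bar>s\<bar> = 1" using False by (auto simp: m_def s_def sgn_if)
  have "0 \<in> Q" using a by (auto simp: Q_def)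
  then obtain r0 where r0: "r0 > 0" "\<And>y. y \<in> Q \<Longrightarrow> dist y 0 < r0 \<Longrightarrow> dist (\<psi> y) (\<psi> 0) < m / 2"
    using \<psi> m(1) unfolding Q_def[symmetric] continuous_on_iff by (metis half_gt_zero)
  define r where "r = min 1 (min a (r0 / 2))"
  have r: "r > 0" "r \<le> 1" "r \<le> a" "r < r0" using r0 a by (auto simp: r_def)
  have psi_r: "s * \<psi> y \<ge> m / 2" if "norm y \<le> r" "y \<in> Q" for y
  proof -
    have "\<bar>s * \<psi> y - s * \<psi> 0\<bar> = \<bar>\<psi> y - \<psi> 0\<bar>" using m(3) by (simp add: right_diff_distrib[symmetric] abs_mult)
    also have "\<dots> < m / 2" using r0(2)[OF that(2)] that r by (simp add: dist_norm)
    finally show ?thesis using m(2) by linarith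
  qed
  obtain P where P: "P > 0" "\<And>y. y \<in> Q \<Longrightarrow> \<bar>\<psi> y\<bar> \<le> P"
    using compact_imp_bounded[OF compact_continuous_image[OF \<psi> compact_cbox]] unfolding bounded_pos Q_def by auto
  define c where "c = 4 * P / r ^ 6 * measure lborel Q"
  have "m * pi / 4 - c * e ^ 4 \<le> K" if e: "0 < e" "e \<le> r" for e
  proof -
    define D where "D y = 4 * e ^ 4 / (y \<bullet> y + e\<^sup>2) ^ 3" for y :: "real^2"
    have pos: "y \<bullet> y + e\<^sup>2 > 0" for y :: "real^2" using e by (simp add: add_nonneg_pos)
    have D0: "D y > 0" for y using pos[of y] e by (simp add: D_def)
    \<comment> \<open>A minorant with an explicit integral: the height is m/2 times the lower bound
      1 / (2 e^2) of the kernel, and the subtracted constant accounts for the points with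
      \<open>norm y > r\<close>.\<close>
    define f where "f y = (m / (4 * e\<^sup>2)) * indicat_real (cball 0 e) y - 4 * P * e ^ 4 / r ^ 6" for y :: "real^2"
    have le: "f y \<le> s * (\<psi> y * D y)" if y: "y \<in> Q" for y
    proof (cases "norm y \<le> r")
      case True
      then have 1: "m / 2 * D y \<le> s * \<psi> y * D y" using psi_r[OF True y] D0[of y] by (intro mult_right_mono) auto
      have 2: "0 \<le> m / 2 * D y" using m D0[of y] by simp
      have 3: "1 / (2 * e\<^sup>2) \<le> D y" if "norm y \<le> e"
      proof -
        have "y \<bullet> y \<le> e\<^sup>2" using that by (simp add: dot_square_norm power_mono)
        then have "(y \<bullet> y + e\<^sup>2) ^ 3 \<le> (2 * e\<^sup>2) ^ 3" using pos[of y] by (intro power_mono) auto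
        then have "4 * e ^ 4 / (2 * e\<^sup>2) ^ 3 \<le> D y" unfolding D_def using pos[of y] e by (intro divide_left_mono) auto
        moreover have "4 * e ^ 4 / (2 * e\<^sup>2) ^ 3 = 1 / (2 * e\<^sup>2)" using e by (simp add: field_simps eval_nat_numeral)
        ultimately show ?thesis by simp
      qed
      have 4: "0 \<le> 4 * P * e ^ 4 / r ^ 6" using P r e by simp
      show ?thesis
      proof (cases "norm y \<le> e")
        case True
        have "m / (4 * e\<^sup>2) = m / 2 * (1 / (2 * e\<^sup>2))" by simp
        also have "\<dots> \<le> m / 2 * D y" using 3[OF True] m by (intro mult_left_mono) auto
        finally show ?thesis using 1 4 True by (simp add: f_def mult.assoc)
      next
        case False
        then show ?thesis using 1 2 4 by (simp add: f_def mult.assoc)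
      qed
    next
      case False
      then have "r\<^sup>2 \<le> y \<bullet> y + e\<^sup>2" using r by (simp add: dot_square_norm power_mono add_increasing2)
      then have "(r\<^sup>2) ^ 3 \<le> (y \<bullet> y + e\<^sup>2) ^ 3" by (intro power_mono) auto
      then have "D y \<le> 4 * e ^ 4 / r ^ 6" unfolding D_def using r e
        by (intro divide_left_mono) (auto simp: power_mult[symmetric] pos)
      then have "\<bar>\<psi> y\<bar> * D y \<le> P * (4 * e ^ 4 / r ^ 6)" using P(2)[OF y] P D0[of y] by (intro mult_mono) auto
      moreover have "- (\<bar>\<psi> y\<bar> * D y) \<le> s * (\<psi> y * D y)"
        using m(3) D0[of y] abs_ge_minus_self[of "s * (\<psi> y * D y)"] by (simp add: abs_mult)
      ultimately show ?thesis using False e by (simp add: f_def)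
    qed
    have ind: "(indicat_real (cball (0::real^2) e) has_integral measure lborel (cball (0::real^2) e)) Q"
    proof -
      have "cball 0 e \<subseteq> Q" using a r e by (auto simp: Q_def)
      then have "((\<lambda>x. 1::real) has_integral measure lborel (cball (0::real^2) e)) (cball (0::real^2) e)" "cball 0 e \<subseteq> Q"
        using has_integral_measure_lborel[of "cball (0::real^2) e"] emeasure_lborel_cball_finite[of 0 e]
        by (auto simp: top.not_eq_extremum)
      then show ?thesis using has_integral_restrict[of "cball 0 e" Q "\<lambda>_. 1::real"]
        by (simp add: indicator_def[abs_def] of_bool_def)
    qed
    have "measure lborel (cball (0::real^2) e) = pi * e\<^sup>2"
      using content_cball[of e "0::real^2"] e by (simp add: unit_ball_vol_2)
    then have fint: "(f has_integral (m / (4 * e\<^sup>2)) * (pi * e\<^sup>2) - 4 * P * e ^ 4 / r ^ 6 * measure lborel Q) Q"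
      unfolding f_def using ind has_integral_const_real
      by (intro has_integral_diff has_integral_mult_right)
        (auto simp: Q_def has_integral_const[of "4 * P * e ^ 4 / r ^ 6" A B, simplified] intro: has_integral_eq_rhs[OF has_integral_const])
    have "continuous_on Q (\<lambda>y. \<psi> y * D y)"
      unfolding D_def Q_def using pos \<psi> by (intro continuous_intros) (auto simp: less_imp_neq[THEN not_sym])
    then have "(\<lambda>y. \<psi> y * D y) integrable_on Q" unfolding Q_def by (rule integrable_continuous)
    then have "((\<lambda>y. s * (\<psi> y * D y)) has_integral s * integral Q (\<lambda>y. \<psi> y * D y)) Q"
      by (intro has_integral_mult_right integrable_integral)
    then have "(m / (4 * e\<^sup>2)) * (pi * e\<^sup>2) - 4 * P * e ^ 4 / r ^ 6 * measure lborel Q \<le> s * integral Q (\<lambda>y. \<psi> y * D y)"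
      using has_integral_le[OF fint] le by blast
    also have "\<dots> \<le> K" using bound[of e] e r m(3) abs_ge_self[of "s * integral Q (\<lambda>y. \<psi> y * D y)"]
      by (simp add: abs_mult D_def Q_def)
    finally show ?thesis using e by (simp add: c_def field_simps)
  qed
  moreover have "((\<lambda>e. m * pi / 4 - c * e ^ 4) \<longlongrightarrow> m * pi / 4 - c * 0 ^ 4) (at_right 0)"
    by (intro tendsto_intros)
  ultimately have "m * pi / 4 - c * 0 ^ 4 \<le> K"
    using r by (intro tendsto_upperbound[where F = "at_right 0"])
      (auto simp: eventually_at_right intro!: exI[of _ r])
  then have "m * pi \<le> 4 * K" by simp
  moreover have "m * 2 \<le> m * pi" using m pi_ge_two by simp
  ultimately show ?thesis by (simp add: m_def)
qed

definition laplace :: "(real^2 \<Rightarrow> real) \<Rightarrow> real^2 \<Rightarrow> real" where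
  "laplace f y = (\<Sum>k\<in>UNIV. pd2 k k f y)"

lemma pd_cong_open:
  assumes "open U" "x \<in> U" "f differentiable at x" "\<And>z. z \<in> U \<Longrightarrow> f z = g z"
  shows "pd i f x = pd i g x" using frechet_derivative_transform_within_open[of f x U g] assms by auto

text \<open>\<open>F\<close> is given on \<open>U\<close> only, but the bump vanishes outside a disc
  contained in \<open>U\<close>, so the product extended by zero is differentiable on the whole
  plane and has compact support.\<close>

lemma integral_pd_bump_mult:
  fixes F :: "real^2 \<Rightarrow> real"
  assumes a: "a > 0" "cball 0 a \<subseteq> T" "T \<subseteq> U" and U: "open U" and F: "Ck 1 U F"
  shows "integral T (\<lambda>y. pd k (\<lambda>z. bump a z * F z) y) = 0"
proof -
  define c where "c y = (if y \<in> U then bump a y * F y else 0)" for y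
  have cU: "Ck 1 U c" by (rule Ck_cong[OF U _ Ck_mult[OF U Ck_subset[OF Ck_bump] F]]) (auto simp: c_def)
  have "Ck 1 UNIV c"
  proof (rule Ck_local)
    fix x :: "real^2"
    show "\<exists>V. open V \<and> x \<in> V \<and> Ck 1 V c"
    proof (cases "x \<in> U")
      case True
      then show ?thesis using U cU by blast
    next
      case False
      have "Ck 1 (- cball 0 a) c"
        by (rule Ck_cong[OF _ _ Ck_const[of _ _ 0]]) (use a in \<open>auto simp: c_def bump_outside\<close>)
      moreover have "x \<in> - cball 0 a" using False a by blast
      ultimately show ?thesis by blast
    qed
  qed
  then have "integral T (\<lambda>x. frechet c x (axis k 1)) = 0"
    by (rule integral_derivative_compact_support[where S = "cball 0 a"])
      (use a in \<open>auto simp: c_def bump_outside\<close>)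
  moreover have "pd k c y = pd k (\<lambda>z. bump a z * F z) y" if "y \<in> T" for y
    using that a U by (intro pd_cong_open[OF U]) (auto simp: c_def intro: Ck_differentiable[OF cU])
  ultimately show ?thesis by (simp cong: integral_cong)
qed

text \<open>The growth of second derivatives of the fundamental solution, except that 1/|y| is a
  coarser bound for \<phi> than the true logarithm.\<close>

abbreviation kernel_bound :: "(real^2) set \<Rightarrow> real \<Rightarrow> (real^2 \<Rightarrow> real) \<Rightarrow> bool" where
  "kernel_bound Q M \<phi> \<equiv> \<forall>y\<in>Q. y \<noteq> 0 \<longrightarrow> \<bar>\<phi> y\<bar> \<le> M / norm y \<and>
    (\<forall>k. \<bar>pd k \<phi> y\<bar> \<le> M / norm y) \<and> (\<forall>k l. \<bar>pd2 k l \<phi> y\<bar> \<le> M / (norm y)\<^sup>2)"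

text \<open>The divergence identity behind the estimate: for functions \<open>w\<close>, \<open>l\<close> one has
  \<open>\<Delta>w l\<^sub>i\<^sub>j - w\<^sub>i\<^sub>j \<Delta>l = \<Sum>\<^sub>k \<partial>\<^sub>i(w\<^sub>k\<^sub>k l\<^sub>j) - \<partial>\<^sub>k(w\<^sub>i\<^sub>k l\<^sub>j) + \<partial>\<^sub>j(w\<^sub>i\<^sub>k l\<^sub>k) - \<partial>\<^sub>k(w\<^sub>i\<^sub>j l\<^sub>k)\<close>.
  With a cut-off, only first derivatives of \<open>l\<close> and second derivatives of \<open>w\<close> remain as errors.\<close>

lemma kernel_estimate:
  fixes A B :: "real^2"
  assumes a: "a > 0" "cball 0 a \<subseteq> cbox A B" "cbox A B \<subseteq> U" "cbox A B \<subseteq> cball 0 1" and U: "open U"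
  shows "\<exists>C>0. \<forall>w q S i j. Ck 3 U w \<longrightarrow> continuous_on (cbox A B) q \<longrightarrow>
    (\<forall>y\<in>cbox A B. \<forall>k l. \<bar>pd2 k l w y\<bar> \<le> q y) \<longrightarrow>
    (\<forall>\<phi> M. (\<forall>n. Ck n UNIV \<phi>) \<longrightarrow> (\<forall>y. norm y \<ge> a \<longrightarrow> \<phi> y = 0) \<longrightarrow>
      kernel_bound (cbox A B) M \<phi> \<longrightarrow>
      \<bar>integral (cbox A B) (\<lambda>y. laplace w y * laplace \<phi> y)\<bar> \<le> M * S) \<longrightarrow>
    \<bar>pd2 i j w 0\<bar> \<le> C * (S + integral (cbox A B) (\<lambda>y. q y * inverse (norm y)))"
proof -
  define Q where "Q = cbox A B"
  define \<zeta> where "\<zeta> = (bump a :: real^2 \<Rightarrow> real)"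
  have z: "Ck n UNIV \<zeta>" for n unfolding \<zeta>_def by (rule Ck_bump)
  have z1: "Ck n UNIV (\<lambda>y. pd k \<zeta> y)" for n k using Ck_pd[OF open_UNIV z] by blast
  have z2: "Ck n UNIV (\<lambda>y. pd2 l k \<zeta> y)" for n k l using Ck_pd[OF open_UNIV z1] by blast
  have cQ: "compact Q" by (simp add: Q_def)
  obtain Z where Z: "Z > 0" "\<And>y. y \<in> Q \<Longrightarrow> \<bar>\<zeta> y\<bar> \<le> Z" "\<And>y k. y \<in> Q \<Longrightarrow> \<bar>pd k \<zeta> y\<bar> \<le> Z"
    "\<And>y k l. y \<in> Q \<Longrightarrow> \<bar>pd2 l k \<zeta> y\<bar> \<le> Z"
  proof -
    have bd: "\<exists>b>0. \<forall>y\<in>Q. \<bar>f y\<bar> \<le> b" if "Ck n UNIV f" for f :: "real^2 \<Rightarrow> real" and n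
      using compact_imp_bounded[OF compact_continuous_image[OF continuous_on_subset[OF Ck_continuous_on[OF that]] cQ]]
      unfolding bounded_pos by auto
    obtain b0 where b0: "b0 > 0" "\<forall>y\<in>Q. \<bar>\<zeta> y\<bar> \<le> b0" using bd[OF z[of 0]] by blast
    have "\<forall>k. \<exists>b>0. \<forall>y\<in>Q. \<bar>pd k \<zeta> y\<bar> \<le> b" using bd[OF z1[of 0]] by blast
    then obtain b1 where b1: "\<And>k. b1 k > 0" "\<And>k. \<forall>y\<in>Q. \<bar>pd k \<zeta> y\<bar> \<le> b1 k" by metis
    have "\<forall>k l. \<exists>b>0. \<forall>y\<in>Q. \<bar>pd2 l k \<zeta> y\<bar> \<le> b" using bd[OF z2[of 0]] by blast
    then obtain b2 where b2: "\<And>k l. b2 k l > 0" "\<And>k l. \<forall>y\<in>Q. \<bar>pd2 l k \<zeta> y\<bar> \<le> b2 k l" by metis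
    define Z where "Z = b0 + (\<Sum>k\<in>UNIV. b1 k) + (\<Sum>k\<in>UNIV. \<Sum>l\<in>UNIV. b2 k l)"
    have s1: "b1 k \<le> (\<Sum>k\<in>UNIV. b1 k)" for k using b1 by (intro member_le_sum) (auto intro: less_imp_le)
    have s2: "b2 k l \<le> (\<Sum>k\<in>UNIV. \<Sum>l\<in>UNIV. b2 k l)" for k l
    proof -
      have "b2 k l \<le> (\<Sum>l\<in>UNIV. b2 k l)" using b2 by (intro member_le_sum) (auto intro: less_imp_le)
      also have "\<dots> \<le> (\<Sum>k\<in>UNIV. \<Sum>l\<in>UNIV. b2 k l)"
        using b2 by (intro member_le_sum[where f = "\<lambda>k. \<Sum>l\<in>UNIV. b2 k l"]) (auto intro!: sum_nonneg intro: less_imp_le)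
      finally show ?thesis .
    qed
    have pos: "0 < (\<Sum>k\<in>UNIV. b1 k)" "0 < (\<Sum>k\<in>UNIV. \<Sum>l\<in>UNIV. b2 k l)"
      using s1[of 1] s2[of 1 1] b1(1)[of 1] b2(1)[of 1 1] by linarith+
    show ?thesis
    proof (rule that[of Z])
      show "Z > 0" using b0 pos by (simp add: Z_def)
      show "\<bar>\<zeta> y\<bar> \<le> Z" if "y \<in> Q" for y using b0(2) that pos unfolding Z_def by force
      show "\<bar>pd k \<zeta> y\<bar> \<le> Z" if "y \<in> Q" for y k
        using b1(2)[of k] that s1[of k] pos b0(1) unfolding Z_def by force
      show "\<bar>pd2 l k \<zeta> y\<bar> \<le> Z" if "y \<in> Q" for y k l
        using b2(2)[of k l] that s2[of k l] pos b0(1) unfolding Z_def by force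
    qed
  qed
  have z0: "\<zeta> 0 > 0" unfolding \<zeta>_def by (rule bump_0[OF a(1)])
  \<comment> \<open>The terms with a differentiated cut-off contribute 80 \<open>Z\<close>, the
    passage from the approximate delta to the value at 0 a factor 2, and division by
    \<open>\<zeta> 0\<close> removes the cut-off.\<close>
  define C where "C = 160 * Z / \<zeta> 0"
  show ?thesis
  proof (intro exI[of _ C] conjI allI impI)
    show "C > 0" using Z z0 by (simp add: C_def)
    fix w q S i j
    assume w: "Ck 3 U w" and q: "continuous_on (cbox A B) q"
      and wq: "\<forall>y\<in>cbox A B. \<forall>k l. \<bar>pd2 k l w y\<bar> \<le> q y"
      and test: "\<forall>\<phi> M. (\<forall>n. Ck n UNIV \<phi>) \<longrightarrow> (\<forall>y. norm y \<ge> a \<longrightarrow> \<phi> y = 0) \<longrightarrow>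
        kernel_bound (cbox A B) M \<phi> \<longrightarrow>
        \<bar>integral (cbox A B) (\<lambda>y. laplace w y * laplace \<phi> y)\<bar> \<le> M * S"
    define J where "J = integral Q (\<lambda>y. q y * inverse (norm y))"
    define w2 where "w2 k l y = pd2 k l w y" for k l y
    have w1C: "Ck 2 U (\<lambda>y. pd l w y)" for l using Ck_pd[OF U, of 2 w l] w by (simp add: eval_nat_numeral)
    have w2C: "Ck 1 U (w2 k l)" for k l
      using Ck_pd[OF U, of 1 "\<lambda>y. pd l w y" k] w1C unfolding w2_def[abs_def] by (simp add: eval_nat_numeral)
    have w2d: "w2 k l differentiable at y" if "y \<in> U" for k l y using Ck_differentiable[OF w2C that] .
    have w2s: "w2 k l y = w2 l k y" if "y \<in> U" for k l y
      unfolding w2_def using Ck_second_derivative_symmetric[OF U _ that, of w] Ck_le[OF w, of 2] by simp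
    have w3a: "pd m (w2 k l) y = pd k (w2 m l) y" if "y \<in> U" for k l m y
      unfolding w2_def[abs_def] by (rule Ck_second_derivative_symmetric[OF U w1C that])
    have w3b: "pd m (w2 k l) y = pd m (w2 l k) y" if "y \<in> U" for k l m y
      by (rule pd_cong_open[OF U that w2d[OF that]]) (rule w2s)
    have "\<bar>integral Q (\<lambda>y. \<zeta> y * w2 i j y * (4 * e ^ 4 / (y \<bullet> y + e\<^sup>2) ^ 3))\<bar> \<le> 80 * Z * (S + J)"
      if e: "0 < e" "e \<le> 1" for e
    proof -
      note CkK = Ck_kg[OF e(1)] Ck_kg3[OF e(1)] Ck_kg4[OF e(1)]
      \<comment> \<open>The cut-off second derivative of the potential; it is smooth because
        \<open>e\<close> is positive, and its bounds are uniform in \<open>e\<close>.\<close>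
      define \<phi> where "\<phi> y = \<zeta> y * kg e i j y" for y
      have dd: "f differentiable at y" if "\<And>n. Ck n UNIV f" for f :: "real^2 \<Rightarrow> real" and y
        using Ck_differentiable[OF that UNIV_I] by blast
      have phi: "Ck n UNIV \<phi>" for n unfolding \<phi>_def[abs_def] by (intro Ck_mult z CkK open_UNIV)
      have phi1: "pd k \<phi> y = pd k \<zeta> y * kg e i j y + \<zeta> y * kg3 e i j k y" for k y
        unfolding \<phi>_def[abs_def] by (subst pd_mult) (auto intro!: dd z CkK simp: pd_kg[OF e(1)])
      have phi2: "pd2 l k \<phi> y = pd2 l k \<zeta> y * kg e i j y + pd k \<zeta> y * kg3 e i j l y
          + (pd l \<zeta> y * kg3 e i j k y + \<zeta> y * kg4 e i j k l y)" for k l y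
        unfolding phi1
        by (subst pd_add) (auto intro!: dd z z1 CkK Ck_mult simp: pd_mult dd z z1 CkK pd_kg[OF e(1)] pd_kg3[OF e(1)])
      have T: "\<bar>integral Q (\<lambda>y. laplace w y * laplace \<phi> y)\<bar> \<le> (20 * Z) * S"
      proof -
        have "\<bar>\<phi> y\<bar> \<le> 20 * Z / norm y \<and> (\<forall>k. \<bar>pd k \<phi> y\<bar> \<le> 20 * Z / norm y) \<and>
          (\<forall>k l. \<bar>pd2 k l \<phi> y\<bar> \<le> 20 * Z / (norm y)\<^sup>2)" if y: "y \<in> Q" "y \<noteq> 0" for y
        proof -
          define n where "n = norm y"
          have n: "0 < n" "n \<le> 1" using y a by (auto simp: n_def Q_def)
          note kb = kg_bounds[OF e, of y, folded n_def, OF n]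
          have mm: "\<bar>s * t\<bar> \<le> Z * b" if "\<bar>s\<bar> \<le> Z" "\<bar>t\<bar> \<le> b" for s t b :: real
            using that Z(1) unfolding abs_mult by (intro mult_mono) auto
          have 1: "\<bar>\<phi> y\<bar> \<le> Z * (2 / n)" unfolding \<phi>_def by (intro mm Z(2) y kb)
          have 2: "\<bar>pd k \<phi> y\<bar> \<le> Z * (2 / n) + Z * (3 / n)" for k
            unfolding phi1 by (intro order_trans[OF abs_triangle_ineq] add_mono mm Z(2,3) y kb)
          have 3: "\<bar>pd2 l k \<phi> y\<bar> \<le> (Z * (2 / n) + Z * (3 / n)) + (Z * (3 / n) + Z * (12 / n\<^sup>2))" for k l
            unfolding phi2 by (intro order_trans[OF abs_triangle_ineq] add_mono mm Z(2,3,4) y kb)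
          have 4: "1 / n \<le> 1 / n\<^sup>2" using n by (intro divide_left_mono) (auto simp: power2_eq_square mult_left_le)
          have 5: "Z * (1 / n) \<le> Z * (1 / n\<^sup>2)" using 4 Z(1) by (intro mult_left_mono) auto
          have 6: "0 < Z * (1 / n)" "0 < Z * (1 / n\<^sup>2)" using Z(1) n by auto
          have "\<bar>\<phi> y\<bar> \<le> 20 * (Z * (1 / n))" using 1 6 by simp
          moreover have "\<bar>pd k \<phi> y\<bar> \<le> 20 * (Z * (1 / n))" for k using 2[of k] 6 by simp
          moreover have "\<bar>pd2 l k \<phi> y\<bar> \<le> 20 * (Z * (1 / n\<^sup>2))" for k l
          proof -
            have "(Z * (2 / n) + Z * (3 / n)) + (Z * (3 / n) + Z * (12 / n\<^sup>2)) = 8 * (Z * (1 / n)) + 12 * (Z * (1 / n\<^sup>2))"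
              by (simp add: field_simps)
            then show ?thesis using 3[of k l] 3[of l k] 5 6 by linarith
          qed
          ultimately show ?thesis by (simp add: n_def)
        qed
        moreover have "\<phi> y = 0" if "norm y \<ge> a" for y
          using bump_outside[OF that a(1)] by (simp add: \<phi>_def \<zeta>_def)
        ultimately show ?thesis using test[rule_format, of \<phi> "20 * Z"] phi unfolding Q_def by blast
      qed
      \<comment> \<open>\<open>L1\<close> and \<open>L2\<close> are the gradient and the Hessian of
        the function l of the divergence identity, the Laplacian of the regularized potential. Its
        own Laplacian is the approximate delta \<open>D\<close>.\<close>
      define L1 where "L1 k y = (\<Sum>m\<in>UNIV. kg3 e m m k y)" for k y
      define L2 where "L2 l k y = (\<Sum>m\<in>UNIV. kg4 e m m k l y)" for l k y
      have L1C: "Ck n UNIV (L1 k)" for n k unfolding L1_def[abs_def] by (intro Ck_sum CkK open_UNIV)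
      have pdL1: "pd l (L1 k) y = L2 l k y" for l k y
        unfolding L1_def[abs_def] L2_def sum_2 by (subst pd_add) (auto intro!: dd CkK simp: pd_kg3[OF e(1)])
      have L2s: "L2 l k y = L2 k l y" for l k y by (simp add: L2_def kg4_commute(2)[of e _ _ l k])
      have L2k: "(\<Sum>k\<in>UNIV. kg4 e i j k k y) = L2 i j y" for y
        unfolding L2_def by (rule sum.cong[OF refl]) (metis kg4_commute)
      define D where "D y = 4 * e ^ 4 / (y \<bullet> y + e\<^sup>2) ^ 3" for y :: "real^2"
      have DL: "(\<Sum>k\<in>UNIV. L2 k k y) = D y" for y
        using kg4_bi_trace[OF e(1), of y] by (simp add: L2_def D_def)
      define dv where "dv m F y = pd m (\<lambda>z. \<zeta> z * F z) y" for m and F :: "real^2 \<Rightarrow> real" and y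
      define DIV where "DIV y = (\<Sum>k\<in>UNIV. dv i (\<lambda>z. w2 k k z * L1 j z) y - dv k (\<lambda>z. w2 i k z * L1 j z) y
        + dv j (\<lambda>z. w2 i k z * L1 k z) y - dv k (\<lambda>z. w2 i j z * L1 k z) y)" for y
      have FC: "Ck 1 U (\<lambda>z. w2 k l z * L1 m z)" for k l m by (intro Ck_mult U w2C Ck_subset[OF L1C]) auto
      have dvC: "continuous_on Q (dv m (\<lambda>z. w2 k l z * L1 p z))" for m k l p
      proof -
        have "Ck 0 U (\<lambda>y. pd m (\<lambda>z. \<zeta> z * (w2 k l z * L1 p z)) y)"
          using Ck_pd[OF U, of 0 "\<lambda>z. \<zeta> z * (w2 k l z * L1 p z)" m]
            Ck_mult[OF U Ck_subset[OF z[of 1]] FC] by simp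
        then show ?thesis unfolding dv_def[abs_def]
          using Ck_continuous_on continuous_on_subset a(3) Q_def by blast
      qed
      have dvI: "integral Q (dv m (\<lambda>z. w2 k l z * L1 p z)) = 0" for m k l p
        unfolding dv_def[abs_def] \<zeta>_def Q_def by (rule integral_pd_bump_mult[OF a(1-3) U FC])
      have dvi: "(dv m (\<lambda>z. w2 k l z * L1 p z) has_integral 0) Q" for m k l p
        using integrable_integral[OF integrable_continuous[OF dvC[unfolded Q_def]]] dvI unfolding Q_def by metis
      have DIVi: "(DIV has_integral 0) Q"
      proof -
        have "(DIV has_integral (\<Sum>k\<in>(UNIV::2 set). 0 - 0 + 0 - 0)) Q"
          unfolding DIV_def[abs_def] by (intro has_integral_sum has_integral_add has_integral_diff dvi) auto
        then show ?thesis by simp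
      qed
      have QU: "y \<in> U" if "y \<in> Q" for y using that a(3) by (auto simp: Q_def)
      have dvE: "dv m (\<lambda>z. w2 k l z * L1 p z) y =
          pd m \<zeta> y * (w2 k l y * L1 p y) + \<zeta> y * (pd m (w2 k l) y * L1 p y + w2 k l y * L2 m p y)"
        if "y \<in> Q" for m k l p y
      proof -
        have 1: "w2 k l differentiable at y" using w2d QU that by blast
        have 2: "L1 p differentiable at y" using dd L1C by blast
        show ?thesis unfolding dv_def
          by (subst pd_mult[OF dd[OF z] differentiable_mult[OF 1 2]]) (simp add: pd_mult[OF 1 2] pdL1)
      qed
      define E where "E y = (\<Sum>k\<in>UNIV. pd i \<zeta> y * (w2 k k y * L1 j y) - pd k \<zeta> y * (w2 i k y * L1 j y)
        + pd j \<zeta> y * (w2 i k y * L1 k y) - pd k \<zeta> y * (w2 i j y * L1 k y))" for y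
      have DIVE: "DIV y = E y + \<zeta> y * (laplace w y * L2 i j y - w2 i j y * D y)" if y: "y \<in> Q" for y
      proof -
        note W = w3a[OF QU[OF y]] and W' = w3b[OF QU[OF y]]
        have W1: "pd i (w2 k k) y = pd k (w2 i k) y" for k by (rule W)
        have W2: "pd j (w2 i k) y = pd k (w2 i j) y" for k
        proof -
          have "pd j (w2 i k) y = pd i (w2 j k) y" by (rule W)
          also have "\<dots> = pd i (w2 k j) y" by (rule W')
          also have "\<dots> = pd k (w2 i j) y" by (rule W)
          finally show ?thesis .
        qed
        have "DIV y = E y + \<zeta> y * (\<Sum>k\<in>UNIV. w2 k k y * L2 i j y - w2 i k y * L2 k j y
            + w2 i k y * L2 j k y - w2 i j y * L2 k k y)"
          unfolding DIV_def E_def dvE[OF y] W1 W2 sum_2 by (simp add: algebra_simps)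
        also have "(\<Sum>k\<in>UNIV. w2 k k y * L2 i j y - w2 i k y * L2 k j y
            + w2 i k y * L2 j k y - w2 i j y * L2 k k y) = laplace w y * L2 i j y - w2 i j y * D y"
          unfolding laplace_def w2_def[symmetric] DL[symmetric] L2s[of j] sum_2 by (simp add: algebra_simps)
        finally show ?thesis .
      qed
      \<comment> \<open>\<open>R\<close> collects every term in which a derivative has fallen on the
        cut-off. None of them contains a fourth derivative of the potential, so all are of order
        1/|y|.\<close>
      define R where "R y = laplace w y * (\<Sum>k\<in>UNIV. pd2 k k \<zeta> y * kg e i j y + 2 * (pd k \<zeta> y * kg3 e i j k y)) - E y" for y
      have main: "\<zeta> y * w2 i j y * D y = laplace w y * laplace \<phi> y - R y - DIV y" if "y \<in> Q" for y
      proof -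
        have "laplace \<phi> y = (\<Sum>k\<in>UNIV. pd2 k k \<zeta> y * kg e i j y + 2 * (pd k \<zeta> y * kg3 e i j k y)) + \<zeta> y * L2 i j y"
          unfolding laplace_def phi2 L2k[symmetric] sum_2 by (simp add: algebra_simps)
        then show ?thesis unfolding R_def DIVE[OF that] by (simp add: algebra_simps)
      qed
      have qn: "(\<lambda>y. q y * inverse (norm y)) integrable_on Q"
        using continuous_over_norm_integrable[OF q compact_cbox] set_lebesgue_integral_eq_integral(1) unfolding Q_def by blast
      have cont: "continuous_on Q f" if "Ck n U f" for f :: "real^2 \<Rightarrow> real" and n
        using Ck_continuous_on[OF that] continuous_on_subset a(3) Q_def by blast
      have cont': "continuous_on Q f" if "Ck n UNIV f" for f :: "real^2 \<Rightarrow> real" and n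
        using Ck_continuous_on[OF that] continuous_on_subset by blast
      have lapwc: "continuous_on Q (laplace w)"
        unfolding laplace_def[abs_def] w2_def[symmetric] by (intro continuous_intros cont[OF w2C])
      have Rc: "continuous_on Q R" unfolding R_def[abs_def] E_def
        by (intro continuous_intros lapwc cont[OF w2C] cont'[OF z1] cont'[OF z2] cont'[OF L1C] cont'[OF CkK(1)] cont'[OF CkK(2)])
      have Ri: "R integrable_on Q" using integrable_continuous Rc unfolding Q_def by blast
      have phic: "continuous_on Q (laplace \<phi>)" unfolding laplace_def[abs_def]
        by (intro continuous_intros cont') (intro Ck_pd phi open_UNIV)
      have wphi: "(\<lambda>y. laplace w y * laplace \<phi> y) integrable_on Q"
        using integrable_continuous[OF continuous_on_mult[OF lapwc phic, unfolded Q_def]] unfolding Q_def .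
      have "((\<lambda>y. laplace w y * laplace \<phi> y - R y - DIV y) has_integral
          (integral Q (\<lambda>y. laplace w y * laplace \<phi> y) - integral Q R - 0)) Q"
        by (intro has_integral_diff integrable_integral wphi Ri DIVi)
      then have "integral Q (\<lambda>y. \<zeta> y * w2 i j y * D y) =
          integral Q (\<lambda>y. laplace w y * laplace \<phi> y) - integral Q R"
        using main by (simp add: integral_unique cong: integral_cong)
      moreover have "\<bar>integral Q R\<bar> \<le> integral Q (\<lambda>y. 80 * Z * (q y * inverse (norm y)))"
      proof (rule integral_abs_le_except_0[OF Ri])
        show "(\<lambda>y. 80 * Z * (q y * inverse (norm y))) integrable_on Q"
          using qn by (rule integrable_on_mult_right)
        fix y assume y: "y \<in> Q" "y \<noteq> 0"
        define n where "n = norm y"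
        have n: "0 < n" "n \<le> 1" using y a by (auto simp: n_def Q_def)
        note kb = kg_bounds[OF e, of y, folded n_def, OF n]
        have W: "\<bar>w2 k l y\<bar> \<le> q y" for k l using wq y by (auto simp: w2_def Q_def)
        have add: "\<bar>x\<bar> \<le> a \<Longrightarrow> \<bar>y\<bar> \<le> b \<Longrightarrow> \<bar>x + y\<bar> \<le> a + b" for x y a b :: real by linarith
        have sub: "\<bar>x\<bar> \<le> a \<Longrightarrow> \<bar>y\<bar> \<le> b \<Longrightarrow> \<bar>x - y\<bar> \<le> a + b" for x y a b :: real by linarith
        have mm: "\<bar>s\<bar> \<le> a \<Longrightarrow> \<bar>t\<bar> \<le> b \<Longrightarrow> \<bar>s * t\<bar> \<le> a * b" for s t a b :: real
          unfolding abs_mult by (intro mult_mono) auto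
        have L1b: "\<bar>L1 k y\<bar> \<le> 3 / n + 3 / n" for k unfolding L1_def sum_2 by (intro add kb)
        have lw: "\<bar>laplace w y\<bar> \<le> q y + q y"
          unfolding laplace_def sum_2 w2_def[symmetric] by (intro add W)
        have two: "\<bar>2::real\<bar> \<le> 2" by simp
        \<comment> \<open>In units of \<open>Z * q y / n\<close> the Laplacian terms contribute 32
          and the eight flux terms 48.\<close>
        have "\<bar>R y\<bar> \<le> (q y + q y) * ((Z * (2 / n) + 2 * (Z * (3 / n))) + (Z * (2 / n) + 2 * (Z * (3 / n))))
           + ((Z * (q y * (3 / n + 3 / n)) + Z * (q y * (3 / n + 3 / n)) + Z * (q y * (3 / n + 3 / n)) + Z * (q y * (3 / n + 3 / n)))
            + (Z * (q y * (3 / n + 3 / n)) + Z * (q y * (3 / n + 3 / n)) + Z * (q y * (3 / n + 3 / n)) + Z * (q y * (3 / n + 3 / n))))"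
          unfolding R_def E_def sum_2 by (intro sub add mm lw kb Z(2,3,4) y W L1b two)
        also have "\<dots> = 80 * Z * (q y * inverse (norm y))"
          by (simp add: n_def[symmetric] divide_inverse algebra_simps)
        finally show "\<bar>R y\<bar> \<le> 80 * Z * (q y * inverse (norm y))" .
      qed
      moreover have "integral Q (\<lambda>y. 80 * Z * (q y * inverse (norm y))) = 80 * Z * J"
        unfolding J_def by (rule integral_mult_right)
      \<comment> \<open>The sign of \<open>S\<close> is read off from the tested inequality; it
        allows the factor 20 to be enlarged to 80.\<close>
      moreover have "0 \<le> Z * S" using T abs_ge_zero[of "integral Q (\<lambda>y. laplace w y * laplace \<phi> y)"] by linarith
      moreover have "80 * Z * (S + J) = 80 * (Z * S) + 80 * Z * J" "20 * Z * S = 20 * (Z * S)"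
        by (simp_all add: algebra_simps)
      ultimately show ?thesis using T unfolding D_def[symmetric] by linarith
    qed
    moreover have "continuous_on (cbox A B) (\<lambda>y. \<zeta> y * w2 i j y)"
      using Ck_continuous_on[OF z] Ck_continuous_on[OF w2C] a(3)
      by (intro continuous_intros) (auto intro: continuous_on_subset)
    ultimately have "\<bar>\<zeta> 0 * w2 i j 0\<bar> \<le> 2 * (80 * Z * (S + J))"
      using approximate_delta_lower_bound[OF _ a(1,2)] unfolding Q_def by blast
    then have "\<bar>w2 i j 0\<bar> \<le> 2 * (80 * Z * (S + J)) / \<zeta> 0" using z0 by (simp add: abs_mult field_simps)
    then show "\<bar>pd2 i j w 0\<bar> \<le> C * (S + integral (cbox A B) (\<lambda>y. q y * inverse (norm y)))"
      using z0 by (simp add: C_def J_def Q_def w2_def)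
  qed
qed

section \<open>Smooth families of bilinear forms\<close>

lemma norm_scaleR_sgn: "norm x *\<^sub>R sgn x = (x :: 'a::real_normed_vector)"
  by (cases "x = 0") (simp_all add: sgn_div_norm)

text \<open>Both the Willmore density and |A|^2 are quadratic in the covariant second derivatives,
  with coefficients smooth in the metric and the first derivatives. The polarized forms share one
  treatment of derivatives and Lipschitz bounds.\<close>

locale bilinear_family =
  fixes O\<^sub>0 :: "'z::euclidean_space set" and B :: "'z \<Rightarrow> 'q::euclidean_space \<Rightarrow> 'r::euclidean_space \<Rightarrow> real"
  assumes open_O: "open O\<^sub>0"
    and Ck_B: "Ck 1 (O\<^sub>0 \<times> UNIV \<times> UNIV) (\<lambda>(z, q, r). B z q r)"
    and add_left: "B z (q + q') r = B z q r + B z q' r"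
    and add_right: "B z q (r + r') = B z q r + B z q r'"
    and scale_left: "B z (c *\<^sub>R q) r = c * B z q r"
    and scale_right: "B z q (c *\<^sub>R r) = c * B z q r"
begin

lemma zero_left: "B z 0 r = 0" and zero_right: "B z q 0 = 0"
  using scale_left[of z 0 0 r] scale_right[of z q 0 0] by auto

definition dB :: "'z \<Rightarrow> 'z \<Rightarrow> 'q \<Rightarrow> 'r \<Rightarrow> real" where
  "dB z z' q r = frechet (\<lambda>(z, q, r). B z q r) (z, q, r) (z', 0, 0)"

lemma open_dom: "open (O\<^sub>0 \<times> (UNIV :: 'q set) \<times> (UNIV :: 'r set))"
  using open_O by (intro open_Times) auto

text \<open>Along a line in \<open>q\<close> or in \<open>r\<close> the form is affine, which
  identifies those two partial derivatives; the remaining one is \<open>dB\<close> by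
  definition.\<close>

lemma has_derivative_B:
  assumes "z \<in> O\<^sub>0"
  shows "((\<lambda>(z, q, r). B z q r) has_derivative (\<lambda>(z', q', r'). dB z z' q r + B z q' r + B z q r')) (at (z, q, r))"
proof -
  let ?F = "\<lambda>(z, q, r). B z q r"
  let ?D = "frechet ?F (z, q, r)"
  have F: "(?F has_derivative ?D) (at (z, q, r))" using Ck_has_derivative[OF Ck_B] assms by auto
  interpret D: bounded_linear ?D using F by (rule has_derivative_bounded_linear)
  have "?D (0, q', 0) = B z q' r" for q'
  proof -
    have "((\<lambda>t. ?F (z, q + t *\<^sub>R q', r)) has_vector_derivative ?D (0, q', 0)) (at 0)"
      using has_vector_derivative_along_line[of ?F ?D "(z, q, r)" 0 "(0, q', 0)" UNIV] F by simp
    moreover have "(\<lambda>t. ?F (z, q + t *\<^sub>R q', r)) = (\<lambda>t. B z q r + t * B z q' r)"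
      by (simp add: add_left scale_left)
    moreover have "((\<lambda>t. B z q r + t * B z q' r) has_vector_derivative B z q' r) (at 0)"
      by (auto intro!: derivative_eq_intros simp flip: has_real_derivative_iff_has_vector_derivative)
    ultimately show ?thesis using vector_derivative_unique_at by metis
  qed
  moreover have "?D (0, 0, r') = B z q r'" for r'
  proof -
    have "((\<lambda>t. ?F (z, q, r + t *\<^sub>R r')) has_vector_derivative ?D (0, 0, r')) (at 0)"
      using has_vector_derivative_along_line[of ?F ?D "(z, q, r)" 0 "(0, 0, r')" UNIV] F by simp
    moreover have "(\<lambda>t. ?F (z, q, r + t *\<^sub>R r')) = (\<lambda>t. B z q r + t * B z q r')"
      by (simp add: add_right scale_right)
    moreover have "((\<lambda>t. B z q r + t * B z q r') has_vector_derivative B z q r') (at 0)"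
      by (auto intro!: derivative_eq_intros simp flip: has_real_derivative_iff_has_vector_derivative)
    ultimately show ?thesis using vector_derivative_unique_at by metis
  qed
  moreover have "?D (z', q', r') = ?D (z', 0, 0) + ?D (0, q', 0) + ?D (0, 0, r')" for z' q' r'
    using D.add[of "(z', 0, 0)" "(0, q', 0)"] D.add[of "(z', q', 0)" "(0, 0, r')"] by simp
  ultimately have "?D = (\<lambda>(z', q', r'). dB z z' q r + B z q' r + B z q r')"
    unfolding dB_def by (intro ext) (metis (no_types, lifting) case_prod_conv prod_cases3)
  then show ?thesis using F by simp
qed

lemma has_derivative_z:
  assumes "z \<in> O\<^sub>0"
  shows "((\<lambda>z. B z q r) has_derivative (\<lambda>z'. dB z z' q r)) (at z)"
proof -
  have 1: "((\<lambda>z. (z, q, r)) has_derivative (\<lambda>z'. (z', 0, 0))) (at z)"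
    by (auto intro!: derivative_eq_intros simp: zero_prod_def)
  show ?thesis
    using has_derivative_compose[OF 1 has_derivative_B[OF assms]] by (simp add: zero_left zero_right)
qed

lemma dB_scale:
  assumes "z \<in> O\<^sub>0"
  shows "dB z z' (c *\<^sub>R q) (d *\<^sub>R r) = c * d * dB z z' q r"
proof -
  have "((\<lambda>z. B z (c *\<^sub>R q) (d *\<^sub>R r)) has_derivative (\<lambda>z'. c * d * dB z z' q r)) (at z)"
    using has_derivative_mult_right[OF has_derivative_z[OF assms, of q r], of "c * d"]
    by (simp add: scale_left scale_right ac_simps)
  from has_derivative_unique[OF this has_derivative_z[OF assms]] show ?thesis by metis
qed

text \<open>Homogeneity reduces the first two bounds to unit vectors, where compactness applies. The
  last one is the mean value theorem and asks for the whole segment in \<open>Z\<close>, because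
  \<open>Z\<close> need not be convex.\<close>

lemma bounds:
  assumes Z: "compact Z" "Z \<subseteq> O\<^sub>0"
  shows "\<exists>L>0. (\<forall>z\<in>Z. \<forall>q r. \<bar>B z q r\<bar> \<le> L * norm q * norm r) \<and>
    (\<forall>z\<in>Z. \<forall>z' q r. \<bar>dB z z' q r\<bar> \<le> L * norm z' * norm q * norm r) \<and>
    (\<forall>z0 z q r. closed_segment z0 z \<subseteq> Z \<longrightarrow> \<bar>B z q r - B z0 q r\<bar> \<le> L * norm (z - z0) * norm q * norm r)"
proof -
  let ?F = "\<lambda>(z, q, r). B z q r"
  let ?K = "Z \<times> cball (0::'q) 1 \<times> cball (0::'r) 1"
  have K: "compact ?K" "?K \<subseteq> O\<^sub>0 \<times> UNIV \<times> UNIV" using Z by (auto intro!: compact_Times)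
  have bd: "\<exists>b>0. \<forall>y\<in>?K. \<bar>f y\<bar> \<le> b" if "continuous_on (O\<^sub>0 \<times> UNIV \<times> UNIV) f" for f :: "'z \<times> 'q \<times> 'r \<Rightarrow> real"
    using compact_imp_bounded[OF compact_continuous_image[OF continuous_on_subset[OF that K(2)] K(1)]]
    unfolding bounded_pos by auto
  obtain L1 where L1: "L1 > 0" "\<And>z q r. z \<in> Z \<Longrightarrow> norm q \<le> 1 \<Longrightarrow> norm r \<le> 1 \<Longrightarrow> \<bar>B z q r\<bar> \<le> L1"
    using bd[OF Ck_continuous_on[OF Ck_B]] by fastforce
  have "\<forall>b. \<exists>l>0. \<forall>y\<in>?K. \<bar>frechet ?F y (b, 0, 0)\<bar> \<le> l"
    using bd[OF Ck_continuous_on[OF Ck_frechet[OF open_dom]]] Ck_B by (metis One_nat_def)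
  then obtain l where l: "\<And>b. l b > 0" "\<And>b y. y \<in> ?K \<Longrightarrow> \<bar>frechet ?F y (b, 0, 0)\<bar> \<le> l b" by metis
  define L2 where "L2 = (\<Sum>b\<in>Basis. l b)"
  have L2: "\<bar>dB z z' q r\<bar> \<le> L2 * norm z'" if z: "z \<in> Z" "norm q \<le> 1" "norm r \<le> 1" for z z' q r
  proof -
    interpret bounded_linear "\<lambda>z'. dB z z' q r"
      using has_derivative_z Z z by (blast intro: has_derivative_bounded_linear)
    have "dB z z' q r = dB z (\<Sum>b\<in>Basis. (z' \<bullet> b) *\<^sub>R b) q r" by (simp add: euclidean_representation)
    also have "\<dots> = (\<Sum>b\<in>Basis. (z' \<bullet> b) * dB z b q r)" by (simp add: sum scaleR)
    finally have "\<bar>dB z z' q r\<bar> \<le> (\<Sum>b\<in>Basis. \<bar>(z' \<bullet> b) * dB z b q r\<bar>)" by simp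
    also have "\<dots> \<le> (\<Sum>b\<in>Basis. norm z' * l b)"
    proof (rule sum_mono)
      fix b :: 'z assume "b \<in> Basis"
      then show "\<bar>(z' \<bullet> b) * dB z b q r\<bar> \<le> norm z' * l b"
        unfolding abs_mult using l(2)[of "(z, q, r)" b] z Basis_le_norm[of b z']
        by (intro mult_mono) (auto simp: dB_def)
    qed
    finally show ?thesis by (simp add: L2_def sum_distrib_left mult.commute)
  qed
  define L where "L = L1 + L2"
  have L: "L > 0" "L1 \<le> L" "L2 \<le> L" using L1(1) l(1) by (auto simp: L_def L2_def sum_nonneg less_imp_le add_pos_nonneg)
  have A: "\<bar>B z q r\<bar> \<le> L * norm q * norm r" if "z \<in> Z" for z q r
  proof -
    have "B z q r = B z (norm q *\<^sub>R sgn q) (norm r *\<^sub>R sgn r)" by (simp add: norm_scaleR_sgn)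
    also have "\<dots> = norm q * norm r * B z (sgn q) (sgn r)" by (simp only: scale_left scale_right ac_simps)
    finally have "B z q r = norm q * norm r * B z (sgn q) (sgn r)" .
    also have "\<bar>norm q * norm r * B z (sgn q) (sgn r)\<bar> \<le> norm q * norm r * L1"
      unfolding abs_mult using L1(2)[OF that, of "sgn q" "sgn r"] by (intro mult_mono) (auto simp: norm_sgn)
    also have "\<dots> \<le> norm q * norm r * L" using L by (intro mult_left_mono) auto
    finally show ?thesis by (simp add: ac_simps)
  qed
  have D: "\<bar>dB z z' q r\<bar> \<le> L * norm z' * norm q * norm r" if "z \<in> Z" for z z' q r
  proof -
    have "dB z z' q r = dB z z' (norm q *\<^sub>R sgn q) (norm r *\<^sub>R sgn r)" by (simp add: norm_scaleR_sgn)
    also have "\<dots> = norm q * norm r * dB z z' (sgn q) (sgn r)" by (rule dB_scale) (use that Z in auto)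
    finally have "dB z z' q r = norm q * norm r * dB z z' (sgn q) (sgn r)" .
    also have "\<bar>norm q * norm r * dB z z' (sgn q) (sgn r)\<bar> \<le> norm q * norm r * (L2 * norm z')"
      unfolding abs_mult using L2[OF that, of "sgn q" "sgn r" z'] by (intro mult_mono) (auto simp: norm_sgn)
    also have "\<dots> \<le> norm q * norm r * (L * norm z')" using L by (intro mult_left_mono mult_right_mono) auto
    finally show ?thesis by (simp add: ac_simps)
  qed
  have "\<bar>B z q r - B z0 q r\<bar> \<le> L * norm (z - z0) * norm q * norm r" if seg: "closed_segment z0 z \<subseteq> Z" for z0 z q r
  proof -
    have "norm (B z q r - B z0 q r) \<le> L * norm q * norm r * norm (z - z0)"
    proof (rule differentiable_bound[OF convex_closed_segment[of z0 z]])
      fix x assume "x \<in> closed_segment z0 z"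
      then have x: "x \<in> Z" using seg by blast
      then show "((\<lambda>z. B z q r) has_derivative (\<lambda>z'. dB x z' q r)) (at x within closed_segment z0 z)"
        using has_derivative_z Z has_derivative_at_withinI by blast
      show "onorm (\<lambda>z'. dB x z' q r) \<le> L * norm q * norm r"
        using D[OF x, of _ q r] by (intro onorm_le) (simp add: ac_simps)
    qed auto
    then show ?thesis by (simp add: ac_simps)
  qed
  then show ?thesis using L(1) A D by blast
qed

end

section \<open>Algebra of the second fundamental form\<close>

text \<open>The algebra is stated for data at a point: \<open>M\<close> is the value of the metric,
  \<open>P\<close> the pair of tangent vectors, \<open>Q\<close> the covariant second derivatives.
  Smooth dependence and invariance under reparametrization become finite-dimensional
  statements.\<close>

definition ipM :: "real^'m^'m \<Rightarrow> real^'m \<Rightarrow> real^'m \<Rightarrow> real" where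
  "ipM M v w = v \<bullet> (M *v w)"

definition gram :: "real^'m^'m \<Rightarrow> real^'m^2 \<Rightarrow> real^2^2" where
  "gram M P = (\<chi> i j. ipM M (P $ i) (P $ j))"

definition nproj :: "real^'m^'m \<Rightarrow> real^'m^2 \<Rightarrow> real^'m \<Rightarrow> real^'m" where
  "nproj M P v = v - (\<Sum>i\<in>UNIV. \<Sum>j\<in>UNIV. (matrix_inv (gram M P) $ i $ j * ipM M v (P $ i)) *\<^sub>R P $ j)"

definition Hvec :: "real^'m^'m \<Rightarrow> real^'m^2 \<Rightarrow> real^'m^2^2 \<Rightarrow> real^'m" where
  "Hvec M P Q = (1/2) *\<^sub>R (\<Sum>i\<in>UNIV. \<Sum>j\<in>UNIV. matrix_inv (gram M P) $ i $ j *\<^sub>R nproj M P (Q $ i $ j))"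

text \<open>Polarized so that \<open>bilinear_family\<close> applies; for equal arguments this is
  |H|^2 times the area density.\<close>

definition Wform :: "(real^'m^'m) \<times> (real^'m^2) \<Rightarrow> real^'m^2^2 \<Rightarrow> real^'m^2^2 \<Rightarrow> real" where
  "Wform = (\<lambda>(M, P) Q Q'. ipM M (Hvec M P Q) (Hvec M P Q') * sqrt (det (gram M P)))"

text \<open>The polarization of |A|^2, this time without the area density.\<close>

definition Aform :: "(real^'m^'m) \<times> (real^'m^2) \<Rightarrow> real^'m^2^2 \<Rightarrow> real^'m^2^2 \<Rightarrow> real" where
  "Aform = (\<lambda>(M, P) Q Q'. \<Sum>i\<in>UNIV. \<Sum>j\<in>UNIV. \<Sum>k\<in>UNIV. \<Sum>l\<in>UNIV.
     matrix_inv (gram M P) $ i $ k * matrix_inv (gram M P) $ j $ l *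
       ipM M (nproj M P (Q $ i $ j)) (nproj M P (Q' $ k $ l)))"

lemma ipM_add_left: "ipM M (v + v') w = ipM M v w + ipM M v' w"
  and ipM_add_right: "ipM M v (w + w') = ipM M v w + ipM M v w'"
  and ipM_diff_left: "ipM M (v - v') w = ipM M v w - ipM M v' w"
  and ipM_diff_right: "ipM M v (w - w') = ipM M v w - ipM M v w'"
  and ipM_scale_left: "ipM M (c *\<^sub>R v) w = c * ipM M v w"
  and ipM_scale_right: "ipM M v (c *\<^sub>R w) = c * ipM M v w"
  and ipM_zero_left: "ipM M 0 w = 0"
  and ipM_zero_right: "ipM M v 0 = 0"
  by (simp_all add: ipM_def inner_add_left inner_diff_left matrix_vector_right_distrib
      matrix_vector_mult_diff_distrib inner_add_right inner_diff_right scaleR_matrix_vector_assoc[symmetric] matrix_vector_mult_scaleR)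

lemmas ipM_simps = ipM_add_left ipM_add_right ipM_diff_left ipM_diff_right ipM_scale_left
  ipM_scale_right ipM_zero_left ipM_zero_right

lemma ipM_commute: "transpose M = M \<Longrightarrow> ipM M v w = ipM M w v"
  unfolding ipM_def by (metis dot_lmul_matrix inner_commute transpose_matrix_vector)

lemma matrix_inv_left_right:
  assumes "invertible (A :: real^'n^'n)"
  shows matrix_inv_left: "matrix_inv A ** A = mat 1" and matrix_inv_right: "A ** matrix_inv A = mat 1"
  using assms someI_ex[of "\<lambda>A'. A ** A' = mat 1 \<and> A' ** A = mat 1"]
  unfolding invertible_def matrix_inv_def by blast+

lemma matrix_inv_unique:
  fixes A :: "real^'n^'n"
  assumes "B ** A = mat 1"
  shows "matrix_inv A = B"
proof -
  have "invertible A" using assms invertible_def matrix_left_right_inverse by blast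
  then have "A ** matrix_inv A = mat 1" by (rule matrix_inv_right)
  then have "B ** (A ** matrix_inv A) = B" by simp
  then show ?thesis using assms by (simp add: matrix_mul_assoc)
qed

lemma nproj_add: "nproj M P (v + w) = nproj M P v + nproj M P w"
  by (simp add: nproj_def ipM_simps sum_2 algebra_simps)

lemma nproj_scale: "nproj M P (c *\<^sub>R v) = c *\<^sub>R nproj M P v"
  by (simp add: nproj_def ipM_simps sum_2 algebra_simps)

lemma Hvec_add: "Hvec M P (Q + Q') = Hvec M P Q + Hvec M P Q'"
  by (simp add: Hvec_def nproj_add sum_2 algebra_simps)

lemma Hvec_scale: "Hvec M P (c *\<^sub>R Q) = c *\<^sub>R Hvec M P Q"
  by (simp add: Hvec_def nproj_scale sum_2 algebra_simps)

lemma gram_inverse: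
  assumes "det (gram M P) \<noteq> 0"
  shows "matrix_inv (gram M P) ** gram M P = mat 1" "gram M P ** matrix_inv (gram M P) = mat 1"
  using assms by (simp_all add: matrix_inv_left matrix_inv_right invertible_det_nz)

lemma matrix_inv_2:
  fixes A :: "real^2^2"
  assumes "det A \<noteq> 0"
  shows "matrix_inv A $ 1 $ 1 = A $ 2 $ 2 / det A" "matrix_inv A $ 1 $ 2 = - A $ 1 $ 2 / det A"
    "matrix_inv A $ 2 $ 1 = - A $ 2 $ 1 / det A" "matrix_inv A $ 2 $ 2 = A $ 1 $ 1 / det A"
proof -
  define B :: "real^2^2" where "B = (\<chi> i j. (if i = 1 then (if j = 1 then A $ 2 $ 2 else - A $ 1 $ 2)
    else (if j = 1 then - A $ 2 $ 1 else A $ 1 $ 1)) / det A)"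
  have "B ** A = mat 1"
    using assms by (simp add: B_def matrix_matrix_mult_def mat_def vec_eq_iff forall_2 sum_2
        add_divide_distrib[symmetric] diff_divide_distrib[symmetric] det_2 mult.commute)
  from matrix_inv_unique[OF this] show "matrix_inv A $ 1 $ 1 = A $ 2 $ 2 / det A" "matrix_inv A $ 1 $ 2 = - A $ 1 $ 2 / det A"
    "matrix_inv A $ 2 $ 1 = - A $ 2 $ 1 / det A" "matrix_inv A $ 2 $ 2 = A $ 1 $ 1 / det A"
    by (simp_all add: B_def)
qed

lemma nproj_tangent:
  assumes "det (gram M P) \<noteq> 0" "transpose M = M"
  shows "nproj M P (P $ a) = 0"
proof -
  have "(\<Sum>i\<in>UNIV. gram M P $ a $ i * matrix_inv (gram M P) $ i $ j) = (if a = j then 1 else 0)" for j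
    using gram_inverse(2)[OF assms(1)] by (simp add: matrix_matrix_mult_def mat_def vec_eq_iff)
  then have "(\<Sum>i\<in>UNIV. \<Sum>j\<in>UNIV. (matrix_inv (gram M P) $ i $ j * ipM M (P $ a) (P $ i)) *\<^sub>R P $ j) =
      (\<Sum>j\<in>UNIV. (if a = j then 1 else 0) *\<^sub>R P $ j)"
    by (subst sum.swap) (simp add: gram_def sum_2 scaleR_add_left[symmetric] mult.commute)
  then show ?thesis by (simp add: nproj_def if_distrib[of "\<lambda>c. c *\<^sub>R _"] cong: if_cong)
qed

text \<open>\<open>P'\<close> and \<open>Q'\<close> are the first and the covariant second derivatives after a change of the
  parametrization; the second derivatives of the change only enter through tangential vectors.\<close>

lemma reparametrization:
  fixes M :: "real^'m^'m" and P :: "real^'m^2" and J :: "real^2^2"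
  assumes M: "transpose M = M" and D: "det (gram M P) \<noteq> 0" and J: "det J \<noteq> 0"
    and P': "\<And>i. P' $ i = (\<Sum>a\<in>UNIV. J $ a $ i *\<^sub>R P $ a)"
    and Q': "\<And>i j. Q' $ i $ j = (\<Sum>a\<in>UNIV. \<Sum>b\<in>UNIV. (J $ a $ i * J $ b $ j) *\<^sub>R Q $ a $ b) + (\<Sum>a\<in>UNIV. c a i j *\<^sub>R P $ a)"
  shows "det (gram M P') = (det J)\<^sup>2 * det (gram M P)"
    and "Wform (M, P') Q' Q' = \<bar>det J\<bar> * Wform (M, P) Q Q"
    and "Aform (M, P') Q' Q' = Aform (M, P) Q Q"
proof -
  have g: "gram M P' = transpose J ** gram M P ** J"
    by (simp add: gram_def P' matrix_matrix_mult_def transpose_def vec_eq_iff sum_2 ipM_simps algebra_simps)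
  then show detg: "det (gram M P') = (det J)\<^sup>2 * det (gram M P)" by (simp add: det_mul power2_eq_square)
  have D': "det (gram M P') \<noteq> 0" using detg D J by simp
  define G where "G = matrix_inv (gram M P)"
  define G' where "G' = matrix_inv (gram M P')"
  \<comment> \<open>Written in this form the transformation of the inverse Gram matrix contains no
    inverse of \<open>J\<close>, and every contraction with \<open>G'\<close> turns into one with
    \<open>G\<close>.\<close>
  have "J ** G' ** transpose J = G"
  proof -
    have Ji: "J ** matrix_inv J = mat 1" using J by (simp add: matrix_inv_right invertible_det_nz)
    have "(J ** G' ** transpose J) ** gram M P = J ** (G' ** (transpose J ** gram M P ** J)) ** matrix_inv J"
      using Ji by (simp add: matrix_mul_assoc[symmetric])
    also have "\<dots> = mat 1" using gram_inverse(1)[OF D'] Ji by (simp add: G'_def g[symmetric])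
    finally show ?thesis unfolding G_def by (rule matrix_inv_unique[symmetric])
  qed
  then have "(\<Sum>i\<in>UNIV. \<Sum>j\<in>UNIV. J $ a $ i * G' $ i $ j * J $ b $ j) = G $ a $ b" for a b
    by (auto simp: matrix_matrix_mult_def transpose_def vec_eq_iff sum_2 algebra_simps)
  then have key: "G $ a $ b = (\<Sum>i\<in>UNIV. \<Sum>j\<in>UNIV. J $ a $ i * G' $ i $ j * J $ b $ j)" for a b by simp
  have contr: "(\<Sum>i\<in>UNIV. \<Sum>k\<in>UNIV. G' $ i $ k *\<^sub>R (\<Sum>a\<in>UNIV. \<Sum>b\<in>UNIV. (J $ a $ i * J $ b $ k) *\<^sub>R f a b)) =
      (\<Sum>a\<in>UNIV. \<Sum>b\<in>UNIV. G $ a $ b *\<^sub>R f a b)" for f :: "2 \<Rightarrow> 2 \<Rightarrow> 'v::real_vector"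
    unfolding key sum_2 by (simp add: algebra_simps)
  have np: "nproj M P' v = nproj M P v" for v
  proof -
    have "(\<Sum>i\<in>UNIV. \<Sum>j\<in>UNIV. (G' $ i $ j * ipM M v (P' $ i)) *\<^sub>R P' $ j) =
        (\<Sum>i\<in>UNIV. \<Sum>j\<in>UNIV. G' $ i $ j *\<^sub>R (\<Sum>a\<in>UNIV. \<Sum>b\<in>UNIV. (J $ a $ i * J $ b $ j) *\<^sub>R (ipM M v (P $ a) *\<^sub>R P $ b)))"
      unfolding P' sum_2 by (simp add: ipM_simps algebra_simps)
    also have "\<dots> = (\<Sum>a\<in>UNIV. \<Sum>b\<in>UNIV. G $ a $ b *\<^sub>R (ipM M v (P $ a) *\<^sub>R P $ b))" by (rule contr)
    finally show ?thesis by (simp add: nproj_def G_def G'_def)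
  qed
  define N where "N a b = nproj M P (Q $ a $ b)" for a b
  have nQ: "nproj M P' (Q' $ i $ j) = (\<Sum>a\<in>UNIV. \<Sum>b\<in>UNIV. (J $ a $ i * J $ b $ j) *\<^sub>R N a b)" for i j
    unfolding np Q' sum_2 N_def by (simp add: nproj_add nproj_scale nproj_tangent[OF D M])
  have H: "Hvec M P' Q' = Hvec M P Q"
    unfolding Hvec_def G_def[symmetric] G'_def[symmetric] nQ contr by (simp add: N_def)
  have "sqrt (det (gram M P')) = \<bar>det J\<bar> * sqrt (det (gram M P))"
    unfolding detg by (simp add: real_sqrt_mult)
  then show "Wform (M, P') Q' Q' = \<bar>det J\<bar> * Wform (M, P) Q Q" by (simp add: Wform_def H)
  define X where "X a j = (\<Sum>b\<in>UNIV. J $ b $ j *\<^sub>R N a b)" for a j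
  have nX: "nproj M P' (Q' $ i $ j) = (\<Sum>a\<in>UNIV. J $ a $ i *\<^sub>R X a j)" for i j
    unfolding nQ X_def sum_2 by (simp add: algebra_simps)
  have bil: "ipM M (\<Sum>a\<in>UNIV. s a *\<^sub>R x a) (\<Sum>c\<in>UNIV. t c *\<^sub>R y c) =
      (\<Sum>a\<in>UNIV. \<Sum>c\<in>UNIV. (s a * t c) *\<^sub>R ipM M (x a) (y c))" for s t :: "2 \<Rightarrow> real" and x y
    unfolding sum_2 by (simp add: ipM_simps algebra_simps)
  \<comment> \<open>The fourfold contraction is split into two twofold ones, so that
    \<open>contr\<close> can act on one pair of indices at a time.\<close>
  have swap: "(\<Sum>i\<in>UNIV. \<Sum>j\<in>UNIV. \<Sum>k\<in>UNIV. \<Sum>l\<in>UNIV. s i k * t j l * f i j k l) =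
      (\<Sum>j\<in>UNIV. \<Sum>l\<in>UNIV. t j l *\<^sub>R (\<Sum>i\<in>UNIV. \<Sum>k\<in>UNIV. s i k *\<^sub>R f i j k l))"
    for s t :: "2 \<Rightarrow> 2 \<Rightarrow> real" and f :: "2 \<Rightarrow> 2 \<Rightarrow> 2 \<Rightarrow> 2 \<Rightarrow> real"
    unfolding sum_2 by (simp add: algebra_simps)
  have swap2: "(\<Sum>j\<in>UNIV. \<Sum>l\<in>UNIV. t j l *\<^sub>R (\<Sum>i\<in>UNIV. \<Sum>k\<in>UNIV. s i k *\<^sub>R f i j k l)) =
      (\<Sum>i\<in>UNIV. \<Sum>k\<in>UNIV. s i k *\<^sub>R (\<Sum>j\<in>UNIV. \<Sum>l\<in>UNIV. t j l *\<^sub>R f i j k l))"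
    for s t :: "2 \<Rightarrow> 2 \<Rightarrow> real" and f :: "2 \<Rightarrow> 2 \<Rightarrow> 2 \<Rightarrow> 2 \<Rightarrow> real"
    unfolding sum_2 by (simp add: algebra_simps)
  have "Aform (M, P') Q' Q' = (\<Sum>j\<in>UNIV. \<Sum>l\<in>UNIV. G' $ j $ l *\<^sub>R (\<Sum>i\<in>UNIV. \<Sum>k\<in>UNIV. G' $ i $ k *\<^sub>R
      (\<Sum>a\<in>UNIV. \<Sum>c\<in>UNIV. (J $ a $ i * J $ c $ k) *\<^sub>R ipM M (X a j) (X c l))))"
    unfolding Aform_def prod.case nX G'_def[symmetric] swap bil ..
  also have "\<dots> = (\<Sum>j\<in>UNIV. \<Sum>l\<in>UNIV. G' $ j $ l *\<^sub>R (\<Sum>a\<in>UNIV. \<Sum>c\<in>UNIV. G $ a $ c *\<^sub>R ipM M (X a j) (X c l)))"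
    unfolding contr ..
  also have "\<dots> = (\<Sum>a\<in>UNIV. \<Sum>c\<in>UNIV. G $ a $ c *\<^sub>R (\<Sum>j\<in>UNIV. \<Sum>l\<in>UNIV. G' $ j $ l *\<^sub>R
        ipM M (X a j) (X c l)))"
    by (rule swap2)
  also have "\<dots> = (\<Sum>a\<in>UNIV. \<Sum>c\<in>UNIV. G $ a $ c *\<^sub>R (\<Sum>j\<in>UNIV. \<Sum>l\<in>UNIV. G' $ j $ l *\<^sub>R
        (\<Sum>b\<in>UNIV. \<Sum>d\<in>UNIV. (J $ b $ j * J $ d $ l) *\<^sub>R ipM M (N a b) (N c d))))"
    unfolding X_def bil ..
  also have "\<dots> = (\<Sum>a\<in>UNIV. \<Sum>c\<in>UNIV. G $ a $ c *\<^sub>R (\<Sum>b\<in>UNIV. \<Sum>d\<in>UNIV. G $ b $ d *\<^sub>R ipM M (N a b) (N c d)))"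
    unfolding contr ..
  also have "\<dots> = Aform (M, P) Q Q"
    unfolding Aform_def prod.case G_def[symmetric] N_def[symmetric] swap by (rule swap2)
  finally show "Aform (M, P') Q' Q' = Aform (M, P) Q Q" .
qed

section \<open>Smooth dependence of the forms on the point data\<close>

lemma Ck_matrix_entry: "open U \<Longrightarrow> Ck n U f \<Longrightarrow> Ck n U (\<lambda>x. f x $ i $ j)"
  by (intro Ck_vec_nth)

lemma Ck_det:
  fixes f :: "'a::euclidean_space \<Rightarrow> real^'n^'n"
  assumes "open U" "Ck n U f"
  shows "Ck n U (\<lambda>x. det (f x))"
  unfolding det_def by (intro Ck_sum Ck_mult Ck_prod Ck_const Ck_vec_nth assms)

text \<open>\<open>matrix_inv\<close> is defined by choice; Cramer's rule is the formula from which
  smoothness in the entries can be read off.\<close>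

lemma matrix_inv_cramer:
  fixes A :: "real^'n^'n"
  assumes "det A \<noteq> 0"
  shows "matrix_inv A = (\<chi> k l. det (\<chi> i j. if j = k then axis l 1 $ i else A $ i $ j) / det A)"
proof -
  have "A *v (matrix_inv A *v axis l 1) = axis l 1" for l
    using matrix_inv_right[of A] assms by (simp add: invertible_det_nz matrix_vector_mul_assoc)
  then have "matrix_inv A *v axis l 1 = (\<chi> k. det (\<chi> i j. if j = k then axis l 1 $ i else A $ i $ j) / det A)" for l
    using cramer[OF assms] by blast
  moreover have "(matrix_inv A *v axis l 1) $ k = matrix_inv A $ k $ l" for k l
    by (simp add: matrix_vector_mult_def axis_def if_distrib cong: if_cong)
  ultimately show ?thesis by (simp add: vec_eq_iff)
qed

lemma Ck_matrix_inv:
  fixes f :: "'a::euclidean_space \<Rightarrow> real^'n^'n"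
  assumes U: "open U" and f: "Ck n U f" and "\<And>x. x \<in> U \<Longrightarrow> det (f x) \<noteq> 0"
  shows "Ck n U (\<lambda>x. matrix_inv (f x))"
proof (rule Ck_cong[OF U])
  have e: "Ck n U (\<lambda>x. if j = k then axis l 1 $ i else f x $ i $ j)" for i j k l
    by (cases "j = k") (simp_all add: Ck_const Ck_matrix_entry[OF U f])
  show "Ck n U (\<lambda>x. \<chi> k l. det (\<chi> i j. if j = k then axis l 1 $ i else f x $ i $ j) / det (f x))"
    using assms by (intro Ck_vec_lambda Ck_divide Ck_det e)
qed (rule matrix_inv_cramer[OF assms(3), symmetric])

lemma ipM_sum: "ipM M v w = (\<Sum>i\<in>UNIV. v $ i * (\<Sum>j\<in>UNIV. M $ i $ j * w $ j))"
  by (simp add: ipM_def inner_vec_def matrix_vector_mult_def)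

lemma Ck_ipM: "open U \<Longrightarrow> Ck n U M \<Longrightarrow> Ck n U v \<Longrightarrow> Ck n U w \<Longrightarrow> Ck n U (\<lambda>x. ipM (M x) (v x) (w x))"
  unfolding ipM_sum by (intro Ck_sum Ck_mult Ck_vec_nth)

lemma Ck_gram: "open U \<Longrightarrow> Ck n U M \<Longrightarrow> Ck n U P \<Longrightarrow> Ck n U (\<lambda>x. gram (M x) (P x))"
  unfolding gram_def by (intro Ck_vec_lambda Ck_ipM Ck_vec_nth)

lemma Ck_nproj:
  assumes "open U" "Ck n U M" "Ck n U P" "Ck n U v" "\<And>x. x \<in> U \<Longrightarrow> det (gram (M x) (P x)) \<noteq> 0"
  shows "Ck n U (\<lambda>x. nproj (M x) (P x) (v x))" unfolding nproj_def using assms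
  by (intro Ck_diff Ck_sum Ck_scaleR Ck_mult Ck_vec_nth Ck_matrix_inv Ck_gram Ck_ipM)

lemma Ck_Hvec:
  assumes "open U" "Ck n U M" "Ck n U P" "Ck n U Q" "\<And>x. x \<in> U \<Longrightarrow> det (gram (M x) (P x)) \<noteq> 0"
  shows "Ck n U (\<lambda>x. Hvec (M x) (P x) (Q x))" unfolding Hvec_def using assms
  by (intro Ck_scaleR Ck_const Ck_sum Ck_vec_nth Ck_matrix_inv Ck_gram Ck_nproj)

lemma Ck_Wform:
  assumes "open U" "Ck n U M" "Ck n U P" "Ck n U Q" "Ck n U Q'" "\<And>x. x \<in> U \<Longrightarrow> det (gram (M x) (P x)) > 0"
  shows "Ck n U (\<lambda>x. Wform (M x, P x) (Q x) (Q' x))"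
proof -
  have "\<And>x. x \<in> U \<Longrightarrow> det (gram (M x) (P x)) \<noteq> 0" using assms(6) by force
  then show ?thesis unfolding Wform_def prod.case
    using assms by (intro Ck_mult Ck_ipM Ck_Hvec Ck_sqrt Ck_det Ck_gram)
qed

lemma Ck_Aform:
  assumes "open U" "Ck n U M" "Ck n U P" "Ck n U Q" "Ck n U Q'" "\<And>x. x \<in> U \<Longrightarrow> det (gram (M x) (P x)) > 0"
  shows "Ck n U (\<lambda>x. Aform (M x, P x) (Q x) (Q' x))"
proof -
  have "\<And>x. x \<in> U \<Longrightarrow> det (gram (M x) (P x)) \<noteq> 0" using assms(6) by force
  then show ?thesis unfolding Aform_def prod.case
    using assms by (intro Ck_sum Ck_mult Ck_ipM Ck_nproj Ck_vec_nth Ck_matrix_inv Ck_gram)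
qed

definition nondeg :: "((real^'m^'m) \<times> (real^'m^2)) set" where
  "nondeg = {(M, P). det (gram M P) > 0}"

lemma open_nondeg: "open (nondeg :: ((real^'m^'m) \<times> (real^'m^2)) set)"
proof -
  have "Ck 0 UNIV (\<lambda>z :: (real^'m^'m) \<times> (real^'m^2). det (gram (fst z) (snd z)))"
    by (intro Ck_det Ck_gram Ck_fst Ck_snd Ck_id open_UNIV)
  then have "continuous_on UNIV (\<lambda>z :: (real^'m^'m) \<times> (real^'m^2). det (gram (fst z) (snd z)))"
    by (rule Ck_continuous_on)
  then have "open {z :: (real^'m^'m) \<times> (real^'m^2). 0 < det (gram (fst z) (snd z))}"
    by (intro open_Collect_less) auto
  then show ?thesis by (simp add: nondeg_def case_prod_beta')
qed

interpretation W: bilinear_family "nondeg :: ((real^'m^'m) \<times> (real^'m^2)) set" Wform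
proof
  have "Ck 1 (nondeg \<times> UNIV \<times> UNIV)
    (\<lambda>x :: ((real^'m^'m) \<times> (real^'m^2)) \<times> (real^'m^2^2) \<times> (real^'m^2^2).
       Wform (fst (fst x), snd (fst x)) (fst (snd x)) (snd (snd x)))"
    by (intro Ck_Wform Ck_fst Ck_snd Ck_id open_Times open_UNIV open_nondeg) (auto simp: nondeg_def)
  then show "Ck 1 (nondeg \<times> UNIV \<times> UNIV)
    (\<lambda>(z :: (real^'m^'m) \<times> (real^'m^2), q, r). Wform z q r)"
    by (simp add: case_prod_beta')
qed (auto simp: open_nondeg Wform_def Hvec_add Hvec_scale ipM_simps algebra_simps)

interpretation A: bilinear_family "nondeg :: ((real^'m^'m) \<times> (real^'m^2)) set" Aform
proof
  have "Ck 1 (nondeg \<times> UNIV \<times> UNIV)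
    (\<lambda>x :: ((real^'m^'m) \<times> (real^'m^2)) \<times> (real^'m^2^2) \<times> (real^'m^2^2).
       Aform (fst (fst x), snd (fst x)) (fst (snd x)) (snd (snd x)))"
    by (intro Ck_Aform Ck_fst Ck_snd Ck_id open_Times open_UNIV open_nondeg) (auto simp: nondeg_def)
  then show "Ck 1 (nondeg \<times> UNIV \<times> UNIV)
    (\<lambda>(z :: (real^'m^'m) \<times> (real^'m^2), q, r). Aform z q r)"
    by (simp add: case_prod_beta')
qed (auto simp: open_nondeg Aform_def nproj_add nproj_scale ipM_simps sum.distrib sum_distrib_left algebra_simps)

lemma norm_matrix_vector_mult: "norm (A *v x) \<le> norm A * norm (x :: real^'n)"
proof -
  have "norm (A *v x) = L2_set (\<lambda>i. norm ((A *v x) $ i)) UNIV" by (simp add: norm_vec_def)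
  also have "\<dots> \<le> L2_set (\<lambda>i. norm x * norm (A $ i)) UNIV"
  proof (rule L2_set_mono)
    fix i
    have "(A *v x) $ i = A $ i \<bullet> x" by (simp add: matrix_vector_mult_def inner_vec_def)
    then show "norm ((A *v x) $ i) \<le> norm x * norm (A $ i)"
      using Cauchy_Schwarz_ineq2[of "A $ i" x] by (simp add: mult.commute)
  qed auto
  also have "\<dots> = norm x * L2_set (\<lambda>i. norm (A $ i)) UNIV" by (simp add: L2_set_right_distrib)
  finally show ?thesis by (simp add: norm_vec_def mult.commute)
qed

lemma ipM_near_id:
  assumes "norm (M - mat 1) \<le> c"
  shows "\<bar>ipM M v w - v \<bullet> w\<bar> \<le> c * norm v * norm w"
proof -
  have "ipM M v w - v \<bullet> w = v \<bullet> ((M - mat 1) *v w)"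
    by (simp add: ipM_def matrix_vector_mult_diff_rdistrib inner_diff_right)
  also have "\<bar>\<dots>\<bar> \<le> norm v * norm ((M - mat 1) *v w)" by (rule Cauchy_Schwarz_ineq2)
  also have "\<dots> \<le> norm v * (c * norm w)"
    by (intro mult_left_mono order_trans[OF norm_matrix_vector_mult mult_right_mono[OF assms]]) auto
  finally show ?thesis by (simp add: ac_simps)
qed

text \<open>A vector in the kernel would satisfy |x|^2 \<le> |x|^2 / 2.\<close>

lemma det_near_id:
  fixes M :: "real^'n^'n"
  assumes "norm (M - mat 1) \<le> 1/2"
  shows "det M \<noteq> 0"
proof -
  have "x = 0" if "M *v x = 0" for x
  proof -
    have "norm x * norm x \<le> 0"
      using ipM_near_id[OF assms, of x x] that by (simp add: ipM_def dot_square_norm power2_eq_square)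
    then show ?thesis by (simp add: mult_le_0_iff)
  qed
  then have "invertible M" using matrix_left_invertible_ker[of M] invertible_left_inverse by blast
  then show ?thesis by (simp add: invertible_det_nz)
qed

section \<open>Asymptotically flat metrics\<close>

definition chr :: "(real^'m \<Rightarrow> real^'m^'m) \<Rightarrow> real^'m \<Rightarrow> real^'m \<Rightarrow> real^'m \<Rightarrow> real^'m" where
  "chr h p v w = (\<chi> \<gamma>. \<Sum>\<alpha>\<in>UNIV. \<Sum>\<beta>\<in>UNIV. christoffel h p \<gamma> \<alpha> \<beta> * v $ \<alpha> * w $ \<beta>)"

lemma cov_deriv_chr:
  "cov_deriv h \<xi> x i j = pd2 i j \<xi> x + chr h (\<xi> x) (pd i \<xi> x) (pd j \<xi> x)"
  by (simp add: cov_deriv_def chr_def)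

lemma chr_bilinear: "bounded_bilinear (chr h p)"
proof (rule bilinear_conv_bounded_bilinear[THEN iffD1])
  show "bilinear (chr h p)"
    by (auto simp: bilinear_def linear_iff chr_def vec_eq_iff sum.distrib sum_distrib_left algebra_simps)
qed

text \<open>\<open>exterior\<close> is closed, so derivatives at its boundary refer to an open set
  around it. That set is shrunk until the metric stays invertible, which makes the Christoffel
  symbols smooth on it.\<close>

lemma riemannian_metric_Ck:
  assumes "riemannian_metric (h :: real^'m \<Rightarrow> real^'m^'m)"
  obtains U where "open U" "exterior \<subseteq> U" "\<And>n. Ck n U h" "\<And>n \<gamma> \<alpha> \<beta>. Ck n U (\<lambda>p. christoffel h p \<gamma> \<alpha> \<beta>)"
    "\<And>p. p \<in> U \<Longrightarrow> det (h p) \<noteq> 0"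
proof -
  obtain U0 where U0: "open U0" "exterior \<subseteq> U0" "\<And>n. Ck n U0 h"
    using assms smooth_on_imp_Ck unfolding riemannian_metric_def by metis
  define U where "U = U0 \<inter> (\<lambda>p. det (h p)) -` (- {0})"
  have "continuous_on U0 (\<lambda>p. det (h p))" using Ck_continuous_on[OF Ck_det[OF U0(1,3)]] by blast
  then have U: "open U" unfolding U_def by (rule continuous_open_preimage) (use U0 in auto)
  have nz: "det (h p) \<noteq> 0" if "p \<in> exterior" for p
  proof -
    have "v = 0" if "h p *v v = 0" for v
      using assms \<open>p \<in> exterior\<close> that unfolding riemannian_metric_def by force
    then have "invertible (h p)"
      using matrix_left_invertible_ker[of "h p"] invertible_left_inverse by blast
    then show ?thesis by (simp add: invertible_det_nz)
  qed
  have h: "Ck n U h" for n using U0(3) Ck_subset unfolding U_def by blast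
  have nzU: "det (h p) \<noteq> 0" if "p \<in> U" for p using that by (auto simp: U_def)
  have pdh: "Ck n U (\<lambda>p. pd i (\<lambda>q. h q $ j $ k) p)" for n i j k by (intro Ck_pd U Ck_matrix_entry h)
  have "Ck n U (\<lambda>p. christoffel h p \<gamma> \<alpha> \<beta>)" for n \<gamma> \<alpha> \<beta> unfolding christoffel_def
    by (intro Ck_mult Ck_const Ck_sum Ck_matrix_entry Ck_matrix_inv Ck_add Ck_diff pdh U h nzU)
  then show ?thesis using that U U0(2) nz h nzU unfolding U_def by blast
qed

lemma frechet_bounded_linear:
  assumes "bounded_linear L" "f differentiable at x"
  shows "frechet (\<lambda>x. L (f x)) x v = L (frechet f x v)"
  using bounded_linear.has_derivative[OF assms(1) assms(2)[unfolded frechet_derivative_works]]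
  by (rule frechet_eqI)

lemma frechet_minus_const:
  assumes "f differentiable at x"
  shows "frechet (\<lambda>x. f x - c) x v = frechet f x v"
  using has_derivative_diff[OF assms[unfolded frechet_derivative_works] has_derivative_const[of c]]
  by (simp add: frechet_eqI)

lemma norm_matrix_le_sum: "norm (A :: real^'n^'m) \<le> (\<Sum>i\<in>UNIV. \<Sum>j\<in>UNIV. \<bar>A $ i $ j\<bar>)"
proof -
  have "norm A \<le> (\<Sum>i\<in>UNIV. norm (A $ i))" unfolding norm_vec_def[of A] by (rule L2_set_le_sum) auto
  also have "\<dots> \<le> (\<Sum>i\<in>UNIV. \<Sum>j\<in>UNIV. \<bar>A $ i $ j\<bar>)" by (intro sum_mono norm_le_l1_cart)
  finally show ?thesis .
qed

text \<open>Only finitely many components and lists of directions occur, so their constants and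
  radii can be merged into one pair.\<close>

lemma asymptotically_flat_bounds:
  fixes h :: "real^'m \<Rightarrow> real^'m^'m"
  assumes "asymptotically_flat \<tau> h"
  obtains C R where "C > 0" "\<And>p \<alpha> \<beta> vs. set vs \<subseteq> Basis \<Longrightarrow> length vs \<le> 2 \<Longrightarrow> norm p \<ge> R \<Longrightarrow>
    \<bar>iter_deriv vs (\<lambda>p. h p $ \<alpha> $ \<beta> - (if \<alpha> = \<beta> then 1 else 0)) p\<bar> \<le> C * norm p powr (- \<tau> - real (length vs))"
proof -
  define f where "f \<alpha> \<beta> p = h p $ \<alpha> $ \<beta> - (if \<alpha> = \<beta> then 1 else 0)" for \<alpha> \<beta> p
  define VS where "VS = {vs :: (real^'m) list. set vs \<subseteq> Basis \<and> length vs \<le> 2}"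
  have fin: "finite VS" unfolding VS_def by (rule finite_lists_length_le) simp
  have "\<forall>i\<in>(UNIV \<times> UNIV) \<times> VS. \<exists>c b. c > 0 \<and> (\<forall>p. norm p \<ge> b \<longrightarrow>
      \<bar>iter_deriv (snd i) (f (fst (fst i)) (snd (fst i))) p\<bar> \<le> c * norm p powr (- \<tau> - real (length (snd i))))"
  proof
    fix i :: "('m \<times> 'm) \<times> (real^'m) list" assume i: "i \<in> (UNIV \<times> UNIV) \<times> VS"
    have "iter_deriv (snd i) (f (fst (fst i)) (snd (fst i))) \<in>
        O[at_infinity](\<lambda>X. norm X powr (- \<tau> - real (length (snd i))))"
    proof -
      have "set (snd i) \<subseteq> Basis \<and> length (snd i) \<le> 2" using i by (auto simp: VS_def)
      then show ?thesis
        using assms unfolding asymptotically_flat_def bigo_derivs_def f_def[abs_def] by blast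
    qed
    then obtain c where "c > 0" "\<forall>\<^sub>F p in at_infinity. norm (iter_deriv (snd i) (f (fst (fst i)) (snd (fst i))) p) \<le>
        c * norm (norm p powr (- \<tau> - real (length (snd i))))"
      by (elim landau_o.bigE)
    then show "\<exists>c b. c > 0 \<and> (\<forall>p. norm p \<ge> b \<longrightarrow>
      \<bar>iter_deriv (snd i) (f (fst (fst i)) (snd (fst i))) p\<bar> \<le> c * norm p powr (- \<tau> - real (length (snd i))))"
      unfolding eventually_at_infinity by auto
  qed
  then obtain c b where cb: "\<And>i. i \<in> (UNIV \<times> UNIV) \<times> VS \<Longrightarrow> c i > 0"
    "\<And>i p. i \<in> (UNIV \<times> UNIV) \<times> VS \<Longrightarrow> norm p \<ge> b i \<Longrightarrow>
      \<bar>iter_deriv (snd i) (f (fst (fst i)) (snd (fst i))) p\<bar> \<le> c i * norm p powr (- \<tau> - real (length (snd i)))"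
    by metis
  let ?I = "((UNIV :: 'm set) \<times> (UNIV :: 'm set)) \<times> VS"
  have finI: "finite ?I" using fin by simp
  show ?thesis
  proof (rule that[of "(\<Sum>i\<in>?I. c i) + 1" "Max (b ` ?I)"])
    show "0 < (\<Sum>i\<in>?I. c i) + 1" using cb(1) by (intro add_nonneg_pos sum_nonneg) (auto intro: less_imp_le)
    fix p :: "real^'m" and \<alpha> \<beta> :: 'm and vs :: "(real^'m) list"
    assume vs: "set vs \<subseteq> Basis" "length vs \<le> 2" and p: "norm p \<ge> Max (b ` ?I)"
    let ?i = "((\<alpha>, \<beta>), vs)"
    have i: "?i \<in> ?I" using vs by (auto simp: VS_def)
    have "b ?i \<le> norm p" using p finI i by (meson Max_ge finite_imageI imageI order_trans)
    then have "\<bar>iter_deriv vs (f \<alpha> \<beta>) p\<bar> \<le> c ?i * norm p powr (- \<tau> - real (length vs))"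
      using cb(2)[OF i] by simp
    also have "c ?i \<le> (\<Sum>i\<in>?I. c i) + 1"
      using member_le_sum[OF i _ finI, of c] cb(1) by (force intro: less_imp_le)
    then have "c ?i * norm p powr (- \<tau> - real (length vs)) \<le> ((\<Sum>i\<in>?I. c i) + 1) * norm p powr (- \<tau> - real (length vs))"
      by (intro mult_right_mono) auto
    finally show "\<bar>iter_deriv vs (\<lambda>p. h p $ \<alpha> $ \<beta> - (if \<alpha> = \<beta> then 1 else 0)) p\<bar> \<le>
        ((\<Sum>i\<in>?I. c i) + 1) * norm p powr (- \<tau> - real (length vs))" by (simp add: f_def[abs_def])
  qed
qed

text \<open>The closed ball of radius 1/2 about the identity is compact and consists of invertible
  matrices.\<close>

lemma matrix_inv_bounds:
  "\<exists>L>0. \<forall>M :: real^'n^'n. norm (M - mat 1) \<le> 1/2 \<longrightarrow> norm (matrix_inv M) \<le> L \<and>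
    matrix_inv differentiable at M \<and> (\<forall>X. norm (frechet matrix_inv M X) \<le> L * norm X)"
proof -
  let ?U = "{M :: real^'n^'n. det M \<noteq> 0}"
  have "continuous_on UNIV (det :: real^'n^'n \<Rightarrow> real)"
    using Ck_continuous_on[OF Ck_det[OF open_UNIV Ck_id[OF open_UNIV]]] .
  then have U: "open ?U" by (intro open_Collect_neq) auto
  let ?K = "cball (mat 1 :: real^'n^'n) (1/2)"
  have K: "?K \<subseteq> ?U"
  proof
    fix M assume "M \<in> ?K"
    then have "norm (M - mat 1) \<le> 1/2" by (simp add: dist_norm norm_minus_commute)
    from det_near_id[OF this] show "M \<in> ?U" by simp
  qed
  have inv: "Ck n ?U matrix_inv" for n by (rule Ck_matrix_inv[OF U Ck_id[OF U]]) auto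
  have bd: "\<exists>b>0. \<forall>y\<in>?K. norm (f y) \<le> b" if "continuous_on ?U f" for f :: "real^'n^'n \<Rightarrow> real^'n^'n"
    using compact_imp_bounded[OF compact_continuous_image[OF continuous_on_subset[OF that K] compact_cball]]
    unfolding bounded_pos by auto
  obtain L1 where L1: "L1 > 0" "\<forall>y\<in>?K. norm (matrix_inv y) \<le> L1" using bd[OF Ck_continuous_on[OF inv[of 0]]] by blast
  have "\<forall>b. \<exists>l>0. \<forall>y\<in>?K. norm (frechet matrix_inv y b) \<le> l"
    using bd[OF Ck_continuous_on[OF Ck_frechet[OF U inv[of "Suc 0"]]]] by blast
  then obtain l where l: "\<And>b. l b > 0" "\<And>b y. y \<in> ?K \<Longrightarrow> norm (frechet matrix_inv y b) \<le> l b" by metis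
  define L2 where "L2 = (\<Sum>b\<in>(Basis::(real^'n^'n) set). l b)"
  have L2: "0 \<le> L2" unfolding L2_def using l(1) by (intro sum_nonneg) (auto intro: less_imp_le)
  show ?thesis
  proof (intro exI[of _ "L1 + L2"] conjI allI impI)
    show "L1 + L2 > 0" using L1 L2 by simp
    fix M :: "real^'n^'n" assume "norm (M - mat 1) \<le> 1/2"
    then have M: "M \<in> ?K" by (simp add: dist_norm norm_minus_commute)
    then show "norm (matrix_inv M) \<le> L1 + L2" using L1 L2 by fastforce
    show d: "matrix_inv differentiable at M" using Ck_differentiable[OF inv[of 0]] M K by blast
    fix X :: "real^'n^'n"
    have "norm (frechet matrix_inv M X) \<le> (\<Sum>b\<in>Basis. norm ((X \<bullet> b) *\<^sub>R frechet matrix_inv M b))"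
      by (subst frechet_expand[OF d]) (rule norm_sum)
    also have "\<dots> \<le> (\<Sum>b\<in>Basis. norm X * l b)"
    proof (rule sum_mono)
      fix b :: "real^'n^'n" assume "b \<in> Basis"
      then show "norm ((X \<bullet> b) *\<^sub>R frechet matrix_inv M b) \<le> norm X * l b"
        unfolding norm_scaleR using l(2)[OF M, of b] Basis_le_norm[of b X] by (intro mult_mono) auto
    qed
    also have "\<dots> \<le> (L1 + L2) * norm X" using L1 by (simp add: L2_def sum_distrib_left[symmetric] algebra_simps)
    finally show "norm (frechet matrix_inv M X) \<le> (L1 + L2) * norm X" .
  qed
qed

lemma norm_vec_le_sum: "norm (v :: real^'n) \<le> real CARD('n) * c" if "\<And>i. \<bar>v $ i\<bar> \<le> c"
proof -
  have "norm v \<le> (\<Sum>i\<in>UNIV. \<bar>v $ i\<bar>)" by (rule norm_le_l1_cart)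
  also have "\<dots> \<le> (\<Sum>i\<in>(UNIV::'n set). c)" by (intro sum_mono that)
  finally show ?thesis by simp
qed

lemma norm_matrix_le: "norm (A :: real^'n^'n) \<le> (real CARD('n))\<^sup>2 * c" if "\<And>i j. \<bar>A $ i $ j\<bar> \<le> c"
proof -
  have "norm A \<le> (\<Sum>i\<in>UNIV. \<Sum>j\<in>UNIV. \<bar>A $ i $ j\<bar>)" by (rule norm_matrix_le_sum)
  also have "\<dots> \<le> (\<Sum>i\<in>(UNIV::'n set). \<Sum>j\<in>(UNIV::'n set). c)" by (intro sum_mono that)
  finally show ?thesis by (simp add: power2_eq_square mult.assoc)
qed

lemma abs_frechet_le_pd:
  fixes f :: "real^'n \<Rightarrow> real"
  assumes "f differentiable at x" "\<And>i. \<bar>pd i f x\<bar> \<le> c"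
  shows "\<bar>frechet f x v\<bar> \<le> real CARD('n) * c * norm v"
proof -
  have "\<bar>frechet f x v\<bar> \<le> (\<Sum>i\<in>UNIV. \<bar>v $ i *\<^sub>R pd i f x\<bar>)"
    unfolding has_derivative_pd_sum[OF assms(1), of v] by (rule sum_abs)
  also have "\<dots> \<le> (\<Sum>i\<in>(UNIV::'n set). norm v * c)"
    using component_le_norm_cart[of v] assms(2) by (intro sum_mono) (auto simp: abs_mult intro!: mult_mono)
  finally show ?thesis by (simp add: ac_simps)
qed

lemma has_derivative_vec_lambda:
  fixes f :: "'n::finite \<Rightarrow> 'a::real_normed_vector \<Rightarrow> 'b::real_normed_vector"
  assumes "\<And>i. (f i has_derivative f' i) F"
  shows "((\<lambda>x. \<chi> i. f i x) has_derivative (\<lambda>u. \<chi> i. f' i u)) F"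
proof -
  have eq: "(\<lambda>x. \<chi> i. g i x) = (\<lambda>x. \<Sum>i\<in>UNIV. axis i (g i x))" for g :: "'n \<Rightarrow> 'a \<Rightarrow> 'b"
    by (auto simp: vec_eq_iff axis_def fun_eq_iff)
  show ?thesis
    unfolding eq by (intro has_derivative_sum bounded_linear.has_derivative[OF bounded_linear_axis] assms)
qed

text \<open>The Christoffel symbols are the inverse metric contracted with first derivatives of
  \<open>h\<close>. Differentiating them produces second derivatives of \<open>h\<close> and
  products of two first derivatives; the latter decay faster than required.\<close>

lemma metric_decay:
  fixes h :: "real^'m \<Rightarrow> real^'m^'m"
  assumes h: "riemannian_metric h" "asymptotically_flat \<tau> h" and \<tau>: "\<tau> > 0"
  obtains C R where "C > 0" "R \<ge> 2"
    "\<And>p. norm p \<ge> R \<Longrightarrow> norm (h p - mat 1) \<le> C * norm p powr (- \<tau>)"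
    "\<And>p v. norm p \<ge> R \<Longrightarrow> norm (frechet h p v) \<le> C * norm p powr (- \<tau> - 1) * norm v"
    "\<And>p v w. norm p \<ge> R \<Longrightarrow> norm (chr h p v w) \<le> C * norm p powr (- \<tau> - 1) * norm v * norm w"
    "\<And>p u v w. norm p \<ge> R \<Longrightarrow> norm (frechet (\<lambda>p. chr h p v w) p u) \<le>
      C * norm p powr (- \<tau> - 2) * norm u * norm v * norm w"
proof -
  obtain U where U: "open U" "exterior \<subseteq> U" and hC: "\<And>n. Ck n U h"
    and chC: "\<And>n \<gamma> \<alpha> \<beta>. Ck n U (\<lambda>p. christoffel h p \<gamma> \<alpha> \<beta>)" and "\<And>p. p \<in> U \<Longrightarrow> det (h p) \<noteq> 0"
    using riemannian_metric_Ck[OF h(1)] by blast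
  obtain C0 R0 where C0: "C0 > 0" and fb: "\<And>p \<alpha> \<beta> vs. set vs \<subseteq> Basis \<Longrightarrow> length vs \<le> 2 \<Longrightarrow> norm p \<ge> R0 \<Longrightarrow>
    \<bar>iter_deriv vs (\<lambda>p. h p $ \<alpha> $ \<beta> - (if \<alpha> = \<beta> then 1 else 0)) p\<bar> \<le> C0 * norm p powr (- \<tau> - real (length vs))"
    using asymptotically_flat_bounds[OF h(2)] by blast
  obtain L where L: "L > 0" and inv: "\<And>M :: real^'m^'m. norm (M - mat 1) \<le> 1/2 \<Longrightarrow> norm (matrix_inv M) \<le> L \<and>
    matrix_inv differentiable at M \<and> (\<forall>X. norm (frechet matrix_inv M X) \<le> L * norm X)"
    using matrix_inv_bounds by blast
  define n where "n = real CARD('m)"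
  have n: "n \<ge> 1" unfolding n_def using zero_less_card_finite[where 'a='m] by linarith
  have "((\<lambda>r. n\<^sup>2 * C0 * r powr (- \<tau>)) \<longlongrightarrow> n\<^sup>2 * C0 * 0) at_top"
    using \<tau> by (intro tendsto_intros tendsto_neg_powr filterlim_ident) auto
  then have "\<forall>\<^sub>F r in at_top. n\<^sup>2 * C0 * r powr (- \<tau>) < 1/2" by (rule order_tendstoD(2)) simp
  \<comment> \<open>Beyond \<open>R1\<close> the metric lies in the ball about the identity on which
    the inverse is controlled.\<close>
  then obtain R1 where R1: "\<And>r. r \<ge> R1 \<Longrightarrow> n\<^sup>2 * C0 * r powr (- \<tau>) < 1/2"
    unfolding eventually_at_top_linorder by blast
  define R where "R = max 2 (max R0 R1)"
  define f where "f \<alpha> \<beta> p = h p $ \<alpha> $ \<beta> - (if \<alpha> = \<beta> then 1 else 0)" for \<alpha> \<beta> p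
  have fb': "\<bar>iter_deriv vs (f \<alpha> \<beta>) p\<bar> \<le> C0 * norm p powr (- \<tau> - real (length vs))"
    if "set vs \<subseteq> Basis" "length vs \<le> 2" "norm p \<ge> R0" for vs \<alpha> \<beta> p
    unfolding f_def[abs_def] by (rule fb[OF that])
  have ax: "axis i (1::real) \<in> Basis" for i :: 'm by (simp add: axis_in_Basis_iff)
  have hd: "h differentiable at p" if "p \<in> U" for p using Ck_differentiable[OF hC that] by blast
  have hcd: "(\<lambda>q. h q $ \<alpha> $ \<beta>) differentiable at p" if "p \<in> U" for p \<alpha> \<beta>
    using Ck_differentiable[OF Ck_matrix_entry[OF U(1) hC] that] by blast
  have pdf: "pd i (\<lambda>q. h q $ \<alpha> $ \<beta>) p = pd i (f \<alpha> \<beta>) p" if "p \<in> U" for p i \<alpha> \<beta>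
    unfolding f_def[abs_def] using frechet_minus_const[OF hcd[OF that]] by metis
  have pdC: "Ck k U (\<lambda>p. pd i (\<lambda>q. h q $ \<alpha> $ \<beta>) p)" for k i \<alpha> \<beta> by (intro Ck_pd U Ck_matrix_entry hC)
  have pdd: "(\<lambda>p. pd i (\<lambda>q. h q $ \<alpha> $ \<beta>) p) differentiable at p" if "p \<in> U" for p i \<alpha> \<beta>
    using Ck_differentiable[OF pdC that] by blast
  have far: "p \<in> U" "norm p \<ge> R0" "norm p \<ge> 2" "norm p \<ge> R1" if "norm p \<ge> R" for p
    using that U(2) by (auto simp: R_def exterior_def)
  define P where "P k p = norm p powr (- \<tau> - k)" for k :: real and p :: "real^'m"
  have P0: "P k p \<ge> 0" for k p by (simp add: P_def)
  have b0: "norm (h p - mat 1) \<le> n\<^sup>2 * C0 * P 0 p" if "norm p \<ge> R" for p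
  proof -
    have "norm (h p - mat 1) \<le> n\<^sup>2 * (C0 * P 0 p)" unfolding n_def
    proof (rule norm_matrix_le)
      show "\<bar>(h p - mat 1) $ i $ j\<bar> \<le> C0 * P 0 p" for i j
        using fb[of "[]" p i j] far[OF that] by (simp add: P_def mat_def)
    qed
    then show ?thesis by (simp add: mult.assoc)
  qed
  have b1: "\<bar>pd i (\<lambda>q. h q $ \<alpha> $ \<beta>) p\<bar> \<le> C0 * P 1 p" if "norm p \<ge> R" for p i \<alpha> \<beta>
    using fb'[of "[axis i 1]" p \<alpha> \<beta>] far(2)[OF that] ax unfolding pdf[OF far(1)[OF that]] P_def by simp
  have b2: "\<bar>pd k (\<lambda>p. pd i (\<lambda>q. h q $ \<alpha> $ \<beta>) p) p\<bar> \<le> C0 * P 2 p" if "norm p \<ge> R" for p i k \<alpha> \<beta>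
  proof -
    have "pd k (\<lambda>p. pd i (\<lambda>q. h q $ \<alpha> $ \<beta>) p) p = pd k (\<lambda>p. pd i (f \<alpha> \<beta>) p) p"
      using frechet_derivative_transform_within_open[OF pdd[OF far(1)[OF that]] U(1) far(1)[OF that] pdf] by metis
    then show ?thesis
      using fb'[of "[axis k 1, axis i 1]" p \<alpha> \<beta>] far(2)[OF that] ax unfolding P_def by simp
  qed
  have bD: "norm (frechet h p v) \<le> n\<^sup>2 * (n * (C0 * P 1 p) * norm v)" if "norm p \<ge> R" for p v
    unfolding n_def
  proof (rule norm_matrix_le)
    fix i j
    have "frechet h p v $ i $ j = frechet (\<lambda>q. h q $ i $ j) p v"
      using frechet_bounded_linear[OF bounded_linear_compose[OF bounded_linear_vec_nth[of j] bounded_linear_vec_nth[of i]] hd[OF far(1)[OF that]], of v]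
      by simp
    also have "\<bar>\<dots>\<bar> \<le> real CARD('m) * (C0 * P 1 p) * norm v"
      by (rule abs_frechet_le_pd[OF hcd[OF far(1)[OF that]] b1[OF that]])
    finally show "\<bar>frechet h p v $ i $ j\<bar> \<le> real CARD('m) * (C0 * P 1 p) * norm v" .
  qed
  define E where "E \<alpha> \<beta> \<delta> p = pd \<alpha> (\<lambda>q. h q $ \<beta> $ \<delta>) p + pd \<beta> (\<lambda>q. h q $ \<alpha> $ \<delta>) p - pd \<delta> (\<lambda>q. h q $ \<alpha> $ \<beta>) p" for \<alpha> \<beta> \<delta> p
  have E1: "\<bar>E \<alpha> \<beta> \<delta> p\<bar> \<le> 3 * (C0 * P 1 p)" if "norm p \<ge> R" for p \<alpha> \<beta> \<delta>
    unfolding E_def using b1[OF that, where i=\<alpha> and \<alpha>=\<beta> and \<beta>=\<delta>] b1[OF that, where i=\<beta> and \<alpha>=\<alpha> and \<beta>=\<delta>] b1[OF that, where i=\<delta> and \<alpha>=\<alpha> and \<beta>=\<beta>] by linarith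
  have EC: "Ck k U (E \<alpha> \<beta> \<delta>)" for k \<alpha> \<beta> \<delta> unfolding E_def[abs_def] by (intro Ck_diff Ck_add pdC U)
  have E2: "\<bar>frechet (E \<alpha> \<beta> \<delta>) p u\<bar> \<le> n * (3 * (C0 * P 2 p)) * norm u" if "norm p \<ge> R" for p u \<alpha> \<beta> \<delta>
    unfolding n_def
  proof (rule abs_frechet_le_pd)
    show "E \<alpha> \<beta> \<delta> differentiable at p" using Ck_differentiable[OF EC far(1)[OF that]] by blast
    note W = pdd[OF far(1)[OF that], unfolded frechet_derivative_works]
    fix i
    have "pd i (E \<alpha> \<beta> \<delta>) p = pd i (\<lambda>p. pd \<alpha> (\<lambda>q. h q $ \<beta> $ \<delta>) p) p + pd i (\<lambda>p. pd \<beta> (\<lambda>q. h q $ \<alpha> $ \<delta>) p) p - pd i (\<lambda>p. pd \<delta> (\<lambda>q. h q $ \<alpha> $ \<beta>) p) p"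
      unfolding E_def[abs_def] by (rule frechet_eqI[OF has_derivative_diff[OF has_derivative_add[OF W W] W]])
    then show "\<bar>pd i (E \<alpha> \<beta> \<delta>) p\<bar> \<le> 3 * (C0 * P 2 p)"
      using b2[OF that, where k=i and i=\<alpha> and \<alpha>=\<beta> and \<beta>=\<delta>] b2[OF that, where k=i and i=\<beta> and \<alpha>=\<alpha> and \<beta>=\<delta>] b2[OF that, where k=i and i=\<delta> and \<alpha>=\<alpha> and \<beta>=\<beta>] by linarith
  qed
  have invb: "norm (matrix_inv (h p)) \<le> L" "matrix_inv differentiable at (h p)"
    "\<And>X. norm (frechet matrix_inv (h p) X) \<le> L * norm X" if "norm p \<ge> R" for p
  proof -
    have "norm (h p - mat 1) \<le> 1/2" using b0[OF that] R1[OF far(4)[OF that]] by (simp add: P_def)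
    from inv[OF this] show "norm (matrix_inv (h p)) \<le> L" "matrix_inv differentiable at (h p)"
      "\<And>X. norm (frechet matrix_inv (h p) X) \<le> L * norm X" by blast+
  qed
  have christ: "christoffel h p \<gamma> \<alpha> \<beta> = (\<Sum>\<delta>\<in>UNIV. 1/2 * (matrix_inv (h p) $ \<gamma> $ \<delta> * E \<alpha> \<beta> \<delta> p))" for p \<gamma> \<alpha> \<beta>
    by (simp add: christoffel_def E_def sum_distrib_left)
  have entry: "\<bar>A $ i $ j\<bar> \<le> norm A" for A :: "real^'m^'m" and i j
    using component_le_norm_cart[of "A $ i" j] Finite_Cartesian_Product.norm_nth_le[of A i] by simp
  have c1: "\<bar>christoffel h p \<gamma> \<alpha> \<beta>\<bar> \<le> n * (1/2 * (L * (3 * (C0 * P 1 p))))" if "norm p \<ge> R" for p \<gamma> \<alpha> \<beta>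
  proof -
    have "\<bar>christoffel h p \<gamma> \<alpha> \<beta>\<bar> \<le> (\<Sum>\<delta>\<in>UNIV. \<bar>1/2 * (matrix_inv (h p) $ \<gamma> $ \<delta> * E \<alpha> \<beta> \<delta> p)\<bar>)"
      unfolding christ by (rule sum_abs)
    also have "\<dots> \<le> (\<Sum>\<delta>\<in>(UNIV::'m set). 1/2 * (L * (3 * (C0 * P 1 p))))"
    proof (rule sum_mono)
      fix \<delta>
      have "\<bar>matrix_inv (h p) $ \<gamma> $ \<delta>\<bar> \<le> L" using entry invb(1)[OF that] order_trans by blast
      then show "\<bar>1/2 * (matrix_inv (h p) $ \<gamma> $ \<delta> * E \<alpha> \<beta> \<delta> p)\<bar> \<le> 1/2 * (L * (3 * (C0 * P 1 p)))"
        unfolding abs_mult using E1[OF that, of \<alpha> \<beta> \<delta>] L by (intro mult_mono) auto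
    qed
    finally show ?thesis by (simp add: n_def)
  qed
  define C2 where "C2 = n * (1/2 * (L * (n\<^sup>2 * n * C0) * (3 * C0) + L * (n * (3 * C0))))"
  have c2: "\<bar>frechet (\<lambda>p. christoffel h p \<gamma> \<alpha> \<beta>) p u\<bar> \<le> C2 * P 2 p * norm u" if p: "norm p \<ge> R" for p u \<gamma> \<alpha> \<beta>
  proof -
    let ?i = "\<lambda>\<delta> u. frechet matrix_inv (h p) (frechet h p u) $ \<gamma> $ \<delta>"
    let ?t = "\<lambda>\<delta> u. matrix_inv (h p) $ \<gamma> $ \<delta> * frechet (E \<alpha> \<beta> \<delta>) p u + ?i \<delta> u * E \<alpha> \<beta> \<delta> p"
    let ?c = "frechet (\<lambda>p. christoffel h p \<gamma> \<alpha> \<beta>) p"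
    have di: "((\<lambda>q. matrix_inv (h q) $ \<gamma> $ \<delta>) has_derivative ?i \<delta>) (at p)" for \<delta>
    proof -
      have "((\<lambda>q. matrix_inv (h q)) has_derivative (\<lambda>u. frechet matrix_inv (h p) (frechet h p u))) (at p)"
        by (rule has_derivative_compose[OF hd[OF far(1)[OF p], unfolded frechet_derivative_works] invb(2)[OF p, unfolded frechet_derivative_works]])
      from bounded_linear.has_derivative[OF bounded_linear_compose[OF bounded_linear_vec_nth[of \<delta>] bounded_linear_vec_nth[of \<gamma>]] this]
      show ?thesis .
    qed
    have dE: "(E \<alpha> \<beta> \<delta> has_derivative frechet (E \<alpha> \<beta> \<delta>) p) (at p)" for \<delta>
      using Ck_has_derivative[OF EC far(1)[OF p]] .
    have "((\<lambda>p. christoffel h p \<gamma> \<alpha> \<beta>) has_derivative (\<lambda>u. \<Sum>\<delta>\<in>UNIV. 1/2 *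
        (?t \<delta> u))) (at p)"
      unfolding christ by (intro has_derivative_sum has_derivative_mult_right has_derivative_mult di dE)
    then have eq: "?c u = (\<Sum>\<delta>\<in>UNIV. 1/2 *
        (?t \<delta> u))"
      by (rule frechet_eqI)
    have "\<bar>?c u\<bar> \<le> (\<Sum>\<delta>\<in>(UNIV::'m set). 1/2 * (L * (n\<^sup>2 * n * C0) * (3 * C0) + L * (n * (3 * C0))) * (P 2 p * norm u))"
      unfolding eq
    proof (rule order_trans[OF sum_abs sum_mono])
      fix \<delta>
      have 1: "\<bar>matrix_inv (h p) $ \<gamma> $ \<delta>\<bar> \<le> L" using entry invb(1)[OF p] order_trans by blast
      have "\<bar>?i \<delta> u\<bar> \<le> norm (frechet matrix_inv (h p) (frechet h p u))" by (rule entry)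
      also have "\<dots> \<le> L * norm (frechet h p u)" by (rule invb(3)[OF p])
      also have "\<dots> \<le> L * (n\<^sup>2 * (n * (C0 * P 1 p) * norm u))" using bD[OF p] L by (intro mult_left_mono) auto
      finally have 2: "\<bar>?i \<delta> u\<bar> \<le> L * (n\<^sup>2 * (n * (C0 * P 1 p) * norm u))" .
      \<comment> \<open>Since |p| \<ge> 1 and \<tau> > 0, the surplus factor |p| to the power
        -\<tau> may be dropped.\<close>
      have PP: "P 1 p * P 1 p \<le> P 2 p"
      proof -
        have "P 1 p * P 1 p = norm p powr (- \<tau> - 1 + (- \<tau> - 1))" unfolding P_def by (simp only: powr_add)
        also have "\<dots> \<le> P 2 p" unfolding P_def using far(3)[OF p] \<tau> by (intro powr_mono) auto
        finally show ?thesis .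
      qed
      have mm: "\<bar>s * t\<bar> \<le> a * b" if "\<bar>s\<bar> \<le> a" "\<bar>t\<bar> \<le> b" for s t a b :: real
        unfolding abs_mult using that by (intro mult_mono) auto
      have "\<bar>?t \<delta> u\<bar> \<le>
          L * (n * (3 * (C0 * P 2 p)) * norm u) + L * (n\<^sup>2 * (n * (C0 * P 1 p) * norm u)) * (3 * (C0 * P 1 p))"
        by (rule order_trans[OF abs_triangle_ineq add_mono[OF mm[OF 1 E2[OF p]] mm[OF 2 E1[OF p]]]])
      also have "\<dots> = L * (n * (3 * C0)) * (P 2 p * norm u) + L * (n\<^sup>2 * n * C0) * (3 * C0) * ((P 1 p * P 1 p) * norm u)"
        by (simp add: algebra_simps)
      also have "\<dots> \<le> L * (n * (3 * C0)) * (P 2 p * norm u) + L * (n\<^sup>2 * n * C0) * (3 * C0) * (P 2 p * norm u)"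
        using L C0 n PP by (intro add_left_mono mult_left_mono mult_right_mono) auto
      finally show "\<bar>1/2 * (?t \<delta> u)\<bar> \<le>
        1/2 * (L * (n\<^sup>2 * n * C0) * (3 * C0) + L * (n * (3 * C0))) * (P 2 p * norm u)"
        by (simp add: abs_mult algebra_simps)
    qed
    then show ?thesis unfolding C2_def sum_constant n_def[symmetric] by (simp only: mult.assoc)
  qed
  have vv: "\<bar>c * v $ i * w $ j\<bar> \<le> b * norm v * norm w" if "\<bar>c\<bar> \<le> b" for c b :: real and v w :: "real^'m" and i j
    unfolding abs_mult using that component_le_norm_cart[of v i] component_le_norm_cart[of w j]
    by (intro mult_mono) auto
  have quad: "norm (\<chi> \<gamma>. \<Sum>\<alpha>\<in>UNIV. \<Sum>\<beta>\<in>UNIV. c \<gamma> \<alpha> \<beta> * v $ \<alpha> * w $ \<beta>) \<le> n ^ 3 * (b * norm v * norm w)" (is "norm ?W \<le> _")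
    if "\<And>\<gamma> \<alpha> \<beta>. \<bar>c \<gamma> \<alpha> \<beta>\<bar> \<le> b" for c :: "'m \<Rightarrow> 'm \<Rightarrow> 'm \<Rightarrow> real" and b and v w :: "real^'m"
  proof -
    have "\<bar>\<Sum>\<alpha>\<in>UNIV. \<Sum>\<beta>\<in>UNIV. c \<gamma> \<alpha> \<beta> * v $ \<alpha> * w $ \<beta>\<bar> \<le> (\<Sum>\<alpha>\<in>(UNIV::'m set). \<Sum>\<beta>\<in>(UNIV::'m set). b * norm v * norm w)" for \<gamma>
      by (intro order_trans[OF sum_abs] sum_mono vv that)
    then have e: "\<bar>?W $ \<gamma>\<bar> \<le> n * (n * (b * norm v * norm w))" for \<gamma> by (simp add: n_def)
    have "norm ?W \<le> n * (n * (n * (b * norm v * norm w)))"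
      using norm_vec_le_sum[OF e] by (simp add: n_def)
    then show ?thesis by (simp add: power3_eq_cube mult.assoc)
  qed
  have chrD: "frechet (\<lambda>p. chr h p v w) p u =
      (\<chi> \<gamma>. \<Sum>\<alpha>\<in>UNIV. \<Sum>\<beta>\<in>UNIV. frechet (\<lambda>p. christoffel h p \<gamma> \<alpha> \<beta>) p u * v $ \<alpha> * w $ \<beta>)"
    if p: "norm p \<ge> R" for p u v w
  proof (rule frechet_eqI)
    note D = Ck_has_derivative[OF chC far(1)[OF p]]
    show "((\<lambda>p. chr h p v w) has_derivative (\<lambda>u. \<chi> \<gamma>. \<Sum>\<alpha>\<in>UNIV. \<Sum>\<beta>\<in>UNIV.
        frechet (\<lambda>p. christoffel h p \<gamma> \<alpha> \<beta>) p u * v $ \<alpha> * w $ \<beta>)) (at p)"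
      unfolding chr_def by (intro has_derivative_vec_lambda has_derivative_sum has_derivative_mult_left D)
  qed
  define C where "C = n\<^sup>2 * C0 + n\<^sup>2 * (n * C0) + n ^ 3 * (n * (1/2 * (L * (3 * C0)))) + n ^ 3 * C2"
  have Cpos: "n\<^sup>2 * C0 > 0" "n\<^sup>2 * (n * C0) > 0" "n ^ 3 * (n * (1/2 * (L * (3 * C0)))) > 0" "n ^ 3 * C2 > 0"
    using n C0 L by (auto simp: C2_def intro!: mult_pos_pos add_pos_pos)
  have Cle: "c \<le> C" if "c \<in> {n\<^sup>2 * C0, n\<^sup>2 * (n * C0), n ^ 3 * (n * (1/2 * (L * (3 * C0)))), n ^ 3 * C2}" for c
    using that Cpos unfolding C_def by (elim insertE) auto
  show ?thesis
  proof (rule that[of C R])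
    show "C > 0" using Cpos unfolding C_def by linarith
    show "R \<ge> 2" by (simp add: R_def)
    fix p u v w :: "real^'m" assume p: "norm p \<ge> R"
    have "n\<^sup>2 * C0 * P 0 p \<le> C * P 0 p" by (intro mult_right_mono Cle P0) auto
    then show "norm (h p - mat 1) \<le> C * norm p powr (- \<tau>)" using b0[OF p] by (simp add: P_def)
    have "(n\<^sup>2 * (n * C0)) * (P 1 p * norm v) \<le> C * (P 1 p * norm v)"
      by (intro mult_right_mono Cle mult_nonneg_nonneg P0) auto
    then show "norm (frechet h p v) \<le> C * norm p powr (- \<tau> - 1) * norm v"
      using bD[OF p, of v] by (simp add: P_def ac_simps)
    have "(n ^ 3 * (n * (1/2 * (L * (3 * C0))))) * (P 1 p * norm v * norm w) \<le> C * (P 1 p * norm v * norm w)"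
      by (intro mult_right_mono Cle mult_nonneg_nonneg P0) auto
    then show "norm (chr h p v w) \<le> C * norm p powr (- \<tau> - 1) * norm v * norm w"
      using quad[of "christoffel h p", OF c1[OF p], of v w] by (simp add: P_def chr_def ac_simps)
    have "(n ^ 3 * C2) * (P 2 p * norm u * norm v * norm w) \<le> C * (P 2 p * norm u * norm v * norm w)"
      by (intro mult_right_mono Cle mult_nonneg_nonneg P0) auto
    then show "norm (frechet (\<lambda>p. chr h p v w) p u) \<le> C * norm p powr (- \<tau> - 2) * norm u * norm v * norm w"
      using quad[of "\<lambda>\<gamma> \<alpha> \<beta>. frechet (\<lambda>p. christoffel h p \<gamma> \<alpha> \<beta>) p u", OF c2[OF p], of v w] unfolding chrD[OF p]
      by (simp add: P_def ac_simps)
  qed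
qed

section \<open>The Willmore energy of a graph\<close>

definition D1 :: "(real^2 \<Rightarrow> real^'m) \<Rightarrow> real^2 \<Rightarrow> real^'m^2" where
  "D1 g y = (\<chi> a. pd a g y)"

definition D2 :: "(real^2 \<Rightarrow> real^'m) \<Rightarrow> real^2 \<Rightarrow> real^'m^2^2" where
  "D2 g y = (\<chi> a b. pd2 a b g y)"

text \<open>The quantity that will control the Hessian at the centre; the summand \<eta> stands for
  the contribution of the ambient metric.\<close>

abbreviation hessian_potential :: "(real^2) set \<Rightarrow> real \<Rightarrow> (real^2 \<Rightarrow> real^'m) \<Rightarrow> real" where
  "hessian_potential Q \<eta> g \<equiv> integral Q (\<lambda>y. (norm (D2 g y) + \<eta>) * inverse (norm y))"

definition chrP :: "(real^'m \<Rightarrow> real^'m^'m) \<Rightarrow> real^'m \<Rightarrow> real^'m^2 \<Rightarrow> real^'m^2^2" where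
  "chrP h p P = (\<chi> a b. chr h p (P $ a) (P $ b))"

text \<open>The covariant second derivatives of \<open>p0 + s *\<^sub>R g\<close>, divided by
  \<open>s\<close>. The Christoffel term is quadratic in the first derivatives and therefore keeps
  one factor \<open>s\<close>; the value 1 gives the usual covariant Hessian.\<close>

definition Qhat :: "(real^'m \<Rightarrow> real^'m^'m) \<Rightarrow> real \<Rightarrow> real^'m \<Rightarrow> (real^2 \<Rightarrow> real^'m) \<Rightarrow> real^2 \<Rightarrow> real^'m^2^2" where
  "Qhat h s p g y = D2 g y + s *\<^sub>R chrP h p (D1 g y)"

lemma pullback_gram: "pullback h \<xi> x = gram (h (\<xi> x)) (D1 \<xi> x)"
  by (simp add: pullback_def gram_def h_inner_def ipM_def D1_def)

lemma second_ff_nproj: "second_ff h \<xi> x i j = nproj (h (\<xi> x)) (D1 \<xi> x) (Qhat h 1 (\<xi> x) \<xi> x $ i $ j)"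
  by (simp add: second_ff_def normal_part_def nproj_def pullback_gram h_inner_def ipM_def
      cov_deriv_chr Qhat_def D2_def chrP_def D1_def)

lemma second_ff_norm_Aform:
  "second_ff_norm h \<xi> x = sqrt (Aform (h (\<xi> x), D1 \<xi> x) (Qhat h 1 (\<xi> x) \<xi> x) (Qhat h 1 (\<xi> x) \<xi> x))"
  by (simp add: second_ff_norm_def Let_def Aform_def second_ff_nproj pullback_gram h_inner_def ipM_def)

lemma ipM_nonneg:
  assumes "riemannian_metric h" "p \<in> exterior"
  shows "ipM (h p) v v \<ge> 0"
  using assms unfolding riemannian_metric_def ipM_def by (cases "v = 0") (auto intro: less_imp_le)

lemma riemannian_symmetric: "riemannian_metric h \<Longrightarrow> p \<in> exterior \<Longrightarrow> transpose (h p) = h p"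
  by (simp add: riemannian_metric_def)

lemma willmore_density_Wform:
  assumes "riemannian_metric h" "\<xi> x \<in> exterior"
  shows "(h_norm h (\<xi> x) (mean_curvature h \<xi> x))\<^sup>2 * area_density h \<xi> x =
    Wform (h (\<xi> x), D1 \<xi> x) (Qhat h 1 (\<xi> x) \<xi> x) (Qhat h 1 (\<xi> x) \<xi> x)"
proof -
  have "mean_curvature h \<xi> x = Hvec (h (\<xi> x)) (D1 \<xi> x) (Qhat h 1 (\<xi> x) \<xi> x)"
    by (simp add: mean_curvature_def Hvec_def second_ff_nproj pullback_gram)
  then show ?thesis using ipM_nonneg[OF assms]
    by (simp add: h_norm_def h_inner_def ipM_def[symmetric] Wform_def area_density_def pullback_gram)
qed

lemma det_matrix_pd: "det (\<chi> a i. s * (pd i f x $ a)) = s\<^sup>2 * det (matrix (frechet f x) :: real^2^2)"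
  by (simp add: det_2 matrix_def algebra_simps power2_eq_square)

text \<open>Second derivatives of the coordinate map \<open>f\<close> occur only as coefficients of
  tangent vectors of the graph, which the normal projection removes later.\<close>

lemma graph_chain:
  fixes f :: "real^2 \<Rightarrow> real^2" and g :: "real^2 \<Rightarrow> real^'m"
  assumes X: "open X" "x \<in> X" and Y: "open Y" "f ` X \<subseteq> Y" and f: "Ck 1 X f" and g: "Ck 1 Y g"
    and \<Phi>: "\<And>z. z \<in> X \<Longrightarrow> \<Phi> z = p0 + s *\<^sub>R g (f z)"
  shows "D1 \<Phi> x $ i = (\<Sum>a\<in>UNIV. (s * (pd i f x $ a)) *\<^sub>R D1 g (f x) $ a)"
    and "D2 \<Phi> x $ i $ j = (\<Sum>a\<in>UNIV. \<Sum>b\<in>UNIV. (s * (pd i f x $ a) * (pd j f x $ b)) *\<^sub>R D2 g (f x) $ a $ b)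
      + (\<Sum>a\<in>UNIV. (s * (pd2 i j f x $ a)) *\<^sub>R D1 g (f x) $ a)"
proof -
  have fx: "f z \<in> Y" if "z \<in> X" for z using that Y by auto
  have pf: "Ck 0 X (\<lambda>z. pd j f z)" for j using Ck_pd[OF X(1), of 0 f j] f by simp
  have pg: "Ck 0 Y (\<lambda>z. pd a g z)" for a using Ck_pd[OF Y(1), of 0 g a] g by simp
  have 1: "pd j \<Phi> z = (\<Sum>a\<in>UNIV. (s * (pd j f z $ a)) *\<^sub>R pd a g (f z))" if z: "z \<in> X" for j z
  proof -
    have "((\<lambda>z. p0 + s *\<^sub>R g (f z)) has_derivative
        (\<lambda>v. s *\<^sub>R frechet g (f z) (frechet f z v))) (at z)"
      using has_derivative_add[OF has_derivative_const has_derivative_scaleR_right[OF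
          has_derivative_compose[OF Ck_has_derivative[OF f z] Ck_has_derivative[OF g fx[OF z]]]], of p0 s]
      by simp
    then have "(\<Phi> has_derivative (\<lambda>v. s *\<^sub>R frechet g (f z) (frechet f z v))) (at z)"
      by (rule has_derivative_transform_within_open[OF _ X(1) z]) (simp add: \<Phi>)
    then have "pd j \<Phi> z = s *\<^sub>R frechet g (f z) (pd j f z)" by (rule pd_eqI)
    also have "\<dots> = s *\<^sub>R (\<Sum>a\<in>UNIV. (pd j f z $ a) *\<^sub>R pd a g (f z))"
      by (subst has_derivative_pd_sum[OF Ck_differentiable[OF g fx[OF z]]]) simp
    finally show ?thesis by (simp add: scaleR_sum_right)
  qed
  then show "D1 \<Phi> x $ i = (\<Sum>a\<in>UNIV. (s * (pd i f x $ a)) *\<^sub>R D1 g (f x) $ a)"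
    using X by (simp add: D1_def)
  have 2: "((\<lambda>z. \<Sum>a\<in>UNIV. (s * (pd j f z $ a)) *\<^sub>R pd a g (f z)) has_derivative
      (\<lambda>v. \<Sum>a\<in>UNIV. (s * (pd j f x $ a)) *\<^sub>R frechet (\<lambda>z. pd a g z) (f x) (frechet f x v)
        + (s * (frechet (\<lambda>z. pd j f z) x v $ a)) *\<^sub>R pd a g (f x))) (at x)"
    by (intro has_derivative_sum has_derivative_scaleR has_derivative_mult_right
        bounded_linear.has_derivative[OF bounded_linear_vec_nth] Ck_has_derivative[OF pf X(2)]
        has_derivative_compose[OF Ck_has_derivative[OF f X(2)] Ck_has_derivative[OF pg fx[OF X(2)]]])
  then have "((\<lambda>z. pd j \<Phi> z) has_derivative
      (\<lambda>v. \<Sum>a\<in>UNIV. (s * (pd j f x $ a)) *\<^sub>R frechet (\<lambda>z. pd a g z) (f x) (frechet f x v)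
        + (s * (frechet (\<lambda>z. pd j f z) x v $ a)) *\<^sub>R pd a g (f x))) (at x)"
    by (rule has_derivative_transform_within_open[OF _ X]) (simp add: 1)
  then have "pd2 i j \<Phi> x = (\<Sum>a\<in>UNIV. (s * (pd j f x $ a)) *\<^sub>R frechet (\<lambda>z. pd a g z) (f x) (pd i f x)
        + (s * (pd2 i j f x $ a)) *\<^sub>R pd a g (f x))"
    by (rule pd_eqI)
  moreover have e: "frechet (\<lambda>z. pd a g z) (f x) (pd i f x) = (\<Sum>b\<in>UNIV. (pd i f x $ b) *\<^sub>R pd2 b a g (f x))" for a
    by (rule has_derivative_pd_sum[OF Ck_differentiable[OF pg fx[OF X(2)]]])
  ultimately show "D2 \<Phi> x $ i $ j = (\<Sum>a\<in>UNIV. \<Sum>b\<in>UNIV. (s * (pd i f x $ a) * (pd j f x $ b)) *\<^sub>R D2 g (f x) $ a $ b)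
      + (\<Sum>a\<in>UNIV. (s * (pd2 i j f x $ a)) *\<^sub>R D1 g (f x) $ a)"
    unfolding e by (simp add: D2_def D1_def sum_2 algebra_simps)
qed

text \<open>The reparametrization has Jacobian \<open>s\<close> times the derivative of
  \<open>f\<close>, and the second derivatives are \<open>Qhat\<close> divided by \<open>s\<close>.
  In the Willmore density the resulting powers of \<open>s\<close> cancel, the scale invariance of
  the energy, whereas |A|^2 scales like 1/s^2.\<close>

lemma density_chain:
  fixes f :: "real^2 \<Rightarrow> real^2" and g :: "real^2 \<Rightarrow> real^'m"
  assumes X: "open X" "x \<in> X" and Y: "open Y" "f ` X \<subseteq> Y" and f: "Ck 1 X f" and g: "Ck 1 Y g"
    and \<Phi>: "\<And>z. z \<in> X \<Longrightarrow> \<Phi> z = p0 + s *\<^sub>R g (f z)"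
    and s: "s > 0" and M: "transpose (h (\<Phi> x)) = h (\<Phi> x)"
    and nd: "(h (\<Phi> x), D1 g (f x)) \<in> nondeg"
    and J: "det (matrix (frechet f x)) \<noteq> 0"
  shows "Wform (h (\<Phi> x), D1 \<Phi> x) (Qhat h 1 (\<Phi> x) \<Phi> x) (Qhat h 1 (\<Phi> x) \<Phi> x) =
      \<bar>det (matrix (frechet f x))\<bar> *
        Wform (h (\<Phi> x), D1 g (f x)) (Qhat h s (\<Phi> x) g (f x)) (Qhat h s (\<Phi> x) g (f x))"
    and "Aform (h (\<Phi> x), D1 \<Phi> x) (Qhat h 1 (\<Phi> x) \<Phi> x) (Qhat h 1 (\<Phi> x) \<Phi> x) =
      Aform (h (\<Phi> x), D1 g (f x)) (Qhat h s (\<Phi> x) g (f x)) (Qhat h s (\<Phi> x) g (f x)) / s\<^sup>2"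
    and "det (gram (h (\<Phi> x)) (D1 \<Phi> x)) = (s\<^sup>2 * det (matrix (frechet f x)))\<^sup>2 * det (gram (h (\<Phi> x)) (D1 g (f x)))"
proof -
  define Jm :: "real^2^2" where "Jm = (\<chi> a i. s * (pd i f x $ a))"
  have dJ: "det Jm = s\<^sup>2 * det (matrix (frechet f x))" unfolding Jm_def by (rule det_matrix_pd)
  have dJ0: "det Jm \<noteq> 0" using dJ s J by simp
  have D: "det (gram (h (\<Phi> x)) (D1 g (f x))) \<noteq> 0" using nd by (auto simp: nondeg_def)
  define Q where "Q = (1/s) *\<^sub>R Qhat h s (\<Phi> x) g (f x)"
  note chain = graph_chain[OF X Y f g \<Phi>]
  interpret c: bounded_bilinear "chr h (\<Phi> x)" by (rule chr_bilinear)
  have P': "D1 \<Phi> x $ i = (\<Sum>a\<in>UNIV. Jm $ a $ i *\<^sub>R D1 g (f x) $ a)" for i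
    using chain(1) by (simp add: Jm_def)
  have Q': "Qhat h 1 (\<Phi> x) \<Phi> x $ i $ j = (\<Sum>a\<in>UNIV. \<Sum>b\<in>UNIV. (Jm $ a $ i * Jm $ b $ j) *\<^sub>R Q $ a $ b)
      + (\<Sum>a\<in>UNIV. (s * (pd2 i j f x $ a)) *\<^sub>R D1 g (f x) $ a)" for i j
  proof -
    have "chr h (\<Phi> x) (D1 \<Phi> x $ i) (D1 \<Phi> x $ j) =
        (\<Sum>a\<in>UNIV. \<Sum>b\<in>UNIV. (Jm $ a $ i * Jm $ b $ j) *\<^sub>R chr h (\<Phi> x) (D1 g (f x) $ a) (D1 g (f x) $ b))"
      unfolding P' sum_2 by (simp add: c.add_left c.add_right c.scaleR_left c.scaleR_right algebra_simps)
    then show ?thesis using s by (simp add: Qhat_def chrP_def chain(2) Q_def Jm_def sum_2 algebra_simps)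
  qed
  note R = reparametrization[OF M D dJ0 P' Q']
  have "Wform (h (\<Phi> x), D1 g (f x)) Q Q = Wform (h (\<Phi> x), D1 g (f x)) (Qhat h s (\<Phi> x) g (f x)) (Qhat h s (\<Phi> x) g (f x)) / s\<^sup>2"
    by (simp add: Q_def W.scale_left W.scale_right power2_eq_square del: scaleR_conv_of_real)
  then show "Wform (h (\<Phi> x), D1 \<Phi> x) (Qhat h 1 (\<Phi> x) \<Phi> x) (Qhat h 1 (\<Phi> x) \<Phi> x) =
      \<bar>det (matrix (frechet f x))\<bar> *
        Wform (h (\<Phi> x), D1 g (f x)) (Qhat h s (\<Phi> x) g (f x)) (Qhat h s (\<Phi> x) g (f x))"
    using R(2) s by (simp add: dJ abs_mult)
  show "Aform (h (\<Phi> x), D1 \<Phi> x) (Qhat h 1 (\<Phi> x) \<Phi> x) (Qhat h 1 (\<Phi> x) \<Phi> x) =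
      Aform (h (\<Phi> x), D1 g (f x)) (Qhat h s (\<Phi> x) g (f x)) (Qhat h s (\<Phi> x) g (f x)) / s\<^sup>2"
    using R(3) by (simp add: Q_def A.scale_left A.scale_right power2_eq_square)
  show "det (gram (h (\<Phi> x)) (D1 \<Phi> x)) = (s\<^sup>2 * det (matrix (frechet f x)))\<^sup>2 * det (gram (h (\<Phi> x)) (D1 g (f x)))"
    using R(1) by (simp add: dJ)
qed

text \<open>Passing through \<open>real^1\<close> specializes the vector-valued change of variables
  to a scalar integrand.\<close>

lemma integral_change_of_variables_real:
  fixes f :: "real^2 \<Rightarrow> real^2" and F :: "real^2 \<Rightarrow> real"
  assumes S: "compact S" and f: "\<And>x. x \<in> S \<Longrightarrow> (f has_derivative f' x) (at x within S)" "inj_on f S"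
    and F: "continuous_on (f ` S) F"
  shows "(\<lambda>x. \<bar>det (matrix (f' x))\<bar> * F (f x)) absolutely_integrable_on S"
    and "integral S (\<lambda>x. \<bar>det (matrix (f' x))\<bar> * F (f x)) = integral (f ` S) F"
proof -
  have cf: "continuous_on S f" by (rule has_derivative_continuous_on) (rule f(1))
  have cS: "compact (f ` S)" using compact_continuous_image[OF cf S] .
  have Fai: "F absolutely_integrable_on (f ` S)" using borel_integrable_compact[OF cS F]
    by (simp add: set_integrable_def integrable_completion borel_measurable_integrable)
  have vai: "(\<lambda>y. vec (F y) :: real^1) absolutely_integrable_on (f ` S)"
  proof (rule absolutely_integrable_componentwise)
    fix b :: "real^1" assume "b \<in> Basis"
    then obtain i where "b = axis i 1" by (auto simp: Basis_vec_def)
    then have "(\<lambda>y. vec (F y) \<bullet> b) = F" by (simp add: inner_axis)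
    then show "(\<lambda>y. vec (F y) \<bullet> b) absolutely_integrable_on (f ` S)" using Fai by simp
  qed
  have "integral (f ` S) (\<lambda>y. vec (F y) :: real^1) = vec (integral (f ` S) F)"
    using integral_component_eq_cart[OF set_lebesgue_integral_eq_integral(1)[OF vai]]
    by (simp add: vec_eq_iff)
  with vai have R: "(\<lambda>x. \<bar>det (matrix (f' x))\<bar> *\<^sub>R (vec (F (f x)) :: real^1)) absolutely_integrable_on S"
    "integral S (\<lambda>x. \<bar>det (matrix (f' x))\<bar> *\<^sub>R (vec (F (f x)) :: real^1)) = vec (integral (f ` S) F)"
    using has_absolute_integral_change_of_variables[of S f f' "\<lambda>y. vec (F y) :: real^1" "vec (integral (f ` S) F)"]
      f S lmeasurable_compact fmeasurableD by blast+
  from R(1) have "(\<lambda>x. (\<bar>det (matrix (f' x))\<bar> *\<^sub>R (vec (F (f x)) :: real^1)) \<bullet> axis 1 1) absolutely_integrable_on S"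
    by (rule absolutely_integrable_component)
  then show "(\<lambda>x. \<bar>det (matrix (f' x))\<bar> * F (f x)) absolutely_integrable_on S" by (simp add: inner_axis)
  have "integral S (\<lambda>x. (\<bar>det (matrix (f' x))\<bar> *\<^sub>R (vec (F (f x)) :: real^1)) $ 1) = integral (f ` S) F"
    using integral_component_eq_cart[OF set_lebesgue_integral_eq_integral(1)[OF R(1)], of 1] R(2) by simp
  then show "integral S (\<lambda>x. \<bar>det (matrix (f' x))\<bar> * F (f x)) = integral (f ` S) F" by simp
qed

text \<open>The image of \<open>\<psi>\<close>, translated by \<open>- p0\<close> and scaled by \<open>1 / s\<close>, is parametrized by \<open>G\<close> over a
  disc; \<open>f\<close> is the coordinate map inverse to \<open>\<psi>\<close>.\<close>

locale graph_patch =
  fixes h :: "real^'m \<Rightarrow> real^'m^'m" and \<xi> :: "real^2 \<Rightarrow> real^'m" and s :: real and p0 :: "real^'m"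
    and \<rho> :: real and \<psi> f :: "real^2 \<Rightarrow> real^2" and G :: "real^2 \<Rightarrow> real^'m"
  assumes riem: "riemannian_metric h" and s_pos: "s > 0"
    and psi: "continuous_on (ball 0 \<rho>) \<psi>" "\<psi> ` ball 0 \<rho> \<subseteq> open_pdisk" "open (\<psi> ` ball 0 \<rho>)"
    and f_psi: "\<And>y. y \<in> ball 0 \<rho> \<Longrightarrow> f (\<psi> y) = y"
    and f_Ck: "\<And>n. Ck n open_pdisk f" and xi_Ck: "\<And>n. Ck n open_pdisk \<xi>"
    and xi_ext: "\<xi> ` open_pdisk \<subseteq> exterior"
    and f_det: "\<And>y. y \<in> ball 0 \<rho> \<Longrightarrow> det (matrix (frechet f (\<psi> y))) \<noteq> 0"
    and G_Ck: "\<And>n. Ck n (ball 0 \<rho>) G"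
    and xi_G: "\<And>y. y \<in> ball 0 \<rho> \<Longrightarrow> \<xi> (\<psi> y) = p0 + s *\<^sub>R G y"
begin

definition V where "V = \<psi> ` ball 0 \<rho>"

abbreviation dens :: "(real^2 \<Rightarrow> real^'m) \<Rightarrow> real^2 \<Rightarrow> real" where
  "dens g y \<equiv> Wform (h (p0 + s *\<^sub>R g y), D1 g y) (Qhat h s (p0 + s *\<^sub>R g y) g y) (Qhat h s (p0 + s *\<^sub>R g y) g y)"

lemma open_V: "open V" and V_sub: "V \<subseteq> open_pdisk" and f_V: "f ` V \<subseteq> ball 0 \<rho>"
  using psi f_psi by (auto simp: V_def)

lemma psi_f: "x \<in> V \<Longrightarrow> \<psi> (f x) = x"
  by (auto simp: V_def f_psi)

lemma f_V_Ck: "Ck n V f"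
  using f_Ck V_sub Ck_subset by blast

text \<open>Stated for an arbitrary graph function \<open>g\<close>, because it is applied to the
  displaced graphs and not to \<open>G\<close> itself. The factor |det Df| produced by the density
  is exactly the one that the change of variables demands.\<close>

lemma energy_as_integral:
  assumes Q: "compact Q" "Q \<subseteq> ball 0 \<rho>" and g: "Ck 1 (ball 0 \<rho>) g"
    and \<Phi>: "\<And>x. x \<in> V \<Longrightarrow> \<Phi> x = p0 + s *\<^sub>R g (f x)"
    and ext: "\<And>y. y \<in> Q \<Longrightarrow> p0 + s *\<^sub>R g y \<in> exterior"
    and nd: "\<And>y. y \<in> Q \<Longrightarrow> (h (p0 + s *\<^sub>R g y), D1 g y) \<in> nondeg"
    and cont: "continuous_on Q (\<lambda>y. dens g y)"
  shows "willmore_energy h \<Phi> (\<psi> ` Q) =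
    integral Q (\<lambda>y. dens g y)"
proof -
  define F where "F y = dens g y" for y
  define S where "S = \<psi> ` Q"
  have S: "compact S" "S \<subseteq> V" unfolding S_def V_def
    using compact_continuous_image[OF continuous_on_subset[OF psi(1) Q(2)] Q(1)] Q(2) by auto
  have fS: "f ` S = Q" using f_psi Q(2) by (force simp: S_def image_iff)
  have inj: "inj_on f S" using psi_f S(2) by (metis inj_on_inverseI subsetD)
  have der: "(f has_derivative frechet f x) (at x)" if "x \<in> V" for x
    using Ck_has_derivative[OF f_V_Ck that] .
  have dens: "(h_norm h (\<Phi> x) (mean_curvature h \<Phi> x))\<^sup>2 * area_density h \<Phi> x =
      \<bar>det (matrix (frechet f x))\<bar> * F (f x)" if x: "x \<in> S" for x
  proof -
    have xV: "x \<in> V" and fQ: "f x \<in> Q" using x S fS by auto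
    have ex: "\<Phi> x \<in> exterior" using ext[OF fQ] \<Phi>[OF xV] by simp
    have "det (matrix (frechet f x)) \<noteq> 0" using f_det[of "f x"] psi_f[OF xV] fQ Q(2) by auto
    moreover have "(h (\<Phi> x), D1 g (f x)) \<in> nondeg" using nd[OF fQ] \<Phi>[OF xV] by simp
    ultimately show ?thesis
      using density_chain(1)[where x = x and X = V and Y = "ball 0 \<rho>" and f = f and g = g and \<Phi> = \<Phi> and ?p0.0 = p0 and s = s and h = h,
          OF open_V xV open_ball f_V f_V_Ck g \<Phi> s_pos riemannian_symmetric[OF riem ex]]
        willmore_density_Wform[where \<xi> = \<Phi> and x = x, OF riem ex] \<Phi>[OF xV] by (simp add: F_def)
  qed
  note cv = integral_change_of_variables_real[OF S(1) has_derivative_at_withinI[OF der[OF subsetD[OF S(2)]]] inj cont[folded fS]]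
  have F2: "integral S (\<lambda>x. \<bar>det (matrix (frechet f x))\<bar> * F (f x)) = integral Q F"
    using cv(2) unfolding fS F_def by blast
  have contD: "continuous_on S (\<lambda>x. \<bar>det (matrix (frechet f x))\<bar> * F (f x))"
  proof -
    have "Ck 0 V (\<lambda>x. det (matrix (frechet f x)))"
      unfolding matrix_def by (intro Ck_det Ck_vec_lambda Ck_vec_nth Ck_pd open_V f_V_Ck)
    then have "continuous_on S (\<lambda>x. det (matrix (frechet f x)))"
      using Ck_continuous_on continuous_on_subset S(2) by blast
    moreover have "continuous_on S (\<lambda>x. F (f x))"
      using continuous_on_compose2[of Q F S f] cont fS Ck_continuous_on[OF f_V_Ck] S(2)
      unfolding F_def by (meson continuous_on_subset order_refl)
    ultimately show ?thesis by (intro continuous_intros)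
  qed
  have int: "set_integrable lborel S (\<lambda>x. \<bar>det (matrix (frechet f x))\<bar> * F (f x))"
    using borel_integrable_compact[OF S(1) contD] by (simp add: set_integrable_def)
  have "willmore_energy h \<Phi> S = (LINT x:S|lborel. \<bar>det (matrix (frechet f x))\<bar> * F (f x))"
    unfolding willmore_energy_def
    by (rule set_lebesgue_integral_cong) (use dens S(1) in \<open>auto intro: borel_compact\<close>)
  also have "\<dots> = integral S (\<lambda>x. \<bar>det (matrix (frechet f x))\<bar> * F (f x))"
    using set_borel_integral_eq_integral(2)[OF int] .
  finally have "willmore_energy h \<Phi> S = integral Q F" using F2 by simp
  then show ?thesis unfolding S_def F_def[abs_def] .
qed

end

section \<open>The first variation under a compactly supported displacement of the graph\<close>

lemma open_open_pdisk: "open open_pdisk"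
  by (simp add: open_pdisk_def open_delete)

lemma Ck_chr:
  assumes "open U" "Ck n U p" "Ck n U v" "Ck n U w" "p ` U \<subseteq> W" "open W"
    "\<And>\<gamma> \<alpha> \<beta>. Ck n W (\<lambda>p. christoffel h p \<gamma> \<alpha> \<beta>)"
  shows "Ck n U (\<lambda>x. chr h (p x) (v x) (w x))"
proof -
  have "Ck n U (\<lambda>x. christoffel h (p x) \<gamma> \<alpha> \<beta>)" for \<gamma> \<alpha> \<beta> by (rule Ck_compose[OF assms(1,6,5,2,7)])
  then show ?thesis unfolding chr_def by (intro Ck_vec_lambda Ck_sum Ck_mult Ck_vec_nth assms(1,3,4))
qed

lemma Ck_snd_compose:
  fixes g :: "'b::euclidean_space \<Rightarrow> 'c::real_normed_vector"
  assumes "open U" "Ck n U g"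
  shows "Ck n ((UNIV :: 'a::euclidean_space set) \<times> U) (\<lambda>w. g (snd w))"
  by (rule Ck_compose[OF open_Times[OF open_UNIV assms(1)] assms(1) _ _ assms(2)])
    (auto intro!: Ck_snd Ck_id open_Times assms(1))

context graph_patch
begin

text \<open>Data along the undisplaced graph: position in the ambient space, metric with tangent
  vectors, covariant second derivatives.\<close>

definition pos where "pos y = p0 + s *\<^sub>R G y"
definition zc where "zc y = (h (pos y), D1 G y)"
definition Qc where "Qc y = Qhat h s (pos y) G y"
text \<open>Derivatives at t = 0 when \<open>G\<close> is replaced by \<open>G\<close> plus
  \<open>t * \<phi>\<close> times the constant vector \<open>e\<close>: of the pair
  \<open>zc\<close>, of the Christoffel part, and of \<open>Qc\<close>.\<close>

definition zv where "zv \<phi> e y = (frechet h (pos y) ((s * \<phi> y) *\<^sub>R e), (\<chi> a. pd a \<phi> y *\<^sub>R e) :: real^'m^2)"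
definition Gv where "Gv \<phi> e y = (\<chi> a b. frechet (\<lambda>p. chr h p (pd a G y) (pd b G y)) (pos y) ((s * \<phi> y) *\<^sub>R e)
  + chr h (pos y) (pd a \<phi> y *\<^sub>R e) (pd b G y) + chr h (pos y) (pd a G y) (pd b \<phi> y *\<^sub>R e))"
definition Qv where "Qv \<phi> e y = (\<chi> a b. pd2 a b \<phi> y *\<^sub>R e) + s *\<^sub>R Gv \<phi> e y"

text \<open>The displacement of the graph is transported to the surface by \<open>f\<close> and
  extended by zero. On the image of the box the energy is the integral of \<open>Wform\<close> over
  the box, so criticality becomes a statement about differentiation under the integral sign.\<close>

lemma first_variation:
  fixes \<phi> :: "real^2 \<Rightarrow> real" and e :: "real^'m"
  assumes crit: "willmore_critical h \<xi>"
    and a: "a > 0" "cball 0 a \<subseteq> cbox A B" "cbox A B \<subseteq> ball 0 \<rho>"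
    and phi: "\<And>n. Ck n UNIV \<phi>" "\<And>y. norm y \<ge> a \<Longrightarrow> \<phi> y = 0"
    and far: "\<And>y. y \<in> ball 0 \<rho> \<Longrightarrow> norm (pos y) \<ge> 2"
    and nd: "\<And>y. y \<in> cbox A B \<Longrightarrow> zc y \<in> nondeg"
  shows "((\<lambda>y. W.dB (zc y) (zv \<phi> e y) (Qc y) (Qc y) + Wform (zc y) (Qv \<phi> e y) (Qc y)
    + Wform (zc y) (Qc y) (Qv \<phi> e y)) has_integral 0) (cbox A B)"
proof -
  obtain Uh where Uh: "open Uh" "exterior \<subseteq> Uh" and hC: "\<And>n. Ck n Uh h"
    and chC: "\<And>n \<gamma> \<alpha> \<beta>. Ck n Uh (\<lambda>p. christoffel h p \<gamma> \<alpha> \<beta>)"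
    using riemannian_metric_Ck[OF riem] by metis
  define Bq where "Bq = ball (0::real^2) \<rho>"
  have oB: "open ((UNIV :: real set) \<times> Bq)" by (auto simp: Bq_def intro: open_Times)
  define pt where "pt w = p0 + s *\<^sub>R (G (snd w) + (fst w * \<phi> (snd w)) *\<^sub>R e)" for w :: "real \<times> (real^2)"
  define Pt where "Pt w = (\<chi> a. pd a G (snd w) + (fst w * pd a \<phi> (snd w)) *\<^sub>R e)" for w :: "real \<times> (real^2)"
  define Qt where "Qt w = (\<chi> a b. pd2 a b G (snd w) + (fst w * pd2 a b \<phi> (snd w)) *\<^sub>R e)
    + s *\<^sub>R chrP h (pt w) (Pt w)" for w :: "real \<times> (real^2)"
  define F where "F w = Wform (h (pt w), Pt w) (Qt w) (Qt w)" for w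
  have G0: "Ck n (UNIV \<times> Bq) (\<lambda>w :: real \<times> (real^2). G (snd w))"
    and G1: "Ck n (UNIV \<times> Bq) (\<lambda>w :: real \<times> (real^2). pd a G (snd w))"
    and G2: "Ck n (UNIV \<times> Bq) (\<lambda>w :: real \<times> (real^2). pd2 b a G (snd w))" for n a b
    unfolding Bq_def by (intro Ck_snd_compose Ck_pd G_Ck open_ball)+
  have f0: "Ck n (UNIV \<times> Bq) (\<lambda>w :: real \<times> (real^2). \<phi> (snd w))"
    and f1: "Ck n (UNIV \<times> Bq) (\<lambda>w :: real \<times> (real^2). pd a \<phi> (snd w))"
    and f2: "Ck n (UNIV \<times> Bq) (\<lambda>w :: real \<times> (real^2). pd2 b a \<phi> (snd w))" for n a b
    by (intro Ck_subset[OF Ck_snd_compose[OF open_UNIV]] Ck_pd phi open_UNIV; simp)+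
  have t0: "Ck n (UNIV \<times> Bq) (fst :: real \<times> (real^2) \<Rightarrow> real)" for n
    by (intro Ck_linear oB bounded_linear_fst)
  have ptC: "Ck n (UNIV \<times> Bq) pt" for n
    unfolding pt_def[abs_def] by (intro Ck_add Ck_scaleR Ck_const Ck_mult oB G0 t0 f0)
  have PtC: "Ck n (UNIV \<times> Bq) Pt" for n
    unfolding Pt_def[abs_def] by (intro Ck_vec_lambda Ck_add Ck_scaleR Ck_const Ck_mult oB G1 t0 f1)
  \<comment> \<open>\<open>O1\<close> keeps the displaced points in the domain of the metric, and
    \<open>N\<close> below keeps the displaced graph nondegenerate. On \<open>N\<close> the
    integrand is continuously differentiable jointly in \<open>t\<close> and
    \<open>y\<close>.\<close>
  define O1 where "O1 = (UNIV \<times> Bq) \<inter> pt -` Uh"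
  have O1: "open O1" unfolding O1_def
    by (rule continuous_open_preimage[OF Ck_continuous_on[OF ptC] oB Uh(1)])
  have sub1: "O1 \<subseteq> UNIV \<times> Bq" by (auto simp: O1_def)
  have hO: "Ck n O1 (\<lambda>w. h (pt w))" for n
    by (rule Ck_compose[OF O1 Uh(1) _ Ck_subset[OF ptC sub1] hC]) (auto simp: O1_def)
  have PO: "Ck n O1 Pt" for n using Ck_subset[OF PtC sub1] .
  have QO: "Ck n O1 Qt" for n unfolding Qt_def[abs_def] chrP_def
    by (intro Ck_add Ck_scaleR Ck_const Ck_vec_lambda Ck_mult O1 Ck_subset[OF G2 sub1] Ck_subset[OF f2 sub1]
        Ck_subset[OF t0 sub1] Ck_chr[OF _ Ck_subset[OF ptC sub1] _ _ _ Uh(1) chC] Ck_vec_nth PO) (auto simp: O1_def)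
  define N where "N = O1 \<inter> (\<lambda>w. det (gram (h (pt w)) (Pt w))) -` {0<..}"
  have N: "open N" unfolding N_def
    by (rule continuous_open_preimage[OF Ck_continuous_on[OF Ck_det[OF O1 Ck_gram[OF O1 hO PO]]] O1]) auto
  have subN: "N \<subseteq> O1" by (auto simp: N_def)
  have FC: "Ck 1 N F" unfolding F_def[abs_def]
    by (intro Ck_Wform N Ck_subset[OF hO subN] Ck_subset[OF PO subN] Ck_subset[OF QO subN]) (auto simp: N_def)
  have at0: "pt (0, y) = pos y" "(h (pt (0, y)), Pt (0, y)) = zc y" "Qt (0, y) = Qc y" for y
    by (simp_all add: pt_def pos_def Pt_def zc_def D1_def Qt_def Qc_def Qhat_def D2_def)
  have pos_ext: "pos y \<in> exterior" if "y \<in> ball 0 \<rho>" for y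
    using far[OF that] by (auto simp: exterior_def)
  have K0: "(0, y) \<in> N" if y: "y \<in> cbox A B" for y
  proof -
    have yr: "y \<in> ball 0 \<rho>" using y a(3) by blast
    then have "pos y \<in> Uh" using pos_ext Uh(2) by blast
    then show ?thesis
      using yr nd[OF y] at0(1,2)[of y] by (auto simp: N_def O1_def Bq_def nondeg_def zc_def)
  qed
  obtain \<epsilon>1 where e1: "\<epsilon>1 > 0" "\<And>t y. y \<in> cbox A B \<Longrightarrow> \<bar>t\<bar> < \<epsilon>1 \<Longrightarrow> (t, y) \<in> N"
  proof -
    \<comment> \<open>A tube around the compact slice t = 0 gives one range of \<open>t\<close> for
      all \<open>y\<close> in the box.\<close>
    have "compact ({0::real} \<times> cbox A B)" "{0} \<times> cbox A B \<subseteq> N" using K0 by (auto intro: compact_Times)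
    then obtain e where e: "e > 0" "(\<Union>x\<in>{0} \<times> cbox A B. ball x e) \<subseteq> N"
      using compact_subset_open_imp_ball_epsilon_subset[OF _ N] by metis
    have "(t, y) \<in> N" if "y \<in> cbox A B" "\<bar>t\<bar> < e" for t y
    proof -
      have "(t, y) \<in> ball (0, y) e" using that by (simp add: dist_Pair_Pair)
      then show ?thesis using e(2) that(1) by blast
    qed
    then show ?thesis using that e(1) by blast
  qed
  obtain b where b: "b > 0" "\<And>y. \<bar>\<phi> y\<bar> \<le> b"
  proof -
    obtain b where b: "b > 0" "\<forall>y\<in>cball 0 a. \<bar>\<phi> y\<bar> \<le> b"
      using compact_imp_bounded[OF compact_continuous_image[OF continuous_on_subset[OF Ck_continuous_on[OF phi(1)[of 0]] subset_UNIV] compact_cball]]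
      unfolding bounded_pos by (metis imageI real_norm_def)
    have "\<bar>\<phi> y\<bar> \<le> b" for y using b phi(2)[of y] by (cases "norm y \<ge> a") auto
    then show ?thesis using that b by blast
  qed
  \<comment> \<open>The second bound limits the displacement to norm 1. The undisplaced graph has
    norm at least 2, so the displaced surface stays in \<open>exterior\<close>.\<close>
  define \<epsilon> where "\<epsilon> = min \<epsilon>1 (1 / (s * b * norm e + 1))"
  have sbe: "s * b * norm e \<ge> 0" using s_pos b by auto
  have eps: "\<epsilon> > 0" "\<epsilon> \<le> \<epsilon>1" using e1 sbe by (auto simp: \<epsilon>_def add_nonneg_pos)
  have small: "norm ((s * t * \<phi> y) *\<^sub>R e) \<le> 1" if "\<bar>t\<bar> < \<epsilon>" for t y
  proof -
    have "norm ((s * t * \<phi> y) *\<^sub>R e) = \<bar>t\<bar> * (s * \<bar>\<phi> y\<bar> * norm e)" using s_pos by (simp add: abs_mult)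
    also have "\<dots> \<le> \<epsilon> * (s * b * norm e)"
      using that s_pos b by (intro mult_mono) (auto intro!: mult_mono mult_nonneg_nonneg)
    also have "\<dots> \<le> (1 / (s * b * norm e + 1)) * (s * b * norm e)" using sbe by (intro mult_right_mono) (auto simp: \<epsilon>_def)
    also have "\<dots> \<le> 1" using sbe by (simp add: divide_le_eq_1)
    finally show ?thesis .
  qed
  define \<Phi> where "\<Phi> t x = (if x \<in> V then \<xi> x + (s * t * \<phi> (f x)) *\<^sub>R e else \<xi> x)" for t x
  have PhiV: "\<Phi> t x = p0 + s *\<^sub>R (G (f x) + (t * \<phi> (f x)) *\<^sub>R e)" if "x \<in> V" for t x
  proof -
    have "f x \<in> ball 0 \<rho>" using f_V that by auto
    then have "\<xi> x = p0 + s *\<^sub>R G (f x)" using xi_G[of "f x"] psi_f[OF that] by simp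
    then show ?thesis using that by (simp add: \<Phi>_def algebra_simps)
  qed
  define Kc where "Kc = \<psi> ` cball 0 a"
  have aB: "cball (0::real^2) a \<subseteq> ball 0 \<rho>" using a by blast
  have Kc: "compact Kc" unfolding Kc_def
    using compact_continuous_image[OF continuous_on_subset[OF psi(1) aB]] by simp
  have PhiK: "\<Phi> t x = \<xi> x" if "x \<notin> Kc" for t x
  proof (cases "x \<in> V")
    case True
    then obtain y where y: "y \<in> ball 0 \<rho>" "x = \<psi> y" by (auto simp: V_def)
    then have "norm y \<ge> a" using that by (force simp: Kc_def)
    then show ?thesis using y phi(2) by (simp add: \<Phi>_def f_psi)
  qed (simp add: \<Phi>_def)
  \<comment> \<open>On \<open>V\<close> the displacement is given by a formula, off the compact set
    \<open>Kc\<close> it vanishes; these two open regions cover the domain.\<close>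
  have smooth: "smooth_on ({-\<epsilon><..<\<epsilon>} \<times> open_pdisk) (\<lambda>(t, x). \<Phi> t x)"
  proof (rule smooth_onI)
    show "open ({-\<epsilon><..<\<epsilon>} \<times> open_pdisk)" by (intro open_Times open_open_pdisk) auto
    fix n
    show "Ck n ({-\<epsilon><..<\<epsilon>} \<times> open_pdisk) (\<lambda>(t, x). \<Phi> t x)"
    proof (rule Ck_local)
      fix w :: "real \<times> (real^2)" assume w: "w \<in> {-\<epsilon><..<\<epsilon>} \<times> open_pdisk"
      show "\<exists>X. open X \<and> w \<in> X \<and> Ck n X (\<lambda>(t, x). \<Phi> t x)"
      proof (cases "snd w \<in> V")
        case True
        have oV: "open ((UNIV :: real set) \<times> V)" by (intro open_Times open_V) auto
        have "Ck n ((UNIV :: real set) \<times> V) (\<lambda>w. \<xi> (snd w) + (s * fst w * \<phi> (f (snd w))) *\<^sub>R e)"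
          by (intro Ck_add Ck_scaleR Ck_mult Ck_const oV Ck_snd_compose[OF open_V] Ck_subset[OF xi_Ck V_sub]
              Ck_compose[OF open_V open_UNIV subset_UNIV f_V_Ck phi(1)] Ck_linear bounded_linear_fst)
        then have "Ck n (UNIV \<times> V) (\<lambda>(t, x). \<Phi> t x)" by (rule Ck_cong[OF oV, rotated]) (auto simp: \<Phi>_def)
        then show ?thesis using oV True by (metis SigmaI UNIV_I prod.collapse)
      next
        case False
        let ?X = "(UNIV :: real set) \<times> (open_pdisk - Kc)"
        have oX: "open (open_pdisk - Kc)" using open_open_pdisk compact_imp_closed[OF Kc] by (rule open_Diff)
        then have oX': "open ?X" by (intro open_Times) auto
        have "Ck n ?X (\<lambda>w. \<xi> (snd w))" by (intro Ck_snd_compose[OF oX] Ck_subset[OF xi_Ck]) auto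
        then have "Ck n ?X (\<lambda>(t, x). \<Phi> t x)" by (rule Ck_cong[OF oX', rotated]) (auto simp: PhiK)
        moreover have "w \<in> ?X" using w False aB by (cases w) (auto simp: Kc_def V_def)
        ultimately show ?thesis using oX' by blast
      qed
    qed
  qed
  have ext: "\<Phi> t x \<in> exterior" if "\<bar>t\<bar> < \<epsilon>" "x \<in> open_pdisk" for t x
  proof (cases "x \<in> V")
    case True
    have fx: "f x \<in> ball 0 \<rho>" using f_V True by auto
    then have "\<xi> x = pos (f x)" using xi_G[of "f x"] psi_f[OF True] by (simp add: pos_def)
    then have "norm (\<xi> x) \<ge> 2" using far[OF fx] by simp
    then have "norm (\<Phi> t x) \<ge> 1" using small[OF that(1), of "f x"] norm_triangle_ineq2[of "\<xi> x" "- ((s * t * \<phi> (f x)) *\<^sub>R e)"] True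
      by (simp add: \<Phi>_def)
    then show ?thesis by (simp add: exterior_def)
  next
    case False
    then show ?thesis using xi_ext that by (auto simp: \<Phi>_def)
  qed
  have cK: "compact (\<psi> ` cbox A B)"
    using compact_continuous_image[OF continuous_on_subset[OF psi(1) a(3)]] by simp
  have KP: "\<psi> ` cbox A B \<subseteq> open_pdisk" using psi(2) a(3) by blast
  \<comment> \<open>The compact set passed to criticality is the image of the whole box, larger than
    the support of the displacement, so that the energy becomes an integral over a box.\<close>
  have d0: "((\<lambda>t. willmore_energy h (\<Phi> t) (\<psi> ` cbox A B)) has_real_derivative 0) (at 0)"
  proof (rule crit[unfolded willmore_critical_def, rule_format, of \<epsilon>], intro conjI ballI)
    show "0 < \<epsilon>" by (rule eps)
    show "compact (\<psi> ` cbox A B)" by (rule cK)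
    show "\<psi> ` cbox A B \<subseteq> open_pdisk" by (rule KP)
    show "smooth_on ({-\<epsilon><..<\<epsilon>} \<times> open_pdisk) (\<lambda>(t, x). \<Phi> t x)" by (rule smooth)
    fix t assume t: "t \<in> {-\<epsilon><..<\<epsilon>}"
    fix x assume x: "x \<in> open_pdisk"
    show "\<Phi> t x \<in> exterior" using ext[OF _ x] t by (auto simp: abs_less_iff)
  next
    fix x show "\<Phi> 0 x = \<xi> x" by (simp add: \<Phi>_def)
  next
    fix t x assume "x \<in> open_pdisk - \<psi> ` cbox A B"
    then have "x \<notin> Kc" using a(2) by (auto simp: Kc_def)
    then show "\<Phi> t x = \<xi> x" by (rule PhiK)
  qed
  have energy: "willmore_energy h (\<Phi> t) (\<psi> ` cbox A B) = integral (cbox A B) (\<lambda>y. F (t, y))" if t: "\<bar>t\<bar> < \<epsilon>" for t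
  proof -
    define g where "g y = G y + (t * \<phi> y) *\<^sub>R e" for y
    have gC: "Ck n (ball 0 \<rho>) g" for n
      unfolding g_def[abs_def] by (intro Ck_add Ck_scaleR Ck_mult Ck_const G_Ck open_ball Ck_subset[OF phi(1)]) auto
    have g1: "pd a g y = pd a G y + (t * pd a \<phi> y) *\<^sub>R e" if "y \<in> ball 0 \<rho>" for a y
    proof -
      have "(g has_derivative (\<lambda>v. frechet G y v + (t * frechet \<phi> y v) *\<^sub>R e)) (at y)"
        unfolding g_def[abs_def]
        by (intro has_derivative_add has_derivative_scaleR_left has_derivative_mult_right Ck_has_derivative[OF G_Ck that] Ck_has_derivative[OF phi(1) UNIV_I])
      then show ?thesis by (rule pd_eqI)
    qed
    have g2: "pd2 b a g y = pd2 b a G y + (t * pd2 b a \<phi> y) *\<^sub>R e" if y: "y \<in> ball 0 \<rho>" for a b y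
    proof -
      have "((\<lambda>z. pd a G z + (t * pd a \<phi> z) *\<^sub>R e) has_derivative
          (\<lambda>v. frechet (\<lambda>z. pd a G z) y v + (t * frechet (\<lambda>z. pd a \<phi> z) y v) *\<^sub>R e)) (at y)"
        by (intro has_derivative_add has_derivative_scaleR_left has_derivative_mult_right
            Ck_has_derivative[OF Ck_pd[OF open_ball G_Ck] y] Ck_has_derivative[OF Ck_pd[OF open_UNIV phi(1)] UNIV_I])
      then have "((\<lambda>z. pd a g z) has_derivative
          (\<lambda>v. frechet (\<lambda>z. pd a G z) y v + (t * frechet (\<lambda>z. pd a \<phi> z) y v) *\<^sub>R e)) (at y)"
        by (rule has_derivative_transform_within_open[OF _ open_ball y]) (simp add: g1)
      then show ?thesis by (rule pd_eqI)
    qed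
    have eqs: "p0 + s *\<^sub>R g y = pt (t, y)" "D1 g y = Pt (t, y)" "Qhat h s (pt (t, y)) g y = Qt (t, y)" if "y \<in> cbox A B" for y
    proof -
      have y: "y \<in> ball 0 \<rho>" using that a(3) by blast
      show "p0 + s *\<^sub>R g y = pt (t, y)" by (simp add: g_def pt_def)
      show P: "D1 g y = Pt (t, y)" by (simp add: D1_def Pt_def g1[OF y])
      show "Qhat h s (pt (t, y)) g y = Qt (t, y)" by (simp add: Qhat_def D2_def Qt_def g2[OF y] P)
    qed
    have inN: "(t, y) \<in> N" if "y \<in> cbox A B" for y using e1(2)[OF that] t eps by simp
    have FF: "dens g y = F (t, y)"
      if "y \<in> cbox A B" for y using eqs[OF that] by (simp add: F_def)
    have "willmore_energy h (\<Phi> t) (\<psi> ` cbox A B) = integral (cbox A B)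
        (\<lambda>y. dens g y)"
    proof (rule energy_as_integral[OF compact_cbox a(3) gC])
      show "\<Phi> t x = p0 + s *\<^sub>R g (f x)" if "x \<in> V" for x using PhiV[OF that] by (simp add: g_def)
      fix y assume y: "y \<in> cbox A B"
      then have yr: "y \<in> ball 0 \<rho>" using a(3) by blast
      have "\<psi> y \<in> V" using yr by (auto simp: V_def)
      then have "\<Phi> t (\<psi> y) = p0 + s *\<^sub>R g y" using PhiV f_psi[OF yr] by (simp add: g_def)
      then show "p0 + s *\<^sub>R g y \<in> exterior" using ext[OF t] \<open>\<psi> y \<in> V\<close> V_sub by (metis subsetD)
      show "(h (p0 + s *\<^sub>R g y), D1 g y) \<in> nondeg"
        using inN[OF y] eqs[OF y] by (auto simp: nondeg_def N_def)
    next
      have "continuous_on (cbox A B) (\<lambda>y. F (t, y))"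
        by (rule continuous_on_compose2[OF Ck_continuous_on[OF FC]]) (auto intro!: continuous_intros inN)
      then show "continuous_on (cbox A B) (\<lambda>y. dens g y)" by (rule continuous_on_eq) (simp add: FF)
    qed
    also have "\<dots> = integral (cbox A B) (\<lambda>y. F (t, y))" by (rule integral_cong) (rule FF)
    finally show ?thesis .
  qed
  define fx where "fx t y = frechet F (t, y) (1, 0)" for t y
  have dF: "(F has_derivative frechet F w) (at w)" if "w \<in> N" for w using Ck_has_derivative[OF FC that] .
  have line: "((\<lambda>t. F (t, y)) has_vector_derivative fx t y) (at t within T)" if "(t, y) \<in> N" for t y T
    using has_vector_derivative_along_line[of F "frechet F (t, y)" "(0, y)" t "(1, 0)" T] dF[OF that]
    by (simp add: fx_def)
  have fxc: "continuous_on N (\<lambda>w. fx (fst w) (snd w))"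
    using Ck_continuous_on[OF Ck_frechet[OF N, of 0 F "(1, 0)"]] FC by (simp add: fx_def)
  have "((\<lambda>t. integral (cbox A B) (\<lambda>y. F (t, y))) has_field_derivative integral (cbox A B) (fx 0)) (at 0 within {-\<epsilon><..<\<epsilon>})"
  proof (rule leibniz_rule_field_derivative)
    fix t y assume t: "t \<in> {-\<epsilon><..<\<epsilon>}" and y: "y \<in> cbox A B"
    then have "(t, y) \<in> N" using e1(2)[OF y, of t] eps by auto
    from line[OF this] show "((\<lambda>t. F (t, y)) has_field_derivative fx t y) (at t within {-\<epsilon><..<\<epsilon>})"
      by (simp add: has_real_derivative_iff_has_vector_derivative)
  next
    fix t assume t: "t \<in> {-\<epsilon><..<\<epsilon>}"
    show "(\<lambda>y. F (t, y)) integrable_on cbox A B"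
      by (intro integrable_continuous continuous_on_compose2[OF Ck_continuous_on[OF FC]])
        (use t eps e1(2) in \<open>auto intro!: continuous_intros\<close>)
  next
    show "continuous_on ({-\<epsilon><..<\<epsilon>} \<times> cbox A B) (\<lambda>(t, y). fx t y)"
    proof -
      have "(t, y) \<in> N" if "t \<in> {-\<epsilon><..<\<epsilon>}" "y \<in> cbox A B" for t y
        using e1(2)[OF that(2), of t] that(1) eps by auto
      then have "{-\<epsilon><..<\<epsilon>} \<times> cbox A B \<subseteq> N" by blast
      from continuous_on_subset[OF fxc this] show ?thesis by (simp add: case_prod_beta')
    qed
  qed (use eps in auto)
  then have "((\<lambda>t. integral (cbox A B) (\<lambda>y. F (t, y))) has_field_derivative integral (cbox A B) (fx 0)) (at 0)"
    using eps by (subst (asm) at_within_open) auto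
  moreover have "((\<lambda>t. integral (cbox A B) (\<lambda>y. F (t, y))) has_real_derivative 0) (at 0)"
    by (rule has_field_derivative_transform_within_open[OF d0, of "{-\<epsilon><..<\<epsilon>}"]) (use energy eps in auto)
  ultimately have I0: "integral (cbox A B) (fx 0) = 0" using DERIV_unique by blast
  have fx0: "fx 0 y = W.dB (zc y) (zv \<phi> e y) (Qc y) (Qc y) + Wform (zc y) (Qv \<phi> e y) (Qc y)
    + Wform (zc y) (Qc y) (Qv \<phi> e y)" if y: "y \<in> cbox A B" for y
  proof -
    have yr: "y \<in> ball 0 \<rho>" using y a(3) by blast
    have pU: "pos y \<in> Uh" using pos_ext[OF yr] Uh(2) by blast
    have dpt: "((\<lambda>t. pt (t, y)) has_derivative (\<lambda>t. t *\<^sub>R ((s * \<phi> y) *\<^sub>R e))) (at 0)"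
      unfolding pt_def by (auto intro!: derivative_eq_intros simp: algebra_simps)
    have dcomp: "((\<lambda>t. k (pt (t, y))) has_vector_derivative frechet k (pos y) ((s * \<phi> y) *\<^sub>R e)) (at 0)"
      if k: "k differentiable at (pos y)" for k :: "real^'m \<Rightarrow> 'x::real_normed_vector"
    proof -
      have K: "(k has_derivative frechet k (pos y)) (at (pt (0, y)))"
        using k unfolding at0(1) frechet_derivative_works .
      interpret K: bounded_linear "frechet k (pos y)" using K by (rule has_derivative_bounded_linear)
      show ?thesis using has_derivative_compose[OF dpt K] unfolding has_vector_derivative_def by (simp only: K.scaleR)
    qed
    have dchr: "(\<lambda>p. chr h p v w) differentiable at (pos y)" for v w
    proof -
      have "Ck 0 Uh (\<lambda>p. chr h p v w)"
        by (rule Ck_chr[OF Uh(1) Ck_id[OF Uh(1)] Ck_const Ck_const _ Uh(1) chC]) auto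
      then show ?thesis using pU by simp
    qed
    have cv: "((\<lambda>t. chr h (pt (t, y)) (Pt (t, y) $ i) (Pt (t, y) $ j)) has_vector_derivative Gv \<phi> e y $ i $ j) (at 0)" for i j
    proof -
      interpret c: bounded_bilinear "chr h p" for p by (rule chr_bilinear)
      define P P' where "P i = pd i G y" and "P' i = pd i \<phi> y *\<^sub>R e" for i
      \<comment> \<open>Bilinearity separates the dependence through the base point from the
        polynomial dependence on \<open>t\<close> through the tangent vectors.\<close>
      have "((\<lambda>t. chr h (pt (t, y)) (P i) (P j) + t *\<^sub>R (chr h (pt (t, y)) (P' i) (P j) + chr h (pt (t, y)) (P i) (P' j)
          + t *\<^sub>R chr h (pt (t, y)) (P' i) (P' j))) has_vector_derivative Gv \<phi> e y $ i $ j) (at 0)"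
        by (rule has_vector_derivative_eq_rhs, (rule has_vector_derivative_add has_vector_derivative_scaleR dcomp dchr DERIV_ident)+)
          (simp add: at0 Gv_def P_def P'_def)
      moreover have "chr h (pt (t, y)) (Pt (t, y) $ i) (Pt (t, y) $ j) = chr h (pt (t, y)) (P i) (P j) + t *\<^sub>R (chr h (pt (t, y)) (P' i) (P j) + chr h (pt (t, y)) (P i) (P' j)
          + t *\<^sub>R chr h (pt (t, y)) (P' i) (P' j))" for t
        by (simp add: Pt_def P_def P'_def c.add_left c.add_right c.scaleR_left c.scaleR_right algebra_simps)
      ultimately show ?thesis by simp
    qed
    have vl: "((\<lambda>t. \<chi> i. k i t) has_vector_derivative (\<chi> i. k' i)) (at 0)" if "\<And>i. (k i has_vector_derivative k' i) (at 0)"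
      for k :: "'i::finite \<Rightarrow> real \<Rightarrow> 'x::real_normed_vector" and k'
      using has_derivative_vec_lambda[of k "\<lambda>i t. t *\<^sub>R k' i" "at 0"] that
      unfolding has_vector_derivative_def by (simp add: scaleR_vec_def)
    have dM: "((\<lambda>t. h (pt (t, y))) has_vector_derivative fst (zv \<phi> e y)) (at 0)"
      unfolding zv_def fst_conv by (rule dcomp) (use Ck_differentiable[OF hC pU] in blast)
    have dP: "((\<lambda>t. Pt (t, y)) has_vector_derivative snd (zv \<phi> e y)) (at 0)"
      unfolding zv_def snd_conv Pt_def by (rule vl) (auto intro!: derivative_eq_intros)
    have dQ: "((\<lambda>t. Qt (t, y)) has_vector_derivative Qv \<phi> e y) (at 0)"
    proof -
      have 1: "((\<lambda>t. \<chi> a b. pd2 a b G y + (t * pd2 a b \<phi> y) *\<^sub>R e) has_vector_derivative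
          (\<chi> a b. pd2 a b \<phi> y *\<^sub>R e)) (at 0)"
        by (rule vl, rule vl) (auto intro!: derivative_eq_intros)
      have "((\<lambda>t. chrP h (pt (t, y)) (Pt (t, y))) has_vector_derivative (\<chi> i j. Gv \<phi> e y $ i $ j)) (at 0)"
        unfolding chrP_def by (rule vl, rule vl, rule cv)
      then have 2: "((\<lambda>t. chrP h (pt (t, y)) (Pt (t, y))) has_vector_derivative Gv \<phi> e y) (at 0)" by simp
      show ?thesis unfolding Qt_def Qv_def fst_conv snd_conv
        by (rule has_vector_derivative_add[OF 1 bounded_linear.has_vector_derivative[OF bounded_linear_scaleR_right 2]])
    qed
    have curve: "((\<lambda>t. ((h (pt (t, y)), Pt (t, y)), Qt (t, y), Qt (t, y))) has_vector_derivative
        (zv \<phi> e y, Qv \<phi> e y, Qv \<phi> e y)) (at 0)"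
      using has_vector_derivative_Pair[OF has_vector_derivative_Pair[OF dM dP] has_vector_derivative_Pair[OF dQ dQ]] by simp
    have ndz: "(h (pt (0, y)), Pt (0, y)) \<in> nondeg" using nd[OF y] at0(2) by simp
    have zc': "zc y = (h (pos y), Pt (0, y))" using at0(1,2)[of y] by simp
    have "((\<lambda>t. F (t, y)) has_vector_derivative
        (W.dB (zc y) (zv \<phi> e y) (Qc y) (Qc y) + Wform (zc y) (Qv \<phi> e y) (Qc y) + Wform (zc y) (Qc y) (Qv \<phi> e y))) (at 0)"
      using vector_derivative_diff_chain_within[OF curve has_derivative_at_withinI[OF W.has_derivative_B[OF ndz]]]
      by (simp add: o_def F_def at0(1,3) zc')
    moreover have "((\<lambda>t. F (t, y)) has_vector_derivative fx 0 y) (at 0)" using line[OF K0[OF y]] .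
    ultimately show ?thesis using vector_derivative_unique_at by blast
  qed
  have "continuous_on (cbox A B) (\<lambda>y. fx (fst (0, y)) (snd (0::real, y)))"
    by (rule continuous_on_compose2[OF fxc]) (use K0 in \<open>auto intro!: continuous_on_Pair continuous_on_const continuous_on_id\<close>)
  then have "continuous_on (cbox A B) (fx 0)" by simp
  then have "(fx 0 has_integral 0) (cbox A B)"
    using I0 integrable_integral[OF integrable_continuous] by metis
  then show ?thesis by (rule has_integral_eq[rotated]) (simp add: fx0)
qed

end

section \<open>Compactness of the normalized data and the leading term of the variation\<close>

definition normalized :: "((real^'m^'m) \<times> (real^'m^2)) set" where
  "normalized = {(M, P). norm (M - mat 1) \<le> 1/4 \<and> gram M P = mat 1}"

lemma normalized_norm_P:
  assumes "(M, P) \<in> normalized"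
  shows "norm (P $ i) \<le> 2" "norm P \<le> 4"
proof -
  have 1: "norm (P $ i) \<le> 2" for i
  proof -
    have "ipM M (P $ i) (P $ i) = 1"
      using assms by (simp add: normalized_def gram_def vec_eq_iff mat_def)
    then have "\<bar>1 - (norm (P $ i))\<^sup>2\<bar> \<le> 1/4 * norm (P $ i) * norm (P $ i)"
      using ipM_near_id[of M "1/4" "P $ i" "P $ i"] assms by (simp add: normalized_def dot_square_norm)
    then have "(norm (P $ i))\<^sup>2 - 1 \<le> 1/4 * norm (P $ i) * norm (P $ i)" by linarith
    then have "(norm (P $ i))\<^sup>2 \<le> 2\<^sup>2" by (simp add: power2_eq_square)
    then show ?thesis by (rule power2_le_imp_le) simp
  qed
  then show "norm (P $ i) \<le> 2" .
  have "norm P \<le> (\<Sum>i\<in>UNIV. norm (P $ i))" unfolding norm_vec_def[of P] by (rule L2_set_le_sum) auto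
  also have "\<dots> \<le> 4" unfolding sum_2 using 1[of 1] 1[of 2] by simp
  finally show "norm P \<le> 4" .
qed

text \<open>Orthonormality bounds the frames, so the normalized data form a compact set inside the
  open set \<open>nondeg\<close> and have a neighbourhood of uniform size. Later constants are taken
  from this neighbourhood, which is the same for every surface and every point.\<close>

lemma normalized_neighbourhood:
  "\<exists>Z \<kappa>. compact Z \<and> Z \<subseteq> (nondeg :: ((real^'m^'m) \<times> (real^'m^2)) set) \<and> 0 < \<kappa> \<and> \<kappa> \<le> 1 \<and>
    (\<forall>z\<in>normalized. cball z \<kappa> \<subseteq> Z)"
proof -
  let ?N = "normalized :: ((real^'m^'m) \<times> (real^'m^2)) set"
  have sub: "?N \<subseteq> nondeg" by (auto simp: normalized_def nondeg_def)
  have bd: "bounded ?N"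
  proof (rule boundedI)
    fix z :: "(real^'m^'m) \<times> (real^'m^2)" assume z: "z \<in> ?N"
    obtain M P where MP: "z = (M, P)" by (cases z)
    have "norm M \<le> norm (mat 1 :: real^'m^'m) + 1/4"
      using z norm_triangle_sub[of M "mat 1"] by (simp add: MP normalized_def)
    moreover have "norm P \<le> 4" using normalized_norm_P(2) z MP by blast
    ultimately show "norm z \<le> norm (mat 1 :: real^'m^'m) + 1/4 + 4"
      using norm_Pair_le[of M P] unfolding MP by linarith
  qed
  have c: "continuous_on UNIV (\<lambda>z :: (real^'m^'m) \<times> (real^'m^2). gram (fst z) (snd z))"
    by (rule Ck_continuous_on[of 0]) (intro Ck_gram Ck_fst Ck_snd Ck_id open_UNIV)
  have "closed {z :: (real^'m^'m) \<times> (real^'m^2). norm (fst z - mat 1) \<le> 1/4 \<and> gram (fst z) (snd z) = mat 1}"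
    by (intro closed_Collect_conj closed_Collect_le closed_Collect_eq c continuous_intros)
  then have "closed ?N" by (simp add: normalized_def case_prod_beta')
  with bd have cN: "compact ?N" by (simp add: compact_eq_bounded_closed)
  obtain e where e: "e > 0" "(\<Union>x\<in>?N. cball x e) \<subseteq> nondeg"
    using compact_subset_open_imp_cball_epsilon_subset[OF cN open_nondeg sub] by metis
  define \<kappa> where "\<kappa> = min e 1"
  define Z where "Z = {x + y | x y. x \<in> ?N \<and> y \<in> cball 0 \<kappa>}"
  have "compact Z" unfolding Z_def by (rule compact_sums[OF cN compact_cball])
  moreover have "Z \<subseteq> nondeg"
  proof
    fix z assume "z \<in> Z"
    then obtain x y where "x \<in> ?N" "norm y \<le> e" "z = x + y" by (auto simp: Z_def \<kappa>_def)
    then have "z \<in> cball x e" by (simp add: dist_norm)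
    then show "z \<in> nondeg" using e(2) \<open>x \<in> ?N\<close> by blast
  qed
  moreover have "cball z \<kappa> \<subseteq> Z" if "z \<in> ?N" for z
  proof
    fix w assume "w \<in> cball z \<kappa>"
    then have "w - z \<in> cball 0 \<kappa>" by (simp add: dist_norm norm_minus_commute)
    moreover have "w = z + (w - z)" by simp
    ultimately show "w \<in> Z" unfolding Z_def using that by blast
  qed
  ultimately show ?thesis using e(1) by (intro exI[of _ Z] exI[of _ \<kappa>]) (auto simp: \<kappa>_def)
qed

lemma matrix_inv_mat_1: "matrix_inv (mat 1) = (mat 1 :: real^'n^'n)"
  by (rule matrix_inv_unique) simp

lemma nproj_normalized:
  assumes "gram M P = mat 1"
  shows "nproj M P v = v - (\<Sum>i\<in>UNIV. ipM M v (P $ i) *\<^sub>R P $ i)"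
  unfolding nproj_def assms matrix_inv_mat_1 by (simp add: mat_def sum_2)

text \<open>For an orthonormal frame and a normal vector \<open>e\<close>, pairing with multiples of
  \<open>e\<close> sees only traces. With \<open>c\<close> the Hessian of the test function this
  produces \<Delta>\<phi>, the origin of the bi-Laplacian.\<close>

lemma Wform_normalized:
  assumes g: "gram M P = mat 1" and M: "transpose M = M" and e: "\<And>i. ipM M e (P $ i) = 0"
    and Y: "\<And>a b. Y $ a $ b = c a b *\<^sub>R e"
  shows "Wform (M, P) X Y = 1/4 * ipM M (\<Sum>a\<in>UNIV. X $ a $ a) e * (\<Sum>a\<in>UNIV. c a a)"
    and "Wform (M, P) Y X = 1/4 * ipM M (\<Sum>a\<in>UNIV. X $ a $ a) e * (\<Sum>a\<in>UNIV. c a a)"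
proof -
  have np: "nproj M P (c *\<^sub>R e) = c *\<^sub>R e" for c by (simp add: nproj_normalized[OF g] ipM_simps e)
  have H: "Hvec M P X = (1/2) *\<^sub>R (\<Sum>a\<in>UNIV. nproj M P (X $ a $ a))" for X
    unfolding Hvec_def g matrix_inv_mat_1 by (simp add: mat_def sum_2)
  have ipn: "ipM M (nproj M P v) e = ipM M v e" for v
    by (simp add: nproj_normalized[OF g] ipM_simps sum_2 ipM_commute[OF M, of "P $ _" e] e)
  show 1: "Wform (M, P) X Y = 1/4 * ipM M (\<Sum>a\<in>UNIV. X $ a $ a) e * (\<Sum>a\<in>UNIV. c a a)"
    unfolding Wform_def prod.case H Y np by (simp add: g sum_2 ipM_simps ipn algebra_simps add_divide_distrib)
  have "Wform (M, P) Y X = Wform (M, P) X Y" by (simp add: Wform_def ipM_commute[OF M])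
  with 1 show "Wform (M, P) Y X = 1/4 * ipM M (\<Sum>a\<in>UNIV. X $ a $ a) e * (\<Sum>a\<in>UNIV. c a a)" by simp
qed

lemma norm_vec2_le: "norm (v :: 'a::real_normed_vector^2) \<le> norm (v $ 1) + norm (v $ 2)"
  using L2_set_le_sum[of UNIV "\<lambda>i. norm (v $ i)"] by (simp add: norm_vec_def sum_2)

lemma norm_vec22_le:
  assumes "\<And>a b. norm ((v :: 'a::real_normed_vector^2^2) $ a $ b) \<le> c"
  shows "norm v \<le> 4 * c"
proof -
  have "norm (v $ a) \<le> 2 * c" for a using norm_vec2_le[of "v $ a"] assms[of a 1] assms[of a 2] by linarith
  then show ?thesis using norm_vec2_le[of v] by (smt (verit))
qed

lemma norm_entry22: "norm ((v :: 'a::real_normed_vector^2^2) $ a $ b) \<le> norm v"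
  using Finite_Cartesian_Product.norm_nth_le[of v a] Finite_Cartesian_Product.norm_nth_le[of "v $ a" b] by linarith

section \<open>Freezing the coefficients at the centre\<close>

context graph_patch
begin

text \<open>Each derivative of the metric carries one factor \<open>s\<close>, and a Christoffel
  symbol counts as one derivative: these are the sizes seen at unit scale.\<close>

definition metric_small where
  "metric_small \<eta> \<longleftrightarrow> 0 \<le> \<eta> \<and> \<eta> \<le> 1 \<and> (\<forall>y\<in>ball 0 \<rho>.
    (\<forall>v. s * norm (frechet h (pos y) v) \<le> \<eta> * norm v) \<and>
    (\<forall>v w. s * norm (chr h (pos y) v w) \<le> \<eta> * norm v * norm w) \<and>
    (\<forall>u v w. s\<^sup>2 * norm (frechet (\<lambda>p. chr h p v w) (pos y) u) \<le> \<eta> * norm u * norm v * norm w))"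

lemma G_derivative:
  assumes "y \<in> ball 0 \<rho>"
  shows "(G has_derivative (\<lambda>v. \<Sum>a\<in>UNIV. v $ a *\<^sub>R D1 G y $ a)) (at y)"
proof -
  have eq: "frechet G y = (\<lambda>v. \<Sum>a\<in>UNIV. v $ a *\<^sub>R D1 G y $ a)" unfolding D1_def vec_lambda_beta
    by (rule ext) (rule has_derivative_pd_sum[OF Ck_differentiable[OF G_Ck assms]])
  show ?thesis using Ck_has_derivative[OF G_Ck assms] unfolding eq .
qed

lemma pos_derivative: "y \<in> ball 0 \<rho> \<Longrightarrow> (pos has_derivative (\<lambda>v. s *\<^sub>R (\<Sum>a\<in>UNIV. v $ a *\<^sub>R D1 G y $ a))) (at y)"
  unfolding pos_def[abs_def]
  using has_derivative_add[OF has_derivative_const has_derivative_scaleR_right[OF G_derivative], of y p0 s] by simp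

lemma norm_combination: "norm (\<Sum>a\<in>UNIV. v $ a *\<^sub>R (P :: real^'m^2) $ a) \<le> 2 * norm P * norm (v :: real^2)"
proof -
  have "norm (\<Sum>a\<in>UNIV. v $ a *\<^sub>R P $ a) \<le> (\<Sum>a\<in>UNIV. norm (v $ a *\<^sub>R P $ a))" by (rule norm_sum)
  also have "\<dots> \<le> (\<Sum>a\<in>(UNIV::2 set). norm v * norm P)"
    by (intro sum_mono) (auto intro!: mult_mono simp: component_le_norm_cart Finite_Cartesian_Product.norm_nth_le)
  finally show ?thesis by (simp add: ac_simps)
qed

text \<open>The derivative of \<open>pos\<close> is \<open>s\<close> times that of \<open>G\<close>,
  so the scaled bound on the derivative of \<open>k\<close> is the natural hypothesis.\<close>

lemma pos_compose_bound:
  fixes k :: "real^'m \<Rightarrow> 'x::real_normed_vector"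
  assumes S: "convex S" "S \<subseteq> ball 0 \<rho>" "0 \<in> S" "y \<in> S"
    and P: "\<And>z. z \<in> S \<Longrightarrow> norm (D1 G z) \<le> B"
    and k: "\<And>z. z \<in> S \<Longrightarrow> k differentiable at (pos z)"
      "\<And>z v. z \<in> S \<Longrightarrow> s * norm (frechet k (pos z) v) \<le> c * norm v" and c: "c \<ge> 0"
  shows "norm (k (pos y) - k (pos 0)) \<le> 2 * c * B * norm y"
proof -
  have "norm (k (pos y) - k (pos 0)) \<le> (c * (2 * B)) * norm (y - 0)"
  proof (rule differentiable_bound[OF S(1)])
    fix z assume z: "z \<in> S"
    then have zb: "z \<in> ball 0 \<rho>" using S(2) by blast
    let ?D = "\<lambda>v. frechet k (pos z) (s *\<^sub>R (\<Sum>a\<in>UNIV. v $ a *\<^sub>R D1 G z $ a))"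
    show "((\<lambda>y. k (pos y)) has_derivative ?D) (at z within S)"
      by (rule has_derivative_at_withinI[OF has_derivative_compose[OF pos_derivative[OF zb] frechet_derivative_works[THEN iffD1, OF k(1)[OF z]]]])
    show "onorm ?D \<le> c * (2 * B)"
    proof (rule onorm_le)
      fix v :: "real^2"
      interpret linear "frechet k (pos z)" by (rule linear_frechet_derivative[OF k(1)[OF z]])
      have "norm (?D v) = s * norm (frechet k (pos z) (\<Sum>a\<in>UNIV. v $ a *\<^sub>R D1 G z $ a))"
        using s_pos by (simp add: scaleR)
      also have "\<dots> \<le> c * norm (\<Sum>a\<in>UNIV. v $ a *\<^sub>R D1 G z $ a)" by (rule k(2)[OF z])
      also have "\<dots> \<le> c * (2 * norm (D1 G z) * norm v)" by (intro mult_left_mono norm_combination c)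
      also have "\<dots> \<le> c * (2 * B * norm v)" using P[OF z] c by (intro mult_left_mono mult_right_mono) auto
      finally show "norm (?D v) \<le> c * (2 * B) * norm v" by (simp add: ac_simps)
    qed
  qed (use S in auto)
  then show ?thesis by (simp add: ac_simps)
qed

lemma D1_lipschitz:
  assumes S: "convex S" "S \<subseteq> ball 0 \<rho>" "0 \<in> S" "y \<in> S" and C1: "\<And>z. z \<in> S \<Longrightarrow> norm (D2 G z) \<le> C1"
  shows "norm (D1 G y - D1 G 0) \<le> 4 * C1 * norm y"
proof -
  have "norm (pd a G y - pd a G 0) \<le> (2 * C1) * norm (y - 0)" for a
  proof (rule differentiable_bound[OF S(1)])
    fix z assume z: "z \<in> S"
    then have zb: "z \<in> ball 0 \<rho>" using S(2) by blast
    let ?D = "frechet (\<lambda>z. pd a G z) z"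
    have d: "Ck 0 (ball 0 \<rho>) (\<lambda>z. pd a G z)" by (rule Ck_pd[OF open_ball G_Ck])
    show "((\<lambda>z. pd a G z) has_derivative ?D) (at z within S)"
      by (rule has_derivative_at_withinI[OF Ck_has_derivative[OF d zb]])
    show "onorm ?D \<le> 2 * C1"
    proof (rule onorm_le)
      fix v :: "real^2"
      have "norm (?D v) \<le> (\<Sum>b\<in>UNIV. norm (v $ b *\<^sub>R pd2 b a G z))"
        unfolding has_derivative_pd_sum[OF Ck_differentiable[OF d zb], of v] by (rule norm_sum)
      also have "\<dots> \<le> (\<Sum>b\<in>(UNIV::2 set). norm v * C1)"
      proof (rule sum_mono)
        fix b
        have "norm (pd2 b a G z) \<le> C1" using norm_entry22[of "D2 G z" b a] C1[OF z] by (simp add: D2_def)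
        then show "norm (v $ b *\<^sub>R pd2 b a G z) \<le> norm v * C1"
          unfolding norm_scaleR by (intro mult_mono) (auto simp: component_le_norm_cart)
      qed
      finally show "norm (?D v) \<le> 2 * C1 * norm v" by (simp add: ac_simps)
    qed
  qed (use S in auto)
  then have "norm ((D1 G y - D1 G 0) $ a) \<le> 2 * C1 * norm y" for a by (simp add: D1_def)
  from this[of 1] this[of 2] show ?thesis using norm_vec2_le[of "D1 G y - D1 G 0"] by linarith
qed

lemma christoffel_differentiable:
  assumes "p \<in> exterior" shows "(\<lambda>p. chr h p v w) differentiable at p" and "h differentiable at p"
proof -
  obtain Uh where Uh: "open Uh" "exterior \<subseteq> Uh" and hC: "\<And>n. Ck n Uh h"
    and chC: "\<And>n \<gamma> \<alpha> \<beta>. Ck n Uh (\<lambda>p. christoffel h p \<gamma> \<alpha> \<beta>)"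
    using riemannian_metric_Ck[OF riem] by metis
  have "Ck 0 Uh (\<lambda>p. chr h p v w)"
    by (rule Ck_chr[OF Uh(1) Ck_id[OF Uh(1)] Ck_const Ck_const _ Uh(1) chC]) auto
  then show "(\<lambda>p. chr h p v w) differentiable at p" using assms Uh by auto
  show "h differentiable at p" using Ck_differentiable[OF hC] assms Uh by blast
qed

definition Gam where "Gam y = s *\<^sub>R chrP h (pos y) (D1 G y)"

lemma Qc_split: "Qc y = D2 G y + Gam y"
  by (simp add: Qc_def Qhat_def Gam_def)

text \<open>With first derivatives bounded by 5, each of the four Christoffel entries is at most 25
  \<eta>. Differences from the centre gain the factor |y|, and those of the Christoffel part keep
  the factor \<eta> as well.\<close>

lemma patch_bounds:
  assumes S: "convex S" "S \<subseteq> ball 0 \<rho>" "0 \<in> S" "y \<in> S" and C1: "\<And>z. z \<in> S \<Longrightarrow> norm (D2 G z) \<le> C1"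
    and P: "\<And>z. z \<in> S \<Longrightarrow> norm (D1 G z) \<le> 5"
    and ms: "metric_small \<eta>" and ext: "\<And>z. z \<in> S \<Longrightarrow> pos z \<in> exterior"
  shows "norm (Gam y) \<le> 100 * \<eta>"
    and "norm (zc y - zc 0) \<le> (4 * C1 + 10 * \<eta>) * norm y"
    and "norm (Gam y - Gam 0) \<le> (1000 + 160 * C1) * \<eta> * norm y"
proof -
  have eta: "0 \<le> \<eta>" "\<eta> \<le> 1" and
    m1: "\<And>z v. z \<in> ball 0 \<rho> \<Longrightarrow> s * norm (frechet h (pos z) v) \<le> \<eta> * norm v" and
    m2: "\<And>z v w. z \<in> ball 0 \<rho> \<Longrightarrow> s * norm (chr h (pos z) v w) \<le> \<eta> * norm v * norm w" and
    m3: "\<And>z u v w. z \<in> ball 0 \<rho> \<Longrightarrow> s\<^sup>2 * norm (frechet (\<lambda>p. chr h p v w) (pos z) u) \<le> \<eta> * norm u * norm v * norm w"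
    using ms by (auto simp: metric_small_def)
  have zb: "0 \<in> ball (0::real^2) \<rho>" using S by auto
  have Pa: "norm (D1 G z $ a) \<le> 5" if "z \<in> S" for z a
    using P[OF that] Finite_Cartesian_Product.norm_nth_le[of "D1 G z" a] by linarith
  have chrb: "s * norm (chr h (pos z) v w) \<le> \<eta> * (b * c)" if "z \<in> S" "norm v \<le> b" "norm w \<le> c" for z v w b c
  proof -
    have "s * norm (chr h (pos z) v w) \<le> \<eta> * norm v * norm w" using m2 S(2) that by blast
    also have "\<dots> = \<eta> * (norm v * norm w)" by simp
    also have "\<dots> \<le> \<eta> * (b * c)" using that eta by (intro mult_left_mono mult_mono) (auto intro: order_trans[OF norm_ge_zero])
    finally show ?thesis .
  qed
  have "norm (Gam y) \<le> 4 * (\<eta> * (5 * 5))" unfolding Gam_def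
    by (rule norm_vec22_le) (use chrb[OF S(4) Pa[OF S(4)] Pa[OF S(4)]] s_pos in \<open>simp add: chrP_def\<close>)
  then show "norm (Gam y) \<le> 100 * \<eta>" by simp
  have D1l: "norm (D1 G y - D1 G 0) \<le> 4 * C1 * norm y" by (rule D1_lipschitz[OF S C1])
  have "norm (h (pos y) - h (pos 0)) \<le> 2 * \<eta> * 5 * norm y"
    by (rule pos_compose_bound[OF S P]) (use S ext m1 eta christoffel_differentiable(2) in auto)
  then show "norm (zc y - zc 0) \<le> (4 * C1 + 10 * \<eta>) * norm y"
    using norm_Pair_le[of "h (pos y) - h (pos 0)" "D1 G y - D1 G 0"] D1l
    by (simp add: zc_def algebra_simps)
  have "norm ((Gam y - Gam 0) $ a $ b) \<le> (250 + 40 * C1) * \<eta> * norm y" for a b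
  proof -
    interpret c: bounded_bilinear "chr h (pos 0)" by (rule chr_bilinear)
    define v where "v = D1 G y $ a"
    define w where "w = D1 G y $ b"
    define v0 where "v0 = D1 G 0 $ a"
    define w0 where "w0 = D1 G 0 $ b"
    have n5: "norm v \<le> 5" "norm w \<le> 5" "norm v0 \<le> 5" unfolding v_def w_def v0_def by (rule Pa S)+
    have dv: "norm (v - v0) \<le> 4 * C1 * norm y" "norm (w - w0) \<le> 4 * C1 * norm y"
      using D1l Finite_Cartesian_Product.norm_nth_le[of "D1 G y - D1 G 0" a]
        Finite_Cartesian_Product.norm_nth_le[of "D1 G y - D1 G 0" b] by (auto simp: v_def w_def v0_def w0_def)
    have "norm (s *\<^sub>R chr h (pos y) v w - s *\<^sub>R chr h (pos 0) v w) \<le> 2 * (\<eta> * 5 * 5) * 5 * norm y"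
    proof (rule pos_compose_bound[OF S P, where k = "\<lambda>p. s *\<^sub>R chr h p v w"])
      fix z assume z: "z \<in> S"
      then have zb: "z \<in> ball 0 \<rho>" using S(2) by blast
      have d: "(\<lambda>p. chr h p v w) differentiable at (pos z)" by (rule christoffel_differentiable(1)[OF ext[OF z]])
      show "(\<lambda>p. s *\<^sub>R chr h p v w) differentiable at (pos z)" using d by simp
      fix u
      have "frechet (\<lambda>p. s *\<^sub>R chr h p v w) (pos z) u = s *\<^sub>R frechet (\<lambda>p. chr h p v w) (pos z) u"
        by (rule frechet_bounded_linear[OF bounded_linear_scaleR_right d])
      then have "s * norm (frechet (\<lambda>p. s *\<^sub>R chr h p v w) (pos z) u) = s\<^sup>2 * norm (frechet (\<lambda>p. chr h p v w) (pos z) u)"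
        using s_pos by (simp add: power2_eq_square)
      also have "\<dots> \<le> \<eta> * norm u * norm v * norm w" by (rule m3[OF zb])
      also have "\<dots> \<le> \<eta> * norm u * 5 * 5" using eta n5 by (intro mult_mono) auto
      finally show "s * norm (frechet (\<lambda>p. s *\<^sub>R chr h p v w) (pos z) u) \<le> \<eta> * 5 * 5 * norm u" by (simp add: ac_simps)
    qed (use eta in auto)
    moreover have "norm (s *\<^sub>R chr h (pos 0) (v - v0) w) \<le> \<eta> * (4 * C1 * norm y * 5)"
      using chrb[OF S(3) dv(1) n5(2)] s_pos by simp
    moreover have "norm (s *\<^sub>R chr h (pos 0) v0 (w - w0)) \<le> \<eta> * (5 * (4 * C1 * norm y))"
      using chrb[OF S(3) n5(3) dv(2)] s_pos by simp
    moreover have "(Gam y - Gam 0) $ a $ b = (s *\<^sub>R chr h (pos y) v w - s *\<^sub>R chr h (pos 0) v w)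
        + s *\<^sub>R chr h (pos 0) (v - v0) w + s *\<^sub>R chr h (pos 0) v0 (w - w0)"
      by (simp add: Gam_def chrP_def v_def w_def v0_def w0_def c.diff_left c.diff_right algebra_simps)
    ultimately have "norm ((Gam y - Gam 0) $ a $ b) \<le> 2 * (\<eta> * 5 * 5) * 5 * norm y + \<eta> * (4 * C1 * norm y * 5) + \<eta> * (5 * (4 * C1 * norm y))"
      by (simp only:) (intro order_trans[OF norm_triangle_ineq] add_mono)
    then show ?thesis by (simp add: algebra_simps)
  qed
  from norm_vec22_le[of "Gam y - Gam 0", OF this] show "norm (Gam y - Gam 0) \<le> (1000 + 160 * C1) * \<eta> * norm y"
    by (simp add: algebra_simps)
qed

end

lemma bounded_linear_ipM_left: "bounded_linear (\<lambda>v. ipM M v e)"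
proof (rule linear_conv_bounded_linear[THEN iffD1])
  show "linear (\<lambda>v. ipM M v e)" by (simp add: linear_iff ipM_simps)
qed

lemma norm_triangle3: "norm (a + b + c) \<le> norm a + norm b + norm c"
  using norm_triangle_ineq[of "a + b" c] norm_triangle_ineq[of a b] by linarith

lemma norm_vec22_const: "norm (\<chi> a b. c a b *\<^sub>R (e :: real^'m) :: real^'m^2^2) \<le> 4 * (m * k)"
  if "\<And>a b. \<bar>c a b\<bar> \<le> m" "norm e \<le> k"
proof (rule norm_vec22_le)
  have "0 \<le> m" using that(1)[of 1 1] by linarith
  then show "norm ((\<chi> a b. c a b *\<^sub>R e :: real^'m^2^2) $ a $ b) \<le> m * k" for a b
    using that by (auto intro!: mult_mono)
qed

context graph_patch
begin

lemma pd_component: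
  assumes "y \<in> ball 0 \<rho>"
  shows "pd b (\<lambda>z. ipM M (G z) e) y = ipM M (pd b G y) e"
    and "pd a (\<lambda>z. pd b (\<lambda>z. ipM M (G z) e) z) y = ipM M (D2 G y $ a $ b) e"
proof -
  have 1: "pd b (\<lambda>z. ipM M (G z) e) y = ipM M (pd b G y) e" if "y \<in> ball 0 \<rho>" for y
    by (rule frechet_bounded_linear[OF bounded_linear_ipM_left Ck_differentiable[OF G_Ck that]])
  then show "pd b (\<lambda>z. ipM M (G z) e) y = ipM M (pd b G y) e" using assms .
  have d: "(\<lambda>z. pd b G z) differentiable at y" by (rule Ck_differentiable[OF Ck_pd[OF open_ball G_Ck] assms])
  have "pd a (\<lambda>z. ipM M (pd b G z) e) y = ipM M (pd2 a b G y) e"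
    by (rule frechet_bounded_linear[OF bounded_linear_ipM_left d])
  moreover have "pd a (\<lambda>z. ipM M (pd b G z) e) y = pd a (\<lambda>z. pd b (\<lambda>z. ipM M (G z) e) z) y"
  proof (rule pd_cong_open[OF open_ball assms])
    show "(\<lambda>z. ipM M (pd b G z) e) differentiable at y"
      using bounded_linear.has_derivative[OF bounded_linear_ipM_left d[unfolded frechet_derivative_works]]
      by (rule differentiableI)
  qed (simp add: 1)
  ultimately show "pd a (\<lambda>z. pd b (\<lambda>z. ipM M (G z) e) z) y = ipM M (D2 G y $ a $ b) e"
    by (simp add: D2_def)
qed

text \<open>Freezing the coefficients at the centre turns the first variation into the weak form of
  the bi-Laplace equation, with errors gaining a factor \<open>|y|\<close> at each singular term.\<close>

lemma weak_biharmonic_estimate: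
  fixes \<phi> :: "real^2 \<Rightarrow> real" and e :: "real^'m"
  assumes crit: "willmore_critical h \<xi>"
    and a: "a > 0" "cball 0 a \<subseteq> cbox A B" "cbox A B \<subseteq> ball 0 \<rho>" "cbox A B \<subseteq> cball 0 1"
    and phi: "\<And>n. Ck n UNIV \<phi>" "\<And>y. norm y \<ge> a \<Longrightarrow> \<phi> y = 0"
    and phiM: "\<And>y. y \<in> cbox A B \<Longrightarrow> y \<noteq> 0 \<Longrightarrow> \<bar>\<phi> y\<bar> \<le> M / norm y"
      "\<And>y k. y \<in> cbox A B \<Longrightarrow> y \<noteq> 0 \<Longrightarrow> \<bar>pd k \<phi> y\<bar> \<le> M / norm y"
      "\<And>y k l. y \<in> cbox A B \<Longrightarrow> y \<noteq> 0 \<Longrightarrow> \<bar>pd2 k l \<phi> y\<bar> \<le> M / (norm y)\<^sup>2"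
    and far: "\<And>y. y \<in> ball 0 \<rho> \<Longrightarrow> norm (pos y) \<ge> 2"
    and G0: "G 0 = 0" and norm0: "(h p0, D1 G 0) \<in> normalized"
    and e: "\<And>i. ipM (h p0) e (D1 G 0 $ i) = 0" "norm e \<le> 2"
    and C1: "\<And>y. y \<in> cbox A B \<Longrightarrow> norm (D2 G y) \<le> C1"
    and P5: "\<And>y. y \<in> cbox A B \<Longrightarrow> norm (D1 G y) \<le> 5"
    and ms: "metric_small \<eta>"
    and Z: "Z \<subseteq> nondeg" "\<And>y. y \<in> cbox A B \<Longrightarrow> closed_segment (zc 0) (zc y) \<subseteq> Z"
    and L: "L > 0" "\<And>z q r. z \<in> Z \<Longrightarrow> \<bar>Wform z q r\<bar> \<le> L * norm q * norm r"
      "\<And>z z' q r. z \<in> Z \<Longrightarrow> \<bar>W.dB z z' q r\<bar> \<le> L * norm z' * norm q * norm r"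
      "\<And>z0 z q r. closed_segment z0 z \<subseteq> Z \<Longrightarrow> \<bar>Wform z q r - Wform z0 q r\<bar> \<le> L * norm (z - z0) * norm q * norm r"
  shows "\<bar>integral (cbox A B) (\<lambda>y. laplace (\<lambda>z. ipM (h p0) (G z) e) y * laplace \<phi> y)\<bar> \<le>
    M * (2 * (L * (100000 * (C1 + 100))) * hessian_potential (cbox A B) \<eta> G)"
proof -
  define X where "X = cbox A B"
  define M0 where "M0 = h p0"
  define w where "w z = ipM M0 (G z) e" for z
  have X: "convex X" "X \<subseteq> ball 0 \<rho>" "0 \<in> X" using a by (auto simp: X_def)
  have eta: "0 \<le> \<eta>" "\<eta> \<le> 1" using ms by (auto simp: metric_small_def)
  have ext: "pos y \<in> exterior" if "y \<in> ball 0 \<rho>" for y using far[OF that] by (auto simp: exterior_def)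
  have pos0: "pos 0 = p0" by (simp add: pos_def G0)
  have "p0 \<in> exterior" using ext[of 0] X pos0 by auto
  then have sym0: "transpose M0 = M0" unfolding M0_def by (rule riemannian_symmetric[OF riem])
  have z0: "zc 0 = (M0, D1 G 0)" by (simp add: zc_def pos0 M0_def)
  have g0: "gram M0 (D1 G 0) = mat 1" using norm0 by (simp add: normalized_def M0_def)
  have zZ: "zc y \<in> Z" if "y \<in> X" for y using Z(2) that by (auto simp: X_def)
  have C1': "C1 \<ge> 0" using C1[of 0] X norm_ge_zero order_trans by (metis X_def)
  define Phe where "Phe y = (\<chi> a b. pd2 a b \<phi> y *\<^sub>R e)" for y
  define I where "I y = W.dB (zc y) (zv \<phi> e y) (Qc y) (Qc y) + Wform (zc y) (Qv \<phi> e y) (Qc y)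
    + Wform (zc y) (Qc y) (Qv \<phi> e y)" for y
  have I0: "(I has_integral 0) X"
    unfolding I_def X_def by (rule first_variation[OF crit a(1-3) phi far]) (use zZ Z(1) in \<open>auto simp: X_def\<close>)
  \<comment> \<open>The Christoffel term frozen at the centre gains no factor |y|. It enters as a
    constant times \<Delta>\<phi>, whose integral vanishes because \<phi> has compact
    support.\<close>
  define c0 where "c0 = ipM M0 (\<Sum>a\<in>UNIV. Gam 0 $ a $ a) e"
  have lapw: "laplace w y = ipM M0 (\<Sum>a\<in>UNIV. D2 G y $ a $ a) e" if "y \<in> X" for y
  proof -
    have "y \<in> ball 0 \<rho>" using that X by blast
    then show ?thesis unfolding laplace_def w_def[abs_def] pd_component(2)[OF \<open>y \<in> ball 0 \<rho>\<close>]
      by (simp add: sum_2 ipM_simps)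
  qed
  \<comment> \<open>The two mixed terms of the first variation contribute one quarter each, hence
    the factors 1/2.\<close>
  define E where "E y = I y - 1/2 * (laplace w y * laplace \<phi> y) - (1/2 * c0) * laplace \<phi> y" for y
  define C4 where "C4 = L * (100000 * (C1 + 100))"
  define q where "q y = norm (D2 G y)" for y
  have Ebound: "\<bar>E y\<bar> \<le> M * C4 * ((q y + \<eta>) * inverse (norm y))" if y: "y \<in> X" "y \<noteq> 0" for y
  proof -
    define n where "n = norm y"
    have n: "0 < n" "n \<le> 1" using y a(4) by (auto simp: n_def X_def)
    have yb: "y \<in> ball 0 \<rho>" using y X by blast
    have p1: "\<bar>\<phi> y\<bar> \<le> M / n" "\<And>k. \<bar>pd k \<phi> y\<bar> \<le> M / n" "\<And>k l. \<bar>pd2 k l \<phi> y\<bar> \<le> M / n\<^sup>2"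
      using phiM y by (auto simp: n_def X_def)
    have Mn: "0 \<le> M / n" "0 \<le> M / n\<^sup>2" "0 \<le> M" using p1(1) p1(3)[of 1 1] n by (auto simp: zero_le_divide_iff dest: order_trans[OF abs_ge_zero])
    have xb: "z \<in> ball 0 \<rho>" if "z \<in> X" for z using that X(2) by blast
    note PB = patch_bounds[OF X y(1) C1 P5 ms ext, unfolded X_def[symmetric], OF _ _ xb]
    have pb: "norm (Gam y) \<le> 100 * \<eta>" "norm (zc y - zc 0) \<le> (4 * C1 + 10 * \<eta>) * n"
      "norm (Gam y - Gam 0) \<le> (1000 + 160 * C1) * \<eta> * n"
      unfolding n_def using PB by blast+
    have m1: "s * norm (frechet h (pos y) v) \<le> \<eta> * norm v" and
      m2: "s * norm (chr h (pos y) v v') \<le> \<eta> * norm v * norm v'" and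
      m3: "s\<^sup>2 * norm (frechet (\<lambda>p. chr h p v v') (pos y) u) \<le> \<eta> * norm u * norm v * norm v'" for u v v'
      using ms yb by (auto simp: metric_small_def)
    have Pa: "norm (pd a G y) \<le> 5" for a
      using P5[of y] y Finite_Cartesian_Product.norm_nth_le[of "D1 G y" a] by (simp add: D1_def X_def)
    define Q0 where "Q0 = q y + 100 * \<eta>"
    have Q0: "norm (Qc y) \<le> Q0" "0 \<le> Q0" "Q0 \<le> C1 + 100"
      using norm_triangle_ineq[of "D2 G y" "Gam y"] pb(1) C1[of y] y eta
      by (auto simp: Qc_split Q0_def q_def X_def)
    have pe: "norm (c *\<^sub>R e) \<le> 2 * b" if "\<bar>c\<bar> \<le> b" for c b
    proof -
      have "0 \<le> b" using that by linarith
      then have "\<bar>c\<bar> * norm e \<le> b * 2" using that e(2) by (intro mult_mono) auto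
      then show ?thesis by simp
    qed
    have zv: "norm (zv \<phi> e y) \<le> 6 * (M / n)"
    proof -
      have dh: "h differentiable at (pos y)" by (rule christoffel_differentiable(2)[OF ext[OF yb]])
      have "frechet h (pos y) ((s * \<phi> y) *\<^sub>R e) = s *\<^sub>R frechet h (pos y) (\<phi> y *\<^sub>R e)"
        using linear_frechet_derivative[OF dh] by (metis linear_scale scaleR_scaleR)
      then have "norm (frechet h (pos y) ((s * \<phi> y) *\<^sub>R e)) \<le> \<eta> * norm (\<phi> y *\<^sub>R e)"
        using m1[of "\<phi> y *\<^sub>R e"] s_pos by simp
      also have "\<dots> \<le> 1 * (2 * (M / n))" using eta pe[OF p1(1)] by (intro mult_mono) auto
      finally have 1: "norm (frechet h (pos y) ((s * \<phi> y) *\<^sub>R e)) \<le> 2 * (M / n)" by simp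
      have 2: "norm (\<chi> a. pd a \<phi> y *\<^sub>R e :: real^'m^2) \<le> 2 * (M / n) + 2 * (M / n)"
        by (rule order_trans[OF norm_vec2_le]) (use pe[OF p1(2)[of 1]] pe[OF p1(2)[of 2]] in simp)
      show ?thesis unfolding zv_def by (rule order_trans[OF norm_Pair_le]) (use 1 2 in linarith)
    qed
    have Gv: "norm (s *\<^sub>R Gv \<phi> e y) \<le> 280 * \<eta> * (M / n)"
    proof -
      have "norm ((s *\<^sub>R Gv \<phi> e y) $ i $ j) \<le> 70 * \<eta> * (M / n)" for i j
      proof -
        let ?c = "\<lambda>p. chr h p (pd i G y) (pd j G y)"
        let ?a = "s *\<^sub>R frechet ?c (pos y) ((s * \<phi> y) *\<^sub>R e)"
        let ?b = "s *\<^sub>R chr h (pos y) (pd i \<phi> y *\<^sub>R e) (pd j G y)"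
        let ?d = "s *\<^sub>R chr h (pos y) (pd i G y) (pd j \<phi> y *\<^sub>R e)"
        have dc: "?c differentiable at (pos y)" by (rule christoffel_differentiable(1)[OF ext[OF yb]])
        have "?a =
            s\<^sup>2 *\<^sub>R frechet ?c (pos y) (\<phi> y *\<^sub>R e)"
          using linear_scale[OF linear_frechet_derivative[OF dc], of s "\<phi> y *\<^sub>R e"] by (simp add: power2_eq_square)
        then have "norm ?a
            \<le> \<eta> * norm (\<phi> y *\<^sub>R e) * norm (pd i G y) * norm (pd j G y)"
          using m3[where u = "\<phi> y *\<^sub>R e" and v = "pd i G y" and v' = "pd j G y"] by simp
        also have "\<dots> \<le> \<eta> * (2 * (M / n)) * 5 * 5"
          using eta pe[OF p1(1)] Pa Mn by (intro mult_mono mult_nonneg_nonneg) auto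
        finally have 1: "norm ?a \<le> 50 * \<eta> * (M / n)" by simp
        have "norm (?b) \<le> \<eta> * norm (pd i \<phi> y *\<^sub>R e) * norm (pd j G y)"
          using m2[of "pd i \<phi> y *\<^sub>R e" "pd j G y"] s_pos by simp
        also have "\<dots> \<le> \<eta> * (2 * (M / n)) * 5" using eta pe[OF p1(2)] Pa Mn by (intro mult_mono mult_nonneg_nonneg) auto
        finally have 2: "norm (?b) \<le> 10 * \<eta> * (M / n)" by simp
        have "norm (?d) \<le> \<eta> * norm (pd i G y) * norm (pd j \<phi> y *\<^sub>R e)"
          using m2[of "pd i G y" "pd j \<phi> y *\<^sub>R e"] s_pos by simp
        also have "\<dots> \<le> \<eta> * 5 * (2 * (M / n))" using eta pe[OF p1(2)] Pa Mn by (intro mult_mono mult_nonneg_nonneg) auto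
        finally have 3: "norm (?d) \<le> 10 * \<eta> * (M / n)" by simp
        have "(s *\<^sub>R Gv \<phi> e y) $ i $ j = ?a
            + ?b + ?d"
          by (simp add: Gv_def scaleR_add_right)
        then have "norm ((s *\<^sub>R Gv \<phi> e y) $ i $ j) \<le> norm ?a
            + norm (?b) + norm (?d)"
          by (simp only: norm_triangle3)
        also have "\<dots> \<le> 50 * \<eta> * (M / n) + 10 * \<eta> * (M / n) + 10 * \<eta> * (M / n)" by (intro add_mono 1 2 3)
        finally show ?thesis by (simp add: algebra_simps)
      qed
      from norm_vec22_le[of "s *\<^sub>R Gv \<phi> e y", OF this] show ?thesis by simp
    qed
    have Phe: "norm (Phe y) \<le> 8 * (M / n\<^sup>2)"
      using norm_vec22_const[of "\<lambda>a b. pd2 a b \<phi> y" "M / n\<^sup>2" e 2] p1(3) e(2) unfolding Phe_def by simp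
    have Qv: "Qv \<phi> e y = Phe y + s *\<^sub>R Gv \<phi> e y" by (simp add: Qv_def Phe_def)
    have seg: "closed_segment (zc 0) (zc y) \<subseteq> Z" using Z(2) y by (simp add: X_def)
    have zZ': "zc y \<in> Z" "zc 0 \<in> Z" using seg by auto
    have mono3: "L * b * c * d \<le> L * b' * c' * d'" if "b \<le> b'" "c \<le> c'" "d \<le> d'" "0 \<le> b" "0 \<le> c" "0 \<le> d" for b b' c c' d d'
      using that L(1) by (intro mult_mono mult_nonneg_nonneg) auto
    have mono2: "L * b * c \<le> L * b' * c'" if "b \<le> b'" "c \<le> c'" "0 \<le> b" "0 \<le> c" for b b' c c'
      using that L(1) by (intro mult_mono mult_nonneg_nonneg) auto
    have t1: "\<bar>W.dB (zc y) (zv \<phi> e y) (Qc y) (Qc y)\<bar> \<le> L * (6 * (M / n)) * Q0 * (C1 + 100)"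
      using Q0 zv by (intro order_trans[OF L(3)[OF zZ'(1)] mono3]) auto
    have t2: "\<bar>Wform (zc y) (s *\<^sub>R Gv \<phi> e y) (Qc y)\<bar> \<le> L * (280 * \<eta> * (M / n)) * (C1 + 100)"
      "\<bar>Wform (zc y) (Qc y) (s *\<^sub>R Gv \<phi> e y)\<bar> \<le> L * (C1 + 100) * (280 * \<eta> * (M / n))"
      using Q0 Gv by (intro order_trans[OF L(2)[OF zZ'(1)] mono2]; simp)+
    have zd: "norm (zc y - zc 0) \<le> (4 * C1 + 10) * n"
      using pb(2) eta n mult_right_mono[of "4 * C1 + 10 * \<eta>" "4 * C1 + 10" n] by linarith
    have t3: "\<bar>Wform (zc y) (Phe y) (Qc y) - Wform (zc 0) (Phe y) (Qc y)\<bar> \<le> L * ((4 * C1 + 10) * n) * (8 * (M / n\<^sup>2)) * Q0"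
      "\<bar>Wform (zc y) (Qc y) (Phe y) - Wform (zc 0) (Qc y) (Phe y)\<bar> \<le> L * ((4 * C1 + 10) * n) * Q0 * (8 * (M / n\<^sup>2))"
      using Q0 Phe zd by (intro order_trans[OF L(4)[OF seg] mono3]; simp)+
    have t4: "\<bar>Wform (zc 0) (Phe y) (Gam y - Gam 0)\<bar> \<le> L * (8 * (M / n\<^sup>2)) * ((1000 + 160 * C1) * \<eta> * n)"
      "\<bar>Wform (zc 0) (Gam y - Gam 0) (Phe y)\<bar> \<le> L * ((1000 + 160 * C1) * \<eta> * n) * (8 * (M / n\<^sup>2))"
      using Phe pb(3) by (intro order_trans[OF L(2)[OF zZ'(2)] mono2]; simp)+
    have Pn: "Phe y $ a $ b = pd2 a b \<phi> y *\<^sub>R e" for a b by (simp add: Phe_def)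
    have lp: "laplace \<phi> y = (\<Sum>a\<in>UNIV. pd2 a a \<phi> y)" by (simp add: laplace_def)
    have Wn: "Wform (zc 0) Y (Phe y) = 1/4 * ipM M0 (\<Sum>a\<in>UNIV. Y $ a $ a) e * laplace \<phi> y"
      "Wform (zc 0) (Phe y) Y = 1/4 * ipM M0 (\<Sum>a\<in>UNIV. Y $ a $ a) e * laplace \<phi> y" for Y
      unfolding z0 lp by (rule Wform_normalized[OF g0 sym0 _ Pn], use e(1) in \<open>simp add: M0_def\<close>)+
    have Qs: "Qc y = D2 G y + Gam 0 + (Gam y - Gam 0)" by (simp add: Qc_split)
    have split: "Wform (zc 0) (Phe y) (Qc y) = 1/4 * (laplace w y * laplace \<phi> y) + 1/4 * c0 * laplace \<phi> y + Wform (zc 0) (Phe y) (Gam y - Gam 0)"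
      "Wform (zc 0) (Qc y) (Phe y) = 1/4 * (laplace w y * laplace \<phi> y) + 1/4 * c0 * laplace \<phi> y + Wform (zc 0) (Gam y - Gam 0) (Phe y)"
    proof -
      have "Wform (zc 0) (Phe y) (Qc y) = Wform (zc 0) (Phe y) (D2 G y) + Wform (zc 0) (Phe y) (Gam 0) + Wform (zc 0) (Phe y) (Gam y - Gam 0)"
        "Wform (zc 0) (Qc y) (Phe y) = Wform (zc 0) (D2 G y) (Phe y) + Wform (zc 0) (Gam 0) (Phe y) + Wform (zc 0) (Gam y - Gam 0) (Phe y)"
        by (simp_all only: Qs W.add_left W.add_right)
      then show "Wform (zc 0) (Phe y) (Qc y) = 1/4 * (laplace w y * laplace \<phi> y) + 1/4 * c0 * laplace \<phi> y + Wform (zc 0) (Phe y) (Gam y - Gam 0)"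
        "Wform (zc 0) (Qc y) (Phe y) = 1/4 * (laplace w y * laplace \<phi> y) + 1/4 * c0 * laplace \<phi> y + Wform (zc 0) (Gam y - Gam 0) (Phe y)"
        using Wn(1)[of "D2 G y"] Wn(2)[of "D2 G y"] Wn(1)[of "Gam 0"] Wn(2)[of "Gam 0"] lapw[OF y(1)] by (simp_all add: c0_def)
    qed
    \<comment> \<open>Seven error terms. Where the Hessian of \<phi>, of size 1/|y|^2, occurs, it is
      paired with a difference from the centre of size |y|; the remaining terms involve only \<phi>
      and its gradient.\<close>
    have Eeq: "E y = W.dB (zc y) (zv \<phi> e y) (Qc y) (Qc y) + Wform (zc y) (s *\<^sub>R Gv \<phi> e y) (Qc y) + Wform (zc y) (Qc y) (s *\<^sub>R Gv \<phi> e y)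
       + (Wform (zc y) (Phe y) (Qc y) - Wform (zc 0) (Phe y) (Qc y)) + (Wform (zc y) (Qc y) (Phe y) - Wform (zc 0) (Qc y) (Phe y))
       + Wform (zc 0) (Phe y) (Gam y - Gam 0) + Wform (zc 0) (Gam y - Gam 0) (Phe y)"
      unfolding E_def I_def Qv W.add_left W.add_right using split by (simp add: algebra_simps)
    have add: "\<bar>x\<bar> \<le> a \<Longrightarrow> \<bar>y\<bar> \<le> b \<Longrightarrow> \<bar>x + y\<bar> \<le> a + b" for x y a b :: real by linarith
    have "\<bar>E y\<bar> \<le> L * (6 * (M / n)) * Q0 * (C1 + 100) + L * (280 * \<eta> * (M / n)) * (C1 + 100) + L * (C1 + 100) * (280 * \<eta> * (M / n))
        + L * ((4 * C1 + 10) * n) * (8 * (M / n\<^sup>2)) * Q0 + L * ((4 * C1 + 10) * n) * Q0 * (8 * (M / n\<^sup>2))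
        + L * (8 * (M / n\<^sup>2)) * ((1000 + 160 * C1) * \<eta> * n) + L * ((1000 + 160 * C1) * \<eta> * n) * (8 * (M / n\<^sup>2))"
      unfolding Eeq by (intro add t1 t2 t3 t4)
    also have "\<dots> = L * (M / n) * ((6 * (C1 + 100) + 16 * (4 * C1 + 10)) * Q0 + (560 * (C1 + 100) + 16 * (1000 + 160 * C1)) * \<eta>)"
    proof -
      define m where "m = M / n\<^sup>2"
      have m: "M / n = n * m" "M / n\<^sup>2 = m" using n by (simp_all add: m_def power2_eq_square)
      show ?thesis unfolding m by (simp add: algebra_simps)
    qed
    also have "\<dots> \<le> L * (M / n) * (100000 * (C1 + 100) * (q y + \<eta>))"
    proof (rule mult_left_mono)
      have qn: "q y \<ge> 0" by (simp add: q_def)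
      have "(6 * (C1 + 100) + 16 * (4 * C1 + 10)) * Q0 \<le> (100 * (C1 + 100)) * Q0"
        using C1' Q0 by (intro mult_right_mono) auto
      moreover have "(100 * (C1 + 100)) * Q0 \<le> (100 * (C1 + 100)) * (100 * (q y + \<eta>))"
        using C1' qn eta by (intro mult_left_mono) (auto simp: Q0_def)
      moreover have "(560 * (C1 + 100) + 16 * (1000 + 160 * C1)) * \<eta> \<le> (10000 * (C1 + 100)) * (q y + \<eta>)"
        using C1' qn eta by (intro mult_mono) auto
      moreover have "0 \<le> (C1 + 100) * (q y + \<eta>)" using C1' qn eta by simp
      ultimately show "(6 * (C1 + 100) + 16 * (4 * C1 + 10)) * Q0 + (560 * (C1 + 100) + 16 * (1000 + 160 * C1)) * \<eta> \<le> 100000 * (C1 + 100) * (q y + \<eta>)"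
        by linarith
    qed (rule mult_nonneg_nonneg[OF less_imp_le[OF L(1)] Mn(1)])
    finally show ?thesis by (simp add: C4_def n_def divide_inverse ac_simps)
  qed
  have GC: "Ck n (ball 0 \<rho>) (\<lambda>y. pd2 a b G y)" for n a b by (intro Ck_pd G_Ck open_ball)
  have D2c: "continuous_on X (D2 G)" unfolding D2_def[abs_def]
    by (intro continuous_on_vec_lambda continuous_on_subset[OF Ck_continuous_on[OF GC] X(2)])
  have qc: "continuous_on X (\<lambda>y. q y + \<eta>)" unfolding q_def by (intro continuous_intros D2c)
  have Jint: "(\<lambda>y. (q y + \<eta>) * inverse (norm y)) integrable_on X"
    using continuous_over_norm_integrable[OF qc] set_lebesgue_integral_eq_integral(1) by (auto simp: X_def)
  have lapc: "continuous_on X (laplace \<phi>)" unfolding laplace_def[abs_def]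
    by (intro continuous_intros continuous_on_subset[OF Ck_continuous_on[where n = 0] subset_UNIV] Ck_pd phi open_UNIV)
  have wC: "Ck n (ball 0 \<rho>) w" for n unfolding w_def[abs_def] by (rule Ck_bounded_linear[OF open_ball bounded_linear_ipM_left G_Ck])
  have lapwc: "continuous_on X (laplace w)" unfolding laplace_def[abs_def]
    by (intro continuous_intros continuous_on_subset[OF Ck_continuous_on[where n = 0] X(2)] Ck_pd wC open_ball)
  have lapi: "laplace \<phi> integrable_on X" unfolding X_def by (rule integrable_continuous[OF lapc[unfolded X_def]])
  have wpi: "(\<lambda>y. laplace w y * laplace \<phi> y) integrable_on X"
    unfolding X_def by (rule integrable_continuous[OF continuous_on_mult[OF lapwc lapc, unfolded X_def]])
  have lap0: "integral X (laplace \<phi>) = 0"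
  proof -
    have "integral X (\<lambda>y. pd2 k k \<phi> y) = 0" for k
    proof (rule integral_derivative_compact_support[where S = "cball 0 a"])
      show "Ck 1 UNIV (\<lambda>z. pd k \<phi> z)" by (intro Ck_pd phi open_UNIV)
      show "pd k \<phi> y = 0" if "y \<notin> cball 0 a" for y
      proof -
        have "(\<phi> has_derivative (\<lambda>_. 0)) (at y)"
          by (rule has_derivative_transform_within_open[where s = "- cball 0 a" and f = "\<lambda>_. 0"]) (use that phi(2) in auto)
        then show ?thesis by (rule pd_eqI)
      qed
    qed (use a in \<open>auto simp: X_def\<close>)
    moreover have "(\<lambda>y. pd2 k k \<phi> y) integrable_on X" for k unfolding X_def
      by (intro integrable_continuous continuous_on_subset[OF Ck_continuous_on[where n = 0] subset_UNIV] Ck_pd phi open_UNIV)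
    ultimately show ?thesis unfolding laplace_def[abs_def] by (subst integral_sum) auto
  qed
  have Eint: "(E has_integral (0 - 1/2 * integral X (\<lambda>y. laplace w y * laplace \<phi> y) - 1/2 * c0 * integral X (laplace \<phi>))) X"
    unfolding E_def[abs_def]
    by (intro has_integral_diff has_integral_mult_right I0 integrable_integral wpi lapi)
  then have "\<bar>integral X E\<bar> \<le> integral X (\<lambda>y. M * C4 * ((q y + \<eta>) * inverse (norm y)))"
    by (intro integral_abs_le_except_0 integrable_on_mult_right Jint Ebound) (auto simp: integrable_on_def)
  moreover have "integral X E = - (1/2 * integral X (\<lambda>y. laplace w y * laplace \<phi> y))"
    using Eint lap0 by (simp add: integral_unique)
  ultimately have "\<bar>integral X (\<lambda>y. laplace w y * laplace \<phi> y)\<bar> \<le> 2 * (M * C4 * integral X (\<lambda>y. (q y + \<eta>) * inverse (norm y)))"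
    by simp
  moreover have "2 * (M * C4 * J) = M * (2 * C4 * J)" for J by simp
  ultimately show ?thesis unfolding X_def w_def[abs_def] M0_def C4_def q_def by simp
qed

end

text \<open>A square instead of a disc, since the variation formula is stated over boxes. It
  contains the disc of radius \<rho>/2 that carries the test functions and lies in the disc of
  radius \<rho>.\<close>

definition sq :: "real \<Rightarrow> (real^2) set" where
  "sq \<rho> = cbox (\<chi> i. - \<rho> / 2) (\<chi> i. \<rho> / 2)"

lemma sq_bounds:
  assumes "0 < \<rho>"
  shows "cball 0 (\<rho>/2) \<subseteq> sq \<rho>" "sq \<rho> \<subseteq> ball 0 \<rho>" "\<rho> \<le> 1 \<Longrightarrow> sq \<rho> \<subseteq> cball 0 1" "0 \<in> sq \<rho>" "convex (sq \<rho>)" "compact (sq \<rho>)"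
proof -
  show "cball 0 (\<rho>/2) \<subseteq> sq \<rho>"
  proof
    fix y :: "real^2" assume "y \<in> cball 0 (\<rho>/2)"
    then have "\<bar>y $ i\<bar> \<le> \<rho>/2" for i using component_le_norm_cart[of y i] by (simp add: order_trans)
    then have "- \<rho>/2 \<le> y $ i \<and> y $ i \<le> \<rho>/2" for i by (smt (verit) minus_divide_left)
    then show "y \<in> sq \<rho>" by (simp add: sq_def mem_box_cart)
  qed
  show 2: "sq \<rho> \<subseteq> ball 0 \<rho>"
  proof
    fix y assume "y \<in> sq \<rho>"
    then have "- \<rho> / 2 \<le> y $ i \<and> y $ i \<le> \<rho> / 2" for i by (simp add: sq_def mem_box_cart)
    then have "\<bar>y $ i\<bar> \<le> \<rho>/2" for i by (smt (verit) minus_divide_left)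
    then have "(y $ i)\<^sup>2 \<le> (\<rho>/2)\<^sup>2" for i by (simp add: abs_le_square_iff[symmetric] assms less_imp_le)
    from this[of 1] this[of 2] have "y \<bullet> y \<le> \<rho>\<^sup>2 / 2" by (simp add: inner_vec_def sum_2 power2_eq_square)
    also have "\<dots> < \<rho>\<^sup>2" using assms by simp
    finally have "(norm y)\<^sup>2 < \<rho>\<^sup>2" by (simp add: dot_square_norm)
    then show "y \<in> ball 0 \<rho>" using assms by (simp add: power_less_imp_less_base)
  qed
  show "\<rho> \<le> 1 \<Longrightarrow> sq \<rho> \<subseteq> cball 0 1" using 2 by (auto simp: subset_iff intro: less_imp_le less_le_trans)
  show "0 \<in> sq \<rho>" using assms by (simp add: sq_def mem_box_cart)
  show "convex (sq \<rho>)" "compact (sq \<rho>)" by (simp_all add: sq_def)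
qed

text \<open>The order of the quantifiers is the point: the constant is found from \<rho>,
  \<open>Z\<close> and \<open>C1\<close> before the metric, the surface and the scale are given. The
  kernel estimate is applied to the scalar component of \<open>G\<close> in the direction
  \<open>e\<close>.\<close>

lemma center_curvature_estimate:
  fixes Z :: "((real^'m^'m) \<times> (real^'m^2)) set"
  assumes \<rho>: "0 < \<rho>" "\<rho> \<le> 1" and Z: "compact Z" "Z \<subseteq> nondeg"
  shows "\<exists>C>0. \<forall>(h :: real^'m \<Rightarrow> real^'m^'m) \<xi> s p0 \<psi> f G \<eta> e i j. graph_patch h \<xi> s p0 \<rho> \<psi> f G \<longrightarrow>
    willmore_critical h \<xi> \<longrightarrow> (\<forall>y\<in>ball 0 \<rho>. norm (p0 + s *\<^sub>R G y) \<ge> 2) \<longrightarrow> G 0 = 0 \<longrightarrow>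
    (h p0, D1 G 0) \<in> normalized \<longrightarrow> (\<forall>i. ipM (h p0) e (D1 G 0 $ i) = 0) \<longrightarrow> norm e \<le> 2 \<longrightarrow>
    (\<forall>y\<in>sq \<rho>. norm (D2 G y) \<le> C1 \<and> norm (D1 G y) \<le> 5) \<longrightarrow>
    graph_patch.metric_small h s p0 \<rho> G \<eta> \<longrightarrow>
    (\<forall>y\<in>sq \<rho>. closed_segment (h p0, D1 G 0) (h (p0 + s *\<^sub>R G y), D1 G y) \<subseteq> Z) \<longrightarrow>
    \<bar>ipM (h p0) (D2 G 0 $ i $ j) e\<bar> \<le> C * hessian_potential (sq \<rho>) \<eta> G"
proof -
  obtain L where L: "L > 0" "\<And>z q r. z \<in> Z \<Longrightarrow> \<bar>Wform z q r\<bar> \<le> L * norm q * norm r"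
      "\<And>z z' q r. z \<in> Z \<Longrightarrow> \<bar>W.dB z z' q r\<bar> \<le> L * norm z' * norm q * norm r"
      "\<And>z0 z q r. closed_segment z0 z \<subseteq> Z \<Longrightarrow> \<bar>Wform z q r - Wform z0 q r\<bar> \<le> L * norm (z - z0) * norm q * norm r"
    using W.bounds[OF Z] by metis
  define A :: "real^2" where "A = (\<chi> i. - \<rho> / 2)"
  define B :: "real^2" where "B = (\<chi> i. \<rho> / 2)"
  have AB: "cbox A B = sq \<rho>" by (simp add: A_def B_def sq_def)
  note sqb = sq_bounds[OF \<rho>(1)]
  have a: "\<rho>/2 > 0" "cball 0 (\<rho>/2) \<subseteq> cbox A B" "cbox A B \<subseteq> ball 0 \<rho>" "cbox A B \<subseteq> cball 0 1"
    using \<rho> sqb unfolding AB by auto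
  obtain C where C: "C > 0" and est: "\<And>w q S i j. Ck 3 (ball 0 \<rho>) w \<Longrightarrow> continuous_on (cbox A B) q \<Longrightarrow>
    (\<forall>y\<in>cbox A B. \<forall>k l. \<bar>pd2 k l w y\<bar> \<le> q y) \<Longrightarrow>
    (\<And>\<phi> M. (\<forall>n. Ck n UNIV \<phi>) \<Longrightarrow> (\<forall>y. norm y \<ge> \<rho>/2 \<longrightarrow> \<phi> y = 0) \<Longrightarrow>
      kernel_bound (cbox A B) M \<phi> \<Longrightarrow>
      \<bar>integral (cbox A B) (\<lambda>y. laplace w y * laplace \<phi> y)\<bar> \<le> M * S) \<Longrightarrow>
    \<bar>pd2 i j w 0\<bar> \<le> C * (S + integral (cbox A B) (\<lambda>y. q y * inverse (norm y)))"
    using kernel_estimate[OF a open_ball] by blast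
  \<comment> \<open>The absolute value keeps the constant positive before \<open>C1\<close> is known
    to be nonnegative.\<close>
  define C4 where "C4 = L * (100000 * (\<bar>C1\<bar> + 100))"
  have C4: "C4 > 0" using L by (simp add: C4_def add_nonneg_pos)
  show ?thesis
  proof (intro exI[of _ "C * (2 * C4 + 3)"] conjI allI impI)
    show "C * (2 * C4 + 3) > 0" using C C4 by simp
    fix h :: "real^'m \<Rightarrow> real^'m^'m" and \<xi> s p0 \<psi> f G \<eta> e i j
    assume gp: "graph_patch h \<xi> s p0 \<rho> \<psi> f G" and crit: "willmore_critical h \<xi>"
      and far: "\<forall>y\<in>ball 0 \<rho>. norm (p0 + s *\<^sub>R G y) \<ge> 2" and G0: "G 0 = 0"
      and nrm: "(h p0, D1 G 0) \<in> normalized" and e: "\<forall>i. ipM (h p0) e (D1 G 0 $ i) = 0" "norm e \<le> 2"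
      and Cb: "\<forall>y\<in>sq \<rho>. norm (D2 G y) \<le> C1 \<and> norm (D1 G y) \<le> 5"
      and ms: "graph_patch.metric_small h s p0 \<rho> G \<eta>"
      and seg: "\<forall>y\<in>sq \<rho>. closed_segment (h p0, D1 G 0) (h (p0 + s *\<^sub>R G y), D1 G y) \<subseteq> Z"
    interpret graph_patch h \<xi> s p0 \<rho> \<psi> f G by (rule gp)
    define w where "w z = ipM (h p0) (G z) e" for z
    define J where "J = hessian_potential (cbox A B) \<eta> G"
    have C1: "\<bar>C1\<bar> = C1" using Cb sqb(4) norm_ge_zero order_trans by (metis abs_of_nonneg)
    have eta: "0 \<le> \<eta>" using ms by (auto simp: metric_small_def)
    have wC: "Ck n (ball 0 \<rho>) w" for n unfolding w_def[abs_def] by (rule Ck_bounded_linear[OF open_ball bounded_linear_ipM_left G_Ck])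
    have pp: "p0 + s *\<^sub>R G y = pos y" "(h (pos y), D1 G y) = zc y" for y by (simp_all add: pos_def zc_def)
    have p00: "pos 0 = p0" by (simp add: pos_def G0)
    have test: "\<bar>integral (cbox A B) (\<lambda>y. laplace w y * laplace \<phi> y)\<bar> \<le> M * (2 * C4 * J)"
      if "\<forall>n. Ck n UNIV \<phi>" "\<forall>y. norm y \<ge> \<rho>/2 \<longrightarrow> \<phi> y = 0"
        "kernel_bound (cbox A B) M \<phi>" for \<phi> M
    proof -
      have "\<bar>integral (cbox A B) (\<lambda>y. laplace (\<lambda>z. ipM (h p0) (G z) e) y * laplace \<phi> y)\<bar> \<le>
        M * (2 * (L * (100000 * (C1 + 100))) * hessian_potential (cbox A B) \<eta> G)"
      proof (rule weak_biharmonic_estimate[OF crit a, where Z = Z])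
        show "closed_segment (zc 0) (zc y) \<subseteq> Z" if "y \<in> cbox A B" for y
          using seg that unfolding AB pp using p00 by (simp add: zc_def)
      qed (use that far G0 nrm e Cb ms Z L in \<open>simp_all add: AB pp\<close>)
      then show ?thesis unfolding w_def[abs_def] C4_def J_def C1 .
    qed
    have D2c: "continuous_on (cbox A B) (D2 G)" unfolding D2_def[abs_def]
      by (intro continuous_on_vec_lambda continuous_on_subset[OF Ck_continuous_on[where n = 0] a(3)] Ck_pd G_Ck open_ball)
    \<comment> \<open>The factor 3 exceeds 5/4 times 2, where 5/4 accounts for the metric at the
      centre and 2 for \<open>norm e\<close>.\<close>
    define q where "q y = 3 * norm (D2 G y)" for y
    have "\<bar>pd2 i j w 0\<bar> \<le> C * (2 * C4 * J + integral (cbox A B) (\<lambda>y. q y * inverse (norm y)))"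
    proof (rule est[OF wC _ _ test])
      show "continuous_on (cbox A B) q" unfolding q_def by (intro continuous_intros D2c)
      show "\<forall>y\<in>cbox A B. \<forall>k l. \<bar>pd2 k l w y\<bar> \<le> q y"
      proof (intro ballI allI)
        fix y k l assume "y \<in> cbox A B"
        then have "y \<in> ball 0 \<rho>" using a by blast
        have n0: "norm (h p0 - mat 1) \<le> 1/4" using nrm by (simp add: normalized_def)
        have "\<bar>ipM (h p0) (D2 G y $ k $ l) e\<bar> \<le> \<bar>(D2 G y $ k $ l) \<bullet> e\<bar> + 1/4 * norm (D2 G y $ k $ l) * norm e"
          using ipM_near_id[OF n0, of "D2 G y $ k $ l" e] by linarith
        also have "\<dots> \<le> norm (D2 G y $ k $ l) * norm e + 1/4 * norm (D2 G y $ k $ l) * norm e"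
          using Cauchy_Schwarz_ineq2 by (intro add_right_mono)
        also have "\<dots> = 5/4 * (norm (D2 G y $ k $ l) * norm e)" by simp
        also have "\<dots> \<le> 5/4 * (norm (D2 G y) * 2)"
          using e(2) norm_entry22 by (intro mult_left_mono mult_mono) auto
        also have "\<dots> \<le> q y" by (simp add: q_def)
        finally show "\<bar>pd2 k l w y\<bar> \<le> q y" unfolding w_def[abs_def] pd_component(2)[OF \<open>y \<in> ball 0 \<rho>\<close>] .
      qed
    qed auto
    also have "integral (cbox A B) (\<lambda>y. q y * inverse (norm y)) \<le> integral (cbox A B) (\<lambda>y. 3 * ((norm (D2 G y) + \<eta>) * inverse (norm y)))"
    proof (rule integral_le)
      have c: "(\<lambda>y. k y * inverse (norm y)) integrable_on cbox A B" if "continuous_on (cbox A B) k" for k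
        using continuous_over_norm_integrable[OF that compact_cbox] set_lebesgue_integral_eq_integral(1) by blast
      show "(\<lambda>y. q y * inverse (norm y)) integrable_on cbox A B"
        unfolding q_def by (intro c continuous_intros D2c)
      show "(\<lambda>y. 3 * ((norm (D2 G y) + \<eta>) * inverse (norm y))) integrable_on cbox A B"
        by (intro integrable_on_mult_right c continuous_intros D2c)
      show "q y * inverse (norm y) \<le> 3 * ((norm (D2 G y) + \<eta>) * inverse (norm y))" for y
        using eta unfolding q_def by (simp add: mult_right_mono algebra_simps)
    qed
    also have "\<dots> = 3 * J" unfolding J_def by (rule integral_mult_right)
    finally have "\<bar>pd2 i j w 0\<bar> \<le> C * (2 * C4 * J + 3 * J)" using C by simp
    moreover have "pd2 i j w 0 = ipM (h p0) (D2 G 0 $ i $ j) e"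
      unfolding w_def[abs_def] by (rule pd_component(2)) (use \<rho> in simp)
    ultimately show "\<bar>ipM (h p0) (D2 G 0 $ i $ j) e\<bar> \<le> C * (2 * C4 + 3) * hessian_potential (sq \<rho>) \<eta> G"
      by (simp add: J_def AB algebra_simps)
  qed
qed

section \<open>Continuation of sections of a local homeomorphism\<close>

text \<open>The set of agreement is closed by continuity and open because \<open>f\<close> is
  locally injective, hence it is all of the connected set \<open>T\<close>.\<close>

lemma sections_agree:
  fixes f :: "'a::euclidean_space \<Rightarrow> 'a"
  assumes T: "connected T" and c: "continuous_on T \<psi>1" "continuous_on T \<psi>2"
    and sec: "\<And>y. y \<in> T \<Longrightarrow> f (\<psi>1 y) = y" "\<And>y. y \<in> T \<Longrightarrow> f (\<psi>2 y) = y"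
    and W: "\<psi>1 ` T \<subseteq> W" and loc: "\<And>x. x \<in> W \<Longrightarrow> \<exists>U. open U \<and> x \<in> U \<and> inj_on f U"
    and y0: "y0 \<in> T" "\<psi>1 y0 = \<psi>2 y0" and y: "y \<in> T"
  shows "\<psi>1 y = \<psi>2 y"
proof -
  let ?E = "{y \<in> T. \<psi>1 y = \<psi>2 y}"
  have "closedin (top_of_set T) {y \<in> T. \<psi>1 y - \<psi>2 y = 0}"
    by (rule continuous_closedin_preimage_constant) (intro continuous_intros c)
  then have cl: "closedin (top_of_set T) ?E" by simp
  have op: "openin (top_of_set T) ?E"
  proof (subst openin_subopen, intro ballI)
    fix y assume y: "y \<in> ?E"
    then obtain U where U: "open U" "\<psi>1 y \<in> U" "inj_on f U" using W loc by blast
    let ?O = "(T \<inter> \<psi>1 -` U) \<inter> (T \<inter> \<psi>2 -` U)"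
    have "openin (top_of_set T) ?O" by (intro openin_Int continuous_openin_preimage_gen c U)
    moreover have "?O \<subseteq> ?E" using sec U(3) by (auto simp: inj_on_def)
    moreover have "y \<in> ?O" using y U(2) by auto
    ultimately show "\<exists>Ta. openin (top_of_set T) Ta \<and> y \<in> Ta \<and> Ta \<subseteq> ?E" by blast
  qed
  have "?E = {} \<or> ?E = T" using T cl op connected_clopen by blast
  then show ?thesis using y0 y by blast
qed

text \<open>Otherwise shrinking neighbourhoods contain pairs of distinct points with equal values.
  Subsequences converge to points of \<open>C\<close>; injectivity on \<open>C\<close> makes the two
  limits equal, and local injectivity there is violated.\<close>

lemma inj_on_neighbourhood_of_compact:
  fixes f :: "'a::euclidean_space \<Rightarrow> 'b::euclidean_space"
  assumes C: "compact C" "C \<subseteq> X" and X: "open X" and f: "continuous_on X f" and inj: "inj_on f C"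
    and loc: "\<And>x. x \<in> C \<Longrightarrow> \<exists>U. open U \<and> x \<in> U \<and> inj_on f U"
  obtains U where "open U" "C \<subseteq> U" "U \<subseteq> X" "inj_on f U"
proof (cases "C = {}")
  case True
  then show ?thesis using that[of "{}"] by auto
next
  case False
  obtain e where e: "e > 0" "(\<Union>x\<in>C. cball x e) \<subseteq> X"
    using compact_subset_open_imp_cball_epsilon_subset[OF C(1) X C(2)] by metis
  define N where "N n = (\<Union>x\<in>C. ball x (e / real (Suc n)))" for n
  have NX: "N n \<subseteq> (\<Union>x\<in>C. cball x e)" for n
  proof -
    have "e / real (Suc n) \<le> e" using e by (simp add: divide_le_eq mult_le_cancel_left1)
    then show ?thesis unfolding N_def by (force simp: subset_iff)
  qed
  have "\<exists>n. inj_on f (N n)"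
  proof (rule ccontr)
    assume "\<nexists>n. inj_on f (N n)"
    then have "\<forall>n. \<exists>u v. u \<in> N n \<and> v \<in> N n \<and> u \<noteq> v \<and> f u = f v" unfolding inj_on_def by blast
    then obtain u v where uv: "\<And>n. u n \<in> N n" "\<And>n. v n \<in> N n" "\<And>n. u n \<noteq> v n" "\<And>n. f (u n) = f (v n)" by metis
    have "\<forall>n. \<exists>x. x \<in> C \<and> dist x (u n) < e / real (Suc n)" "\<forall>n. \<exists>x. x \<in> C \<and> dist x (v n) < e / real (Suc n)"
      using uv(1,2) by (auto simp: N_def)
    then obtain x y where x: "\<And>n. x n \<in> C" "\<And>n. dist (x n) (u n) < e / real (Suc n)"
      and y: "\<And>n. y n \<in> C" "\<And>n. dist (y n) (v n) < e / real (Suc n)" by metis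
    have cc: "compact (C \<times> C)" using C by (intro compact_Times)
    have xy: "\<forall>n. (x n, y n) \<in> C \<times> C" using x y by auto
    obtain l r where l: "l \<in> C \<times> C" "strict_mono r" "((\<lambda>n. (x n, y n)) \<circ> r) \<longlonglongrightarrow> l"
      using cc[unfolded compact_def, THEN spec, THEN mp, OF xy] by blast
    obtain a b where ab: "l = (a, b)" "a \<in> C" "b \<in> C" using l(1) by (cases l) auto
    have xa: "(\<lambda>n. x (r n)) \<longlonglongrightarrow> a" and yb: "(\<lambda>n. y (r n)) \<longlonglongrightarrow> b"
      using tendsto_fst[OF l(3)] tendsto_snd[OF l(3)] ab by (auto simp: o_def)
    have er: "(\<lambda>n. e / real (Suc n)) \<longlonglongrightarrow> 0"
      using tendsto_mult_right[OF LIMSEQ_inverse_real_of_nat, of e] by (simp add: divide_inverse mult.commute)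
    have close: "(\<lambda>n. w (r n)) \<longlonglongrightarrow> c" if "(\<lambda>n. z (r n)) \<longlonglongrightarrow> c" "\<And>n. dist (z n) (w n) < e / real (Suc n)"
      for z w :: "nat \<Rightarrow> 'a" and c
    proof -
      have "(\<lambda>n. dist (z (r n)) (w (r n))) \<longlonglongrightarrow> 0" using LIMSEQ_subseq_LIMSEQ[OF er l(2)] that(2)
        by (rule_tac tendsto_sandwich[where f = "\<lambda>_. 0" and h = "\<lambda>n. e / real (Suc (r n))"])
          (auto simp: o_def less_imp_le)
      then have "(\<lambda>n. w (r n) - z (r n)) \<longlonglongrightarrow> 0"
        by (subst tendsto_norm_zero_iff[symmetric]) (simp add: dist_norm norm_minus_commute)
      from tendsto_add[OF this that(1)] show ?thesis by simp
    qed
    have ua: "(\<lambda>n. u (r n)) \<longlonglongrightarrow> a" and vb: "(\<lambda>n. v (r n)) \<longlonglongrightarrow> b" using close[OF xa x(2)] close[OF yb y(2)] .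
    have ct: "isCont f a" "isCont f b" using f X C(2) ab continuous_on_eq_continuous_at by blast+
    have "(\<lambda>n. f (u (r n))) \<longlonglongrightarrow> f a" "(\<lambda>n. f (u (r n))) \<longlonglongrightarrow> f b"
      using isCont_tendsto_compose[OF ct(1) ua] isCont_tendsto_compose[OF ct(2) vb] uv(4) by auto
    then have "f a = f b" using LIMSEQ_unique by blast
    then have "a = b" using inj ab by (simp add: inj_on_def)
    obtain U where U: "open U" "a \<in> U" "inj_on f U" using loc ab by blast
    have "\<forall>\<^sub>F n in sequentially. u (r n) \<in> U" "\<forall>\<^sub>F n in sequentially. v (r n) \<in> U"
      using topological_tendstoD[OF ua U(1,2)] topological_tendstoD[OF vb U(1)] U(2) \<open>a = b\<close> by auto
    then have "\<forall>\<^sub>F n in sequentially. False"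
      by eventually_elim (use U(3) uv(3,4) in \<open>auto simp: inj_on_def\<close>)
    then show False by simp
  qed
  then obtain n where "inj_on f (N n)" by blast
  moreover have "open (N n)" unfolding N_def by blast
  moreover have "C \<subseteq> N n" unfolding N_def using e by (auto intro!: bexI)
  ultimately show ?thesis using that NX e(2) by blast
qed

text \<open>A section on a maximal disc extends: the limits along rays give a section on the closed disc, and
  \<open>f\<close> remains injective on a neighbourhood of its compact image.\<close>

lemma section_continuation:
  fixes f :: "'a::euclidean_space \<Rightarrow> 'a"
  assumes X: "open X" "continuous_on X f" and W': "W' \<subseteq> X"
    and loc: "\<And>x. x \<in> W' \<Longrightarrow> \<exists>U. open U \<and> x \<in> U \<and> inj_on f U"
    and W: "\<And>x. x \<in> W \<Longrightarrow> \<exists>U. open U \<and> x \<in> U \<and> U \<subseteq> W'"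
    and x0: "x0 \<in> W" "f x0 = 0" and r0: "r0 > 0"
    and step: "\<And>r \<psi>. \<lbrakk>0 < r; r \<le> r0; continuous_on (ball 0 r) \<psi>; \<psi> 0 = x0; \<psi> ` ball 0 r \<subseteq> W';
        \<And>y. y \<in> ball 0 r \<Longrightarrow> f (\<psi> y) = y\<rbrakk> \<Longrightarrow>
      \<psi> ` ball 0 r \<subseteq> W \<and> (\<forall>y. norm y = r \<longrightarrow> (\<exists>z\<in>W. ((\<lambda>t. \<psi> (t *\<^sub>R y)) \<longlongrightarrow> z) (at_left 1)))"
  obtains \<psi> where "continuous_on (ball 0 r0) \<psi>" "\<psi> 0 = x0" "\<psi> ` ball 0 r0 \<subseteq> W'"
    "\<And>y. y \<in> ball 0 r0 \<Longrightarrow> f (\<psi> y) = y"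
proof -
  define Sec where "Sec r \<psi> \<longleftrightarrow> continuous_on (ball 0 r) \<psi> \<and> \<psi> 0 = x0 \<and> \<psi> ` ball 0 r \<subseteq> W' \<and>
    (\<forall>y\<in>ball 0 r. f (\<psi> y) = y)" for r and \<psi> :: "'a \<Rightarrow> 'a"
  have WW': "W \<subseteq> W'" using W by blast
  \<comment> \<open>Injectivity on the compact image of a section persists on an open neighbourhood.
    By invariance of domain the image of that neighbourhood is open, so it contains a larger ball,
    on which the inverse is again a section. The slack between \<open>W\<close> and
    \<open>W'\<close> makes room for the neighbourhood.\<close>
  have extend: "\<exists>r>q. \<exists>\<psi>. Sec r \<psi>"
    if C: "compact C" "C \<subseteq> W" "inj_on f C" "x0 \<in> C" "cball 0 q \<subseteq> f ` C" "q \<ge> 0" for C q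
  proof -
    define X1 where "X1 = \<Union>{U. open U \<and> U \<subseteq> W'}"
    have X1: "open X1" "C \<subseteq> X1" "X1 \<subseteq> W'" unfolding X1_def using W C(2) by auto blast
    obtain U where U: "open U" "C \<subseteq> U" "U \<subseteq> X1" "inj_on f U"
    proof (rule inj_on_neighbourhood_of_compact[OF C(1) X1(2,1) continuous_on_subset[OF X(2)] C(3)])
      show "X1 \<subseteq> X" using X1(3) W' by blast
      show "\<exists>U. open U \<and> x \<in> U \<and> inj_on f U" if "x \<in> C" for x using that C(2) WW' loc by blast
    qed
    have cU: "continuous_on U f" using X(2) continuous_on_subset U X1 W' by blast
    have oU: "open (f ` U)" by (rule invariance_of_domain[OF cU U(1,4)])
    have "cball 0 q \<subseteq> f ` U" using C(5) U(2) by blast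
    then obtain e where e: "e > 0" "(\<Union>x\<in>cball 0 q. ball x e) \<subseteq> f ` U"
      using compact_subset_open_imp_ball_epsilon_subset[OF compact_cball oU] by metis
    have sub: "ball 0 (q + e) \<subseteq> f ` U"
    proof
      fix y :: 'a assume y: "y \<in> ball 0 (q + e)"
      show "y \<in> f ` U"
      proof (cases "norm y \<le> q")
        case True
        then have "y \<in> cball 0 q" by simp
        then show ?thesis using \<open>cball 0 q \<subseteq> f ` U\<close> by blast
      next
        case False
        let ?y = "(q / norm y) *\<^sub>R y"
        have "norm y > 0" using False C(6) by linarith
        have "y - ?y = (1 - q / norm y) *\<^sub>R y" by (simp add: algebra_simps)
        then have "dist ?y y = \<bar>1 - q / norm y\<bar> * norm y" by (simp add: dist_norm norm_minus_commute)
        also have "\<dots> = norm y - q" using False \<open>norm y > 0\<close> C(6) by (simp add: abs_of_nonneg field_simps)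
        finally have "y \<in> ball ?y e" using y by simp
        moreover have "?y \<in> cball 0 q" using C(6) \<open>norm y > 0\<close> by simp
        ultimately show ?thesis using e(2) by blast
      qed
    qed
    define \<psi> where "\<psi> = inv_into U f"
    obtain g where "homeomorphism U (f ` U) f g"
      using invariance_of_domain_homeomorphism[OF U(1) cU _ U(4)] by auto
    then have cpsi: "continuous_on (f ` U) \<psi>" unfolding \<psi>_def homeomorphism_def using U(4)
      by (elim conjE, rule_tac f = g in continuous_on_eq) (auto simp: inv_into_f_f)
    have "Sec (q + e) \<psi>"
    proof -
      have "f (\<psi> y) = y" "\<psi> y \<in> U" if "y \<in> ball 0 (q + e)" for y
        using sub that by (auto simp: \<psi>_def f_inv_into_f inv_into_into subset_iff)
      moreover have "\<psi> 0 = x0" unfolding \<psi>_def x0(2)[symmetric] by (rule inv_into_f_f[OF U(4)]) (use C(4) U(2) in blast)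
      moreover have "continuous_on (ball 0 (q + e)) \<psi>" using continuous_on_subset cpsi sub by blast
      moreover have "U \<subseteq> W'" using U(3) X1(3) by blast
      ultimately show ?thesis unfolding Sec_def by blast
    qed
    then show ?thesis using e(1) by (intro exI[of _ "q + e"]) auto
  qed
  have uniq: "\<psi>1 y = \<psi>2 y" if "Sec r1 \<psi>1" "Sec r2 \<psi>2" "y \<in> ball 0 r1" "y \<in> ball 0 r2" for r1 r2 \<psi>1 \<psi>2 y
  proof -
    have "(0::'a) \<in> ball 0 (min r1 r2)" using that(3,4) by (auto intro: order_le_less_trans[OF norm_ge_zero])
    moreover have "continuous_on (ball 0 (min r1 r2)) \<psi>1" "continuous_on (ball 0 (min r1 r2)) \<psi>2"
      using that(1,2) unfolding Sec_def by (auto intro: continuous_on_subset)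
    ultimately show ?thesis by (intro sections_agree[of "ball 0 (min r1 r2)" \<psi>1 \<psi>2 f W' 0 y] loc)
        (use that in \<open>auto simp: Sec_def\<close>)
  qed
  define S where "S = {r. 0 < r \<and> r \<le> r0 \<and> (\<exists>\<psi>. Sec r \<psi>)}"
  have Sec_mono: "Sec r' \<psi>" if "Sec r \<psi>" "r' \<le> r" for r r' \<psi>
    using that by (auto simp: Sec_def intro: continuous_on_subset)
  have "S \<noteq> {}"
  proof -
    obtain r \<psi> where "r > 0" "Sec r \<psi>" using extend[of "{x0}" 0] x0 by auto
    then have "min r r0 \<in> S" using r0 Sec_mono[of r \<psi> "min r r0"] by (auto simp: S_def)
    then show ?thesis by blast
  qed
  have bdd: "bdd_above S" by (auto simp: S_def)
  define q where "q = Sup S"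
  have q: "0 < q" "q \<le> r0"
  proof -
    obtain r where r: "r \<in> S" using \<open>S \<noteq> {}\<close> by blast
    then have "r \<le> q" unfolding q_def using bdd by (rule cSup_upper)
    moreover have "0 < r" using r by (simp add: S_def)
    ultimately show "0 < q" by linarith
    show "q \<le> r0" unfolding q_def by (rule cSup_least[OF \<open>S \<noteq> {}\<close>]) (simp add: S_def)
  qed
  have "\<exists>\<psi>. Sec q \<psi>"
  proof -
    have "\<forall>y\<in>ball (0::'a) q. \<exists>r. r \<in> S \<and> norm y < r"
      using less_cSup_iff[OF \<open>S \<noteq> {}\<close> bdd] by (auto simp: q_def)
    then obtain rr where rr: "\<And>y. y \<in> ball 0 q \<Longrightarrow> rr y \<in> S" "\<And>y. y \<in> ball (0::'a) q \<Longrightarrow> norm y < rr y" by metis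
    have "\<forall>r\<in>S. \<exists>\<psi>. Sec r \<psi>" by (auto simp: S_def)
    then obtain F where F: "\<And>r. r \<in> S \<Longrightarrow> Sec r (F r)" by metis
    \<comment> \<open>Sections on smaller discs are glued. By uniqueness the value does not depend
      on the radius chosen for \<open>y\<close>, so there is a section on the disc of the supremal
      radius itself.\<close>
    define \<psi> where "\<psi> y = F (rr y) y" for y
    have eq: "\<psi> z = F (rr y) z" if "y \<in> ball 0 q" "z \<in> ball 0 q" "norm z < rr y" for y z
      unfolding \<psi>_def by (rule uniq[OF F F]) (use that rr in auto)
    have "continuous_on (ball 0 q) \<psi>"
    proof (rule continuous_at_imp_continuous_on, rule ballI)
      fix y :: 'a assume y: "y \<in> ball 0 q"
      let ?B = "ball 0 (rr y) \<inter> ball (0::'a) q"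
      have "continuous_on ?B (F (rr y))" using F[OF rr(1)[OF y]] by (auto simp: Sec_def intro: continuous_on_subset)
      then have "continuous_on ?B \<psi>" by (rule continuous_on_eq) (use eq y in auto)
      moreover have "y \<in> ?B" using y rr by auto
      ultimately show "isCont \<psi> y" by (meson continuous_on_eq_continuous_at open_Int open_ball)
    qed
    moreover have "f (\<psi> y) = y" "\<psi> y \<in> W'" if "y \<in> ball 0 q" for y
      using F[OF rr(1)[OF that]] rr(2)[OF that] by (auto simp: Sec_def \<psi>_def)
    moreover have "\<psi> 0 = x0" using F[OF rr(1)[of 0]] q by (auto simp: Sec_def \<psi>_def)
    ultimately show ?thesis by (auto simp: Sec_def)
  qed
  then obtain \<psi> where psi: "Sec q \<psi>" by blast
  have "q = r0"
  proof (rule ccontr)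
    assume "q \<noteq> r0"
    have psi': "continuous_on (ball 0 q) \<psi>" "\<psi> 0 = x0" "\<psi> ` ball 0 q \<subseteq> W'" "\<And>y. y \<in> ball 0 q \<Longrightarrow> f (\<psi> y) = y"
      using psi by (auto simp: Sec_def)
    have st: "\<psi> ` ball 0 q \<subseteq> W" "\<And>y. norm y = q \<Longrightarrow> \<exists>z\<in>W. ((\<lambda>t. \<psi> (t *\<^sub>R y)) \<longlongrightarrow> z) (at_left 1)"
      using step[OF q psi'] by blast+
    then obtain Zl where Zl: "\<And>y. norm y = q \<Longrightarrow> Zl y \<in> W" "\<And>y. norm y = q \<Longrightarrow> ((\<lambda>t. \<psi> (t *\<^sub>R y)) \<longlongrightarrow> Zl y) (at_left 1)"
      by metis
    \<comment> \<open>The limits are known along rays only, so continuity up to the boundary is not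
      automatic; a local inverse of \<open>f\<close> at each limit point provides it.\<close>
    define \<psi>b where "\<psi>b y = (if norm y < q then \<psi> y else Zl y)" for y
    have lt1: "\<forall>\<^sub>F t in at_left (1::real). 0 < t \<and> t < 1"
      using eventually_at_left_real[of 0 1] by (auto elim: eventually_mono)
    have in_ball: "t *\<^sub>R y \<in> ball 0 q" if "0 < t" "t < 1" "norm y = q" for t and y :: 'a
      using that q by (simp add: mult_less_cancel_right2)
    have ray: "((\<lambda>t. t *\<^sub>R y) \<longlongrightarrow> y) (at_left (1::real))" for y :: 'a
      using tendsto_scaleR[OF tendsto_ident_at[of 1 "{..<1}"] tendsto_const[of y]] by simp
    have fZ: "f (Zl y) = y" if "norm y = q" for y
    proof -
      have "Zl y \<in> X" using Zl(1)[OF that] WW' W' by blast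
      then have "isCont f (Zl y)" using X continuous_on_eq_continuous_at by blast
      then have "((\<lambda>t. f (\<psi> (t *\<^sub>R y))) \<longlongrightarrow> f (Zl y)) (at_left 1)"
        using Zl(2)[OF that] by (rule isCont_tendsto_compose)
      moreover have "\<forall>\<^sub>F t in at_left 1. f (\<psi> (t *\<^sub>R y)) = t *\<^sub>R y"
        using lt1 by eventually_elim (use psi'(4) in_ball that in blast)
      ultimately have "((\<lambda>t. t *\<^sub>R y) \<longlongrightarrow> f (Zl y)) (at_left 1)" by (rule Lim_transform_eventually)
      then show ?thesis using tendsto_unique[OF _ _ ray] trivial_limit_at_left_real by blast
    qed
    have sec_b: "f (\<psi>b y) = y" "\<psi>b y \<in> W" if "y \<in> cball 0 q" for y
      using that psi'(4) st(1) fZ Zl(1) by (auto simp: \<psi>b_def)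
    have cont_b: "continuous_on (cball 0 q) \<psi>b"
    proof (subst continuous_on_eq_continuous_within, rule ballI)
      fix y1 :: 'a assume y1: "y1 \<in> cball 0 q"
      show "continuous (at y1 within cball 0 q) \<psi>b"
      proof (cases "norm y1 < q")
        case True
        have "continuous_on (ball 0 q) \<psi>b" by (rule continuous_on_eq[OF psi'(1)]) (simp add: \<psi>b_def)
        then have "isCont \<psi>b y1" using True by (auto simp: continuous_on_eq_continuous_at)
        then show ?thesis by (rule continuous_at_imp_continuous_at_within)
      next
        case False
        then have n1: "norm y1 = q" using y1 by simp
        let ?z = "Zl y1"
        obtain U1 where U1: "open U1" "?z \<in> U1" "inj_on f U1" using loc Zl(1)[OF n1] WW' by blast
        obtain U2 where U2: "open U2" "?z \<in> U2" "U2 \<subseteq> W'" using W Zl(1)[OF n1] by blast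
        define U where "U = U1 \<inter> U2"
        have U: "open U" "?z \<in> U" "inj_on f U" "U \<subseteq> W'" using U1 U2 by (auto simp: U_def intro: inj_on_subset)
        have cU: "continuous_on U f" using X(2) U(4) W' continuous_on_subset by blast
        obtain g where g: "homeomorphism U (f ` U) f g"
          using invariance_of_domain_homeomorphism[OF U(1) cU _ U(3)] by auto
        have oU: "open (f ` U)" by (rule invariance_of_domain[OF cU U(1,3)])
        have "y1 \<in> f ` U" using fZ[OF n1] U(2) by force
        then obtain d where d: "d > 0" "ball y1 d \<subseteq> f ` U" using oU openE by blast
        have gc: "continuous_on (ball y1 d) g" using g d(2) by (auto simp: homeomorphism_def intro: continuous_on_subset)
        have gU: "g y \<in> U" "f (g y) = y" if "y \<in> ball y1 d" for y
          using g d(2) that by (auto simp: homeomorphism_def)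
        \<comment> \<open>On the intersection of the two balls, which is convex and hence connected,
          the local inverse and the section meet at a point of the ray, so they coincide.\<close>
        have agree: "g y = \<psi> y" if "y \<in> ball y1 d \<inter> ball 0 q" for y
        proof -
          have "\<forall>\<^sub>F t in at_left 1. \<psi> (t *\<^sub>R y1) \<in> U" using topological_tendstoD[OF Zl(2)[OF n1] U(1,2)] .
          moreover have "\<forall>\<^sub>F t in at_left 1. t *\<^sub>R y1 \<in> ball y1 d"
            using topological_tendstoD[OF ray open_ball, of y1 y1 d] d(1) by simp
          ultimately have "\<forall>\<^sub>F t in at_left (1::real). \<psi> (t *\<^sub>R y1) \<in> U \<and> t *\<^sub>R y1 \<in> ball y1 d \<and> 0 < t \<and> t < 1"
            using lt1 by eventually_elim auto
          then obtain t where t: "\<psi> (t *\<^sub>R y1) \<in> U" "t *\<^sub>R y1 \<in> ball y1 d" "0 < t" "t < 1"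
            using eventually_happens[of _ "at_left (1::real)"] by auto
          have tb: "t *\<^sub>R y1 \<in> ball 0 q" by (rule in_ball[OF t(3,4) n1])
          have "f (g (t *\<^sub>R y1)) = f (\<psi> (t *\<^sub>R y1))" using gU(2)[OF t(2)] psi'(4)[OF tb] by simp
          then have "g (t *\<^sub>R y1) = \<psi> (t *\<^sub>R y1)" using U(3) gU(1)[OF t(2)] t(1) by (simp add: inj_on_def)
          moreover have "g ` (ball y1 d \<inter> ball 0 q) \<subseteq> W'" using gU U(4) by blast
          ultimately show ?thesis
            using sections_agree[of "ball y1 d \<inter> ball 0 q" g \<psi> f W' "t *\<^sub>R y1" y] that t(2) tb gU U(4) psi' loc gc
            by (auto simp: convex_connected convex_Int continuous_on_subset)
        qed
        have agree_b: "g y = \<psi>b y" if "y \<in> ball y1 d \<inter> cball 0 q" for y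
        proof (cases "norm y < q")
          case True
          then show ?thesis using agree that by (simp add: \<psi>b_def)
        next
          case False
          then have n2: "norm y = q" using that by simp
          have "isCont g y" using gc that by (auto simp: continuous_on_eq_continuous_at)
          then have "((\<lambda>t. g (t *\<^sub>R y)) \<longlongrightarrow> g y) (at_left 1)" by (rule isCont_tendsto_compose[OF _ ray])
          moreover have "\<forall>\<^sub>F t in at_left 1. t *\<^sub>R y \<in> ball y1 d"
            using topological_tendstoD[OF ray open_ball, of y y1 d] that by simp
          then have "\<forall>\<^sub>F t in at_left 1. g (t *\<^sub>R y) = \<psi> (t *\<^sub>R y)"
            using lt1 by eventually_elim (use agree in_ball n2 in blast)
          ultimately have "((\<lambda>t. \<psi> (t *\<^sub>R y)) \<longlongrightarrow> g y) (at_left 1)" by (rule Lim_transform_eventually)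
          then show ?thesis using tendsto_unique[OF _ _ Zl(2)[OF n2]] False by (simp add: \<psi>b_def)
        qed
        have y1b: "y1 \<in> ball y1 d" using d by simp
        have "continuous (at y1 within cball 0 q) g"
          using gc y1b by (meson continuous_at_imp_continuous_at_within continuous_on_eq_continuous_at open_ball)
        then show ?thesis
          by (rule continuous_transform_within[OF _ d(1) y1]) (use agree_b in \<open>auto simp: dist_commute\<close>)
      qed
    qed
    define C where "C = \<psi>b ` cball 0 q"
    have "\<exists>r>q. \<exists>\<psi>. Sec r \<psi>"
    proof (rule extend)
      show "compact C" unfolding C_def by (rule compact_continuous_image[OF cont_b compact_cball])
      show "C \<subseteq> W" using sec_b by (auto simp: C_def)
      show "inj_on f C" using sec_b by (force simp: C_def inj_on_def)
      show "x0 \<in> C" unfolding C_def using q psi'(2) by (intro image_eqI[of _ _ 0]) (auto simp: \<psi>b_def)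
      show "cball 0 q \<subseteq> f ` C" using sec_b by (force simp: C_def image_iff)
    qed (use q in simp)
    then obtain r \<psi>' where "r > q" "Sec r \<psi>'" by blast
    then have "min r r0 \<in> S" using q Sec_mono[of r \<psi>' "min r r0"] by (auto simp: S_def)
    then have "min r r0 \<le> q" unfolding q_def using bdd by (rule cSup_upper)
    then show False using \<open>r > q\<close> q \<open>q \<noteq> r0\<close> by auto
  qed
  then show ?thesis using that psi by (auto simp: Sec_def)
qed

section \<open>Paths in the end\<close>

lemma derivative_near:
  fixes f :: "real^2 \<Rightarrow> 'b::real_normed_vector"
  assumes X: "open X" "x \<in> X" and f: "Ck 1 X f" and B: "B > 0"
  obtains e where "e > 0" "ball x e \<subseteq> X"
    "\<And>y v. y \<in> ball x e \<Longrightarrow> norm (frechet f y v - frechet f x v) \<le> B * norm v"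
proof -
  let ?D = "\<lambda>y. frechet f y"
  have fd: "f differentiable at y" if "y \<in> X" for y by (rule Ck_differentiable[OF f that])
  obtain e0 where e0: "e0 > 0" "ball x e0 \<subseteq> X" using X openE by blast
  have "\<exists>d>0. \<forall>y\<in>ball x d. norm (pd i f y - pd i f x) < B/2" for i
  proof -
    have "continuous_on X (pd i f)" using Ck_continuous_on[OF Ck_pd[OF X(1), of 0 f i]] f by simp
    then have "isCont (pd i f) x" using X continuous_on_eq_continuous_at by blast
    then obtain d where "d > 0" "\<And>y. dist y x < d \<Longrightarrow> dist (pd i f y) (pd i f x) < B/2"
      using B(1) unfolding continuous_at_eps_delta by (metis divide_pos_pos zero_less_numeral)
    then show ?thesis by (intro exI[of _ d]) (auto simp: dist_norm norm_minus_commute)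
  qed
  then obtain d where d: "\<And>i. d i > 0" "\<And>i y. y \<in> ball x (d i) \<Longrightarrow> norm (pd i f y - pd i f x) < B/2"
    by metis
  define e where "e = Min {e0, d 1, d 2}"
  have e: "e > 0" "ball x e \<subseteq> ball x e0" "\<And>i. ball x e \<subseteq> ball x (d i)"
  proof -
    show "e > 0" using e0 d(1)[of 1] d(1)[of 2] by (simp add: e_def)
    show "ball x e \<subseteq> ball x e0" by (rule subset_ball) (simp add: e_def)
    fix i :: 2
    have "e \<le> d i" using exhaust_2[of i] by (auto simp: e_def)
    then show "ball x e \<subseteq> ball x (d i)" by (rule subset_ball)
  qed
  have "norm (?D y v - ?D x v) \<le> B * norm v" if y: "y \<in> ball x e" for y v
  proof -
    have yX: "y \<in> X" using y e e0 by blast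
    have eq: "?D y v - ?D x v = v $ 1 *\<^sub>R (pd 1 f y - pd 1 f x) + v $ 2 *\<^sub>R (pd 2 f y - pd 2 f x)"
      by (subst has_derivative_pd_sum[OF fd[OF yX], of v], subst has_derivative_pd_sum[OF fd[OF X(2)], of v])
        (simp add: sum_2 algebra_simps)
    have t: "norm (v $ i *\<^sub>R (pd i f y - pd i f x)) \<le> norm v * (B/2)" for i
      unfolding norm_scaleR real_norm_def
      by (rule mult_mono[OF component_le_norm_cart less_imp_le[OF d(2)[OF subsetD[OF e(3) y]]]]) auto
    have "norm (?D y v - ?D x v) \<le> norm v * (B/2) + norm v * (B/2)"
      unfolding eq by (rule norm_triangle_le[OF add_mono[OF t t]])
    then show ?thesis by (simp add: mult.commute)
  qed
  moreover have "ball x e \<subseteq> X" using e(2) e0(2) by blast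
  ultimately show ?thesis using that[OF e(1)] by blast
qed

text \<open>Near \<open>x\<close> the map differs from its linearization by a map whose Lipschitz
  constant is half the lower bound \<open>B\<close> of the derivative.\<close>

lemma local_bilipschitz:
  fixes f :: "real^2 \<Rightarrow> 'b::euclidean_space"
  assumes X: "open X" "x \<in> X" and f: "Ck 1 X f" and inj: "\<And>v. v \<noteq> 0 \<Longrightarrow> frechet f x v \<noteq> 0"
  obtains e c where "e > 0" "c > 0" "ball x e \<subseteq> X"
    "\<And>u v. u \<in> ball x e \<Longrightarrow> v \<in> ball x e \<Longrightarrow> c * norm (u - v) \<le> norm (f u - f v)"
proof -
  let ?D = "\<lambda>y. frechet f y"
  have fd: "f differentiable at y" if "y \<in> X" for y by (rule Ck_differentiable[OF f that])
  have lin: "linear (?D x)" by (rule linear_frechet_derivative[OF fd[OF X(2)]])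
  have "inj (?D x)" using inj linear_injective_0[OF lin] by blast
  then obtain B where B: "B > 0" "\<And>v. B * norm v \<le> norm (?D x v)"
    using linear_inj_bounded_below_pos[OF lin] by metis
  obtain e where e: "e > 0" "ball x e \<subseteq> X" and bound: "\<And>y v. y \<in> ball x e \<Longrightarrow> norm (?D y v - ?D x v) \<le> B/2 * norm v"
    using derivative_near[OF X f half_gt_zero[OF B(1)]] by metis
  have lip: "norm ((f u - ?D x u) - (f v - ?D x v)) \<le> B/2 * norm (u - v)" if "u \<in> ball x e" "v \<in> ball x e" for u v
  proof (rule differentiable_bound[where S = "ball x e" and f' = "\<lambda>y w. ?D y w - ?D x w"])
    fix y assume y: "y \<in> ball x e"
    then have "y \<in> X" using e by blast
    then have "((\<lambda>w. f w - ?D x w) has_derivative (\<lambda>w. ?D y w - ?D x w)) (at y)"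
      by (intro has_derivative_diff Ck_has_derivative[OF f] linear_imp_has_derivative lin)
    then show "((\<lambda>w. f w - ?D x w) has_derivative (\<lambda>w. ?D y w - ?D x w)) (at y within ball x e)"
      by (rule has_derivative_at_withinI)
    show "onorm (\<lambda>w. ?D y w - ?D x w) \<le> B/2" by (rule onorm_le[OF bound[OF y]])
  qed (use that in auto)
  have "B/2 * norm (u - v) \<le> norm (f u - f v)" if "u \<in> ball x e" "v \<in> ball x e" for u v
  proof -
    have "B * norm (u - v) \<le> norm (?D x u - ?D x v)" using B(2)[of "u - v"] by (simp add: linear_diff[OF lin])
    also have "?D x u - ?D x v = (f u - f v) - ((f u - ?D x u) - (f v - ?D x v))" by simp
    also have "norm \<dots> \<le> norm (f u - f v) + norm ((f u - ?D x u) - (f v - ?D x v))" by (rule norm_triangle_ineq4)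
    also have "\<dots> \<le> norm (f u - f v) + B/2 * norm (u - v)" using lip[OF that] by simp
    finally show ?thesis by simp
  qed
  then show ?thesis using that[OF e(1) half_gt_zero[OF B(1)] e(2)] by blast
qed

lemma pullback_quadratic:
  assumes "\<xi> differentiable at x"
  shows "v \<bullet> (pullback h \<xi> x *v v) = ipM (h (\<xi> x)) (frechet \<xi> x v) (frechet \<xi> x v)"
  unfolding has_derivative_pd_sum[OF assms, of v] pullback_gram gram_def D1_def
  by (simp add: inner_vec_def matrix_vector_mult_def sum_2 ipM_simps algebra_simps)

section \<open>Immersedness and completeness of the end\<close>

locale willmore_end =
  fixes h :: "real^'m \<Rightarrow> real^'m^'m" and \<xi> :: "real^2 \<Rightarrow> real^'m" and \<tau> :: real
  assumes riem: "riemannian_metric h" and tau: "0 < \<tau>" and flat: "asymptotically_flat \<tau> h"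
    and immersion: "weak_immersion h \<xi>" and smooth: "smooth_on open_pdisk \<xi>"
    and critical: "willmore_critical h \<xi>" and complete: "complete_end h \<xi>"
begin

lemma xi_Ck: "Ck n open_pdisk \<xi>"
  using smooth_on_imp_Ck[OF smooth] Ck_subset by metis

lemma xi_differentiable: "x \<in> open_pdisk \<Longrightarrow> \<xi> differentiable at x"
  by (rule Ck_differentiable[OF xi_Ck])

lemma xi_continuous: "continuous_on open_pdisk \<xi>"
  by (rule Ck_continuous_on[OF xi_Ck])

lemma open_pdisk_subset: "open_pdisk \<subseteq> pdisk 1"
  by (auto simp: open_pdisk_def pdisk_def)

lemma xi_ext: "\<xi> ` open_pdisk \<subseteq> exterior"
  using immersion open_pdisk_subset by (auto simp: weak_immersion_def)

text \<open>The lower bound of the weak immersion holds almost everywhere only. As \<xi> is smooth,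
  the set where it fails for a fixed vector is open near \<open>x\<close>; being a null set, it is
  empty.\<close>

lemma immersed:
  assumes x: "x \<in> open_pdisk" and v: "v \<noteq> 0"
  shows "frechet \<xi> x v \<noteq> 0"
proof
  assume 0: "frechet \<xi> x v = 0"
  obtain e where e: "e > 0" "cball x e \<subseteq> open_pdisk"
    using open_contains_cball open_open_pdisk x by blast
  have "compact (cball x e)" "cball x e \<subseteq> pdisk 1" using e open_pdisk_subset by auto
  then obtain C where C: "C > 0" "AE y in lebesgue. y \<in> cball x e \<longrightarrow>
      (\<forall>X. norm X / C \<le> norm (frechet \<xi> y X) \<and> norm (frechet \<xi> y X) \<le> C * norm X)"
    using immersion unfolding weak_immersion_def by blast
  let ?N = "{y \<in> ball x e. norm (frechet \<xi> y v) < norm v / C}"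
  have "AE y in lebesgue. y \<notin> ?N" using C(2) by eventually_elim (auto simp: not_less)
  then have "negligible ?N" unfolding eventually_ae_filter_negligible by (auto intro: negligible_subset)
  moreover have "open ?N"
  proof -
    have "continuous_on (ball x e) (\<lambda>y. frechet \<xi> y v)"
      using Ck_continuous_on[OF Ck_frechet[OF open_open_pdisk xi_Ck[of "Suc 0"]], of v] e(2)
      by (rule continuous_on_subset[OF _ subset_trans[OF ball_subset_cball]])
    then have "open (ball x e \<inter> (\<lambda>y. norm (frechet \<xi> y v)) -` {..<norm v / C})"
      by (intro continuous_open_preimage continuous_intros) auto
    moreover have "ball x e \<inter> (\<lambda>y. norm (frechet \<xi> y v)) -` {..<norm v / C} = ?N" by auto
    ultimately show ?thesis by simp
  qed
  moreover have "x \<in> ?N" using e 0 v C(1) by simp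
  ultimately show False using open_not_negligible by blast
qed

lemma D_xi_vector_derivative:
  assumes "(\<gamma> has_vector_derivative D) (at t)" "\<gamma> t \<in> open_pdisk"
  shows "((\<lambda>t. \<xi> (\<gamma> t)) has_vector_derivative frechet \<xi> (\<gamma> t) D) (at t)"
proof -
  interpret linear "frechet \<xi> (\<gamma> t)" by (rule linear_frechet_derivative[OF xi_differentiable[OF assms(2)]])
  show ?thesis
    using has_derivative_compose[OF assms(1)[unfolded has_vector_derivative_def] Ck_has_derivative[OF xi_Ck assms(2)]]
    by (simp add: has_vector_derivative_def scaleR)
qed

lemma norm_vector_derivative_le_lipschitz:
  fixes g :: "real \<Rightarrow> 'b::real_normed_vector"
  assumes g: "(g has_vector_derivative D) (at t)" and t: "t \<in> {0<..<1}"
    and L: "\<And>s t. s \<in> {0..<1} \<Longrightarrow> t \<in> {0..<1} \<Longrightarrow> norm (g s - g t) \<le> M * \<bar>s - t\<bar>"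
  shows "norm D \<le> M"
proof (rule field_le_epsilon)
  fix e :: real assume e: "e > 0"
  obtain d where d: "d > 0" "\<And>u. norm (u - t) < d \<Longrightarrow> norm (g u - g t - (u - t) *\<^sub>R D) \<le> e * norm (u - t)"
    using g e unfolding has_vector_derivative_def has_derivative_at_alt by blast
  define u where "u = t + min (d/2) ((1 - t)/2)"
  have u: "u > t" "u < 1" "norm (u - t) < d" using t d(1) by (auto simp: u_def min_def field_simps)
  have "norm ((u - t) *\<^sub>R D) = norm ((g u - g t) - (g u - g t - (u - t) *\<^sub>R D))" by simp
  also have "\<dots> \<le> norm (g u - g t) + norm (g u - g t - (u - t) *\<^sub>R D)" by (rule norm_triangle_ineq4)
  also have "\<dots> \<le> M * \<bar>u - t\<bar> + e * norm (u - t)" using d(2)[OF u(3)] L[of u t] u t by (intro add_mono) auto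
  finally have "(u - t) * norm D \<le> M * (u - t) + e * (u - t)" using u(1) by (simp only: norm_scaleR real_norm_def abs_of_pos diff_gt_0_iff_gt)
  also have "\<dots> = (u - t) * (M + e)" by (simp add: algebra_simps)
  finally show "norm D \<le> M + e" using u(1) by simp
qed

text \<open>Points whose image is this far out stay away from the boundary circle, so a path among
  them can only leave the domain through the puncture; and lengths in \<open>h\<close> are
  comparable to Euclidean ones.\<close>

definition far where
  "far R \<longleftrightarrow> R \<ge> 2 \<and> (\<forall>x\<in>pdisk 1. R \<le> norm (\<xi> x) \<longrightarrow> norm x < 1/2) \<and>
    (\<forall>p. R \<le> norm p \<longrightarrow> norm (h p - mat 1) \<le> 1/4)"

lemma ex_far: "\<exists>R. far R"
proof -
  obtain C R where C: "C > 0" "R \<ge> 2" "\<And>p. norm p \<ge> R \<Longrightarrow> norm (h p - mat 1) \<le> C * norm p powr (- \<tau>)"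
    using metric_decay[OF riem flat tau] by metis
  have "((\<lambda>r. C * r powr (- \<tau>)) \<longlongrightarrow> C * 0) at_top"
    by (intro tendsto_mult tendsto_const tendsto_neg_powr filterlim_ident) (use tau in auto)
  then have "\<forall>\<^sub>F r in at_top. C * r powr (- \<tau>) < 1/4" by (rule order_tendstoD) simp
  then obtain R1 where R1: "\<And>r. r \<ge> R1 \<Longrightarrow> C * r powr (- \<tau>) < 1/4" unfolding eventually_at_top_linorder by blast
  let ?K = "cball 0 1 - ball (0::real^2) (1/2)"
  have sub: "?K \<subseteq> pdisk 1" by (auto simp: pdisk_def)
  have "continuous_on (pdisk 1) \<xi>" unfolding continuous_on_eq_continuous_within
  proof
    fix x assume x: "x \<in> pdisk 1"
    then obtain u L where u: "u > 0" "L-lipschitz_on (cball x u \<inter> pdisk 1) \<xi>"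
      using immersion unfolding weak_immersion_def by blast
    have "continuous_on (cball x u \<inter> pdisk 1) \<xi>" by (rule lipschitz_on_continuous_on[OF u(2)])
    then have "continuous (at x within cball x u \<inter> pdisk 1) \<xi>"
      using x u(1) by (auto simp: continuous_on_eq_continuous_within)
    moreover have "at x within cball x u \<inter> pdisk 1 = at x within pdisk 1"
      by (rule at_within_nhd[of x "ball x u"]) (use u in auto)
    ultimately show "continuous (at x within pdisk 1) \<xi>" by simp
  qed
  then have "compact (\<xi> ` ?K)"
    by (intro compact_continuous_image continuous_on_subset[OF _ sub] compact_diff) auto
  then obtain B where B: "\<And>p. p \<in> \<xi> ` ?K \<Longrightarrow> norm p \<le> B" using compact_imp_bounded bounded_iff by metis
  have "norm x < 1/2" if "x \<in> pdisk 1" "B + 1 \<le> norm (\<xi> x)" for x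
    using B[of "\<xi> x"] that by (force simp: pdisk_def)
  moreover have "norm (h p - mat 1) \<le> 1/4" if "max R R1 \<le> norm p" for p
    using C(3)[of p] R1[of "norm p"] that by auto
  ultimately show ?thesis unfolding far_def using C(2) by (intro exI[of _ "max (B + 1) (max R R1)"]) auto
qed

text \<open>Near a cluster point of \<open>\<Gamma>\<close> other than \<open>0\<close> the map \<open>\<xi>\<close> is bilipschitz, so that \<open>\<Gamma>\<close> converges to it;
  without such a point \<open>\<Gamma>\<close> would tend to \<open>0\<close> with finite length.\<close>

lemma escape:
  assumes R: "far R" and pw: "\<And>b. b \<in> {0<..<1} \<Longrightarrow> \<Gamma> piecewise_C1_differentiable_on {0..b}"
    and sub: "\<Gamma> ` {0..<1} \<subseteq> open_pdisk" and ge: "\<And>t. t \<in> {0..<1} \<Longrightarrow> R \<le> norm (\<xi> (\<Gamma> t))"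
    and L: "\<And>s t. s \<in> {0..<1} \<Longrightarrow> t \<in> {0..<1} \<Longrightarrow> norm (\<xi> (\<Gamma> s) - \<xi> (\<Gamma> t)) \<le> M * \<bar>s - t\<bar>"
  obtains z where "z \<in> open_pdisk" "(\<Gamma> \<longlongrightarrow> z) (at_left 1)"
proof -
  have M0: "M \<ge> 0" using order_trans[OF norm_ge_zero L[of "1/2" 0]] by simp
  have half: "norm (\<Gamma> t) < 1/2" if "t \<in> {0..<1}" for t
    using R ge[OF that] sub that open_pdisk_subset unfolding far_def by blast
  have not0: "\<not> (\<Gamma> \<longlongrightarrow> 0) (at_left 1)"
  proof
    assume "(\<Gamma> \<longlongrightarrow> 0) (at_left 1)"
    then have inf: "(\<integral>\<^sup>+t\<in>{0..<1}. ennreal (sqrt (vector_derivative \<Gamma> (at t) \<bullet>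
        (pullback h \<xi> (\<Gamma> t) *v vector_derivative \<Gamma> (at t)))) \<partial>lborel) = \<infinity>"
      using complete pw sub unfolding complete_end_def by blast
    have "\<exists>S. finite S \<and> (\<forall>t\<in>{0..b} - S. \<Gamma> differentiable (at t))" if "b \<in> {0<..<1}" for b
      using pw[OF that] unfolding piecewise_C1_differentiable_on_def C1_differentiable_on_def
      by (meson differentiableI_vector)
    then obtain S where S: "\<And>b. b \<in> {0<..<1} \<Longrightarrow> finite (S b)"
      "\<And>b t. b \<in> {0<..<1} \<Longrightarrow> t \<in> {0..b} - S b \<Longrightarrow> \<Gamma> differentiable (at t)" by metis
    \<comment> \<open>The path is piecewise smooth on each interval ending before 1, so exceptional
      points may accumulate at 1; countably many still form a null set. The point 0 is added to
      leave interior times.\<close>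
    define N where "N = insert 0 (\<Union>n. S (1 - 1 / (real n + 2)))"
    have bn: "1 - 1 / (real n + 2) \<in> {0<..<1}" for n by simp
    have "countable N" unfolding N_def using S(1)[OF bn] by (intro countable_insert countable_UN) (auto simp: countable_finite)
    then have "AE t in lborel. t \<notin> N" using countable_imp_null_set_lborel AE_not_in by blast
    then have "AE t in lborel. ennreal (sqrt (vector_derivative \<Gamma> (at t) \<bullet>
        (pullback h \<xi> (\<Gamma> t) *v vector_derivative \<Gamma> (at t)))) * indicator {0..<1} t \<le> ennreal (2 * M) * indicator {0..<1} t"
    proof eventually_elim
      case (elim t)
      show ?case
      proof (cases "t \<in> {0..<1}")
        case True
        obtain n :: nat where "1 / (1 - t) < real n" using reals_Archimedean2 by blast
        then have "t \<le> 1 - 1 / (real n + 2)" using True by (simp add: field_simps)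
        then have "\<Gamma> differentiable (at t)" using S(2)[OF bn, of t n] elim True by (auto simp: N_def)
        then have d: "(\<Gamma> has_vector_derivative vector_derivative \<Gamma> (at t)) (at t)" by (simp add: vector_derivative_works)
        define w where "w = frechet \<xi> (\<Gamma> t) (vector_derivative \<Gamma> (at t))"
        have op: "\<Gamma> t \<in> open_pdisk" using sub True by blast
        have "0 < t" using True elim by (cases "t = 0") (auto simp: N_def)
        then have w: "norm w \<le> M"
          using norm_vector_derivative_le_lipschitz[OF D_xi_vector_derivative[OF d op] _ L] True by (simp add: w_def)
        \<comment> \<open>As \<open>h\<close> is within 1/4 of the identity, the speed in
          \<open>h\<close> is at most twice the Euclidean one, and the total length at most 2
          M.\<close>
        have "ipM (h (\<xi> (\<Gamma> t))) w w \<le> w \<bullet> w + 1/4 * norm w * norm w"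
          using ipM_near_id[of "h (\<xi> (\<Gamma> t))" "1/4" w w] R ge[OF True] unfolding far_def by (smt (verit))
        also have "\<dots> \<le> (2 * norm w)\<^sup>2" by (simp add: dot_square_norm power2_eq_square)
        also have "\<dots> \<le> (2 * M)\<^sup>2" using w by (intro power_mono) auto
        finally have "sqrt (ipM (h (\<xi> (\<Gamma> t))) w w) \<le> 2 * M" using M0 by (intro real_le_lsqrt) auto
        then show ?thesis unfolding pullback_quadratic[OF xi_differentiable[OF op]] w_def[symmetric]
          by (intro mult_right_mono ennreal_leI) auto
      qed simp
    qed
    then have "(\<integral>\<^sup>+t\<in>{0..<1}. ennreal (sqrt (vector_derivative \<Gamma> (at t) \<bullet>
        (pullback h \<xi> (\<Gamma> t) *v vector_derivative \<Gamma> (at t)))) \<partial>lborel) \<le> (\<integral>\<^sup>+t. ennreal (2 * M) * indicator {0..<1::real} t \<partial>lborel)"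
      by (rule nn_integral_mono_AE)
    also have "\<dots> = ennreal (2 * M)" by (simp add: nn_integral_cmult_indicator)
    finally show False using inf by (simp add: top_unique)
  qed
  \<comment> \<open>A path that does not tend to 0 visits, at times arbitrarily close to 1, a
    compact annulus inside the half disc; this yields a cluster point different from 0.\<close>
  have "\<exists>z. z \<noteq> 0 \<and> norm z \<le> 1/2 \<and> (\<forall>e>0. \<forall>a<1. \<exists>t\<in>{0..<1}. a < t \<and> dist (\<Gamma> t) z < e)"
  proof -
    obtain e where e: "e > 0" "\<not> (\<forall>\<^sub>F t in at_left 1. dist (\<Gamma> t) 0 < e)" using not0 unfolding tendsto_iff by blast
    have "\<exists>t\<in>{0..<1}. a < t \<and> e \<le> norm (\<Gamma> t)" if "a < 1" for a
    proof (rule ccontr)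
      assume neg: "\<not> ?thesis"
      have "\<forall>\<^sub>F t in at_left 1. t \<in> {max a 0<..<1}" using that by (intro eventually_at_left_real) auto
      then have "\<forall>\<^sub>F t in at_left 1. dist (\<Gamma> t) 0 < e" by eventually_elim (use neg in \<open>force simp: not_le\<close>)
      then show False using e by blast
    qed
    then have "\<forall>n. \<exists>t\<in>{0..<1}. 1 - 1 / real (Suc n) < t \<and> e \<le> norm (\<Gamma> t)" by simp
    then obtain t where t: "\<And>n. t n \<in> {0..<1}" "\<And>n. 1 - 1 / real (Suc n) < t n" "\<And>n. e \<le> norm (\<Gamma> (t n))" by metis
    have cc: "compact (cball 0 (1/2) - ball (0::real^2) e)" by (intro compact_diff) auto
    have tc: "\<forall>n. \<Gamma> (t n) \<in> cball 0 (1/2) - ball 0 e"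
      using t(3) less_imp_le[OF half[OF t(1)]] by (simp add: not_less)
    obtain z r where z: "z \<in> cball 0 (1/2) - ball 0 e" "strict_mono r" "((\<lambda>n. \<Gamma> (t n)) \<circ> r) \<longlonglongrightarrow> z"
      using cc[unfolded compact_def, THEN spec, THEN mp, OF tc] by blast
    have "\<exists>t\<in>{0..<1}. a < t \<and> dist (\<Gamma> t) z < u" if "u > 0" "a < 1" for u a
    proof -
      obtain N where N: "\<And>n. n \<ge> N \<Longrightarrow> dist (\<Gamma> (t (r n))) z < u"
        using z(3) \<open>u > 0\<close> unfolding lim_sequentially o_def by blast
      obtain n :: nat where n: "1 / (1 - a) < real n" using reals_Archimedean2 by blast
      define k where "k = max N n"
      have "n \<le> r k" using seq_suble[OF z(2), of k] by (simp add: k_def)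
      then have "1 / (1 - a) < real (Suc (r k))" using n by linarith
      then have "a < 1 - 1 / real (Suc (r k))" using that by (simp add: field_simps)
      then show ?thesis using t(1,2)[of "r k"] N[of k] by (intro bexI[of _ "t (r k)"]) (auto simp: k_def)
    qed
    then show ?thesis using z(1) e(1) by (intro exI[of _ z]) auto
  qed
  then obtain z where z: "z \<noteq> 0" "norm z \<le> 1/2" and cl: "\<And>e a. e > 0 \<Longrightarrow> a < 1 \<Longrightarrow> \<exists>t\<in>{0..<1}. a < t \<and> dist (\<Gamma> t) z < e"
    by blast
  have zp: "z \<in> open_pdisk" using z by (simp add: open_pdisk_def)
  obtain e c where e: "e > 0" "c > 0" "ball z e \<subseteq> open_pdisk"
    and bl: "\<And>u v. u \<in> ball z e \<Longrightarrow> v \<in> ball z e \<Longrightarrow> c * norm (u - v) \<le> norm (\<xi> u - \<xi> v)"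
    using local_bilipschitz[OF open_open_pdisk zp xi_Ck immersed[OF zp]] by metis
  have near: "\<exists>a\<in>{0..<1}. \<forall>t\<in>{a..<1}. dist (\<Gamma> t) z < u" if u: "0 < u" "u \<le> e" for u
  proof -
    \<comment> \<open>After the time \<open>a\<close> the remaining path moves \<xi> by less than c
      u / 8, whereas getting from distance u/4 of \<open>z\<close> to distance u/2 would take at
      least c u / 4. Adding 1 to \<open>M\<close> keeps the quotient defined.\<close>
    define a0 where "a0 = 1 - c * u / (8 * (M + 1))"
    have "a0 < 1" using e u M0 by (simp add: a0_def)
    then obtain a where a: "a \<in> {0..<1}" "a0 < a" "dist (\<Gamma> a) z < u/4" using cl[of "u/4" a0] u by auto
    have Ma: "M * (1 - a) < c * (u / 8)"
    proof -
      have "M * (1 - a) \<le> (M + 1) * (1 - a)" using a by (intro mult_right_mono) auto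
      also have "\<dots> < (M + 1) * (c * u / (8 * (M + 1)))" using a M0 by (intro mult_strict_left_mono) (auto simp: a0_def)
      also have "\<dots> = c * (u / 8)" using M0 by (simp add: field_simps)
      finally show ?thesis .
    qed
    have "dist (\<Gamma> t) z < u" if t: "t \<in> {a..<1}" for t
    proof (rule ccontr)
      assume "\<not> dist (\<Gamma> t) z < u"
      moreover have "continuous_on {a..t} (\<lambda>t. dist (\<Gamma> t) z)"
      proof -
        obtain b where b: "t < b" "b < 1" "0 < b" using t a dense[of t 1] by auto
        then have "continuous_on {0..b} \<Gamma>" using pw[of b] by (simp add: piecewise_C1_differentiable_on_def)
        then have "continuous_on {a..t} \<Gamma>" by (rule continuous_on_subset) (use a b in auto)
        then show ?thesis by (intro continuous_intros)
      qed
      ultimately obtain t' where t': "a \<le> t'" "t' \<le> t" "dist (\<Gamma> t') z = u/2"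
        using IVT'[of "\<lambda>t. dist (\<Gamma> t) z" a "u/2" t] a t u by auto
      have "c * norm (\<Gamma> t' - \<Gamma> a) \<le> norm (\<xi> (\<Gamma> t') - \<xi> (\<Gamma> a))"
        using t' a u by (intro bl) (auto simp: dist_commute)
      also have "\<dots> \<le> M * \<bar>t' - a\<bar>" using t' t a by (intro L) auto
      also have "\<dots> \<le> M * (1 - a)" using t' t M0 by (intro mult_left_mono) auto
      also note Ma
      finally have "norm (\<Gamma> t' - \<Gamma> a) < u / 8" using e(2) by simp
      then show False using dist_triangle[of "\<Gamma> t'" z "\<Gamma> a"] t'(3) a(3) u by (simp add: dist_norm)
    qed
    then show ?thesis using a by blast
  qed
  have "(\<Gamma> \<longlongrightarrow> z) (at_left 1)" unfolding tendsto_iff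
  proof (intro allI impI)
    fix u :: real assume "u > 0"
    then obtain a where a: "a \<in> {0..<1}" "\<forall>t\<in>{a..<1}. dist (\<Gamma> t) z < min u e" using near[of "min u e"] e by auto
    have "\<forall>\<^sub>F t in at_left 1. t \<in> {a<..<1}" using a by (intro eventually_at_left_real) auto
    then show "\<forall>\<^sub>F t in at_left 1. dist (\<Gamma> t) z < u" by eventually_elim (use a in auto)
  qed
  then show ?thesis using that zp by blast
qed

end

section \<open>Graphs over tangent planes\<close>

lemma section_derivative:
  fixes f \<psi> :: "real^'n \<Rightarrow> real^'n"
  assumes f: "f differentiable at (\<psi> y)" and B: "open B" "y \<in> B" and c: "continuous_on B \<psi>"
    and sec: "\<And>z. z \<in> B \<Longrightarrow> f (\<psi> z) = z" and d: "det (matrix (frechet f (\<psi> y))) \<noteq> 0"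
  shows "(\<psi> has_derivative (\<lambda>v. matrix_inv (matrix (frechet f (\<psi> y))) *v v)) (at y)"
    and "frechet f (\<psi> y) (frechet \<psi> y v) = v"
proof -
  let ?D = "frechet f (\<psi> y)"
  have lin: "linear ?D" by (rule linear_frechet_derivative[OF f])
  have inv: "matrix_inv (matrix ?D) ** matrix ?D = mat 1" "matrix ?D ** matrix_inv (matrix ?D) = mat 1"
    using d by (simp_all add: matrix_inv_left matrix_inv_right invertible_det_nz)
  have m: "?D w = matrix ?D *v w" for w using lin by (simp add: linear_matrix_vector_mul_eq[symmetric] matrix_works)
  show 1: "(\<psi> has_derivative (\<lambda>v. matrix_inv (matrix ?D) *v v)) (at y)"
  proof (rule has_derivative_inverse_basic[where f = f and g = \<psi> and y = y and T = B, OF _ _ _ _ B sec])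
    show "(f has_derivative ?D) (at (\<psi> y))" using f by (simp add: frechet_derivative_works)
    show "(\<lambda>v. matrix_inv (matrix ?D) *v v) \<circ> ?D = id"
      by (rule ext) (simp add: m matrix_vector_mul_assoc inv)
    show "isCont \<psi> y" using c B continuous_on_eq_continuous_at by blast
  qed auto
  show "?D (frechet \<psi> y v) = v"
    by (subst frechet_eqI[OF 1], subst m) (simp add: matrix_vector_mul_assoc inv)
qed

text \<open>Bootstrapping: the derivative of the section is the inverse of the derivative of
  \<open>f\<close> taken along the section, hence as smooth as the section itself.\<close>

lemma Ck_section:
  fixes f \<psi> :: "real^'n \<Rightarrow> real^'n"
  assumes X: "open X" and f: "\<And>n. Ck n X f" and B: "open B" and c: "continuous_on B \<psi>"
    and sub: "\<psi> ` B \<subseteq> X" and sec: "\<And>y. y \<in> B \<Longrightarrow> f (\<psi> y) = y"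
    and d: "\<And>y. y \<in> B \<Longrightarrow> det (matrix (frechet f (\<psi> y))) \<noteq> 0"
  shows "Ck n B \<psi>"
proof (induction n)
  have der: "(\<psi> has_derivative (\<lambda>v. matrix_inv (matrix (frechet f (\<psi> y))) *v v)) (at y)" if "y \<in> B" for y
    by (rule section_derivative(1)[OF Ck_differentiable[OF f] B that c sec d[OF that]]) (use that sub in auto)
  {
    case 0
    show ?case using der by (auto intro: differentiableI)
  next
    case (Suc n)
    show ?case
    proof (rule Ck_SucI[OF B der])
      fix v :: "real^'n"
      have e: "Ck n B (\<lambda>y. frechet f (\<psi> y) w)" for w
        by (rule Ck_compose[OF B X sub Suc Ck_frechet[OF X f]])
      have "Ck n B (\<lambda>y. matrix (frechet f (\<psi> y)))"
        unfolding matrix_def by (intro Ck_vec_lambda Ck_vec_nth B e)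
      then have "Ck n B (\<lambda>y. matrix_inv (matrix (frechet f (\<psi> y))))" by (rule Ck_matrix_inv[OF B _ d])
      then show "Ck n B (\<lambda>y. matrix_inv (matrix (frechet f (\<psi> y))) *v v)"
        by (intro Ck_bounded_linear[OF B, where L = "\<lambda>M. M *v v"] linear_conv_bounded_linear[THEN iffD1])
          (auto simp: linear_iff matrix_vector_mult_add_rdistrib scaleR_matrix_vector_assoc)
    qed
  }
qed

lemma Aform_normalized:
  assumes "gram M P = mat 1"
  shows "Aform (M, P) Q Q = (\<Sum>i\<in>UNIV. \<Sum>j\<in>UNIV. ipM M (nproj M P (Q $ i $ j)) (nproj M P (Q $ i $ j)))"
  unfolding Aform_def prod.case assms matrix_inv_mat_1 by (simp add: mat_def sum_2)

lemma norm22_square: "(norm (v :: 'a::real_inner^2^2))\<^sup>2 = (\<Sum>i\<in>UNIV. \<Sum>j\<in>UNIV. (norm (v $ i $ j))\<^sup>2)"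
  by (simp add: power2_norm_eq_inner inner_vec_def)

lemma ipM_near_id_bounds:
  assumes "norm (M - mat 1) \<le> 1/4"
  shows "3/4 * (norm v)\<^sup>2 \<le> ipM M v v" "ipM M v v \<le> 5/4 * (norm v)\<^sup>2"
proof -
  have "\<bar>ipM M v v - (norm v)\<^sup>2\<bar> \<le> 1/4 * (norm v)\<^sup>2"
    using ipM_near_id[OF assms, of v v] by (simp add: dot_square_norm power2_eq_square)
  then show "3/4 * (norm v)\<^sup>2 \<le> ipM M v v" "ipM M v v \<le> 5/4 * (norm v)\<^sup>2" by linarith+
qed

lemma nproj_contraction:
  assumes "gram M P = mat 1" "transpose M = M"
  shows "ipM M (nproj M P v) (nproj M P v) \<le> ipM M v v"
proof -
  have g: "ipM M (P $ i) (P $ j) = (if i = j then 1 else 0)" for i j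
    using assms(1) by (simp add: gram_def vec_eq_iff mat_def)
  have "ipM M (nproj M P v) (nproj M P v) = ipM M v v - (ipM M v (P $ 1))\<^sup>2 - (ipM M v (P $ 2))\<^sup>2"
    by (simp add: nproj_normalized[OF assms(1)] sum_2 ipM_simps g ipM_commute[OF assms(2), of "P $ _" v] power2_eq_square algebra_simps)
  then show ?thesis by simp
qed

text \<open>Since \<open>H\<close> is normal for the frame, the projection leaves it unchanged and
  |A|^2 sees all of it. Half of its square is kept against the Christoffel part; with the metric
  distortion this is 3/8, and the change of the form takes away twice 1/16.\<close>

lemma hessian_bound:
  assumes nz: "(M, P) \<in> normalized" and M: "transpose M = M" and tang: "\<And>i j a. ipM M (H $ i $ j) (P $ a) = 0"
    and near: "\<bar>Aform z (H + \<Gamma>) (H + \<Gamma>) - Aform (M, P) (H + \<Gamma>) (H + \<Gamma>)\<bar> \<le> 1/16 * norm (H + \<Gamma>) * norm (H + \<Gamma>)"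
  shows "1/4 * (norm H)\<^sup>2 - 4 * (norm \<Gamma>)\<^sup>2 \<le> Aform z (H + \<Gamma>) (H + \<Gamma>)"
proof -
  have n: "norm (M - mat 1) \<le> 1/4" and g: "gram M P = mat 1" using nz by (auto simp: normalized_def)
  have e: "3/8 * (norm (H $ i $ j))\<^sup>2 - 5/4 * (norm (\<Gamma> $ i $ j))\<^sup>2 \<le>
      ipM M (nproj M P ((H + \<Gamma>) $ i $ j)) (nproj M P ((H + \<Gamma>) $ i $ j))" for i j
  proof -
    define u where "u = H $ i $ j"
    define w where "w = nproj M P (\<Gamma> $ i $ j)"
    have "nproj M P u = u" by (simp add: nproj_normalized[OF g] u_def tang)
    then have eq: "nproj M P ((H + \<Gamma>) $ i $ j) = u + w" by (simp add: nproj_add u_def w_def)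
    \<comment> \<open>The inequality |u + w|^2 \<ge> |u|^2 / 2 - |w|^2 in disguise.\<close>
    have "0 \<le> ipM M (u + 2 *\<^sub>R w) (u + 2 *\<^sub>R w)"
      using ipM_near_id_bounds(1)[OF n] by (rule order_trans[rotated]) simp
    then have "1/2 * ipM M u u - ipM M w w \<le> ipM M (u + w) (u + w)"
      by (simp add: ipM_simps algebra_simps ipM_commute[OF M, of w u])
    moreover have "3/4 * (norm u)\<^sup>2 \<le> ipM M u u" by (rule ipM_near_id_bounds(1)[OF n])
    moreover have "ipM M w w \<le> 5/4 * (norm (\<Gamma> $ i $ j))\<^sup>2"
      unfolding w_def by (rule order_trans[OF nproj_contraction[OF g M] ipM_near_id_bounds(2)[OF n]])
    ultimately show ?thesis unfolding eq u_def by linarith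
  qed
  have "3/8 * (norm H)\<^sup>2 - 5/4 * (norm \<Gamma>)\<^sup>2 = (\<Sum>i\<in>UNIV. \<Sum>j\<in>UNIV. 3/8 * (norm (H $ i $ j))\<^sup>2 - 5/4 * (norm (\<Gamma> $ i $ j))\<^sup>2)"
    by (simp add: norm22_square sum_subtractf sum_distrib_left)
  also have "\<dots> \<le> Aform (M, P) (H + \<Gamma>) (H + \<Gamma>)" unfolding Aform_normalized[OF g] by (intro sum_mono e)
  finally have 1: "3/8 * (norm H)\<^sup>2 - 5/4 * (norm \<Gamma>)\<^sup>2 \<le> Aform (M, P) (H + \<Gamma>) (H + \<Gamma>)" .
  have "(norm (H + \<Gamma>))\<^sup>2 \<le> (norm H + norm \<Gamma>)\<^sup>2" by (intro power_mono norm_triangle_ineq) auto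
  moreover have "0 \<le> (norm H - norm \<Gamma>)\<^sup>2" by simp
  ultimately have "norm (H + \<Gamma>) * norm (H + \<Gamma>) \<le> 2 * (norm H)\<^sup>2 + 2 * (norm \<Gamma>)\<^sup>2"
    by (simp add: power2_eq_square algebra_simps)
  moreover have "\<bar>a - b\<bar> \<le> 1/16 * N \<Longrightarrow> 3/8 * A - 5/4 * B \<le> b \<Longrightarrow> N \<le> 2 * A + 2 * B \<Longrightarrow> 0 \<le> B \<Longrightarrow> 1/4 * A - 4 * B \<le> a"
    for a b N A B :: real by linarith
  ultimately show ?thesis using near 1 by (simp add: mult.assoc)
qed

text \<open>Gram-Schmidt for the inner product of \<open>M\<close>, applied to the images of the two
  coordinate vectors.\<close>

lemma orthonormal_tangent:
  fixes D :: "real^2 \<Rightarrow> real^'m"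
  assumes M: "transpose M = M" "norm (M - mat 1) \<le> 1/4" and D: "linear D" "\<And>v. v \<noteq> 0 \<Longrightarrow> D v \<noteq> 0"
  obtains P where "gram M P = mat 1" "\<And>w. D w = (\<Sum>a\<in>UNIV. ipM M (D w) (P $ a) *\<^sub>R P $ a)"
proof -
  interpret linear D by (rule D(1))
  have pos: "ipM M v v > 0" if "v \<noteq> 0" for v
    by (rule less_le_trans[OF _ ipM_near_id_bounds(1)[OF M(2)]]) (simp add: that)
  define v1 where "v1 = D (axis 1 1)"
  define v2 where "v2 = D (axis 2 1)"
  have v1: "v1 \<noteq> 0" unfolding v1_def by (rule D(2)) (simp add: axis_eq_0_iff)
  define n1 where "n1 = sqrt (ipM M v1 v1)"
  have n1: "n1 > 0" "n1 * n1 = ipM M v1 v1" using pos[OF v1] by (simp_all add: n1_def)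
  define b1 where "b1 = v1 /\<^sub>R n1"
  define c where "c = ipM M v2 b1"
  define u where "u = v2 - c *\<^sub>R b1"
  have "u = D (axis 2 1 - (c / n1) *\<^sub>R axis 1 1)" by (simp add: u_def b1_def v1_def v2_def diff scale divide_inverse)
  moreover have "axis 2 1 - (c / n1) *\<^sub>R axis 1 1 \<noteq> (0 :: real^2)" by (auto simp: vec_eq_iff axis_def forall_2)
  ultimately have u: "u \<noteq> 0" using D(2) by simp
  define n2 where "n2 = sqrt (ipM M u u)"
  have n2: "n2 > 0" "n2 * n2 = ipM M u u" using pos[OF u] by (simp_all add: n2_def)
  define b2 where "b2 = u /\<^sub>R n2"
  have b11: "ipM M b1 b1 = 1" using n1 pos[OF v1] by (simp add: b1_def ipM_simps field_simps)
  have b22: "ipM M b2 b2 = 1" using n2 pos[OF u] by (simp add: b2_def ipM_simps field_simps)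
  have "ipM M u b1 = 0" by (simp add: u_def ipM_simps b11 c_def)
  then have b21: "ipM M b2 b1 = 0" "ipM M b1 b2 = 0" by (simp_all add: b2_def ipM_simps ipM_commute[OF M(1), of b1])
  define P :: "real^'m^2" where "P = (\<chi> a. if a = 1 then b1 else b2)"
  have P12: "P $ 1 = b1" "P $ 2 = b2" by (simp_all add: P_def)
  have "gram M P = mat 1" by (simp add: gram_def vec_eq_iff mat_def forall_2 P12 b11 b22 b21)
  moreover have "D w = (\<Sum>a\<in>UNIV. ipM M (D w) (P $ a) *\<^sub>R P $ a)" for w
  proof -
    have "w = w $ 1 *\<^sub>R axis 1 1 + w $ 2 *\<^sub>R axis 2 1" by (simp add: vec_eq_iff forall_2 axis_def)
    then have "D w = w $ 1 *\<^sub>R v1 + w $ 2 *\<^sub>R v2" by (metis add scale v1_def v2_def)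
    moreover have "v1 = n1 *\<^sub>R b1" "v2 = n2 *\<^sub>R b2 + c *\<^sub>R b1" using n1 n2 by (simp_all add: b1_def b2_def u_def)
    ultimately have "D w = (w $ 1 * n1 + w $ 2 * c) *\<^sub>R b1 + (w $ 2 * n2) *\<^sub>R b2"
      by (simp add: algebra_simps)
    then show ?thesis by (simp add: sum_2 P12 ipM_simps b11 b22 b21)
  qed
  ultimately show ?thesis using that by blast
qed

text \<open>A Cholesky factor \<open>l\<close> of the inverse Gram matrix turns the fourfold
  contraction into a sum of squares.\<close>

lemma Aform_nonneg:
  assumes M: "transpose M = M" and nn: "\<And>v. ipM M v v \<ge> 0" and nd: "(M, P) \<in> nondeg"
  shows "Aform (M, P) Q Q \<ge> 0"
proof -
  define g where "g = matrix_inv (gram M P)"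
  have d: "det (gram M P) > 0" using nd by (simp add: nondeg_def)
  have s: "gram M P $ 2 $ 1 = gram M P $ 1 $ 2" by (simp add: gram_def ipM_commute[OF M])
  have "gram M P $ 2 $ 2 \<noteq> 0" using d s by (auto simp: det_2)
  then have g22: "gram M P $ 2 $ 2 > 0" using nn[of "P $ 2"] by (simp add: gram_def)
  define a where "a = g $ 1 $ 1"
  define b where "b = g $ 1 $ 2"
  define c where "c = g $ 2 $ 2"
  have g12: "g $ 2 $ 1 = b" unfolding b_def g_def using matrix_inv_2[of "gram M P"] d s by simp
  have a: "a > 0" unfolding a_def g_def using matrix_inv_2[of "gram M P"] d g22 by simp
  have "det (g ** gram M P) = 1" unfolding g_def using gram_inverse(1)[of M P] d by simp
  then have "det g > 0" using d by (simp add: det_mul) (metis zero_less_mult_pos2 zero_less_one)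
  then have ac: "c - b\<^sup>2 / a \<ge> 0" using a g12 by (simp add: det_2 a_def[symmetric] b_def[symmetric] c_def[symmetric] field_simps power2_eq_square)
  define l :: "2 \<Rightarrow> 2 \<Rightarrow> real" where "l = (\<lambda>i j. if i = 1 then (if j = 1 then sqrt a else 0) else (if j = 1 then b / sqrt a else sqrt (c - b\<^sup>2 / a)))"
  have L: "g $ i $ k = (\<Sum>m\<in>UNIV. l i m * l k m)" for i k using exhaust_2[of i] exhaust_2[of k] a ac g12
    by (auto simp: l_def sum_2 a_def[symmetric] b_def[symmetric] c_def[symmetric] power2_eq_square)
  define N where "N i j = nproj M P (Q $ i $ j)" for i j
  have "Aform (M, P) Q Q = (\<Sum>m\<in>UNIV. \<Sum>n\<in>UNIV. ipM M (\<Sum>i\<in>UNIV. \<Sum>j\<in>UNIV. (l i m * l j n) *\<^sub>R N i j) (\<Sum>i\<in>UNIV. \<Sum>j\<in>UNIV. (l i m * l j n) *\<^sub>R N i j))"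
    unfolding Aform_def prod.case g_def[symmetric] N_def[symmetric] L
    by (simp add: sum_2 ipM_simps algebra_simps)
  also have "\<dots> \<ge> 0" by (intro sum_nonneg nn)
  finally show ?thesis .
qed

context willmore_end
begin

text \<open>The Gram determinant times |u|^2 is the squared length of the vector |u|^2 v - (u,v) u,
  which is nonzero because the derivative is injective.\<close>

lemma immersed_nondeg:
  assumes x: "x \<in> open_pdisk"
  shows "(h (\<xi> x), D1 \<xi> x) \<in> nondeg"
proof -
  let ?M = "h (\<xi> x)"
  have ex: "\<xi> x \<in> exterior" using xi_ext x by blast
  have p: "ipM ?M v v > 0" if "v \<noteq> 0" for v
    using riem ex that by (simp add: riemannian_metric_def ipM_def)
  have D: "frechet \<xi> x w = w $ 1 *\<^sub>R D1 \<xi> x $ 1 + w $ 2 *\<^sub>R D1 \<xi> x $ 2" for w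
    by (rule trans[OF has_derivative_pd_sum[OF xi_differentiable[OF x]]]) (simp add: sum_2 D1_def)
  define u where "u = D1 \<xi> x $ 1"
  define v where "v = D1 \<xi> x $ 2"
  have "axis 1 1 \<noteq> (0 :: real^2)" by (simp add: axis_eq_0_iff)
  from immersed[OF x this] have "u \<noteq> 0" unfolding D by (simp add: u_def axis_def)
  then have uu: "ipM ?M u u > 0" by (rule p)
  define w :: "real^2" where "w = (\<chi> i. if i = 1 then - ipM ?M u v else ipM ?M u u)"
  have w12: "w $ 1 = - ipM ?M u v" "w $ 2 = ipM ?M u u" by (simp_all add: w_def)
  have "w \<noteq> 0" using uu w12(2) by auto
  then have "ipM ?M u u *\<^sub>R v - ipM ?M u v *\<^sub>R u \<noteq> 0" using immersed[OF x, of w] unfolding D w12 by (simp add: u_def v_def)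
  from p[OF this] have "0 < ipM ?M u u * (ipM ?M u u * ipM ?M v v - ipM ?M u v * ipM ?M u v)"
    by (simp add: ipM_simps ipM_commute[OF riemannian_symmetric[OF riem ex], of v u] algebra_simps)
  then have "0 < ipM ?M u u * ipM ?M v v - ipM ?M u v * ipM ?M u v" using uu by (rule zero_less_mult_pos)
  then show ?thesis
    by (simp add: nondeg_def det_2 gram_def u_def v_def ipM_commute[OF riemannian_symmetric[OF riem ex], of "D1 \<xi> x $ 2" "D1 \<xi> x $ 1"])
qed

lemma second_ff_norm_nonneg: "x \<in> open_pdisk \<Longrightarrow> 0 \<le> second_ff_norm h \<xi> x"
  unfolding second_ff_norm_Aform real_sqrt_ge_0_iff
  by (rule Aform_nonneg[OF riemannian_symmetric[OF riem] ipM_nonneg[OF riem] immersed_nondeg]) (use xi_ext in auto)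

text \<open>The Lipschitz bound stands for a path of Euclidean length at most \<open>L\<close> on
  the surface, with parameter proportional to length. It avoids an integral and behaves well under
  concatenation.\<close>

definition reach :: "real^2 \<Rightarrow> real \<Rightarrow> real^2 \<Rightarrow> bool" where
  "reach x L y \<longleftrightarrow> (\<exists>\<gamma>. \<gamma> piecewise_C1_differentiable_on {0..1} \<and> \<gamma> ` {0..1} \<subseteq> open_pdisk \<and>
    \<gamma> 0 = x \<and> \<gamma> 1 = y \<and> (\<forall>s\<in>{0..1}. \<forall>t\<in>{0..1}. norm (\<xi> (\<gamma> s) - \<xi> (\<gamma> t)) \<le> L * \<bar>s - t\<bar>))"

end

text \<open>The scale is \<open>1 / K\<close>; \<open>P\<close> is an orthonormal basis of the tangent plane at \<open>x0\<close>, \<open>\<kappa>\<close> the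
  admitted deviation of \<open>h\<close> and of the tangent planes, and \<open>\<eta>\<close> bounds the scaled first and second
  derivatives of \<open>h\<close>.\<close>

locale tangent_chart = willmore_end h \<xi> \<tau>
  for h :: "real^'m \<Rightarrow> real^'m^'m" and \<xi> :: "real^2 \<Rightarrow> real^'m" and \<tau> :: real +
  fixes x0 :: "real^2" and K \<rho> \<kappa> \<eta> R :: real and P :: "real^'m^2"
  assumes x0: "x0 \<in> open_pdisk" and K_pos: "K > 0" and far_R: "far R"
    and P_gram: "gram (h (\<xi> x0)) P = mat 1"
    and P_span: "\<And>w. frechet \<xi> x0 w =
      (\<Sum>a\<in>UNIV. ipM (h (\<xi> x0)) (frechet \<xi> x0 w) (P $ a) *\<^sub>R P $ a)"
    and kappa: "0 < \<kappa>" "\<kappa> \<le> 1" and rho: "0 < \<rho>" "\<rho> \<le> 1" "400 * \<rho> \<le> \<kappa>"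
    and eta: "0 \<le> \<eta>" "100 * \<eta> \<le> 1" "20 * \<eta> \<le> \<kappa>"
    and A_near: "\<And>z q. norm (z - (h (\<xi> x0), P)) \<le> \<kappa> \<Longrightarrow> z \<in> nondeg \<and>
      \<bar>Aform z q q - Aform (h (\<xi> x0), P) q q\<bar> \<le> 1/16 * norm q * norm q"
    and near: "\<And>p. norm (p - \<xi> x0) \<le> 5 * \<rho> / K \<Longrightarrow> R \<le> norm p"
    and metric: "\<And>p v. norm (p - \<xi> x0) \<le> 5 * \<rho> / K \<Longrightarrow> 1 / K * norm (frechet h p v) \<le> \<eta> * norm v"
      "\<And>p v w. norm (p - \<xi> x0) \<le> 5 * \<rho> / K \<Longrightarrow> 1 / K * norm (chr h p v w) \<le> \<eta> * norm v * norm w"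
      "\<And>p u v w. norm (p - \<xi> x0) \<le> 5 * \<rho> / K \<Longrightarrow>
        (1 / K)\<^sup>2 * norm (frechet (\<lambda>p. chr h p v w) p u) \<le> \<eta> * norm u * norm v * norm w"
    and curv: "\<And>y. reach x0 (5 * \<rho> / K) y \<Longrightarrow> second_ff_norm h \<xi> y \<le> 2 * K"
begin

definition iota :: "real^2 \<Rightarrow> real^'m" where "iota v = (\<Sum>a\<in>UNIV. v $ a *\<^sub>R P $ a)"

text \<open>Tangential coordinates of the surface scaled by \<open>K\<close>, measured in the metric
  frozen at the centre.\<close>

definition f :: "real^2 \<Rightarrow> real^2" where "f x = (\<chi> a. K * ipM (h (\<xi> x0)) (\<xi> x - \<xi> x0) (P $ a))"

text \<open>The tangent plane at a point of \<open>good c\<close> is a graph of slope at most \<open>c\<close> over the one at \<open>x0\<close>.\<close>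

definition good :: "real \<Rightarrow> (real^2) set" where
  "good c = {x \<in> open_pdisk. \<forall>w. norm (K *\<^sub>R frechet \<xi> x w - iota (frechet f x w))
     \<le> c * norm (frechet f x w)}"

lemma f_Ck: "Ck n open_pdisk f"
  unfolding f_def[abs_def] by (intro Ck_vec_lambda Ck_mult Ck_const Ck_ipM Ck_diff xi_Ck open_open_pdisk)

lemma center_near: "norm (\<xi> x0 - \<xi> x0) \<le> 5 * \<rho> / K"
  using rho K_pos by simp

lemma center_normalized: "(h (\<xi> x0), P) \<in> normalized"
  using far_R near[OF center_near] P_gram by (simp add: normalized_def far_def)

lemma center_symmetric: "transpose (h (\<xi> x0)) = h (\<xi> x0)"
  using riemannian_symmetric[OF riem] x0 xi_ext by blast

lemma iota_linear: "linear iota"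
  by (simp add: linear_iff iota_def sum_2 algebra_simps)

lemma norm_iota: "norm (iota v) \<le> 4 * norm v"
proof -
  have "norm (v $ a *\<^sub>R P $ a) \<le> norm v * 2" for a unfolding norm_scaleR real_norm_def
    by (rule mult_mono[OF component_le_norm_cart normalized_norm_P(1)[OF center_normalized]]) auto
  from norm_triangle_le[OF add_mono[OF this this], of 1 2] show ?thesis
    by (simp add: iota_def sum_2 mult.commute)
qed

lemma Df: "x \<in> open_pdisk \<Longrightarrow> frechet f x w = (\<chi> a. K * ipM (h (\<xi> x0)) (frechet \<xi> x w) (P $ a))"
proof (rule frechet_eqI)
  assume x: "x \<in> open_pdisk"
  show "(f has_derivative (\<lambda>w. \<chi> a. K * ipM (h (\<xi> x0)) (frechet \<xi> x w) (P $ a))) (at x)"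
    unfolding f_def[abs_def] by (rule has_derivative_vec_lambda)
      (auto intro!: derivative_eq_intros bounded_linear.has_derivative[OF bounded_linear_ipM_left] Ck_has_derivative[OF xi_Ck x])
qed

lemma Df_inj:
  assumes "x \<in> good c" "w \<noteq> 0"
  shows "frechet f x w \<noteq> 0"
proof
  assume 0: "frechet f x w = 0"
  have "norm (K *\<^sub>R frechet \<xi> x w - iota (frechet f x w)) \<le> c * norm (frechet f x w)"
    using assms by (simp add: good_def)
  then have "K * norm (frechet \<xi> x w) \<le> 0" using K_pos by (simp add: 0 linear_0[OF iota_linear])
  then have "frechet \<xi> x w = 0" using K_pos by (simp add: mult_le_0_iff)
  moreover have "x \<in> open_pdisk" using assms by (simp add: good_def)
  ultimately show False using immersed assms(2) by blast
qed

lemma good_subset: "good c \<subseteq> open_pdisk"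
  by (auto simp: good_def)

lemma good_locally_injective:
  assumes "x \<in> good c"
  shows "\<exists>U. open U \<and> x \<in> U \<and> inj_on f U"
proof -
  have x: "x \<in> open_pdisk" using assms good_subset by blast
  obtain e c where e: "e > 0" "c > 0" "\<And>u v. u \<in> ball x e \<Longrightarrow> v \<in> ball x e \<Longrightarrow> c * norm (u - v) \<le> norm (f u - f v)"
    using local_bilipschitz[OF open_open_pdisk x f_Ck Df_inj[OF assms]] by metis
  have "inj_on f (ball x e)"
  proof (rule inj_onI)
    fix u v assume "u \<in> ball x e" "v \<in> ball x e" "f u = f v"
    then have "c * norm (u - v) \<le> 0" using e(3)[of u v] by simp
    then show "u = v" using e(2) by (simp add: mult_le_0_iff)
  qed
  then show ?thesis using e(1) by (intro exI[of _ "ball x e"]) auto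
qed

text \<open>Openness with a loss: the slack between \<kappa>/8 and \<kappa>/4 absorbs the variation
  of the derivatives near \<open>x\<close>.\<close>

lemma good_neighbourhood:
  assumes "x \<in> good (\<kappa>/8)"
  shows "\<exists>U. open U \<and> x \<in> U \<and> U \<subseteq> good (\<kappa>/4)"
proof -
  let ?Df = "\<lambda>y. frechet f y"
  have x: "x \<in> open_pdisk" using assms good_subset by blast
  have lin: "linear (?Df y)" if "y \<in> open_pdisk" for y by (rule linear_frechet_derivative[OF Ck_differentiable[OF f_Ck that]])
  have "inj (?Df x)" using Df_inj[OF assms] linear_injective_0[OF lin[OF x]] by blast
  then obtain c where c: "c > 0" "\<And>w. c * norm w \<le> norm (?Df x w)"
    using linear_inj_bounded_below_pos[OF lin[OF x]] by metis
  define g where "g y = K *\<^sub>R \<xi> y - iota (f y)" for y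
  have gC: "Ck n open_pdisk g" for n unfolding g_def[abs_def]
    by (intro Ck_diff Ck_scaleR Ck_const xi_Ck open_open_pdisk Ck_bounded_linear[OF open_open_pdisk _ f_Ck]
        linear_conv_bounded_linear[THEN iffD1] iota_linear)
  have Dg: "frechet g y w = K *\<^sub>R frechet \<xi> y w - iota (?Df y w)" if "y \<in> open_pdisk" for y w
    unfolding g_def[abs_def] by (rule frechet_eqI)
      (intro has_derivative_diff has_derivative_scaleR_right Ck_has_derivative[OF xi_Ck that]
        bounded_linear.has_derivative[OF iota_linear[unfolded linear_conv_bounded_linear]] Ck_has_derivative[OF f_Ck that])
  \<comment> \<open>\<open>c\<close> bounds the derivative of \<open>f\<close> at \<open>x\<close>
    from below, so an error of size \<open>B\<close> is a small multiple of \<kappa> relative to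
    that derivative; the sum of the errors stays below \<kappa>/4.\<close>
  define B where "B = \<kappa> * c / 16"
  have B: "B > 0" using kappa c by (simp add: B_def)
  obtain e1 where e1: "e1 > 0" "ball x e1 \<subseteq> open_pdisk"
    "\<And>y v. y \<in> ball x e1 \<Longrightarrow> norm (?Df y v - ?Df x v) \<le> B * norm v"
    using derivative_near[OF open_open_pdisk x f_Ck B] by metis
  obtain e2 where e2: "e2 > 0" "ball x e2 \<subseteq> open_pdisk"
    "\<And>y v. y \<in> ball x e2 \<Longrightarrow> norm (frechet g y v - frechet g x v) \<le> B * norm v"
    using derivative_near[OF open_open_pdisk x gC B] by metis
  have "ball x (min e1 e2) \<subseteq> good (\<kappa>/4)"
  proof
    fix y assume "y \<in> ball x (min e1 e2)"
    then have y: "y \<in> ball x e1" "y \<in> ball x e2" "y \<in> open_pdisk" using e1 by auto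
    have "norm (frechet g y w) \<le> \<kappa>/4 * norm (?Df y w)" for w
    proof -
      have 1: "norm (frechet g x w) \<le> \<kappa>/8 * norm (?Df x w)"
        using assms unfolding Dg[OF x] good_def by simp
      have 2: "norm (?Df x w) \<le> norm (?Df y w) + B * norm w"
        using e1(3)[OF y(1), of w] norm_triangle_ineq2[of "?Df x w" "?Df y w"] by (simp add: norm_minus_commute)
      have 3: "norm (frechet g y w) \<le> norm (frechet g x w) + B * norm w"
        using e2(3)[OF y(2), of w] norm_triangle_ineq2[of "frechet g y w" "frechet g x w"] by simp
      have "B \<le> c / 16" using kappa c by (simp add: B_def)
      then have "B * norm w \<le> c / 16 * norm w" by (rule mult_right_mono) simp
      then have 4: "15/16 * (c * norm w) \<le> norm (?Df y w)" using 2 c(2)[of w] by simp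
      have 5: "B * norm w \<le> \<kappa>/15 * norm (?Df y w)"
        using mult_left_mono[OF 4, of "\<kappa>/15"] kappa by (simp add: B_def)
      have "\<kappa>/8 * norm (?Df x w) \<le> \<kappa>/8 * (norm (?Df y w) + B * norm w)" using 2 kappa by (intro mult_left_mono) auto
      also have "\<dots> \<le> \<kappa>/8 * norm (?Df y w) + 1/8 * (B * norm w)"
        using mult_right_mono[of \<kappa> 1 "1/8 * (B * norm w)"] kappa B by (simp add: algebra_simps)
      finally have "norm (frechet g y w) \<le> \<kappa>/8 * norm (?Df y w) + 9/8 * (B * norm w)" using 1 3 by simp
      also have "\<dots> \<le> \<kappa>/8 * norm (?Df y w) + 9/8 * (\<kappa>/15 * norm (?Df y w))" using 5 by simp
      also have "\<dots> \<le> \<kappa>/4 * norm (?Df y w)" using kappa by (simp add: algebra_simps)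
      finally show ?thesis .
    qed
    then show "y \<in> good (\<kappa>/4)" using y(3) unfolding Dg[OF y(3)] good_def by simp
  qed
  then show ?thesis using e1(1) e2(1) by (intro exI[of _ "ball x (min e1 e2)"]) auto
qed

end

text \<open>The radius \<open>r\<close> is free because the same facts are needed for the partial
  sections met during the continuation, before the radius \<rho> is reached.\<close>

locale chart_section = tangent_chart h \<xi> \<tau> x0 K \<rho> \<kappa> \<eta> R P
  for h :: "real^'m \<Rightarrow> real^'m^'m" and \<xi> \<tau> x0 K \<rho> \<kappa> \<eta> R P +
  fixes r :: real and \<psi> :: "real^2 \<Rightarrow> real^2"
  assumes r: "0 < r" "r \<le> \<rho>" and psi_c: "continuous_on (ball 0 r) \<psi>" and psi_0: "\<psi> 0 = x0"
    and psi_good: "\<psi> ` ball 0 r \<subseteq> good (\<kappa>/4)" and psi_sec: "\<And>y. y \<in> ball 0 r \<Longrightarrow> f (\<psi> y) = y"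
begin

definition G :: "real^2 \<Rightarrow> real^'m" where "G y = K *\<^sub>R (\<xi> (\<psi> y) - \<xi> x0)"

lemma psi_pdisk: "y \<in> ball 0 r \<Longrightarrow> \<psi> y \<in> open_pdisk"
  using psi_good good_subset by blast

lemma f_det: "y \<in> ball 0 r \<Longrightarrow> det (matrix (frechet f (\<psi> y))) \<noteq> 0"
proof -
  assume y: "y \<in> ball 0 r"
  have "linear (frechet f (\<psi> y))" by (rule linear_frechet_derivative[OF Ck_differentiable[OF f_Ck psi_pdisk[OF y]]])
  moreover have "inj (frechet f (\<psi> y))"
    using Df_inj psi_good y linear_injective_0[OF calculation] by blast
  ultimately show ?thesis using det_nz_iff_inj by blast
qed

lemma psi_Ck: "Ck n (ball 0 r) \<psi>"
  by (rule Ck_section[OF open_open_pdisk f_Ck open_ball psi_c _ psi_sec f_det]) (use psi_pdisk in auto)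

sublocale graph_patch h \<xi> "1/K" "\<xi> x0" r \<psi> f G
proof
  show "open (\<psi> ` ball 0 r)"
    by (rule invariance_of_domain[OF psi_c open_ball]) (metis inj_on_inverseI psi_sec)
  show "Ck n (ball 0 r) G" for n unfolding G_def[abs_def]
    by (intro Ck_scaleR Ck_const Ck_diff Ck_compose[OF open_ball open_open_pdisk _ psi_Ck xi_Ck] open_ball) (use psi_pdisk in auto)
qed (use riem K_pos psi_c psi_pdisk psi_sec f_Ck xi_Ck xi_ext f_det in \<open>auto simp: G_def\<close>)

lemma pos_psi: "y \<in> ball 0 r \<Longrightarrow> pos y = \<xi> (\<psi> y)"
  by (simp add: pos_def xi_G)

lemma D_G:
  assumes y: "y \<in> ball 0 r"
  shows "frechet G y v = K *\<^sub>R frechet \<xi> (\<psi> y) (frechet \<psi> y v)" unfolding G_def[abs_def]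
  by (rule frechet_eqI) (auto intro!: derivative_eq_intros
      has_derivative_compose[OF Ck_has_derivative[OF psi_Ck y] Ck_has_derivative[OF xi_Ck psi_pdisk[OF y]]])

lemma Df_D_psi:
  assumes y: "y \<in> ball 0 r"
  shows "frechet f (\<psi> y) (frechet \<psi> y v) = v"
  by (rule section_derivative(2)[OF Ck_differentiable[OF f_Ck psi_pdisk[OF y]] open_ball y psi_c psi_sec f_det[OF y]])

lemma D_G_near:
  assumes y: "y \<in> ball 0 r"
  shows "norm (frechet G y v - iota v) \<le> \<kappa>/4 * norm v"
  using psi_good y unfolding D_G[OF y] good_def by (auto simp: Df_D_psi[OF y] image_subset_iff dest!: bspec[of _ _ y] spec[of _ "frechet \<psi> y v"])

lemma norm_D_G:
  assumes y: "y \<in> ball 0 r"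
  shows "norm (frechet G y v) \<le> 5 * norm v"
proof -
  have "\<kappa>/4 * norm v \<le> 1 * norm v" using kappa by (intro mult_right_mono) auto
  then show ?thesis
    using D_G_near[OF y, of v] norm_iota[of v] norm_triangle_ineq2[of "frechet G y v" "iota v"] by linarith
qed

lemma iota_axis: "iota (axis a 1) = P $ a"
  using exhaust_2[of a] by (auto simp: iota_def sum_2 axis_def)

lemma D1_G_near:
  assumes y: "y \<in> ball 0 r"
  shows "norm (D1 G y - P) \<le> \<kappa>/2" "norm (D1 G y) \<le> 5"
proof -
  have "norm ((D1 G y - P) $ a) \<le> \<kappa>/4" for a
    using D_G_near[OF y, of "axis a 1"] by (simp add: D1_def iota_axis)
  from this[of 1] this[of 2] show 1: "norm (D1 G y - P) \<le> \<kappa>/2" using norm_vec2_le[of "D1 G y - P"] by linarith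
  then show "norm (D1 G y) \<le> 5"
    using normalized_norm_P(2)[OF center_normalized] norm_triangle_ineq2[of "D1 G y" P] kappa by linarith
qed

lemma G_0: "G 0 = 0" by (simp add: G_def psi_0)

lemma D1_G_0: "D1 G 0 = P"
proof -
  have 0: "(0::real^2) \<in> ball 0 r" using r by simp
  have "frechet G 0 v = iota v" for v
  proof -
    define w where "w = frechet \<psi> 0 v"
    have "v = frechet f x0 w" using Df_D_psi[OF 0] by (simp add: psi_0 w_def)
    then have "iota v = K *\<^sub>R (\<Sum>a\<in>UNIV. ipM (h (\<xi> x0)) (frechet \<xi> x0 w) (P $ a) *\<^sub>R P $ a)"
      by (simp add: Df[OF x0] iota_def scaleR_sum_right)
    also have "\<dots> = K *\<^sub>R frechet \<xi> x0 w" using P_span by simp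
    finally show ?thesis by (simp add: D_G[OF 0] psi_0 w_def)
  qed
  then show ?thesis by (simp add: D1_def iota_axis vec_eq_iff)
qed

lemma G_lipschitz:
  assumes "y \<in> ball 0 r" "y' \<in> ball 0 r"
  shows "norm (G y - G y') \<le> 5 * norm (y - y')"
  by (rule differentiable_bound[OF convex_ball[of 0 r] has_derivative_at_withinI[OF Ck_has_derivative[OF G_Ck]] onorm_le[OF norm_D_G]])
    (use assms in auto)

lemma pos_lipschitz:
  assumes "y \<in> ball 0 r" "y' \<in> ball 0 r"
  shows "norm (pos y - pos y') \<le> 5 / K * norm (y - y')"
proof -
  have "pos y - pos y' = (1/K) *\<^sub>R (G y - G y')" by (simp add: pos_def algebra_simps)
  then show ?thesis using G_lipschitz[OF assms] K_pos by (simp add: divide_right_mono)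
qed

lemma pos_0: "pos 0 = \<xi> x0" by (simp add: pos_def G_0)

lemma pos_near: "y \<in> ball 0 r \<Longrightarrow> norm (pos y - \<xi> x0) \<le> 5 * \<rho> / K"
proof -
  assume y: "y \<in> ball 0 r"
  then have "norm (pos y - \<xi> x0) \<le> 5 / K * norm y" using pos_lipschitz[OF y, of 0] r by (simp add: pos_0)
  also have "\<dots> \<le> 5 / K * \<rho>" using y r K_pos by (intro mult_left_mono) auto
  finally show ?thesis by simp
qed

lemma small: "metric_small \<eta>"
  unfolding metric_small_def using eta pos_near metric by auto

lemma pos_ext: "y \<in> ball 0 r \<Longrightarrow> pos y \<in> exterior"
  using pos_psi psi_pdisk xi_ext by auto

text \<open>Half of \<kappa> is spent on the metric, which moves by at most 10 \<eta>, and half on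
  the frame.\<close>

lemma zc_near: "y \<in> ball 0 r \<Longrightarrow> norm (zc y - (h (\<xi> x0), P)) \<le> \<kappa>"
proof -
  assume y: "y \<in> ball 0 r"
  have "norm (h (pos y) - h (pos 0)) \<le> 2 * \<eta> * 5 * norm y"
    by (rule pos_compose_bound[OF convex_ball order_refl _ y D1_G_near(2)])
      (use r pos_ext small eta christoffel_differentiable(2) in \<open>auto simp: metric_small_def\<close>)
  also have "\<dots> \<le> 10 * \<eta> * 1" using y r rho eta mult_left_mono[of "norm y" 1 "10 * \<eta>"] by simp
  finally have "norm (h (pos y) - h (\<xi> x0)) \<le> \<kappa> / 2" using eta pos_0 by simp
  then show ?thesis using norm_Pair_le[of "h (pos y) - h (\<xi> x0)" "D1 G y - P"] D1_G_near(1)[OF y]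
    by (simp add: zc_def)
qed

lemma D2_tangential:
  assumes y: "y \<in> ball 0 r"
  shows "ipM (h (\<xi> x0)) (D2 G y $ i $ j) (P $ a) = 0"
proof -
  have 1: "ipM (h (\<xi> x0)) (G z) (P $ a) = z $ a" if "z \<in> ball 0 r" for z
  proof -
    have "f (\<psi> z) $ a = z $ a" using psi_sec[OF that] by simp
    then show ?thesis by (simp add: f_def G_def ipM_simps)
  qed
  have d: "((\<lambda>z. z $ a) has_derivative (\<lambda>v. v $ a)) (at z)" for z :: "real^2"
    by (rule bounded_linear_imp_has_derivative[OF bounded_linear_vec_nth])
  have 2: "pd j (\<lambda>z. ipM (h (\<xi> x0)) (G z) (P $ a)) z = axis j 1 $ a" if "z \<in> ball 0 r" for z
  proof -
    have "pd j (\<lambda>z. z $ a) z = pd j (\<lambda>z. ipM (h (\<xi> x0)) (G z) (P $ a)) z"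
      by (rule pd_cong_open[OF open_ball that differentiableI[OF d]]) (rule 1[symmetric])
    then have "pd j (\<lambda>z. ipM (h (\<xi> x0)) (G z) (P $ a)) z = pd j (\<lambda>z. z $ a) z" by (rule sym)
    also have "\<dots> = axis j 1 $ a" by (rule pd_eqI[OF d])
    finally show ?thesis .
  qed
  have "pd i (\<lambda>z. axis j 1 $ a :: real) y = pd i (\<lambda>z. pd j (\<lambda>z. ipM (h (\<xi> x0)) (G z) (P $ a)) z) y"
    by (rule pd_cong_open[OF open_ball y differentiable_const]) (rule 2[symmetric])
  then have "pd i (\<lambda>z. pd j (\<lambda>z. ipM (h (\<xi> x0)) (G z) (P $ a)) z) y = pd i (\<lambda>z. axis j 1 $ a :: real) y" by (rule sym)
  also have "\<dots> = 0" by (rule pd_eqI[OF has_derivative_const])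
  finally show ?thesis unfolding pd_component(2)[OF y] .
qed

lemma ray_C1:
  assumes "\<And>t. t \<in> T \<Longrightarrow> t *\<^sub>R y \<in> ball 0 r"
  shows "(\<lambda>t. \<psi> (t *\<^sub>R y)) C1_differentiable_on T" unfolding C1_differentiable_on_def
proof (intro exI conjI ballI)
  fix t :: real assume t: "t \<in> T"
  interpret linear "frechet \<psi> (t *\<^sub>R y)"
    by (rule linear_frechet_derivative[OF Ck_differentiable[OF psi_Ck assms[OF t]]])
  have "((\<lambda>t. t *\<^sub>R y) has_derivative (\<lambda>u. u *\<^sub>R y)) (at t)" by (auto intro!: derivative_eq_intros)
  from has_derivative_compose[OF this Ck_has_derivative[OF psi_Ck assms[OF t]]]
  show "((\<lambda>t. \<psi> (t *\<^sub>R y)) has_vector_derivative frechet \<psi> (t *\<^sub>R y) y) (at t)"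
    by (simp add: has_vector_derivative_def scaleR)
next
  have "continuous_on (ball 0 r) (\<lambda>z. frechet \<psi> z y)"
    by (rule Ck_continuous_on[OF Ck_frechet[OF open_ball psi_Ck]])
  then show "continuous_on T (\<lambda>t. frechet \<psi> (t *\<^sub>R y) y)"
    by (rule continuous_on_compose2) (use assms in \<open>auto intro!: continuous_intros\<close>)
qed

lemma ray_lipschitz:
  assumes st: "s *\<^sub>R y \<in> ball 0 r" "t *\<^sub>R y \<in> ball 0 r" and y: "norm y \<le> \<rho>"
  shows "norm (\<xi> (\<psi> (s *\<^sub>R y)) - \<xi> (\<psi> (t *\<^sub>R y))) \<le> 5 * \<rho> / K * \<bar>s - t\<bar>"
proof -
  have "norm (\<xi> (\<psi> (s *\<^sub>R y)) - \<xi> (\<psi> (t *\<^sub>R y))) \<le> 5 / K * norm (s *\<^sub>R y - t *\<^sub>R y)"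
    using pos_lipschitz[OF st] pos_psi st by simp
  also have "s *\<^sub>R y - t *\<^sub>R y = (s - t) *\<^sub>R y" by (simp add: algebra_simps)
  also have "5 / K * norm ((s - t) *\<^sub>R y) = 5 / K * \<bar>s - t\<bar> * norm y" by simp
  also have "\<dots> \<le> 5 / K * \<bar>s - t\<bar> * \<rho>" using y K_pos by (intro mult_left_mono) auto
  finally show ?thesis by (simp add: ac_simps)
qed

text \<open>The lifted radius moves \<xi> by at most 5 \<rho> / K. This makes the curvature bound of
  the selected point available on the whole disc.\<close>

lemma reach_psi:
  assumes y: "y \<in> ball 0 r"
  shows "reach x0 (5 * \<rho> / K) (\<psi> y)" unfolding reach_def
proof (intro exI conjI ballI)
  let ?\<gamma> = "\<lambda>t. \<psi> (t *\<^sub>R y)"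
  have b: "t *\<^sub>R y \<in> ball 0 r" if "t \<in> {0..1}" for t
    using y that mult_left_le_one_le[of "norm y" "\<bar>t\<bar>"] by auto
  show "?\<gamma> piecewise_C1_differentiable_on {0..1}"
    by (rule C1_differentiable_imp_piecewise[OF ray_C1[OF b]])
  show "?\<gamma> ` {0..1} \<subseteq> open_pdisk" using b psi_pdisk by auto
  show "?\<gamma> 0 = x0" "?\<gamma> 1 = \<psi> y" by (simp_all add: psi_0)
  show "norm (\<xi> (?\<gamma> s) - \<xi> (?\<gamma> t)) \<le> 5 * \<rho> / K * \<bar>s - t\<bar>" if "s \<in> {0..1}" "t \<in> {0..1}" for s t
    by (rule ray_lipschitz[OF b[OF that(1)] b[OF that(2)]]) (use y r in auto)
qed

text \<open>In the last identity the factors \<open>K\<close> cancel: the integral of |A|^2 is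
  invariant under scaling.\<close>

lemma second_ff_norm_square:
  assumes y: "y \<in> ball 0 r"
  shows "(second_ff_norm h \<xi> (\<psi> y))\<^sup>2 = K\<^sup>2 * Aform (zc y) (Qc y) (Qc y)"
    and "Aform (zc y) (Qc y) (Qc y) \<ge> 0"
    and "(second_ff_norm h \<xi> (\<psi> y))\<^sup>2 * area_density h \<xi> (\<psi> y) =
      Aform (zc y) (Qc y) (Qc y) * sqrt (det (gram (h (pos y)) (D1 G y))) * \<bar>det (matrix (frechet f (\<psi> y)))\<bar>"
proof -
  define x where "x = \<psi> y"
  have x: "x \<in> V" "f x = y" "x \<in> open_pdisk" using y psi_sec psi_pdisk by (auto simp: V_def x_def)
  have nd: "(h (\<xi> x), D1 G (f x)) \<in> nondeg" using A_near[OF zc_near[OF y]] x by (simp add: zc_def pos_psi[OF y] x_def)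
  have xi_eq: "\<And>z. z \<in> V \<Longrightarrow> \<xi> z = \<xi> x0 + (1/K) *\<^sub>R G (f z)"
    using xi_G f_V psi_f by (metis image_subset_iff)
  note chain = density_chain(2,3)[where x = x and X = V and Y = "ball 0 r" and f = f and g = G and \<Phi> = \<xi> and ?p0.0 = "\<xi> x0" and s = "1/K" and h = h,
      OF open_V x(1) open_ball f_V f_V_Ck G_Ck xi_eq s_pos riemannian_symmetric[OF riem] nd f_det[OF y, folded x_def]]
  have ex: "\<xi> x \<in> exterior" using x xi_ext by auto
  have A: "Aform (h (\<xi> x), D1 \<xi> x) (Qhat h 1 (\<xi> x) \<xi> x) (Qhat h 1 (\<xi> x) \<xi> x) = K\<^sup>2 * Aform (zc y) (Qc y) (Qc y)"
    using chain(1)[OF _ ex] K_pos x(2) by (simp add: zc_def Qc_def pos_psi[OF y] x_def[symmetric] field_simps)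
  have nnA: "Aform (zc y) (Qc y) (Qc y) \<ge> 0" unfolding zc_def
    by (rule Aform_nonneg[OF riemannian_symmetric[OF riem] ipM_nonneg[OF riem]])
      (use pos_ext[OF y] A_near[OF zc_near[OF y]] in \<open>auto simp: zc_def\<close>)
  then have nn: "Aform (h (\<xi> x), D1 \<xi> x) (Qhat h 1 (\<xi> x) \<xi> x) (Qhat h 1 (\<xi> x) \<xi> x) \<ge> 0"
    unfolding A by simp
  then show 1: "(second_ff_norm h \<xi> (\<psi> y))\<^sup>2 = K\<^sup>2 * Aform (zc y) (Qc y) (Qc y)"
    by (simp add: second_ff_norm_Aform x_def[symmetric] A)
  show "Aform (zc y) (Qc y) (Qc y) \<ge> 0" by (rule nnA)
  have "sqrt (K ^ 4) = K\<^sup>2" using real_sqrt_unique[of "K\<^sup>2" "K ^ 4"] by simp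
  then have "area_density h \<xi> x = sqrt (det (gram (h (pos y)) (D1 G y))) * (\<bar>det (matrix (frechet f x))\<bar> / K\<^sup>2)"
    using chain(2)[OF _ ex] x(2) by (simp add: area_density_def pullback_gram real_sqrt_mult real_sqrt_divide abs_mult pos_psi[OF y] x_def[symmetric] power_divide)
  then show "(second_ff_norm h \<xi> (\<psi> y))\<^sup>2 * area_density h \<xi> (\<psi> y) =
      Aform (zc y) (Qc y) (Qc y) * sqrt (det (gram (h (pos y)) (D1 G y))) * \<bar>det (matrix (frechet f (\<psi> y)))\<bar>"
    unfolding 1 using K_pos by (simp add: x_def[symmetric])
qed

text \<open>The Christoffel part is at most 100 \<eta>, and 16 times its square is the error term.
  As |A| \<le> 2 K, the form is at most 4, so the squared Hessian is at most 16 + 16, below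
  36.\<close>

lemma hessian_le:
  assumes y: "y \<in> ball 0 r"
  shows "(norm (D2 G y))\<^sup>2 \<le> 4 * Aform (zc y) (Qc y) (Qc y) + 160000 * \<eta>\<^sup>2" "norm (D2 G y) \<le> 6"
proof -
  have "norm (Gam y) \<le> 4 * (\<eta> * 5 * 5)"
  proof (unfold Gam_def, rule norm_vec22_le)
    fix a b
    have "1 / K * norm (chr h (pos y) (D1 G y $ a) (D1 G y $ b)) \<le> \<eta> * norm (D1 G y $ a) * norm (D1 G y $ b)"
      using small y by (simp add: metric_small_def)
    also have "\<dots> \<le> \<eta> * 5 * 5"
      using order_trans[OF Finite_Cartesian_Product.norm_nth_le D1_G_near(2)[OF y]] eta by (intro mult_mono) auto
    finally show "norm (((1 / K) *\<^sub>R chrP h (pos y) (D1 G y)) $ a $ b) \<le> \<eta> * 5 * 5"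
      using K_pos by (simp add: chrP_def)
  qed
  then have "(norm (Gam y))\<^sup>2 \<le> (100 * \<eta>)\<^sup>2" by (intro power_mono) auto
  moreover have "1/4 * (norm (D2 G y))\<^sup>2 - 4 * (norm (Gam y))\<^sup>2 \<le> Aform (zc y) (D2 G y + Gam y) (D2 G y + Gam y)"
    by (rule hessian_bound[OF center_normalized center_symmetric D2_tangential[OF y]]) (use A_near[OF zc_near[OF y]] in blast)
  ultimately show 1: "(norm (D2 G y))\<^sup>2 \<le> 4 * Aform (zc y) (Qc y) (Qc y) + 160000 * \<eta>\<^sup>2"
    by (simp add: Qc_split power_mult_distrib)
  have "(second_ff_norm h \<xi> (\<psi> y))\<^sup>2 \<le> (2 * K)\<^sup>2"
  proof (rule power_mono)
    show "second_ff_norm h \<xi> (\<psi> y) \<le> 2 * K" by (rule curv[OF reach_psi[OF y]])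
    show "0 \<le> second_ff_norm h \<xi> (\<psi> y)" by (rule second_ff_norm_nonneg[OF psi_pdisk[OF y]])
  qed
  then have "Aform (zc y) (Qc y) (Qc y) \<le> 4" using K_pos by (simp add: second_ff_norm_square(1)[OF y] power_mult_distrib)
  moreover have "(100 * \<eta>)\<^sup>2 \<le> 1\<^sup>2" using eta by (intro power_mono) auto
  ultimately have "(norm (D2 G y))\<^sup>2 \<le> 6\<^sup>2" using 1 by (simp add: power_mult_distrib)
  then show "norm (D2 G y) \<le> 6" by (rule power2_le_imp_le) simp
qed

text \<open>The a priori improvement that drives the continuation: the Hessian bound 6 lets the
  tangent frame move by at most 24 \<rho>, which gives slope at most 48 \<rho>, and 400 \<rho> \<le>
  \<kappa> puts this below \<kappa>/8.\<close>

lemma psi_better: "\<psi> ` ball 0 r \<subseteq> good (\<kappa>/8)"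
proof
  fix x assume "x \<in> \<psi> ` ball 0 r"
  then obtain y where y: "y \<in> ball 0 r" "x = \<psi> y" by blast
  have "norm (D1 G y - D1 G 0) \<le> 4 * 6 * norm y"
    by (rule D1_lipschitz[OF convex_ball order_refl _ y(1) hessian_le(2)]) (use r in auto)
  also have "\<dots> \<le> 24 * \<rho>" using y r by simp
  finally have 1: "norm (D1 G y - P) \<le> 24 * \<rho>" by (simp add: D1_G_0)
  have "norm (K *\<^sub>R frechet \<xi> x w - iota (frechet f x w)) \<le> \<kappa>/8 * norm (frechet f x w)" for w
  proof -
    define v where "v = frechet f x w"
    define w' where "w' = frechet \<psi> y v"
    have "linear (frechet f x)"
      by (rule linear_frechet_derivative[OF Ck_differentiable[OF f_Ck]]) (use y psi_pdisk in auto)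
    moreover have "frechet f x w' = frechet f x w" using Df_D_psi[OF y(1), of v] by (simp add: w'_def y(2) v_def)
    ultimately have "w' = w"
      using Df_inj[of x "\<kappa>/4" "w' - w"] psi_good y by (auto simp: linear_diff image_subset_iff)
    then have "K *\<^sub>R frechet \<xi> x w = frechet G y v" by (simp add: D_G[OF y(1)] y(2) w'_def)
    also have "\<dots> = (\<Sum>a\<in>UNIV. v $ a *\<^sub>R D1 G y $ a)" using frechet_eqI[OF G_derivative[OF y(1)]] .
    finally have "K *\<^sub>R frechet \<xi> x w - iota v = (\<Sum>a\<in>UNIV. v $ a *\<^sub>R (D1 G y - P) $ a)"
      by (simp add: iota_def sum_subtractf scaleR_diff_right)
    then have "norm (K *\<^sub>R frechet \<xi> x w - iota v) \<le> 2 * norm (D1 G y - P) * norm v"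
      using norm_combination by metis
    also have "\<dots> \<le> 2 * (24 * \<rho>) * norm v" using 1 by (intro mult_right_mono mult_left_mono) auto
    also have "\<dots> \<le> \<kappa>/8 * norm v" using rho by (intro mult_right_mono) auto
    finally show ?thesis by (simp add: v_def)
  qed
  then show "x \<in> good (\<kappa>/8)" using y psi_pdisk by (auto simp: good_def)
qed

text \<open>The image of a ray has bounded length, so completeness yields a limit in the domain; the
  slope bound is a closed condition and passes to it.\<close>

lemma ray_limit:
  assumes y: "norm y = r"
  shows "\<exists>z\<in>good (\<kappa>/8). ((\<lambda>t. \<psi> (t *\<^sub>R y)) \<longlongrightarrow> z) (at_left 1)"
proof -
  let ?\<Gamma> = "\<lambda>t. \<psi> (t *\<^sub>R y)"
  have b: "t *\<^sub>R y \<in> ball 0 r" if "t \<in> {0..<1}" for t using y r that by simp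
  have eq: "\<xi> (?\<Gamma> t) = pos (t *\<^sub>R y)" if "t \<in> {0..<1}" for t using pos_psi[OF b[OF that]] by simp
  obtain z where z: "z \<in> open_pdisk" "(?\<Gamma> \<longlongrightarrow> z) (at_left 1)"
  proof (rule escape[OF far_R])
    show "?\<Gamma> piecewise_C1_differentiable_on {0..b'}" if "b' \<in> {0<..<1}" for b'
      by (rule C1_differentiable_imp_piecewise[OF ray_C1[OF b]]) (use that in auto)
    show "?\<Gamma> ` {0..<1} \<subseteq> open_pdisk" using b psi_pdisk by auto
    show "R \<le> norm (\<xi> (?\<Gamma> t))" if "t \<in> {0..<1}" for t unfolding eq[OF that] by (rule near[OF pos_near[OF b[OF that]]])
    show "norm (\<xi> (?\<Gamma> s) - \<xi> (?\<Gamma> t)) \<le> 5 * \<rho> / K * \<bar>s - t\<bar>" if "s \<in> {0..<1}" "t \<in> {0..<1}" for s t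
      by (rule ray_lipschitz[OF b[OF that(1)] b[OF that(2)]]) (use y r in auto)
  qed
  have ev: "\<forall>\<^sub>F t in at_left 1. t \<in> {0<..<(1::real)}" by (intro eventually_at_left_real) auto
  have lim: "((\<lambda>t. frechet k (?\<Gamma> t) w) \<longlongrightarrow> frechet k z w) (at_left 1)"
    if "\<And>n. Ck n open_pdisk k" for k :: "real^2 \<Rightarrow> 'x::real_normed_vector" and w
  proof -
    have "continuous_on open_pdisk (\<lambda>x. frechet k x w)"
      by (rule Ck_continuous_on[OF Ck_frechet[OF open_open_pdisk that]])
    then have "isCont (\<lambda>x. frechet k x w) z" using z(1) open_open_pdisk continuous_on_eq_continuous_at by blast
    then show ?thesis using z(2) by (rule isCont_tendsto_compose)
  qed
  have "norm (K *\<^sub>R frechet \<xi> z w - iota (frechet f z w)) \<le> \<kappa>/8 * norm (frechet f z w)" for w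
  proof (rule tendsto_le)
    show "((\<lambda>t. \<kappa>/8 * norm (frechet f (?\<Gamma> t) w)) \<longlongrightarrow> \<kappa>/8 * norm (frechet f z w)) (at_left 1)"
      by (intro tendsto_intros lim f_Ck)
    show "((\<lambda>t. norm (K *\<^sub>R frechet \<xi> (?\<Gamma> t) w - iota (frechet f (?\<Gamma> t) w))) \<longlongrightarrow>
      norm (K *\<^sub>R frechet \<xi> z w - iota (frechet f z w))) (at_left 1)"
      by (intro tendsto_intros lim f_Ck xi_Ck bounded_linear.tendsto[OF iota_linear[unfolded linear_conv_bounded_linear]])
    show "\<forall>\<^sub>F t in at_left 1. norm (K *\<^sub>R frechet \<xi> (?\<Gamma> t) w - iota (frechet f (?\<Gamma> t) w))
      \<le> \<kappa>/8 * norm (frechet f (?\<Gamma> t) w)"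
      using ev
    proof eventually_elim
      case (elim t)
      then have "?\<Gamma> t \<in> good (\<kappa>/8)" using psi_better b[of t] by auto
      then show ?case by (simp add: good_def)
    qed
  qed simp
  then show ?thesis using z by (auto simp: good_def)
qed

end

context tangent_chart
begin

lemma x0_good: "x0 \<in> good (\<kappa>/8)"
proof -
  have "K *\<^sub>R frechet \<xi> x0 w = iota (frechet f x0 w)" for w
    by (subst P_span) (simp add: Df[OF x0] iota_def scaleR_sum_right)
  then show ?thesis using x0 kappa by (simp add: good_def)
qed

text \<open>Continuation with \<open>good (\<kappa>/8)\<close> inside
  \<open>good (\<kappa>/4)\<close>: at each intermediate radius the a priori improvement recovers
  the smaller constant, so the radius \<rho> is reached.\<close>

lemma ex_section: "\<exists>\<psi>. chart_section h \<xi> \<tau> x0 K \<rho> \<kappa> \<eta> R P \<rho> \<psi>"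
proof -
  obtain \<psi> where psi: "continuous_on (ball 0 \<rho>) \<psi>" "\<psi> 0 = x0" "\<psi> ` ball 0 \<rho> \<subseteq> good (\<kappa>/4)"
    "\<And>y. y \<in> ball 0 \<rho> \<Longrightarrow> f (\<psi> y) = y"
  proof (rule section_continuation[OF open_open_pdisk Ck_continuous_on[OF f_Ck] good_subset good_locally_injective good_neighbourhood x0_good _ rho(1)])
    show "f x0 = 0" by (simp add: f_def ipM_def vec_eq_iff)
    fix r \<psi>
    assume A: "0 < r" "r \<le> \<rho>" "continuous_on (ball 0 r) \<psi>" "\<psi> 0 = x0" "\<psi> ` ball 0 r \<subseteq> good (\<kappa>/4)"
      "\<And>y. y \<in> ball 0 r \<Longrightarrow> f (\<psi> y) = y"
    interpret chart_section h \<xi> \<tau> x0 K \<rho> \<kappa> \<eta> R P r \<psi>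
      by unfold_locales (use A in auto)
    show "\<psi> ` ball 0 r \<subseteq> good (\<kappa>/8) \<and> (\<forall>y. norm y = r \<longrightarrow> (\<exists>z\<in>good (\<kappa>/8). ((\<lambda>t. \<psi> (t *\<^sub>R y)) \<longlongrightarrow> z) (at_left 1)))"
      using psi_better ray_limit by blast
  next
    fix \<psi>
    assume "continuous_on (ball 0 \<rho>) \<psi>" "\<psi> 0 = x0" "\<psi> ` ball 0 \<rho> \<subseteq> good (\<kappa>/4)" "\<And>y. y \<in> ball 0 \<rho> \<Longrightarrow> f (\<psi> y) = y"
    then show thesis by (rule that)
  qed
  have "chart_section h \<xi> \<tau> x0 K \<rho> \<kappa> \<eta> R P \<rho> \<psi>" by unfold_locales (use psi rho in auto)
  then show ?thesis by blast
qed

end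

section \<open>Point picking\<close>

text \<open>The end points join the exceptional set, because derivatives are two-sided and the
  functions may differ outside the interval.\<close>

lemma piecewise_C1_cong:
  fixes f g :: "real \<Rightarrow> 'a::real_normed_vector"
  assumes f: "f piecewise_C1_differentiable_on {a..b}" and eq: "\<And>x. x \<in> {a..b} \<Longrightarrow> f x = g x"
  shows "g piecewise_C1_differentiable_on {a..b}"
proof -
  obtain S D where S: "finite S" "\<And>x. x \<in> {a..b} - S \<Longrightarrow> (f has_vector_derivative D x) (at x)" "continuous_on ({a..b} - S) D"
    and c: "continuous_on {a..b} f"
    using f unfolding piecewise_C1_differentiable_on_def C1_differentiable_on_def by blast
  have "(g has_vector_derivative D x) (at x)" if "x \<in> {a..b} - (S \<union> {a, b})" for x
    by (rule has_vector_derivative_transform_within_open[where S = "{a<..<b}" and f = f])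
      (use S(2)[of x] that eq in auto)
  moreover have "continuous_on ({a..b} - (S \<union> {a, b})) D" by (rule continuous_on_subset[OF S(3)]) auto
  moreover have "continuous_on {a..b} g" by (rule continuous_on_eq[OF c eq])
  ultimately show ?thesis
    unfolding piecewise_C1_differentiable_on_def C1_differentiable_on_def using S(1)
    by (intro conjI exI[of _ "S \<union> {a, b}"] exI[of _ D]) auto
qed

text \<open>The n-th path is run on the interval from 1 - 2^-n to 1 - 2^-(n+1). Its speed grows by
  the factor 2^(n+1), which turns the Lipschitz constants \<open>B / 2 ^ n\<close> into the common
  value \<open>2 * B\<close>.\<close>

lemma concatenate_paths:
  fixes \<gamma> :: "nat \<Rightarrow> real \<Rightarrow> 'a::real_normed_vector" and F :: "'a \<Rightarrow> 'b::real_normed_vector"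
  assumes pw: "\<And>n. \<gamma> n piecewise_C1_differentiable_on {0..1}" and join: "\<And>n. \<gamma> n 1 = \<gamma> (Suc n) 0"
    and sub: "\<And>n. \<gamma> n ` {0..1} \<subseteq> X"
    and lip: "\<And>n s t. s \<in> {0..1} \<Longrightarrow> t \<in> {0..1} \<Longrightarrow> norm (F (\<gamma> n s) - F (\<gamma> n t)) \<le> B / 2 ^ n * \<bar>s - t\<bar>"
  obtains \<Gamma> where "\<And>b. b \<in> {0<..<1} \<Longrightarrow> \<Gamma> piecewise_C1_differentiable_on {0..b}" "\<Gamma> ` {0..<1} \<subseteq> X"
    "\<And>n. \<Gamma> (1 - 1 / 2 ^ n) = \<gamma> n 0"
    "\<And>s t. s \<in> {0..<1} \<Longrightarrow> t \<in> {0..<1} \<Longrightarrow> norm (F (\<Gamma> s) - F (\<Gamma> t)) \<le> 2 * B * \<bar>s - t\<bar>"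
proof -
  define a :: "nat \<Rightarrow> real" where "a n = 1 - 1 / 2 ^ n" for n
  define u where "u n t = 2 ^ Suc n * t + - (2 ^ Suc n * a n)" for n and t :: real
  define k where "k t = (LEAST n. t < a (Suc n))" for t
  define \<Gamma> where "\<Gamma> t = \<gamma> (k t) (u (k t) t)" for t
  have a_mono: "a m \<le> a n" if "m \<le> n" for m n using that by (simp add: a_def field_simps)
  have a0: "a 0 = 0" and aS: "a (Suc n) = a n + 1 / 2 ^ Suc n" and a_less: "a n < a (Suc n)" and a_nn: "0 \<le> a n" for n
    by (simp_all add: a_def field_simps)
  have kn: "k t = n" if "a n \<le> t" "t < a (Suc n)" for t n unfolding k_def
  proof (rule Least_equality)
    show "n \<le> m" if "t < a (Suc m)" for m
      using that \<open>a n \<le> t\<close> a_mono[of "Suc m" n] by (meson leD leI less_le_trans not_less_eq_eq order_trans)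
  qed (use that in auto)
  have un: "u n t \<in> {0..1}" if "t \<in> {a n..a (Suc n)}" for n t
  proof -
    have "2 ^ Suc n * (t - a n) \<le> 2 ^ Suc n * (1 / 2 ^ Suc n)" using that aS[of n] by (intro mult_left_mono) auto
    moreover have "0 \<le> 2 ^ Suc n * (t - a n)" using that by (intro mult_nonneg_nonneg) auto
    moreover have "u n t = 2 ^ Suc n * (t - a n)" by (simp add: u_def algebra_simps)
    ultimately show ?thesis by simp
  qed
  have u0: "u n (a n) = 0" for n by (simp add: u_def)
  have u1: "u n (a (Suc n)) = 1" for n by (simp add: u_def aS algebra_simps)
  have piece: "\<Gamma> t = \<gamma> n (u n t)" if "t \<in> {a n..a (Suc n)}" for n t
  proof (cases "t < a (Suc n)")
    case True
    then show ?thesis using kn[of n t] that by (simp add: \<Gamma>_def)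
  next
    case False
    then have t: "t = a (Suc n)" using that by simp
    have "\<Gamma> t = \<gamma> (Suc n) 0" using kn[of "Suc n" t] a_less[of "Suc n"] u0[of "Suc n"] by (simp add: \<Gamma>_def t)
    then show ?thesis using join[of n] u1[of n] by (simp add: t)
  qed
  have cover: "\<exists>n. t \<in> {0..a n}" if t: "t \<in> {0..<1}" for t
  proof -
    obtain n where "(1/2) ^ n < 1 - t" using t real_arch_pow_inv[of "1 - t" "1/2"] by auto
    then show ?thesis using t by (intro exI[of _ n]) (simp add: a_def power_divide)
  qed
  have cover': "\<exists>m. t \<in> {a m..a (Suc m)}" if "t \<in> {0..a n}" for t n using that
  proof (induction n)
    case (Suc n)
    then show ?case by (cases "t \<le> a n") (auto intro!: exI[of _ n])
  qed (use a0 a_less[of 0] in \<open>auto intro!: exI[of _ 0]\<close>)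
  have pwn: "\<Gamma> piecewise_C1_differentiable_on {0..a n}" for n
  proof (induction n)
    case 0
    show ?case unfolding piecewise_C1_differentiable_on_def C1_differentiable_on_def
      by (auto simp: a0 intro!: exI[of _ "{0}"])
  next
    case (Suc n)
    have im: "(\<lambda>x. 2 ^ Suc n *\<^sub>R x + - (2 ^ Suc n * a n)) ` {a n..a (Suc n)} \<subseteq> {0..1}"
      using un unfolding u_def by auto
    have "(\<gamma> n \<circ> (\<lambda>x. 2 ^ Suc n *\<^sub>R x + - (2 ^ Suc n * a n))) piecewise_C1_differentiable_on {a n..a (Suc n)}"
      by (rule piecewise_C1_differentiable_affine) (use im in \<open>auto intro: piecewise_C1_differentiable_on_subset[OF pw]\<close>)
    then have g: "(\<lambda>t. \<gamma> n (u n t)) piecewise_C1_differentiable_on {a n..a (Suc n)}"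
      by (simp add: o_def u_def)
    have "(\<lambda>t. if t \<le> a n then \<Gamma> t else \<gamma> n (u n t)) piecewise_C1_differentiable_on {0..a (Suc n)}"
      by (rule piecewise_C1_differentiable_cases[OF Suc g]) (use a_nn[of n] a_less[of n] piece[of "a n" n] in auto)
    then show ?case by (rule piecewise_C1_cong) (use piece[of _ n] in auto)
  qed
  have lipn: "norm (F (\<Gamma> s) - F (\<Gamma> t)) \<le> 2 * B * \<bar>s - t\<bar>" if "s \<in> {0..a n}" "t \<in> {0..a n}" "s \<le> t" for n s t
    using that
  proof (induction n arbitrary: s t)
    case 0
    then show ?case by (simp add: a0)
  next
    case (Suc n)
    have local: "norm (F (\<Gamma> s) - F (\<Gamma> t)) \<le> 2 * B * \<bar>s - t\<bar>" if "s \<in> {a n..a (Suc n)}" "t \<in> {a n..a (Suc n)}" for s t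
    proof -
      have "norm (F (\<Gamma> s) - F (\<Gamma> t)) \<le> B / 2 ^ n * \<bar>u n s - u n t\<bar>"
        unfolding piece[OF that(1)] piece[OF that(2)] by (rule lip[OF un[OF that(1)] un[OF that(2)]])
      also have "u n s - u n t = 2 ^ Suc n * (s - t)" by (simp add: u_def algebra_simps)
      finally show ?thesis by (simp add: abs_mult)
    qed
    show ?case
    proof (cases "t \<le> a n")
      case True
      then show ?thesis using Suc.IH[of s t] Suc.prems by auto
    next
      case False
      show ?thesis
      proof (cases "a n \<le> s")
        case True
        then show ?thesis using local[of s t] Suc.prems by auto
      next
        case s: False
        have "norm (F (\<Gamma> s) - F (\<Gamma> (a n))) \<le> 2 * B * \<bar>s - a n\<bar>" using Suc.IH[of s "a n"] Suc.prems s a_nn[of n] by auto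
        moreover have "norm (F (\<Gamma> (a n)) - F (\<Gamma> t)) \<le> 2 * B * \<bar>a n - t\<bar>" using local[of "a n" t] Suc.prems False a_less[of n] by auto
        ultimately have "norm (F (\<Gamma> s) - F (\<Gamma> t)) \<le> 2 * B * \<bar>s - a n\<bar> + 2 * B * \<bar>a n - t\<bar>"
          using norm_triangle_le[OF add_mono, of "F (\<Gamma> s) - F (\<Gamma> (a n))" _ "F (\<Gamma> (a n)) - F (\<Gamma> t)"] by simp
        also have "\<dots> = 2 * B * \<bar>s - t\<bar>" using s False by (simp add: algebra_simps)
        finally show ?thesis .
      qed
    qed
  qed
  have lip': "norm (F (\<Gamma> s) - F (\<Gamma> t)) \<le> 2 * B * \<bar>s - t\<bar>" if st: "s \<in> {0..<1}" "t \<in> {0..<1}" for s t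
  proof -
    obtain n where n: "s \<in> {0..a n}" using cover[OF st(1)] by blast
    obtain m where m: "t \<in> {0..a m}" using cover[OF st(2)] by blast
    have "s \<in> {0..a (max n m)}" "t \<in> {0..a (max n m)}" using n m a_mono[of n "max n m"] a_mono[of m "max n m"] by auto
    then show ?thesis using lipn[of s "max n m" t] lipn[of t "max n m" s] by (cases "s \<le> t") (auto simp: norm_minus_commute abs_minus_commute)
  qed
  show ?thesis
  proof (rule that[OF _ _ _ lip'])
    fix b :: real assume "b \<in> {0<..<1}"
    then obtain n where "b \<in> {0..a n}" using cover[of b] by auto
    then show "\<Gamma> piecewise_C1_differentiable_on {0..b}" by (intro piecewise_C1_differentiable_on_subset[OF pwn[of n]]) auto
  next
    show "\<Gamma> ` {0..<1} \<subseteq> X"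
    proof
      fix x assume "x \<in> \<Gamma> ` {0..<1}"
      then obtain t where t: "t \<in> {0..<1}" "x = \<Gamma> t" by blast
      then obtain m where "t \<in> {a m..a (Suc m)}" using cover cover' by blast
      then show "x \<in> X" using piece[of t m] un[of t m] sub[of m] t by auto
    qed
  next
    show "\<Gamma> (1 - 1 / 2 ^ n) = \<gamma> n 0" for n
      using piece[of "a n" n] a_less[of n] u0[of n] by (simp add: a_def)
  qed
qed

context willmore_end
begin

lemma second_ff_norm_continuous: "continuous_on open_pdisk (second_ff_norm h \<xi>)"
proof -
  obtain U where U: "open U" "exterior \<subseteq> U" and hC: "\<And>n. Ck n U h"
    and chC: "\<And>n \<gamma> \<alpha> \<beta>. Ck n U (\<lambda>p. christoffel h p \<gamma> \<alpha> \<beta>)"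
    using riemannian_metric_Ck[OF riem] by metis
  have sub: "\<xi> ` open_pdisk \<subseteq> U" using xi_ext U by blast
  have D1: "continuous_on open_pdisk (D1 \<xi>)"
    unfolding D1_def[abs_def] by (intro continuous_on_vec_lambda Ck_continuous_on[of 0] Ck_pd xi_Ck open_open_pdisk)
  have hx: "continuous_on open_pdisk (\<lambda>x. h (\<xi> x))"
    by (rule Ck_continuous_on[of 0, OF Ck_compose[OF open_open_pdisk U(1) sub xi_Ck hC]])
  have Q: "continuous_on open_pdisk (\<lambda>x. Qhat h 1 (\<xi> x) \<xi> x)"
    unfolding Qhat_def D2_def D1_def chrP_def vec_lambda_beta
    by (intro continuous_intros continuous_on_vec_lambda Ck_continuous_on[of 0] Ck_pd xi_Ck open_open_pdisk
        Ck_chr[OF open_open_pdisk xi_Ck _ _ sub U(1) chC])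
  have "continuous_on open_pdisk (\<lambda>x. case ((h (\<xi> x), D1 \<xi> x), Qhat h 1 (\<xi> x) \<xi> x, Qhat h 1 (\<xi> x) \<xi> x) of (z, q, r) \<Rightarrow> Aform z q r)"
    by (rule continuous_on_compose2[OF Ck_continuous_on[OF A.Ck_B]])
      (use immersed_nondeg in \<open>auto intro!: continuous_intros hx D1 Q\<close>)
  then show ?thesis unfolding second_ff_norm_Aform[abs_def] by (intro continuous_intros) simp
qed

lemma reach_subset: "reach x L y \<Longrightarrow> y \<in> open_pdisk"
  by (force simp: reach_def)

lemma reach_mono:
  assumes "reach x L y" "L \<le> L'"
  shows "reach x L' y"
proof -
  obtain \<gamma> where g: "\<gamma> piecewise_C1_differentiable_on {0..1}" "\<gamma> ` {0..1} \<subseteq> open_pdisk" "\<gamma> 0 = x" "\<gamma> 1 = y"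
    "\<And>s t. s \<in> {0..1} \<Longrightarrow> t \<in> {0..1} \<Longrightarrow> norm (\<xi> (\<gamma> s) - \<xi> (\<gamma> t)) \<le> L * \<bar>s - t\<bar>"
    using assms(1) unfolding reach_def by blast
  have "norm (\<xi> (\<gamma> s) - \<xi> (\<gamma> t)) \<le> L' * \<bar>s - t\<bar>" if "s \<in> {0..1}" "t \<in> {0..1}" for s t
    by (rule order_trans[OF g(5)[OF that] mult_right_mono[OF assms(2)]]) simp
  then show ?thesis unfolding reach_def using g by blast
qed

text \<open>Otherwise the curvature doubles along a sequence of paths with summable lengths, whose
  concatenation contradicts the previous convergence statement.\<close>

lemma point_picking:
  assumes R: "far R" and x0: "x0 \<in> open_pdisk" and A0: "second_ff_norm h \<xi> x0 > 0" and c: "c > 0"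
    and d: "norm (\<xi> x0) \<ge> R + 2 * c / second_ff_norm h \<xi> x0"
  shows "\<exists>x\<in>open_pdisk. second_ff_norm h \<xi> x \<ge> second_ff_norm h \<xi> x0 \<and>
    norm (\<xi> x - \<xi> x0) \<le> 2 * c / second_ff_norm h \<xi> x0 \<and>
    (\<forall>y. reach x (c / second_ff_norm h \<xi> x) y \<longrightarrow> second_ff_norm h \<xi> y \<le> 2 * second_ff_norm h \<xi> x)"
proof (rule ccontr)
  assume neg: "\<not> ?thesis"
  let ?A = "second_ff_norm h \<xi>"
  define B where "B = c / ?A x0"
  have B: "B > 0" using A0 c by (simp add: B_def)
  have neg': "\<exists>y. reach x (c / ?A x) y \<and> ?A y > 2 * ?A x"
    if "x \<in> open_pdisk" "?A x \<ge> ?A x0" "norm (\<xi> x - \<xi> x0) \<le> 2 * B" for x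
    using neg that by (auto simp: B_def not_le)
  \<comment> \<open>After \<open>n\<close> steps the curvature has at least doubled \<open>n\<close>
    times, and the displacement is bounded by a geometric sum whose closed form makes the induction
    exact.\<close>
  define Pn where "Pn n x \<longleftrightarrow> x \<in> open_pdisk \<and> 2 ^ n * ?A x0 \<le> ?A x \<and> norm (\<xi> x - \<xi> x0) \<le> 2 * B - 2 * B / 2 ^ n" for n x
  have "\<exists>x. \<forall>n. Pn n (x n) \<and> reach (x n) (B / 2 ^ n) (x (Suc n)) \<and> (n = 0 \<longrightarrow> x n = x0)"
  proof -
    have "\<exists>x. \<forall>n. (Pn n (x n) \<and> (n = 0 \<longrightarrow> x n = x0)) \<and> reach (x n) (B / 2 ^ n) (x (Suc n))"
    proof (rule dependent_nat_choice)
      show "\<exists>x. Pn 0 x \<and> (0 = 0 \<longrightarrow> x = x0)" using x0 by (auto simp: Pn_def)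
      fix x n assume "Pn n x \<and> (n = 0 \<longrightarrow> x = x0)"
      then have P: "x \<in> open_pdisk" "2 ^ n * ?A x0 \<le> ?A x" "norm (\<xi> x - \<xi> x0) \<le> 2 * B - 2 * B / 2 ^ n" by (auto simp: Pn_def)
      have "1 * ?A x0 \<le> 2 ^ n * ?A x0" using A0 by (intro mult_right_mono) auto
      then have ge: "?A x \<ge> ?A x0" using P(2) by simp
      have "norm (\<xi> x - \<xi> x0) \<le> 2 * B" by (rule order_trans[OF P(3)]) (use B in simp)
      then obtain y where y: "reach x (c / ?A x) y" "?A y > 2 * ?A x" using neg'[OF P(1) ge] by blast
      have cA: "c / ?A x \<le> B / 2 ^ n"
        using divide_left_mono[OF P(2), of c] c A0 ge by (simp add: B_def mult.commute)
      have reach': "reach x (B / 2 ^ n) y" by (rule reach_mono[OF y(1) cA])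
      then obtain \<gamma> where "\<gamma> 0 = x" "\<gamma> 1 = y" "\<And>s t. s \<in> {0..1} \<Longrightarrow> t \<in> {0..1} \<Longrightarrow> norm (\<xi> (\<gamma> s) - \<xi> (\<gamma> t)) \<le> B / 2 ^ n * \<bar>s - t\<bar>"
        unfolding reach_def by blast
      from this(3)[of 1 0] this(1,2) have "norm (\<xi> y - \<xi> x) \<le> B / 2 ^ n" by simp
      then have "norm (\<xi> y - \<xi> x0) \<le> B / 2 ^ n + (2 * B - 2 * B / 2 ^ n)"
        using norm_triangle_le[OF add_mono[OF _ P(3)], of "\<xi> y - \<xi> x" "B / 2 ^ n"] by (simp del: diff_le_eq)
      also have "\<dots> = 2 * B - 2 * B / 2 ^ Suc n" by (simp add: field_simps)
      finally have "Pn (Suc n) y" using y(2) P(2) reach_subset[OF y(1)] by (simp add: Pn_def)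
      then show "\<exists>y. (Pn (Suc n) y \<and> (Suc n = 0 \<longrightarrow> y = x0)) \<and> reach x (B / 2 ^ n) y" using reach' by blast
    qed
    then show ?thesis by blast
  qed
  then obtain x where x: "\<And>n. Pn n (x n)" "\<And>n. reach (x n) (B / 2 ^ n) (x (Suc n))" "x 0 = x0" by blast
  obtain \<gamma> where g: "\<And>n. \<gamma> n piecewise_C1_differentiable_on {0..1}" "\<And>n. \<gamma> n ` {0..1} \<subseteq> open_pdisk"
    "\<And>n. \<gamma> n 0 = x n" "\<And>n. \<gamma> n 1 = x (Suc n)"
    "\<And>n s t. s \<in> {0..1} \<Longrightarrow> t \<in> {0..1} \<Longrightarrow> norm (\<xi> (\<gamma> n s) - \<xi> (\<gamma> n t)) \<le> B / 2 ^ n * \<bar>s - t\<bar>"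
    using x(2) unfolding reach_def by metis
  obtain \<Gamma> where G: "\<And>b. b \<in> {0<..<1} \<Longrightarrow> \<Gamma> piecewise_C1_differentiable_on {0..b}" "\<Gamma> ` {0..<1} \<subseteq> open_pdisk"
    "\<And>n. \<Gamma> (1 - 1 / 2 ^ n) = \<gamma> n 0"
    "\<And>s t. s \<in> {0..<1} \<Longrightarrow> t \<in> {0..<1} \<Longrightarrow> norm (\<xi> (\<Gamma> s) - \<xi> (\<Gamma> t)) \<le> 2 * B * \<bar>s - t\<bar>"
    using concatenate_paths[of \<gamma> open_pdisk \<xi> B] g by (metis (full_types))
  have G0: "\<Gamma> 0 = x0" using G(3)[of 0] g(3) x(3) by simp
  obtain z where z: "z \<in> open_pdisk" "(\<Gamma> \<longlongrightarrow> z) (at_left 1)"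
  proof (rule escape[OF R G(1,2) _ G(4)])
    fix t :: real assume t: "t \<in> {0..<1}"
    have "norm (\<xi> (\<Gamma> 0) - \<xi> (\<Gamma> t)) \<le> 2 * B * \<bar>0 - t\<bar>" by (rule G(4)) (use t in auto)
    also have "\<dots> \<le> 2 * B" using t B by simp
    finally have "norm (\<xi> x0) - norm (\<xi> (\<Gamma> t)) \<le> 2 * B" using norm_triangle_ineq2[of "\<xi> x0" "\<xi> (\<Gamma> t)"] by (simp add: G0)
    then show "R \<le> norm (\<xi> (\<Gamma> t))" using d by (simp add: B_def)
  qed auto
  have "isCont ?A z" using second_ff_norm_continuous z(1) open_open_pdisk continuous_on_eq_continuous_at by blast
  then have "((\<lambda>t. ?A (\<Gamma> t)) \<longlongrightarrow> ?A z) (at_left 1)" using z(2) by (rule isCont_tendsto_compose)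
  \<comment> \<open>The selected points are the values of the concatenated path at the times 1 -
    2^-n, so their curvatures converge to the one at the limit point, against the doubling.\<close>
  moreover have "filterlim (\<lambda>n. 1 - 1 / 2 ^ n :: real) (at_left 1) sequentially"
    unfolding filterlim_at using tendsto_diff[OF tendsto_const LIMSEQ_divide_realpow_zero[of 2 1], of 1] by simp
  ultimately have "(\<lambda>n. ?A (\<Gamma> (1 - 1 / 2 ^ n))) \<longlonglongrightarrow> ?A z" by (rule filterlim_compose)
  then have "Bseq (\<lambda>n. ?A (x n))" using G(3) g(3) by (simp add: convergent_imp_Bseq convergentI)
  then obtain M where M: "\<And>n. ?A (x n) \<le> M" unfolding Bseq_def by (auto dest!: abs_le_D1)
  obtain n where "M / ?A x0 < 2 ^ n" using real_arch_pow[of 2 "M / ?A x0"] by auto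
  then have "M < 2 ^ n * ?A x0" using A0 by (simp add: divide_less_eq)
  moreover have "2 ^ n * ?A x0 \<le> ?A (x n)" using x(1)[of n] by (simp add: Pn_def)
  ultimately show False using M[of n] by simp
qed

end

section \<open>The energy and the curvature at the centre\<close>

lemma measure_sq: "0 < \<rho> \<Longrightarrow> measure lborel (sq \<rho>) = \<rho>\<^sup>2"
  unfolding sq_def by (subst content_cbox_cart) (auto simp: interval_ne_empty_cart UNIV_2 power2_eq_square)

text \<open>Inside the disc of radius \<sigma> the bound \<open>b\<close> is used with the integral
  of 1/|y|. Outside, 1/|y| is at most 1/\<sigma>, and the inequality q \<le> q^2 / (2 l) + l / 2
  brings in the energy. Both parameters stay free to be chosen before the energy is made
  small.\<close>

lemma weighted_integral_bound:
  fixes q :: "real^2 \<Rightarrow> real"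
  assumes q: "continuous_on (sq \<rho>) q" "\<And>y. y \<in> sq \<rho> \<Longrightarrow> 0 \<le> q y \<and> q y \<le> b" and \<rho>: "0 < \<rho>" "\<rho> \<le> 1"
    and \<sigma>: "0 < \<sigma>" and l: "0 < l" and \<eta>: "0 \<le> \<eta>"
  shows "integral (sq \<rho>) (\<lambda>y. (q y + \<eta>) * inverse (norm y)) \<le>
    4 * pi * b * \<sigma> + l / (2 * \<sigma>) + integral (sq \<rho>) (\<lambda>y. (q y)\<^sup>2) / (2 * \<sigma> * l) + 4 * pi * \<eta>"
proof -
  have b: "0 \<le> b" using q(2)[OF sq_bounds(4)[OF \<rho>(1)]] by linarith
  have cs: "compact (sq \<rho>)" by (rule sq_bounds(6)[OF \<rho>(1)])
  have part: "(\<lambda>y. indicator (cball 0 s) y * inverse (norm y)) integrable_on sq \<rho>"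
    "integral (sq \<rho>) (\<lambda>y. indicator (cball 0 s) y * inverse (norm y)) \<le> 4 * pi * s" if s: "s > 0" for s
  proof -
    have ai: "(\<lambda>y::real^2. inverse (norm y)) absolutely_integrable_on cball 0 s"
      and le: "integral (cball (0::real^2) s) (\<lambda>y. inverse (norm y)) \<le> 4 * pi * s"
      using inverse_norm_integral[OF s] by auto
    have eq: "(\<lambda>y::real^2. indicator (cball 0 s) y * inverse (norm y)) = (\<lambda>y. if y \<in> cball 0 s then inverse (norm y) else 0)"
      by (rule ext) (simp add: indicator_def)
    have U: "(\<lambda>y::real^2. indicator (cball 0 s) y * inverse (norm y)) absolutely_integrable_on UNIV"
      unfolding eq by (rule absolutely_integrable_restrict_UNIV[THEN iffD2, OF ai])
    have S: "(\<lambda>y::real^2. indicator (cball 0 s) y * inverse (norm y)) absolutely_integrable_on sq \<rho>"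
      by (rule set_integrable_subset[OF U fmeasurableD[OF lmeasurable_compact[OF cs]] subset_UNIV])
    then show 1: "(\<lambda>y. indicator (cball 0 s) y * inverse (norm y)) integrable_on sq \<rho>"
      by (rule set_lebesgue_integral_eq_integral(1))
    have "integral (sq \<rho>) (\<lambda>y. indicator (cball 0 s) y * inverse (norm y)) \<le> integral UNIV (\<lambda>y::real^2. indicator (cball 0 s) y * inverse (norm y))"
      by (rule integral_subset_le[OF _ 1 set_lebesgue_integral_eq_integral(1)[OF U]]) auto
    also have "\<dots> = integral (cball (0::real^2) s) (\<lambda>y. inverse (norm y))"
      unfolding eq by (rule integral_restrict_UNIV)
    finally show "integral (sq \<rho>) (\<lambda>y. indicator (cball 0 s) y * inverse (norm y)) \<le> 4 * pi * s" using le by linarith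
  qed
  have q2: "(\<lambda>y. (q y)\<^sup>2) integrable_on sq \<rho>"
    unfolding sq_def by (intro integrable_continuous continuous_intros q(1)[unfolded sq_def])
  have one: "((\<lambda>y::real^2. c) has_integral (\<rho>\<^sup>2 * c)) (sq \<rho>)" for c :: real
    using has_integral_const[of c "\<chi> i. - \<rho> / 2" "\<chi> i. \<rho> / 2 :: real^2"] measure_sq[OF \<rho>(1)] by (simp add: sq_def)
  define Fn where "Fn y = b * (indicator (cball 0 \<sigma>) y * inverse (norm y)) + (1 / (2 * \<sigma> * l)) * (q y)\<^sup>2 + l / (2 * \<sigma>) +
    \<eta> * (indicator (cball 0 1) y * inverse (norm y))" for y :: "real^2"
  have FI: "(Fn has_integral (b * integral (sq \<rho>) (\<lambda>y. indicator (cball 0 \<sigma>) y * inverse (norm y)) + (1 / (2 * \<sigma> * l)) * integral (sq \<rho>) (\<lambda>y. (q y)\<^sup>2) +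
    \<rho>\<^sup>2 * (l / (2 * \<sigma>)) + \<eta> * integral (sq \<rho>) (\<lambda>y. indicator (cball 0 1) y * inverse (norm y)))) (sq \<rho>)"
    unfolding Fn_def[abs_def]
    by (intro has_integral_add has_integral_mult_right integrable_integral part(1) \<sigma> q2 one) simp
  have L: "(\<lambda>y. (q y + \<eta>) * inverse (norm y)) integrable_on sq \<rho>"
    using continuous_over_norm_integrable[OF continuous_on_add[OF q(1) continuous_on_const] cs] set_lebesgue_integral_eq_integral(1) by blast
  have "\<bar>integral (sq \<rho>) (\<lambda>y. (q y + \<eta>) * inverse (norm y))\<bar> \<le> integral (sq \<rho>) Fn"
  proof (rule integral_abs_le_except_0[OF L])
    show "Fn integrable_on sq \<rho>" using FI by (auto simp: integrable_on_def)
    fix y assume y: "y \<in> sq \<rho>" "y \<noteq> 0"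
    have y1: "y \<in> cball 0 1" using sq_bounds(3)[OF \<rho>] y(1) by blast
    have 0: "0 \<le> (1 / (2 * \<sigma> * l)) * (q y)\<^sup>2" "0 \<le> l / (2 * \<sigma>)" using \<sigma> l by simp_all
    have "q y * inverse (norm y) \<le> b * (indicator (cball 0 \<sigma>) y * inverse (norm y)) + ((1 / (2 * \<sigma> * l)) * (q y)\<^sup>2 + l / (2 * \<sigma>))"
    proof (cases "norm y \<le> \<sigma>")
      case True
      then have "q y * inverse (norm y) \<le> b * (indicator (cball 0 \<sigma>) y * inverse (norm y))"
        using q(2)[OF y(1)] by (simp add: mult_right_mono)
      then show ?thesis using 0 by linarith
    next
      case False
      then have "inverse (norm y) \<le> 1 / \<sigma>" using \<sigma> by (simp add: inverse_eq_divide frac_le)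
      then have "q y * inverse (norm y) \<le> q y * (1 / \<sigma>)" using q(2)[OF y(1)] by (intro mult_left_mono) auto
      also have "\<dots> \<le> (1 / (2 * \<sigma> * l)) * (q y)\<^sup>2 + l / (2 * \<sigma>)"
      proof -
        have "0 \<le> (q y - l)\<^sup>2 / (2 * \<sigma> * l)" using \<sigma> l by simp
        also have "\<dots> = (1 / (2 * \<sigma> * l)) * (q y)\<^sup>2 + l / (2 * \<sigma>) - q y * (1 / \<sigma>)"
          using \<sigma> l by (simp add: field_simps power2_eq_square)
        finally show ?thesis by simp
      qed
      finally show ?thesis using False by (simp add: indicator_def)
    qed
    moreover have "0 \<le> (q y + \<eta>) * inverse (norm y)" using q(2)[OF y(1)] \<eta> by simp
    ultimately show "\<bar>(q y + \<eta>) * inverse (norm y)\<bar> \<le> Fn y" using y1 by (simp add: Fn_def distrib_right)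
  qed
  then have "integral (sq \<rho>) (\<lambda>y. (q y + \<eta>) * inverse (norm y)) \<le> integral (sq \<rho>) Fn" by linarith
  also have "\<dots> = b * integral (sq \<rho>) (\<lambda>y. indicator (cball 0 \<sigma>) y * inverse (norm y)) + (1 / (2 * \<sigma> * l)) * integral (sq \<rho>) (\<lambda>y. (q y)\<^sup>2) +
    \<rho>\<^sup>2 * (l / (2 * \<sigma>)) + \<eta> * integral (sq \<rho>) (\<lambda>y. indicator (cball 0 1) y * inverse (norm y))"
    using FI by (rule integral_unique)
  also have "\<dots> \<le> b * (4 * pi * \<sigma>) + (1 / (2 * \<sigma> * l)) * integral (sq \<rho>) (\<lambda>y. (q y)\<^sup>2) + 1 * (l / (2 * \<sigma>)) + \<eta> * (4 * pi * 1)"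
    using \<rho> \<sigma> l by (intro add_mono mult_left_mono mult_right_mono part(2) b \<eta> order_refl) (auto simp: power_le_one)
  finally show ?thesis by (simp add: ac_simps)
qed

section \<open>Energy of the tail and energy in a chart\<close>

context willmore_end
begin

lemma area_density_continuous: "continuous_on open_pdisk (area_density h \<xi>)"
proof -
  obtain U where U: "open U" "exterior \<subseteq> U" and hC: "\<And>n. Ck n U h"
    using riemannian_metric_Ck[OF riem] by metis
  have sub: "\<xi> ` open_pdisk \<subseteq> U" using xi_ext U by blast
  have "continuous_on open_pdisk (\<lambda>x. det (gram (h (\<xi> x)) (D1 \<xi> x)))" unfolding D1_def
    by (intro Ck_continuous_on[of 0] Ck_det Ck_gram Ck_vec_lambda Ck_pd xi_Ck open_open_pdisk
        Ck_compose[OF open_open_pdisk U(1) sub xi_Ck hC])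
  then show ?thesis unfolding area_density_def[abs_def] pullback_gram by (intro continuous_intros)
qed

lemma energy_density_nonneg: "x \<in> open_pdisk \<Longrightarrow> 0 \<le> (second_ff_norm h \<xi> x)\<^sup>2 * area_density h \<xi> x"
  using immersed_nondeg[of x] by (simp add: area_density_def pullback_gram nondeg_def)

text \<open>The sets where |\<xi>| \<ge> n decrease to the empty set, and the energy is a finite
  measure, hence continuous from above. The result is stated for compact sets and gauge integrals,
  the form in which charts use it.\<close>

lemma energy_tail:
  assumes fin: "(\<integral>\<^sup>+x\<in>open_pdisk. ennreal ((second_ff_norm h \<xi> x)\<^sup>2 * area_density h \<xi> x) \<partial>lborel) < \<infinity>"
    and e: "e > 0"
  shows "\<exists>s. \<forall>S. compact S \<longrightarrow> S \<subseteq> open_pdisk \<longrightarrow> (\<forall>x\<in>S. s \<le> norm (\<xi> x)) \<longrightarrow>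
    integral S (\<lambda>x. (second_ff_norm h \<xi> x)\<^sup>2 * area_density h \<xi> x) \<le> e"
proof -
  define g where "g x = (second_ff_norm h \<xi> x)\<^sup>2 * area_density h \<xi> x" for x
  have gc: "continuous_on open_pdisk g"
    unfolding g_def by (intro continuous_intros second_ff_norm_continuous area_density_continuous)
  have op: "open_pdisk \<in> sets borel" using open_open_pdisk by simp
  have gm: "(\<lambda>x. indicator open_pdisk x *\<^sub>R g x) \<in> borel_measurable lborel"
    using borel_measurable_continuous_on_indicator[OF op gc] by simp
  define fn where "fn x = ennreal (indicator open_pdisk x *\<^sub>R g x)" for x
  have fm: "fn \<in> borel_measurable lborel" unfolding fn_def[abs_def] using gm by measurable
  define T where "T n = {x \<in> open_pdisk. real n \<le> norm (\<xi> x)}" for n :: nat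
  have Tm: "T n \<in> sets lborel" for n
  proof -
    have "(\<lambda>x. indicator open_pdisk x *\<^sub>R \<xi> x) \<in> borel_measurable borel"
      using borel_measurable_continuous_on_indicator[OF op xi_continuous] .
    then have "{x \<in> space borel. real n \<le> norm (indicator open_pdisk x *\<^sub>R \<xi> x)} \<in> sets borel" by measurable
    then have "{x \<in> space borel. real n \<le> norm (indicator open_pdisk x *\<^sub>R \<xi> x)} \<inter> open_pdisk \<in> sets borel" using op by blast
    moreover have "{x \<in> space borel. real n \<le> norm (indicator open_pdisk x *\<^sub>R \<xi> x)} \<inter> open_pdisk = T n"
      by (auto simp: T_def)
    ultimately show ?thesis by simp
  qed
  have eT: "emeasure (density lborel fn) (T n) = (\<integral>\<^sup>+x. fn x * indicator (T n) x \<partial>lborel)" for n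
    by (rule emeasure_density[OF fm Tm])
  have total: "(\<integral>\<^sup>+x. fn x * indicator (T n) x \<partial>lborel) < \<infinity>" for n
  proof -
    have "(\<integral>\<^sup>+x. fn x * indicator (T n) x \<partial>lborel) \<le> (\<integral>\<^sup>+x\<in>open_pdisk. ennreal (g x) \<partial>lborel)"
      by (rule nn_integral_mono) (auto simp: fn_def T_def indicator_def)
    then show ?thesis using fin unfolding g_def by (rule le_less_trans)
  qed
  have "(\<lambda>n. emeasure (density lborel fn) (T n)) \<longlonglongrightarrow> emeasure (density lborel fn) (\<Inter>n. T n)"
  proof (rule Lim_emeasure_decseq)
    show "range T \<subseteq> sets (density lborel fn)" using Tm by auto
    show "decseq T" by (auto simp: decseq_def T_def)
    show "emeasure (density lborel fn) (T n) \<noteq> \<infinity>" for n using total[of n] unfolding eT by auto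
  qed
  moreover have "(\<Inter>n. T n) = {}"
  proof -
    have False if "x \<in> (\<Inter>n. T n)" for x
    proof -
      obtain n where "norm (\<xi> x) < real n" using reals_Archimedean2 by blast
      then show False using that by (auto simp: T_def not_le dest!: spec[of _ n])
    qed
    then show ?thesis by blast
  qed
  ultimately have "(\<lambda>n. emeasure (density lborel fn) (T n)) \<longlonglongrightarrow> 0" by simp
  then have "\<forall>\<^sub>F n in sequentially. emeasure (density lborel fn) (T n) < ennreal e"
    by (rule order_tendstoD) (use e in simp)
  then obtain n where n: "emeasure (density lborel fn) (T n) < ennreal e" by (auto simp: eventually_sequentially)
  have "integral S g \<le> e" if S: "compact S" "S \<subseteq> open_pdisk" "\<forall>x\<in>S. real n \<le> norm (\<xi> x)" for S
  proof -
    have si: "set_integrable lborel S g"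
      using borel_integrable_compact[OF S(1) continuous_on_subset[OF gc S(2)]] by (simp add: set_integrable_def)
    have "ennreal (integral S g) = ennreal (LINT x:S|lborel. g x)" using set_borel_integral_eq_integral(2)[OF si] by simp
    also have "\<dots> = (\<integral>\<^sup>+x. ennreal (indicator S x *\<^sub>R g x) \<partial>lborel)" unfolding set_lebesgue_integral_def
      by (rule nn_integral_eq_integral[symmetric])
        (use si S(2) energy_density_nonneg in \<open>auto simp: set_integrable_def g_def indicator_def\<close>)
    also have "\<dots> \<le> (\<integral>\<^sup>+x. fn x * indicator (T n) x \<partial>lborel)"
      by (rule nn_integral_mono) (use S(2,3) in \<open>auto simp: fn_def T_def indicator_def\<close>)
    also have "\<dots> \<le> ennreal e" using n unfolding eT by simp
    finally show ?thesis using e by (simp add: ennreal_le_iff)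
  qed
  then show ?thesis unfolding g_def by blast
qed

end

context chart_section
begin

text \<open>After the change of variables the scale has cancelled, so small energy of the surface is
  small energy of the graph; \<open>d\<close> bounds the area density of the graph from
  below.\<close>

lemma energy_in_chart:
  assumes Q: "compact Q" "Q \<subseteq> ball 0 r"
    and d: "\<And>y. y \<in> Q \<Longrightarrow> d \<le> sqrt (det (gram (h (pos y)) (D1 G y)))" "d > 0"
  shows "integral Q (\<lambda>y. (norm (D2 G y))\<^sup>2) \<le> 4 / d * integral (\<psi> ` Q) (\<lambda>x. (second_ff_norm h \<xi> x)\<^sup>2 * area_density h \<xi> x)
    + 160000 * \<eta>\<^sup>2 * measure lborel Q"
proof -
  define g where "g x = (second_ff_norm h \<xi> x)\<^sup>2 * area_density h \<xi> x" for x
  define J where "J x = \<bar>det (matrix (frechet f x))\<bar>" for x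
  \<comment> \<open>Dividing by the Jacobian makes the pulled-back integrand equal to the energy
    density of the surface.\<close>
  define F where "F y = g (\<psi> y) / J (\<psi> y)" for y
  have S: "compact (\<psi> ` Q)" "\<psi> ` Q \<subseteq> V" "\<psi> ` Q \<subseteq> open_pdisk"
    using compact_continuous_image[OF continuous_on_subset[OF psi_c Q(2)] Q(1)] Q(2) psi_pdisk by (auto simp: V_def)
  have J: "J (\<psi> y) > 0" if "y \<in> Q" for y using f_det that Q(2) by (auto simp: J_def)
  have gc: "continuous_on open_pdisk g"
    unfolding g_def by (intro continuous_intros second_ff_norm_continuous area_density_continuous)
  have Jc: "continuous_on open_pdisk J" unfolding J_def matrix_def
    by (intro continuous_on_rabs Ck_continuous_on[of 0] Ck_det Ck_vec_lambda Ck_vec_nth Ck_pd f_Ck open_open_pdisk)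
  have Fc: "continuous_on Q F" unfolding F_def
  proof (rule continuous_on_divide)
    show "continuous_on Q (\<lambda>y. g (\<psi> y))" "continuous_on Q (\<lambda>y. J (\<psi> y))"
      by (rule continuous_on_compose2[OF _ continuous_on_subset[OF psi_c Q(2)] S(3)], rule gc Jc)+
    show "\<forall>y\<in>Q. J (\<psi> y) \<noteq> 0" using J by force
  qed
  have fS: "f ` \<psi> ` Q = Q" using psi_sec Q(2) by (force simp: image_iff)
  have Fc': "continuous_on (f ` \<psi> ` Q) F" unfolding fS by (rule Fc)
  have inj: "inj_on f (\<psi> ` Q)" using psi_f S(2) by (metis inj_on_inverseI subsetD)
  have der: "(f has_derivative frechet f x) (at x within \<psi> ` Q)" if "x \<in> \<psi> ` Q" for x
    using has_derivative_at_withinI[OF Ck_has_derivative[OF f_Ck]] that S(3) by blast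
  have "integral (\<psi> ` Q) (\<lambda>x. \<bar>det (matrix (frechet f x))\<bar> * F (f x)) = integral (f ` \<psi> ` Q) F"
    by (rule integral_change_of_variables_real(2)[OF S(1) der inj Fc'])
  then have "integral (\<psi> ` Q) (\<lambda>x. \<bar>det (matrix (frechet f x))\<bar> * F (f x)) = integral Q F" unfolding fS .
  moreover have "integral (\<psi> ` Q) (\<lambda>x. \<bar>det (matrix (frechet f x))\<bar> * F (f x)) = integral (\<psi> ` Q) g"
  proof (rule integral_cong)
    fix x assume "x \<in> \<psi> ` Q"
    then obtain y where y: "y \<in> Q" "x = \<psi> y" by blast
    then have "f x = y" using psi_sec Q(2) by blast
    then show "\<bar>det (matrix (frechet f x))\<bar> * F (f x) = g x"
      using J[OF y(1)] y(2) by (simp add: F_def J_def)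
  qed
  ultimately have IF: "integral Q F = integral (\<psi> ` Q) g" by simp
  have ai: "u integrable_on Q" if "continuous_on Q u" for u :: "real^2 \<Rightarrow> real"
    using borel_integrable_compact[OF Q(1) that]
    by (intro set_borel_integral_eq_integral(1)) (simp add: set_integrable_def)
  have D2c: "continuous_on Q (D2 G)" unfolding D2_def[abs_def]
    by (intro continuous_on_vec_lambda continuous_on_subset[OF Ck_continuous_on[where n = 0] Q(2)] Ck_pd G_Ck open_ball)
  have const: "integral Q (\<lambda>y. c) = c * measure lborel Q" for c :: real
    using lmeasure_integral[OF lmeasurable_compact[OF Q(1)]] integral_mult_right[of Q c "\<lambda>_. 1"]
      measure_completion[of Q lborel] Q(1) by (simp add: borel_compact)
  have "integral Q (\<lambda>y. (norm (D2 G y))\<^sup>2) \<le> integral Q (\<lambda>y. 4 / d * F y + 160000 * \<eta>\<^sup>2)"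
  proof (rule integral_le)
    show "(\<lambda>y. (norm (D2 G y))\<^sup>2) integrable_on Q" "(\<lambda>y. 4 / d * F y + 160000 * \<eta>\<^sup>2) integrable_on Q"
      by (intro ai continuous_intros D2c Fc)+
    fix y assume y: "y \<in> Q"
    then have yb: "y \<in> ball 0 r" using Q by blast
    have "F y = Aform (zc y) (Qc y) (Qc y) * sqrt (det (gram (h (pos y)) (D1 G y)))"
      using second_ff_norm_square(3)[OF yb] J[OF y] by (simp add: F_def g_def J_def)
    moreover have "Aform (zc y) (Qc y) (Qc y) * d \<le> Aform (zc y) (Qc y) (Qc y) * sqrt (det (gram (h (pos y)) (D1 G y)))"
      by (intro mult_left_mono d y second_ff_norm_square(2)[OF yb])
    ultimately have "Aform (zc y) (Qc y) (Qc y) \<le> F y / d" using d(2) by (simp add: pos_le_divide_eq)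
    then show "(norm (D2 G y))\<^sup>2 \<le> 4 / d * F y + 160000 * \<eta>\<^sup>2" using hessian_le(1)[OF yb] by simp
  qed
  also have "\<dots> = 4 / d * integral Q F + 160000 * \<eta>\<^sup>2 * measure lborel Q"
    by (subst integral_add) (use d(2) in \<open>auto intro!: ai continuous_intros Fc simp: const\<close>)
  finally show ?thesis unfolding IF g_def .
qed

end

text \<open>Every chart of radius \<rho> whose point data stay in \<open>Z\<close> satisfies the
  hypotheses of the kernel estimate with the Hessian bound 6, so one constant serves all of
  them.\<close>

lemma chart_center:
  fixes Z :: "((real^'m^'m) \<times> (real^'m^2)) set"
  assumes \<rho>: "0 < \<rho>" "\<rho> \<le> 1" and Z: "compact Z" "Z \<subseteq> nondeg"
  shows "\<exists>C>0. \<forall>(h :: real^'m \<Rightarrow> real^'m^'m) \<xi> \<tau> x0 K \<kappa> \<eta> R P \<psi>. chart_section h \<xi> \<tau> x0 K \<rho> \<kappa> \<eta> R P \<rho> \<psi> \<longrightarrow>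
    cball (h (\<xi> x0), P) \<kappa> \<subseteq> Z \<longrightarrow> norm (D2 (chart_section.G \<xi> x0 K \<psi>) 0) \<le>
      C * hessian_potential (sq \<rho>) \<eta> (chart_section.G \<xi> x0 K \<psi>)"
proof -
  obtain C where C: "C > 0" and est: "\<And>(h :: real^'m \<Rightarrow> real^'m^'m) \<xi> s p0 \<psi> f G \<eta> e i j. graph_patch h \<xi> s p0 \<rho> \<psi> f G \<Longrightarrow>
    willmore_critical h \<xi> \<Longrightarrow> (\<forall>y\<in>ball 0 \<rho>. norm (p0 + s *\<^sub>R G y) \<ge> 2) \<Longrightarrow> G 0 = 0 \<Longrightarrow>
    (h p0, D1 G 0) \<in> normalized \<Longrightarrow> (\<forall>i. ipM (h p0) e (D1 G 0 $ i) = 0) \<Longrightarrow> norm e \<le> 2 \<Longrightarrow>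
    (\<forall>y\<in>sq \<rho>. norm (D2 G y) \<le> 6 \<and> norm (D1 G y) \<le> 5) \<Longrightarrow>
    graph_patch.metric_small h s p0 \<rho> G \<eta> \<Longrightarrow>
    (\<forall>y\<in>sq \<rho>. closed_segment (h p0, D1 G 0) (h (p0 + s *\<^sub>R G y), D1 G y) \<subseteq> Z) \<Longrightarrow>
    \<bar>ipM (h p0) (D2 G 0 $ i $ j) e\<bar> \<le> C * hessian_potential (sq \<rho>) \<eta> G"
    using center_curvature_estimate[OF \<rho> Z, of 6] by blast
  show ?thesis
  \<comment> \<open>The factor 6 is 4 times 3/2: four entries of the Hessian, and 3/2 exceeds 4/3,
    the loss from the metric at the centre.\<close>
  proof (intro exI[of _ "6 * C"] conjI allI impI)
    show "6 * C > 0" using C by simp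
    fix h :: "real^'m \<Rightarrow> real^'m^'m" and \<xi> \<tau> x0 K \<kappa> \<eta> R P \<psi>
    assume cs: "chart_section h \<xi> \<tau> x0 K \<rho> \<kappa> \<eta> R P \<rho> \<psi>" and sub: "cball (h (\<xi> x0), P) \<kappa> \<subseteq> Z"
    interpret chart_section h \<xi> \<tau> x0 K \<rho> \<kappa> \<eta> R P \<rho> \<psi> by (rule cs)
    define J where "J = hessian_potential (sq \<rho>) \<eta> G"
    have sqb: "y \<in> ball 0 \<rho>" if "y \<in> sq \<rho>" for y using sq_bounds(2)[OF \<rho>(1)] that by blast
    have seg: "closed_segment (h (\<xi> x0), P) (zc y) \<subseteq> Z" if "y \<in> ball 0 \<rho>" for y
    proof -
      have "zc y \<in> cball (h (\<xi> x0), P) \<kappa>" using zc_near[OF that] by (simp add: dist_norm norm_minus_commute)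
      then have "closed_segment (h (\<xi> x0), P) (zc y) \<subseteq> cball (h (\<xi> x0), P) \<kappa>"
        using kappa by (intro closed_segment_subset) auto
      then show ?thesis using sub by blast
    qed
    have bound: "\<bar>ipM (h (\<xi> x0)) (D2 G 0 $ i $ j) e\<bar> \<le> C * J" if e: "\<And>a. ipM (h (\<xi> x0)) e (P $ a) = 0" "norm e \<le> 2" for e i j
      unfolding J_def
    proof (rule est[OF graph_patch_axioms critical _ G_0 _ _ e(2) _ small])
      show "\<forall>y\<in>ball 0 \<rho>. 2 \<le> norm (\<xi> x0 + (1 / K) *\<^sub>R G y)"
        using near[OF pos_near] far_R unfolding far_def pos_def by fastforce
      show "\<forall>y\<in>sq \<rho>. norm (D2 G y) \<le> 6 \<and> norm (D1 G y) \<le> 5" using hessian_le(2) D1_G_near(2) sqb by blast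
      show "\<forall>y\<in>sq \<rho>. closed_segment (h (\<xi> x0), D1 G 0) (h (\<xi> x0 + (1 / K) *\<^sub>R G y), D1 G y) \<subseteq> Z"
        using seg sqb by (simp add: D1_G_0 zc_def pos_def)
    qed (use center_normalized e(1) in \<open>simp_all add: D1_G_0\<close>)
    have J0: "0 \<le> C * J" using bound[of 0] by (simp add: ipM_def)
    have "norm (D2 G 0 $ i $ j) \<le> 3/2 * (C * J)" for i j
    proof (cases "D2 G 0 $ i $ j = 0")
      case False
      define u where "u = D2 G 0 $ i $ j"
      have u: "norm u > 0" using False by (simp add: u_def)
      have z0: "(0::real^2) \<in> ball 0 \<rho>" using \<rho> by simp
      have "\<bar>ipM (h (\<xi> x0)) u ((1 / norm u) *\<^sub>R u)\<bar> \<le> C * J"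
        unfolding u_def by (rule bound) (use D2_tangential[OF z0] False in \<open>simp_all add: ipM_simps\<close>)
      then have "\<bar>ipM (h (\<xi> x0)) u u / norm u\<bar> \<le> C * J" by (simp add: ipM_simps)
      then have "ipM (h (\<xi> x0)) u u / norm u \<le> C * J" by (rule abs_le_D1)
      moreover have "3/4 * (norm u)\<^sup>2 / norm u \<le> ipM (h (\<xi> x0)) u u / norm u"
        using ipM_near_id_bounds(1)[of "h (\<xi> x0)" u] center_normalized u by (intro divide_right_mono) (auto simp: normalized_def)
      moreover have "3/4 * (norm u)\<^sup>2 / norm u = 3/4 * norm u" using u by (simp add: power2_eq_square)
      ultimately have "3/4 * norm u \<le> C * J" by linarith
      then show ?thesis using J0 by (simp add: u_def)
    qed (use J0 in simp)
    from norm_vec22_le[OF this] show "norm (D2 G 0) \<le> 6 * C * hessian_potential (sq \<rho>) \<eta> G"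
      by (simp add: J_def)
  qed
qed

context willmore_end
begin

text \<open>The constants are fixed in the order of their dependence: the neighbourhood
  \<open>Z\<close>, the radius \<rho>, the kernel constant \<open>C\<close>, the splitting
  parameters, the threshold \<open>t\<close>, and then \<open>R0\<close>. None of them depends on
  the point that violates the estimate.\<close>

lemma curvature_decay:
  assumes fin: "(\<integral>\<^sup>+x\<in>open_pdisk. ennreal ((second_ff_norm h \<xi> x)\<^sup>2 * area_density h \<xi> x) \<partial>lborel) < \<infinity>"
    and \<delta>: "\<delta> > 0"
  shows "\<exists>R0. \<forall>x\<in>open_pdisk. R0 \<le> norm (\<xi> x) \<longrightarrow> norm (\<xi> x) * second_ff_norm h \<xi> x < \<delta>"
proof -
  let ?A = "second_ff_norm h \<xi>"
  obtain Z :: "((real^'m^'m) \<times> (real^'m^2)) set" and \<kappa>Z where Z: "compact Z" "Z \<subseteq> nondeg" "0 < \<kappa>Z" "\<kappa>Z \<le> 1"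
    and ZN: "\<And>z. z \<in> normalized \<Longrightarrow> cball z \<kappa>Z \<subseteq> Z"
    using normalized_neighbourhood by blast
  obtain L where L: "L > 0" "\<And>z q r. z \<in> Z \<Longrightarrow> \<bar>Aform z q r\<bar> \<le> L * norm q * norm r"
      "\<And>z0 z q r. closed_segment z0 z \<subseteq> Z \<Longrightarrow> \<bar>Aform z q r - Aform z0 q r\<bar> \<le> L * norm (z - z0) * norm q * norm r"
    using A.bounds[OF Z(1,2)] by metis
  \<comment> \<open>On a ball of this radius about normalized data, \<open>Aform\<close> changes by
    at most 1/16.\<close>
  define \<kappa> where "\<kappa> = min \<kappa>Z (1 / (16 * L))"
  have \<kappa>: "0 < \<kappa>" "\<kappa> \<le> 1" "\<kappa> \<le> \<kappa>Z" "L * \<kappa> \<le> 1/16"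
  proof -
    show "0 < \<kappa>" "\<kappa> \<le> 1" "\<kappa> \<le> \<kappa>Z" using Z L(1) by (auto simp: \<kappa>_def)
    have "L * \<kappa> \<le> L * (1 / (16 * L))" using L(1) by (intro mult_left_mono) (auto simp: \<kappa>_def)
    then show "L * \<kappa> \<le> 1/16" using L(1) by simp
  qed
  have cb: "cball z \<kappa> \<subseteq> Z" if "z \<in> normalized" for z using ZN[OF that] subset_cball[OF \<kappa>(3)] by blast
  obtain d where d: "d > 0" "\<And>z. z \<in> Z \<Longrightarrow> d \<le> sqrt (det (gram (fst z) (snd z)))"
  proof (cases "Z = {}")
    case False
    have "continuous_on Z (\<lambda>z. sqrt (det (gram (fst z) (snd z))))"
      by (intro continuous_intros continuous_on_subset[OF Ck_continuous_on[of 0 UNIV]] Ck_det Ck_gram Ck_fst Ck_snd Ck_id open_UNIV) auto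
    from continuous_attains_inf[OF Z(1) False this] obtain z0 where z0: "z0 \<in> Z"
      "\<And>z. z \<in> Z \<Longrightarrow> sqrt (det (gram (fst z0) (snd z0))) \<le> sqrt (det (gram (fst z) (snd z)))" by blast
    moreover have "sqrt (det (gram (fst z0) (snd z0))) > 0" using z0(1) Z(2) by (auto simp: nondeg_def)
    ultimately show ?thesis using that by blast
  qed (use that[of 1] in auto)
  \<comment> \<open>The first bound yields the slope improvement in the chart, the second keeps the
    chart and the selected point within a fraction of |\<xi>| of the original point.\<close>
  define \<rho> where "\<rho> = min (\<kappa> / 400) (\<delta> / 80)"
  have \<rho>: "0 < \<rho>" "\<rho> \<le> 1" "400 * \<rho> \<le> \<kappa>" "80 * \<rho> \<le> \<delta>" using \<kappa> \<delta> by (auto simp: \<rho>_def)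
  obtain C where C: "C > 0" and center: "\<And>(h :: real^'m \<Rightarrow> real^'m^'m) \<xi> \<tau> x0 K \<kappa> \<eta> R P \<psi>. chart_section h \<xi> \<tau> x0 K \<rho> \<kappa> \<eta> R P \<rho> \<psi> \<Longrightarrow>
    cball (h (\<xi> x0), P) \<kappa> \<subseteq> Z \<Longrightarrow> norm (D2 (chart_section.G \<xi> x0 K \<psi>) 0) \<le>
      C * hessian_potential (sq \<rho>) \<eta> (chart_section.G \<xi> x0 K \<psi>)"
    using chart_center[OF \<rho>(1,2) Z(1,2)] by blast
  \<comment> \<open>A lower bound for the covariant Hessian at the centre, where the scaled
    curvature equals 1 and \<open>Aform\<close> is bounded by \<open>L\<close>.\<close>
  define a where "a = 1 / sqrt L"
  have a: "a > 0" using L(1) by (simp add: a_def)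
  \<comment> \<open>\<sigma> and \<open>l\<close> make the two terms that carry no small factor
    equal to a/4 each.\<close>
  define \<sigma> where "\<sigma> = a / (96 * pi * C)"
  define l where "l = a * \<sigma> / (2 * C)"
  have \<sigma>: "\<sigma> > 0" "C * (4 * pi * 6 * \<sigma>) = a / 4" using a C by (simp_all add: \<sigma>_def)
  have l: "l > 0" "C * (l / (2 * \<sigma>)) = a / 4" using a C \<sigma>(1) by (simp_all add: l_def)
  \<comment> \<open>\<open>\<Phi>\<close> collects the terms that vanish with \<open>t\<close>. The
    same \<open>t\<close> bounds the energy of the tail and the scaled derivatives of the
    metric.\<close>
  define \<Phi> where "\<Phi> t = C * ((4 / d * t + 160000 * t\<^sup>2) / (2 * \<sigma> * l) + 4 * pi * t) + 100 * t" for t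
  have "(\<Phi> \<longlongrightarrow> \<Phi> 0) (at_right 0)" unfolding \<Phi>_def using \<sigma>(1) l(1) by (intro tendsto_intros) auto
  then have "\<forall>\<^sub>F t in at_right 0. \<Phi> t < a / 2" by (rule order_tendstoD) (use a in \<open>simp add: \<Phi>_def\<close>)
  moreover have "\<forall>\<^sub>F t in at_right (0::real). t \<in> {0<..<min (1/100) (\<kappa>/20)}"
    by (rule eventually_at_right_real) (use \<kappa> in auto)
  ultimately have "\<forall>\<^sub>F t in at_right 0. \<Phi> t < a / 2 \<and> t \<in> {0<..<min (1/100) (\<kappa>/20)}" by (rule eventually_conj)
  then obtain t where t: "\<Phi> t < a / 2" "0 < t" "100 * t \<le> 1" "20 * t \<le> \<kappa>"
    using eventually_happens[of _ "at_right (0::real)"] by force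
  obtain s0 where s0: "\<And>S. compact S \<Longrightarrow> S \<subseteq> open_pdisk \<Longrightarrow> (\<forall>x\<in>S. s0 \<le> norm (\<xi> x)) \<Longrightarrow>
    integral S (\<lambda>x. (?A x)\<^sup>2 * area_density h \<xi> x) \<le> t"
    using energy_tail[OF fin t(2)] by blast
  obtain R where R: "far R" using ex_far by blast
  obtain Cm Rm where Cm: "Cm > 0" and decay:
    "\<And>p v. norm p \<ge> Rm \<Longrightarrow> norm (frechet h p v) \<le> Cm * norm p powr (- \<tau> - 1) * norm v"
    "\<And>p v w. norm p \<ge> Rm \<Longrightarrow> norm (chr h p v w) \<le> Cm * norm p powr (- \<tau> - 1) * norm v * norm w"
    "\<And>p u v w. norm p \<ge> Rm \<Longrightarrow> norm (frechet (\<lambda>p. chr h p v w) p u) \<le>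
      Cm * norm p powr (- \<tau> - 2) * norm u * norm v * norm w"
    using metric_decay[OF riem flat tau] by metis
  \<comment> \<open>The scale will be at most r/\<delta> and the points of the chart will have norm
    at least r/2, so the decay of the metric becomes the power -\<tau> of r/2.\<close>
  have "((\<lambda>r. Cm * (2 / \<delta> + 4 / \<delta>\<^sup>2) * (r / 2) powr (- \<tau>)) \<longlongrightarrow> Cm * (2 / \<delta> + 4 / \<delta>\<^sup>2) * 0) at_top"
    by (intro tendsto_mult tendsto_const tendsto_neg_powr filterlim_at_top_mult_tendsto_pos[OF tendsto_const, of "1/2", simplified])
      (use tau filterlim_tendsto_pos_mult_at_top[OF tendsto_const, of "1/2" "\<lambda>r. r" at_top] filterlim_ident in auto)
  then have "\<forall>\<^sub>F r in at_top. Cm * (2 / \<delta> + 4 / \<delta>\<^sup>2) * (r / 2) powr (- \<tau>) < t"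
    by (rule order_tendstoD) (use t in simp)
  then obtain R1 where R1: "\<And>r. r \<ge> R1 \<Longrightarrow> Cm * (2 / \<delta> + 4 / \<delta>\<^sup>2) * (r / 2) powr (- \<tau>) < t"
    unfolding eventually_at_top_linorder by blast
  define R0 where "R0 = Max {R1, 2 * s0, 2 * Rm, 4 * R, 2}"
  have R0: "R1 \<le> R0" "2 * s0 \<le> R0" "2 * Rm \<le> R0" "4 * R \<le> R0" "2 \<le> R0" by (simp_all add: R0_def)
  have "norm (\<xi> x1) * ?A x1 < \<delta>" if x1: "x1 \<in> open_pdisk" "R0 \<le> norm (\<xi> x1)" for x1
  proof (rule ccontr)
    assume neg: "\<not> norm (\<xi> x1) * ?A x1 < \<delta>"
    define r where "r = norm (\<xi> x1)"
    have r: "r \<ge> R0" "r \<ge> 2" using x1 R0 by (simp_all add: r_def)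
    note r_ge = r
    have rA: "\<delta> \<le> r * ?A x1" using neg by (simp add: r_def)
    have A1: "?A x1 > 0" using rA \<delta> r by (metis less_le_trans not_less mult_nonneg_nonpos order_trans zero_le_numeral linorder_not_less)
    have \<rho>A: "5 * \<rho> / ?A x1 \<le> r / 16"
    proof -
      have "80 * \<rho> \<le> r * ?A x1" using \<rho>(4) rA by linarith
      then show ?thesis using A1 by (simp add: field_simps)
    qed
    obtain x0 where x0: "x0 \<in> open_pdisk" "?A x0 \<ge> ?A x1" "norm (\<xi> x0 - \<xi> x1) \<le> 2 * (5 * \<rho>) / ?A x1"
      and curv: "\<And>y. reach x0 (5 * \<rho> / ?A x0) y \<Longrightarrow> ?A y \<le> 2 * ?A x0"
      using point_picking[OF R x1(1) A1, of "5 * \<rho>"] \<rho>(1) \<rho>A r R0(4) unfolding r_def by auto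
    define K where "K = ?A x0"
    have K: "K > 0" using A1 x0(2) by (simp add: K_def)
    have invK: "1 / K \<le> r / \<delta>"
    proof -
      have "\<delta> \<le> r * K" unfolding K_def by (rule order_trans[OF rA mult_left_mono[OF x0(2)]]) (use r in simp)
      then show ?thesis using K \<delta> by (simp add: field_simps)
    qed
    have x0r: "norm (\<xi> x0 - \<xi> x1) \<le> r / 8" using x0(3) \<rho>A by simp
    have \<rho>K: "5 * \<rho> / K \<le> r / 16"
    proof -
      have "5 * \<rho> / K \<le> 5 * \<rho> / ?A x1" using \<rho>(1) A1 x0(2) by (intro divide_left_mono) (auto simp: K_def)
      then show ?thesis using \<rho>A by linarith
    qed
    have near_half: "r / 2 \<le> norm p" if "norm (p - \<xi> x0) \<le> 5 * \<rho> / K" for p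
    proof -
      have "norm (\<xi> x1) \<le> norm p + (norm (p - \<xi> x0) + norm (\<xi> x0 - \<xi> x1))"
      proof -
        have "\<xi> x1 = p - ((p - \<xi> x0) + (\<xi> x0 - \<xi> x1))" by simp
        then have "norm (\<xi> x1) \<le> norm p + norm ((p - \<xi> x0) + (\<xi> x0 - \<xi> x1))" by (metis norm_triangle_ineq4)
        then show ?thesis using norm_triangle_ineq[of "p - \<xi> x0" "\<xi> x0 - \<xi> x1"] by linarith
      qed
      then show ?thesis using that \<rho>K x0r r by (simp add: r_def)
    qed
    have cn: "norm (\<xi> x0 - \<xi> x0) \<le> 5 * \<rho> / K" using \<rho>(1) K by simp
    have M0: "norm (h (\<xi> x0) - mat 1) \<le> 1/4" using R near_half[OF cn] r(1) R0(4) R0(5) by (auto simp: far_def)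
    have sym: "transpose (h (\<xi> x0)) = h (\<xi> x0)" using riemannian_symmetric[OF riem] xi_ext x0(1) by blast
    obtain P where P: "gram (h (\<xi> x0)) P = mat 1"
      "\<And>w. frechet \<xi> x0 w = (\<Sum>b\<in>UNIV. ipM (h (\<xi> x0)) (frechet \<xi> x0 w) (P $ b) *\<^sub>R P $ b)"
      using orthonormal_tangent[OF sym M0 linear_frechet_derivative[OF xi_differentiable[OF x0(1)]] immersed[OF x0(1)]] by blast
    have nz: "(h (\<xi> x0), P) \<in> normalized" using M0 P(1) by (simp add: normalized_def)
    have small: "r / \<delta> * (Cm * norm p powr (- \<tau> - 1)) \<le> t" "(r / \<delta>)\<^sup>2 * (Cm * norm p powr (- \<tau> - 2)) \<le> t"
      if "r / 2 \<le> norm p" for p :: "real^'m"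
    proof -
      define T where "T = (r / 2) powr (- \<tau>)"
      have T: "T > 0" using r by (simp add: T_def)
      have bound: "Cm * (2 / \<delta>) * T + Cm * (4 / \<delta>\<^sup>2) * T \<le> t" using R1[of r] r R0(1) by (simp add: T_def algebra_simps)
      have pos: "0 \<le> Cm * (2 / \<delta>) * T" "0 \<le> Cm * (4 / \<delta>\<^sup>2) * T" using Cm \<delta> T by simp_all
      have "norm p powr (- \<tau> - 1) \<le> (r / 2) powr (- \<tau> - 1)" using that r tau by (intro powr_mono2') auto
      also have "\<dots> = T / (r / 2)" using r by (simp add: powr_diff T_def)
      finally have "r / \<delta> * (Cm * norm p powr (- \<tau> - 1)) \<le> r / \<delta> * (Cm * (T / (r / 2)))"
        using r \<delta> Cm by (intro mult_left_mono) auto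
      also have "\<dots> = Cm * (2 / \<delta>) * T" using r by (simp add: field_simps)
      finally show "r / \<delta> * (Cm * norm p powr (- \<tau> - 1)) \<le> t" using bound pos by linarith
      have "norm p powr (- \<tau> - 2) \<le> (r / 2) powr (- \<tau> - 2)" using that r tau by (intro powr_mono2') auto
      also have "\<dots> = T / (r / 2)\<^sup>2" using r by (simp add: powr_diff T_def powr_numeral)
      finally have "(r / \<delta>)\<^sup>2 * (Cm * norm p powr (- \<tau> - 2)) \<le> (r / \<delta>)\<^sup>2 * (Cm * (T / (r / 2)\<^sup>2))"
        using r \<delta> Cm by (intro mult_left_mono) auto
      also have "\<dots> = Cm * (4 / \<delta>\<^sup>2) * T" using r by (simp add: field_simps power2_eq_square)
      finally show "(r / \<delta>)\<^sup>2 * (Cm * norm p powr (- \<tau> - 2)) \<le> t" using bound pos by linarith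
    qed
    have metric1: "1 / K * X \<le> t * b" if "r / 2 \<le> norm p" "X \<le> Cm * norm p powr (- \<tau> - 1) * b" "0 \<le> b" "0 \<le> X" for X b and p :: "real^'m"
    proof -
      have "1 / K * X \<le> r / \<delta> * (Cm * norm p powr (- \<tau> - 1) * b)" using invK that K r \<delta> by (intro mult_mono) auto
      also have "\<dots> = (r / \<delta> * (Cm * norm p powr (- \<tau> - 1))) * b" by simp
      also have "\<dots> \<le> t * b" by (rule mult_right_mono[OF small(1)[OF that(1)] that(3)])
      finally show ?thesis .
    qed
    have metric2: "(1 / K)\<^sup>2 * X \<le> t * b" if "r / 2 \<le> norm p" "X \<le> Cm * norm p powr (- \<tau> - 2) * b" "0 \<le> b" "0 \<le> X" for X b and p :: "real^'m"
    proof -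
      have "(1 / K)\<^sup>2 * X \<le> (r / \<delta>)\<^sup>2 * (Cm * norm p powr (- \<tau> - 2) * b)" using invK that K r \<delta> by (intro mult_mono power_mono) auto
      also have "\<dots> = ((r / \<delta>)\<^sup>2 * (Cm * norm p powr (- \<tau> - 2))) * b" by simp
      also have "\<dots> \<le> t * b" by (rule mult_right_mono[OF small(2)[OF that(1)] that(3)])
      finally show ?thesis .
    qed
    have Rm: "Rm \<le> norm p" if "r / 2 \<le> norm p" for p :: "real^'m" using that r R0(3) by linarith
    interpret tangent_chart h \<xi> \<tau> x0 K \<rho> \<kappa> t R P
    proof
      fix z :: "(real^'m^'m) \<times> (real^'m^2)" and q :: "real^'m^2^2"
      assume z: "norm (z - (h (\<xi> x0), P)) \<le> \<kappa>"
      then have zc: "z \<in> cball (h (\<xi> x0), P) \<kappa>" by (simp add: dist_norm norm_minus_commute)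
      then have "closed_segment (h (\<xi> x0), P) z \<subseteq> cball (h (\<xi> x0), P) \<kappa>" using \<kappa>(1) by (intro closed_segment_subset) auto
      then have "\<bar>Aform z q q - Aform (h (\<xi> x0), P) q q\<bar> \<le> L * norm (z - (h (\<xi> x0), P)) * norm q * norm q"
        using L(3) cb[OF nz] by blast
      also have "\<dots> \<le> 1/16 * norm q * norm q"
        by (intro mult_right_mono order_trans[OF mult_left_mono[OF z] \<kappa>(4)]) (use L(1) in auto)
      finally show "z \<in> nondeg \<and> \<bar>Aform z q q - Aform (h (\<xi> x0), P) q q\<bar> \<le> 1/16 * norm q * norm q"
        using zc cb[OF nz] Z(2) by blast
    next
      fix p u v w assume p: "norm (p - \<xi> x0) \<le> 5 * \<rho> / K"
      show "R \<le> norm p" using near_half[OF p] r(1) R0(4,5) by linarith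
      show "1 / K * norm (frechet h p v) \<le> t * norm v"
        by (rule metric1[OF near_half[OF p] decay(1)[OF Rm[OF near_half[OF p]]]]) auto
      show "1 / K * norm (chr h p v w) \<le> t * norm v * norm w"
        using metric1[OF near_half[OF p], of "norm (chr h p v w)" "norm v * norm w"] decay(2)[OF Rm[OF near_half[OF p]], of v w] by (simp add: mult.assoc)
      show "(1 / K)\<^sup>2 * norm (frechet (\<lambda>p. chr h p v w) p u) \<le> t * norm u * norm v * norm w"
        using metric2[OF near_half[OF p], of "norm (frechet (\<lambda>p. chr h p v w) p u)" "norm u * norm v * norm w"]
          decay(3)[OF Rm[OF near_half[OF p]], of v w u] by (simp add: mult.assoc)
    qed (use x0 K R P \<kappa> \<rho> t curv in \<open>simp_all add: K_def\<close>)
    obtain \<psi> where "chart_section h \<xi> \<tau> x0 K \<rho> \<kappa> t R P \<rho> \<psi>" using ex_section by blast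
    then interpret chart_section h \<xi> \<tau> x0 K \<rho> \<kappa> t R P \<rho> \<psi> .
    have z0: "(0::real^2) \<in> ball 0 \<rho>" using \<rho> by simp
    have sqb: "y \<in> ball 0 \<rho>" if "y \<in> sq \<rho>" for y using sq_bounds(2)[OF \<rho>(1)] that by blast
    have "norm (Gam 0) \<le> 100 * t"
      by (rule patch_bounds(1)[OF convex_ball order_refl z0 z0 hessian_le(2) D1_G_near(2) small pos_ext])
    moreover have "norm (Qc 0) \<le> norm (D2 G 0) + norm (Gam 0)" unfolding Qc_split by (rule norm_triangle_ineq)
    moreover have "a \<le> norm (Qc 0)"
    proof -
      have zc0: "zc 0 = (h (\<xi> x0), P)" by (simp add: zc_def pos_0 D1_G_0)
      have "K\<^sup>2 = K\<^sup>2 * Aform (zc 0) (Qc 0) (Qc 0)" using second_ff_norm_square(1)[OF z0] by (simp add: psi_0 K_def)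
      then have "Aform (zc 0) (Qc 0) (Qc 0) = 1" using K by simp
      moreover have "zc 0 \<in> Z" using cb[OF nz] \<kappa>(1) unfolding zc0 by auto
      ultimately have "1 \<le> L * norm (Qc 0) * norm (Qc 0)" using L(2)[of "zc 0" "Qc 0" "Qc 0"] by simp
      then have "1 \<le> (sqrt L * norm (Qc 0))\<^sup>2"
        unfolding power_mult_distrib using L(1) by (simp add: power2_eq_square[of "norm (Qc 0)"] mult.assoc)
      then have "1 \<le> sqrt L * norm (Qc 0)" using L(1) power2_le_imp_le[of 1 "sqrt L * norm (Qc 0)"] by simp
      then show ?thesis using L(1) by (simp add: a_def field_simps)
    qed
    moreover have "norm (D2 G 0) \<le> C * (4 * pi * 6 * \<sigma> + l / (2 * \<sigma>) + (4 / d * t + 160000 * t\<^sup>2) / (2 * \<sigma> * l) + 4 * pi * t)"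
    proof -
      have D2c: "continuous_on (sq \<rho>) (D2 G)" unfolding D2_def[abs_def]
        by (intro continuous_on_vec_lambda continuous_on_subset[OF Ck_continuous_on[where n = 0] sq_bounds(2)[OF \<rho>(1)]] Ck_pd G_Ck open_ball)
      have "integral (\<psi> ` sq \<rho>) (\<lambda>x. (?A x)\<^sup>2 * area_density h \<xi> x) \<le> t"
      proof (rule s0)
        show "compact (\<psi> ` sq \<rho>)"
          by (rule compact_continuous_image[OF continuous_on_subset[OF psi_c sq_bounds(2)[OF \<rho>(1)]] sq_bounds(6)[OF \<rho>(1)]])
        show "\<psi> ` sq \<rho> \<subseteq> open_pdisk" using psi_pdisk sqb by blast
        show "\<forall>x\<in>\<psi> ` sq \<rho>. s0 \<le> norm (\<xi> x)"
        proof clarify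
          fix y assume "y \<in> sq \<rho>"
          then have "y \<in> ball 0 \<rho>" by (rule sqb)
          then show "s0 \<le> norm (\<xi> (\<psi> y))" using near_half[OF pos_near] pos_psi r_ge(1) R0(2) by fastforce
        qed
      qed
      moreover have "integral (sq \<rho>) (\<lambda>y. (norm (D2 G y))\<^sup>2) \<le> 4 / d * integral (\<psi> ` sq \<rho>) (\<lambda>x. (?A x)\<^sup>2 * area_density h \<xi> x)
          + 160000 * t\<^sup>2 * measure lborel (sq \<rho>)"
      proof (rule energy_in_chart[OF sq_bounds(6,2)[OF \<rho>(1)] _ d(1)])
        fix y assume "y \<in> sq \<rho>"
        then have "zc y \<in> cball (h (\<xi> x0), P) \<kappa>" using zc_near[OF sqb] by (simp add: dist_norm norm_minus_commute)
        then have "zc y \<in> Z" using cb[OF nz] by blast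
        from d(2)[OF this] show "d \<le> sqrt (det (gram (h (pos y)) (D1 G y)))" by (simp add: zc_def)
      qed
      moreover have "160000 * t\<^sup>2 * measure lborel (sq \<rho>) \<le> 160000 * t\<^sup>2 * 1"
        using \<rho> by (intro mult_left_mono) (auto simp: measure_sq power_le_one)
      moreover have "4 / d * I \<le> 4 / d * t" if "I \<le> t" for I using that d(1) by (intro mult_left_mono) auto
      ultimately have E2: "integral (sq \<rho>) (\<lambda>y. (norm (D2 G y))\<^sup>2) \<le> 4 / d * t + 160000 * t\<^sup>2" by fastforce
      have "norm (D2 G 0) \<le> C * hessian_potential (sq \<rho>) t G"
        by (rule center[OF chart_section_axioms cb[OF nz]])
      also have "\<dots> \<le> C * (4 * pi * 6 * \<sigma> + l / (2 * \<sigma>) + integral (sq \<rho>) (\<lambda>y. (norm (D2 G y))\<^sup>2) / (2 * \<sigma> * l) + 4 * pi * t)"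
        using C by (intro mult_left_mono weighted_integral_bound \<rho> \<sigma>(1) l(1) continuous_intros D2c) (use hessian_le(2) sqb t in auto)
      also have "\<dots> \<le> C * (4 * pi * 6 * \<sigma> + l / (2 * \<sigma>) + (4 / d * t + 160000 * t\<^sup>2) / (2 * \<sigma> * l) + 4 * pi * t)"
        using C E2 \<sigma>(1) l(1) by (intro mult_left_mono add_mono divide_right_mono order_refl) auto
      finally show ?thesis .
    qed
    moreover have "C * (4 * pi * 6 * \<sigma> + l / (2 * \<sigma>) + X + Y) = a / 4 + a / 4 + C * (X + Y)" for X Y
      using \<sigma>(2) l(2) by (simp add: distrib_left)
    ultimately have "a \<le> a / 4 + a / 4 + \<Phi> t" by (simp add: \<Phi>_def)
    then show False using t(1) by simp
  qed
  then show ?thesis by blast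
qed

end

section \<open>From uniform smallness to a modulus of decay\<close>

theorem theoremI1:
  fixes h :: "real^'m \<Rightarrow> real^'m^'m" and \<xi> :: "real^2 \<Rightarrow> real^'m" and \<tau> \<Theta> q :: real
  assumes "CARD('m) \<ge> 3"
    and "0 < \<tau>" and "\<tau> \<le> 1"
    and "riemannian_metric h"
    and "asymptotically_flat \<tau> h"
    and "weak_willmore_immersion h \<xi>"
    and "\<not> compact (\<xi> ` pdisk 1)"
    and "complete_end h \<xi>"
    and "\<And>r. 0 < r \<Longrightarrow> r < 1 \<Longrightarrow> \<not> compact (\<xi> ` pdisk r)"
    and "(\<integral>\<^sup>+x\<in>open_pdisk. ennreal ((second_ff_norm h \<xi> x)\<^sup>2 * area_density h \<xi> x) \<partial>lborel) < \<infinity>"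
    and "\<Theta> > 0" and "0 < q" and "q < 2 * (1 + \<tau>)"
    and "\<And>p r. p \<in> \<xi> ` pdisk 1 \<Longrightarrow> r \<ge> 1 \<Longrightarrow>
           hausdorff2 h (\<xi> ` pdisk 1 \<inter> ball p r) \<le> ennreal (\<Theta> * r powr q)"
  shows "\<exists>\<mu> :: real \<Rightarrow> real. (\<mu> \<longlongrightarrow> 0) at_top \<and>
    (\<exists>C>0. \<exists>R>0. \<forall>x\<in>pdisk 1. norm (\<xi> x) \<ge> R \<longrightarrow>
       second_ff_norm h \<xi> x \<le> C * (inverse (norm (\<xi> x)) * \<mu> (norm (\<xi> x))))"
proof -
  interpret willmore_end h \<xi> \<tau>
    by unfold_locales (use assms in \<open>auto simp: weak_willmore_immersion_def\<close>)
  \<comment> \<open>The inserted 0 makes the set nonempty and its supremum nonnegative, also when no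
    point of the surface lies beyond \<open>s\<close>.\<close>
  define B where "B s = insert 0 {norm (\<xi> x) * second_ff_norm h \<xi> x | x. x \<in> open_pdisk \<and> s \<le> norm (\<xi> x)}" for s
  define \<mu> where "\<mu> s = Sup (B s)" for s
  have small: "\<exists>s0. \<forall>s\<ge>s0. \<forall>b\<in>B s. b \<le> e" if e: "e > 0" for e
  proof -
    obtain R0 where "\<forall>x\<in>open_pdisk. R0 \<le> norm (\<xi> x) \<longrightarrow> norm (\<xi> x) * second_ff_norm h \<xi> x < e"
      using curvature_decay[OF assms(10) e] by blast
    then show ?thesis using e by (intro exI[of _ R0]) (auto simp: B_def intro!: less_imp_le)
  qed
  have "(\<mu> \<longlongrightarrow> 0) at_top" unfolding tendsto_iff eventually_at_top_linorder
  proof (intro allI impI)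
    fix e :: real assume e: "e > 0"
    obtain s0 where s0: "\<And>s b. s \<ge> s0 \<Longrightarrow> b \<in> B s \<Longrightarrow> b \<le> e/2" using small[of "e/2"] e by auto
    have "dist (\<mu> s) 0 < e" if s: "s \<ge> s0" for s
    proof -
      have "\<mu> s \<le> e/2" unfolding \<mu>_def by (rule cSup_least) (use s0[OF s] in \<open>auto simp: B_def\<close>)
      moreover have "0 \<le> \<mu> s" unfolding \<mu>_def by (rule cSup_upper[OF _ bdd_aboveI[OF s0[OF s]]]) (auto simp: B_def)
      ultimately show ?thesis using e by simp
    qed
    then show "\<exists>N. \<forall>n\<ge>N. dist (\<mu> n) 0 < e" by blast
  qed
  moreover obtain R where R: "far R" using ex_far by blast
  obtain s0 where s0: "\<And>s b. s \<ge> s0 \<Longrightarrow> b \<in> B s \<Longrightarrow> b \<le> 1" using small[of 1] by auto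
  have "second_ff_norm h \<xi> x \<le> 1 * (inverse (norm (\<xi> x)) * \<mu> (norm (\<xi> x)))"
    if x: "x \<in> pdisk 1" "max R s0 \<le> norm (\<xi> x)" for x
  proof -
    \<comment> \<open>\<open>pdisk 1\<close> contains the boundary circle, where \<xi> need not be
      smooth; points with image far out lie in the half disc.\<close>
    have xo: "x \<in> open_pdisk" using R x by (force simp: far_def pdisk_def open_pdisk_def)
    have "norm (\<xi> x) * second_ff_norm h \<xi> x \<in> B (norm (\<xi> x))" using xo by (auto simp: B_def)
    then have "norm (\<xi> x) * second_ff_norm h \<xi> x \<le> \<mu> (norm (\<xi> x))"
      unfolding \<mu>_def by (rule cSup_upper[OF _ bdd_aboveI[OF s0]]) (use x(2) in auto)
    moreover have "norm (\<xi> x) > 0" using R x(2) by (auto simp: far_def)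
    ultimately show ?thesis by (simp add: field_simps)
  qed
  moreover have "max R s0 > 0" using R by (auto simp: far_def)
  ultimately show ?thesis by (intro exI[of _ \<mu>] conjI exI[of _ 1] exI[of _ "max R s0"]) auto
qed

end
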